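(* Let $1<p<\infty$. (1) $\bm{u}\in\bm{h}^p_-(\mathbb{B})$ if and only if there exists $g\in W^{1,p}(\mathbb{S})$ such that $\bm{u}(x)=\nabla(Pg)(x)=P(\mathcal{L}_-g)(x)$ for all $x\in\mathbb{B}$. (2) $\bm{u}\in\bm{h}^p_0(\mathbb{B})$ if and only if there exists $g\in W^{1,p}(\mathbb{S})$ such that $\bm{u}(x)=x\times\nabla(Pg)(x)=P(\mathcal{L}_0g)(x)$ for all $x\in\mathbb{B}$.
   Context: $\mathbb{B}$ the open unit ball of $\mathbb{R}^3$, $\mathbb{S}$ the unit sphere, $\sigma$ surface measure; Lamé constants $\mu>0,2\mu+\lambda>0$. The elastic Poisson transform is $\bm{P}_e\bm{f}(x)=\int_{\mathbb{S}}\mathcal{P}_e(x,\eta)\bm{f}(\eta)d\sigma(\eta)$ with $\mathcal{P}_e=P\mathcal{I}+\mathcal{L}$, where $P(x,\eta)=\frac{1}{4\pi}\frac{1-|x|^2}{|x-\eta|^3}$, $\mathcal{L}_{ij}=\beta(1-|x|^2)\partial_{x_i}\partial_{x_j}\Phi$, $\Phi(x,\eta)=\frac{1}{4\pi}\int_0^1\big(\frac{1-t^2|x|^2}{(1-2tx\cdot\eta+t^2|x|^2)^{3/2}}-1-3tx\cdot\eta\big)\frac{dt}{t^{1+\alpha}}$, $\beta=\frac{\lambda+\mu}{2\lambda+6\mu}$, $\alpha=\frac{\lambda+2\mu}{\lambda+3\mu}$; $Pf=\int P(\cdot,\eta)f(\eta)d\sigma(\eta)$. $\{Y_{\ell,m}\}$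 orthonormal basis of real spherical harmonics; $\bm{f}^\vee(\eta)=f(\eta)\eta$; $\mathcal{M}_\ell$ is the zonal multiplier $Y_{\ell,m}\mapsto\ell Y_{\ell,m}$; $W^{1,p}(\mathbb{S})=\{f\in L^p:(-\Delta_\sigma)^{1/2}f\in L^p\}$ with $(-\Delta_\sigma)^{1/2}$ the multiplier $\sqrt{\ell(\ell+1)}$, and $\nabla_\sigma f$ its weak spherical gradient. $\mathcal{L}_-g=(\mathcal{M}_\ell g)^\vee+\nabla_\sigma g$, $\mathcal{L}_0g(\eta)=\eta\times\nabla_\sigma g(\eta)$. $\bm{E}^-_{\ell,m}=\ell\bm{Y}^\vee_{\ell,m}+\nabla_\sigma Y_{\ell,m}$, $\bm{E}^0_{\ell,m}(\eta)=\eta\times\nabla_\sigma Y_{\ell,m}(\eta)$; $\bm{L}^p_-(\mathbb{S})$, $\bm{L}^p_0(\mathbb{S})$ are the images of $\bm{L}^p(\mathbb{S})$ under the $\bm{L}^p$-bounded extensions of the orthogonal projections onto the closed spans of $\{\bm{E}^-_{\ell,m}\}_{\ell\ge1}$, resp. $\{\bm{E}^0_{\ell,m}\}_{\ell\ge1}$. $\bm{h}^p_-(\mathbb{B})=\bm{P}_e(\bm{L}^p_-(\mathbb{S}))$ and $\bm{h}^p_0(\mathbb{B})=\bm{P}_e(\bm{L}^p_0(\mathbb{S}))$. *)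

theory Defs
  imports "HOL-Analysis.Analysis"
begin

type_synonym R3 = "real^3"

definition pd :: "3 \<Rightarrow> (R3 \<Rightarrow> real) \<Rightarrow> R3 \<Rightarrow> real" where
  "pd i f x = deriv (\<lambda>t. f (x + t *\<^sub>R axis i (1::real))) 0"

definition grad :: "(R3 \<Rightarrow> real) \<Rightarrow> R3 \<Rightarrow> R3" where
  "grad f x = (\<chi> i. pd i f x)"

definition lap :: "(R3 \<Rightarrow> real) \<Rightarrow> R3 \<Rightarrow> real" where
  "lap f x = (\<Sum>i\<in>UNIV. pd i (pd i f) x)"

text \<open>Classical spherical gradient: gradient of the 0-homogeneous extension.\<close>
definition sgrad :: "(R3 \<Rightarrow> real) \<Rightarrow> R3 \<Rightarrow> R3" where
  "sgrad f \<eta> = grad (\<lambda>x. f (x /\<^sub>R norm x)) \<eta>"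

definition poly3 :: "(R3 \<Rightarrow> real) \<Rightarrow> bool" where
  "poly3 q \<longleftrightarrow> (\<exists>N::nat. \<exists>c::nat \<Rightarrow> nat \<Rightarrow> nat \<Rightarrow> real. \<forall>x.
      q x = (\<Sum>a<N. \<Sum>b<N. \<Sum>d<N. c a b d * (x$1)^a * (x$2)^b * (x$3)^d))"

definition hom_poly3 :: "nat \<Rightarrow> (R3 \<Rightarrow> real) \<Rightarrow> bool" where
  "hom_poly3 l q \<longleftrightarrow> (\<exists>c::nat \<Rightarrow> nat \<Rightarrow> nat \<Rightarrow> real. \<forall>x.
      q x = (\<Sum>a\<le>l. \<Sum>b\<le>l. \<Sum>d\<le>l. if a + b + d = l
               then c a b d * (x$1)^a * (x$2)^b * (x$3)^d else 0))"

text \<open>Spherical harmonics of degree l (as harmonic homogeneous polynomials of degree l,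
  whose restrictions to the unit sphere are the spherical harmonics).\<close>
definition Harm :: "nat \<Rightarrow> (R3 \<Rightarrow> real) set" where
  "Harm l = {q. hom_poly3 l q \<and> (\<forall>x. lap q x = 0)}"

text \<open>Surface measure on the unit sphere: sigma = 3 times push-forward of Lebesgue measure
  on the (punctured) unit ball under radial projection (polar coordinates).\<close>
definition sigmaS :: "R3 measure" where
  "sigmaS = distr (density (restrict_space lborel (ball 0 1 - {0})) (\<lambda>_. 3))
                  (restrict_space borel (sphere 0 1)) (\<lambda>x. x /\<^sub>R norm x)"

definition Lp_s :: "real \<Rightarrow> (R3 \<Rightarrow> real) \<Rightarrow> bool" where
  "Lp_s p f \<longleftrightarrow> f \<in> borel_measurable sigmaS \<and> integrable sigmaS (\<lambda>\<eta>. \<bar>f \<eta>\<bar> powr p)"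

definition Lp_v :: "real \<Rightarrow> (R3 \<Rightarrow> R3) \<Rightarrow> bool" where
  "Lp_v p f \<longleftrightarrow> f \<in> borel_measurable sigmaS \<and> integrable sigmaS (\<lambda>\<eta>. norm (f \<eta>) powr p)"

definition Lp_dist :: "real \<Rightarrow> (R3 \<Rightarrow> R3) \<Rightarrow> (R3 \<Rightarrow> R3) \<Rightarrow> real" where
  "Lp_dist p f g = (\<integral>\<eta>. norm (f \<eta> - g \<eta>) powr p \<partial>sigmaS)"

text \<open>h is the zonal multiplier m(l) applied to g: Y_{l,m} -> m(l) Y_{l,m}, in the weak sense.\<close>
definition mult_rel :: "(nat \<Rightarrow> real) \<Rightarrow> (R3 \<Rightarrow> real) \<Rightarrow> (R3 \<Rightarrow> real) \<Rightarrow> bool" where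
  "mult_rel m g h \<longleftrightarrow> integrable sigmaS h \<and>
     (\<forall>l. \<forall>Y\<in>Harm l. (\<integral>\<eta>. h \<eta> * Y \<eta> \<partial>sigmaS) = m l * (\<integral>\<eta>. g \<eta> * Y \<eta> \<partial>sigmaS))"

definition W1p :: "real \<Rightarrow> (R3 \<Rightarrow> real) \<Rightarrow> bool" where
  "W1p p g \<longleftrightarrow> Lp_s p g \<and>
     (\<exists>h. Lp_s p h \<and> mult_rel (\<lambda>l. sqrt (real l * (real l + 1))) g h)"

text \<open>Weak spherical gradient G of g, tested against (restrictions of) polynomials, via
  the integration by parts formula on the unit sphere of R^3:
  int phi grad_s g = - int g grad_s phi + 2 int g phi eta.\<close>
definition weak_sgrad :: "(R3 \<Rightarrow> real) \<Rightarrow> (R3 \<Rightarrow> R3) \<Rightarrow> bool" where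
  "weak_sgrad g G \<longleftrightarrow> integrable sigmaS G \<and>
     (\<forall>\<phi>. poly3 \<phi> \<longrightarrow>
        (\<integral>\<eta>. \<phi> \<eta> *\<^sub>R G \<eta> \<partial>sigmaS) =
        (\<integral>\<eta>. g \<eta> *\<^sub>R (2 * \<phi> \<eta>) *\<^sub>R \<eta> - g \<eta> *\<^sub>R sgrad \<phi> \<eta> \<partial>sigmaS))"

definition Eminus_span :: "(R3 \<Rightarrow> R3) set" where
  "Eminus_span = {(\<lambda>\<eta>. \<Sum>l\<in>{1..<N}. (real l * Y l \<eta>) *\<^sub>R \<eta> + sgrad (Y l) \<eta>)
                   | N Y. \<forall>l. Y l \<in> Harm l}"

definition Ezero_span :: "(R3 \<Rightarrow> R3) set" where
  "Ezero_span = {(\<lambda>\<eta>. \<Sum>l\<in>{1..<N}. cross3 \<eta> (sgrad (Y l) \<eta>))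
                   | N Y. \<forall>l. Y l \<in> Harm l}"

definition proj_rel :: "(R3 \<Rightarrow> R3) set \<Rightarrow> (R3 \<Rightarrow> R3) \<Rightarrow> (R3 \<Rightarrow> R3) \<Rightarrow> bool" where
  "proj_rel V f g \<longleftrightarrow> Lp_v 2 f \<and> Lp_v 2 g \<and>
     (\<exists>vs. (\<forall>n. vs n \<in> V) \<and> (\<lambda>n. Lp_dist 2 (vs n) g) \<longlonglongrightarrow> 0) \<and>
     (\<forall>v\<in>V. (\<integral>\<eta>. (f \<eta> - g \<eta>) \<bullet> v \<eta> \<partial>sigmaS) = 0)"

text \<open>Image of L^p under the L^p-bounded extension of the projection: limits in L^p of
  projections of L^2 \<inter> L^p functions converging in L^p.\<close>
definition Lp_sub :: "(R3 \<Rightarrow> R3) set \<Rightarrow> real \<Rightarrow> (R3 \<Rightarrow> R3) set" where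
  "Lp_sub V p = {g. Lp_v p g \<and> (\<exists>f fs hs. Lp_v p f \<and>
        (\<forall>n. Lp_v p (fs n) \<and> proj_rel V (fs n) (hs n)) \<and>
        (\<lambda>n. Lp_dist p (fs n) f) \<longlonglongrightarrow> 0 \<and>
        (\<lambda>n. Lp_dist p (hs n) g) \<longlonglongrightarrow> 0)}"

definition Pker :: "R3 \<Rightarrow> R3 \<Rightarrow> real" where
  "Pker x \<eta> = (1 / (4 * pi)) * (1 - (norm x)^2) / (norm (x - \<eta>))^3"

definition Poisson :: "(R3 \<Rightarrow> real) \<Rightarrow> R3 \<Rightarrow> real" where
  "Poisson f x = (\<integral>\<eta>. Pker x \<eta> * f \<eta> \<partial>sigmaS)"

definition PoissonV :: "(R3 \<Rightarrow> R3) \<Rightarrow> R3 \<Rightarrow> R3" where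
  "PoissonV f x = (\<integral>\<eta>. Pker x \<eta> *\<^sub>R f \<eta> \<partial>sigmaS)"

definition alpha_L :: "real \<Rightarrow> real \<Rightarrow> real" where
  "alpha_L lam mu = (lam + 2 * mu) / (lam + 3 * mu)"

definition beta_L :: "real \<Rightarrow> real \<Rightarrow> real" where
  "beta_L lam mu = (lam + mu) / (2 * lam + 6 * mu)"

definition PhiL :: "real \<Rightarrow> real \<Rightarrow> R3 \<Rightarrow> R3 \<Rightarrow> real" where
  "PhiL lam mu x \<eta> = (1 / (4 * pi)) *
     (LBINT t=0..1. ((1 - t^2 * (norm x)^2) / (1 - 2 * t * (x \<bullet> \<eta>) + t^2 * (norm x)^2) powr (3/2)
                     - 1 - 3 * t * (x \<bullet> \<eta>)) / t powr (1 + alpha_L lam mu))"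

definition Lker :: "real \<Rightarrow> real \<Rightarrow> R3 \<Rightarrow> R3 \<Rightarrow> real^3^3" where
  "Lker lam mu x \<eta> = (\<chi> i j. beta_L lam mu * (1 - (norm x)^2) *
       pd i (\<lambda>y. pd j (\<lambda>z. PhiL lam mu z \<eta>) y) x)"

definition Pe :: "real \<Rightarrow> real \<Rightarrow> (R3 \<Rightarrow> R3) \<Rightarrow> R3 \<Rightarrow> R3" where
  "Pe lam mu f x = (\<integral>\<eta>. Pker x \<eta> *\<^sub>R f \<eta> + Lker lam mu x \<eta> *v f \<eta> \<partial>sigmaS)"

definition hp_minus :: "real \<Rightarrow> real \<Rightarrow> real \<Rightarrow> (R3 \<Rightarrow> R3) set" where
  "hp_minus lam mu p = {u. \<exists>f\<in>Lp_sub Eminus_span p. \<forall>x\<in>ball 0 1. u x = Pe lam mu f x}"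

definition hp_zero :: "real \<Rightarrow> real \<Rightarrow> real \<Rightarrow> (R3 \<Rightarrow> R3) set" where
  "hp_zero lam mu p = {u. \<exists>f\<in>Lp_sub Ezero_span p. \<forall>x\<in>ball 0 1. u x = Pe lam mu f x}"

end

theory Submission
  imports Defs
begin

text \<open>On the sphere the fields \<open>\<nabla>Y\<close> and \<open>x \<times> \<nabla>Y\<close> of a solid harmonic \<open>Y\<close> have harmonic, divergence-free
  extensions. The elastic kernel \<open>L\<close> integrates such a field to zero, so \<open>P\<^sub>e = P\<close> on the two subspaces, and
  the theorem becomes the boundedness of the operators taking \<open>(2l+1)g\<close> to \<open>lg\<close>, \<open>\<nabla>\<^sub>\<sigma>g\<close>
  and \<open>\<surd>(l(l+1))g\<close>, together with the reverse estimates.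

  The multiplier \<open>1/(2l+1)\<close> is the single layer operator, a positive integral operator; \<open>\<surd>(l(l+1))\<close> differs
  from \<open>l + 1/2\<close> by a bounded multiplier. The transforms \<open>J\<^sub>i/(2l+1)\<close>, with \<open>J\<^sub>i\<close> the
  rotation fields, are bounded by a Bellman function argument along the harmonic extensions (in the
  manner of Nazarov and Treil). Reverse estimates follow by duality, since
  \<open>\<integral>\<psi>\<chi> = \<integral>D\<psi> \<bullet> Dm\<chi>\<close> for a bounded multiplier \<open>m\<close> and \<open>D = \<nabla>/(2l+1)\<close> or \<open>x \<times> \<nabla>/(2l+1)\<close>.\<close>

section \<open>Integral inequalities and limits\<close>

text \<open>No singular integral is ever formed. Estimates are proved for finite sums of spherical
  harmonics, with constants independent of the number of terms, and reach \<open>L^p\<close> by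
  density and completeness. Sizes are integrals of p-th powers, without the root: the triangle
  inequality costs a factor \<open>2^(p-1)\<close> and duality takes the additive form of Young's
  inequality. \<open>sigmaS\<close> is an image of Lebesgue measure on the ball; integration by
  parts on the sphere is derived from its rotation invariance, which is why the rotation fields
  carry the analysis. The kernel \<open>L\<close> disappears because its integral against a field
  with harmonic extension \<open>V\<close> is a weighted integral of the gradient of
  \<open>div V\<close> along the ray to \<open>x\<close>. The subspaces are given as limits of
  projections. For \<open>p > 2\<close> a projection is at first known only to lie in
  \<open>L^2\<close>; the duality behind the reverse estimates puts it into the \<open>L^p\<close>
  closure of the span, with which the subspace is thus identified. Constants need care throughout:
  the operators kill them, so the reverse estimates hold only in their absence.\<close>

lemmas lint_cong = Bochner_Integration.integral_cong
  and lint_bound = Bochner_Integration.integrable_bound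
  and lint_sum = Bochner_Integration.integral_sum
  and lint_add = Bochner_Integration.integral_add
  and lint_diff = Bochner_Integration.integral_diff

lemma Youngs_inequality_unweighted:
  fixes a b p q :: real
  assumes "p > 1" "q > 1" "1/p + 1/q = 1" "a \<ge> 0" "b \<ge> 0"
  shows "a * b \<le> a powr p + b powr q"
proof -
  have "a powr p / p \<le> a powr p" "b powr q / q \<le> b powr q"
    using assms by (auto simp: divide_le_eq mult_le_cancel_left1 not_less)
  then show ?thesis using Youngs_inequality[OF assms] by linarith
qed

text \<open>Where \<open>x > e\<close>, monotonicity of \<open>x powr (1 - p)\<close> bounds
  \<open>x\<close> by the second term. On a finite measure space this does the work of Hoelder's
  inequality: after integration the first term is small with \<open>e\<close>, and the second is a
  constant times the integral of the p-th power.\<close>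

lemma le_eps_plus_powr:
  fixes x e p :: real
  assumes "x \<ge> 0" "e > 0" "p \<ge> 1"
  shows "x \<le> e + e powr (1 - p) * x powr p"
proof (cases "x \<le> e")
  case True then show ?thesis by (simp add: add_increasing2)
next
  case False
  then have "x > 0" using assms by linarith
  have "x powr (1-p) \<le> e powr (1-p)"
    using False assms powr_mono2'[of "1-p" e x] by auto
  then have "x powr p * x powr (1-p) \<le> x powr p * e powr (1-p)"
    by (intro mult_left_mono) auto
  moreover have "x powr p * x powr (1-p) = x" using \<open>x > 0\<close> by (simp flip: powr_add)
  ultimately show ?thesis using assms by (simp add: mult.commute)
qed

lemma powr_add_le:
  fixes a b p :: real
  assumes "a \<ge> 0" "b \<ge> 0" "p \<ge> 1"
  shows "(a + b) powr p \<le> 2 powr (p - 1) * (a powr p + b powr p)"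
proof (cases "a = 0 \<or> b = 0")
  case True
  have "2 powr (p - 1) \<ge> 1" using assms by (intro ge_one_powr_ge_zero) auto
  then show ?thesis
    using True mult_right_mono[of 1 "2 powr (p - 1)" "(a+b) powr p"] by auto
next
  case False
  then have "a > 0" "b > 0" using assms by auto
  have c: "convex_on {0<..} (\<lambda>x::real. x powr p)"
    using powr_convex[OF assms(3)] by simp
  have "((1/2) *\<^sub>R a + (1/2) *\<^sub>R b) powr p \<le> (1/2) * a powr p + (1/2) * b powr p"
    using convex_onD[OF c, of "1/2" a b] \<open>a > 0\<close> \<open>b > 0\<close> by (auto simp: algebra_simps)
  moreover have "(1/2) *\<^sub>R a + (1/2) *\<^sub>R b = (a+b)/2" by (simp add: add_divide_distrib)
  ultimately have "((a + b)/2) powr p \<le> (a powr p + b powr p)/2" by (simp only:) (simp add: add_divide_distrib)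
  moreover have "(a+b) powr p = 2 powr p * ((a+b)/2) powr p"
    using assms by (simp add: powr_divide)
  moreover have "2 powr (p-1) = 2 powr p / 2" by (simp add: powr_diff)
  ultimately show ?thesis
    using mult_left_mono[of "((a + b)/2) powr p" "(a powr p + b powr p)/2" "2 powr p"]
    by (simp only: powr_ge_zero times_divide_eq_left times_divide_eq_right)
qed

lemma norm_add_powr_le:
  fixes a b :: "'a::real_normed_vector"
  assumes "p \<ge> 1"
  shows "norm (a + b) powr p \<le> 2 powr (p - 1) * (norm a powr p + norm b powr p)"
  by (rule order_trans[OF powr_mono2[OF _ _ norm_triangle_ineq] powr_add_le]) (use assms in auto)

lemma powr_mean_le:
  fixes a b p :: real
  assumes "p \<ge> 1"
  shows "\<bar>(a + b) / 2\<bar> powr p \<le> (\<bar>a\<bar> powr p + \<bar>b\<bar> powr p) / 2"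
proof -
  have "\<bar>(a + b) / 2\<bar> powr p = \<bar>a + b\<bar> powr p / 2 powr p"
    by (simp add: powr_divide)
  moreover have "\<bar>a + b\<bar> powr p / 2 powr p \<le> (2 powr (p-1) * (\<bar>a\<bar> powr p + \<bar>b\<bar> powr p)) / 2 powr p"
    using norm_add_powr_le[OF assms, of a b] by (intro divide_right_mono) auto
  moreover have "2 powr (p-1) = 2 powr p / (2::real)" by (simp add: powr_diff)
  ultimately show ?thesis by simp
qed

text \<open>Young's inequality for \<open>a\<close> and \<open>b powr (p - 1)\<close> is the tangent
  line inequality of the power function at \<open>b\<close> in disguise.\<close>

lemma powr_tangent_le:
  fixes a b p :: real
  assumes "a \<ge> 0" "b > 0" "p > 1"
  shows "b powr p + p * b powr (p - 1) * (a - b) \<le> a powr p"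
proof -
  define q where "q = p / (p - 1)"
  have q: "q > 1" "1/p + 1/q = 1" using assms by (auto simp: q_def field_simps)
  have "a * b powr (p-1) \<le> a powr p / p + (b powr (p-1)) powr q / q"
    using Youngs_inequality[of p q a "b powr (p-1)"] assms q by simp
  moreover have "(b powr (p-1)) powr q = b powr p" using assms by (simp add: powr_powr q_def)
  moreover have "b powr (p-1) * b = b powr p"
    using assms powr_add[of b "p-1" 1] by simp
  moreover have "1/q = (p-1)/p" using assms by (simp add: q_def)
  ultimately have "a * b powr (p-1) \<le> a powr p / p + b powr p * ((p-1)/p)"
    by (metis times_divide_eq_right mult.right_neutral)
  then have "p * (a * b powr (p-1)) \<le> p * (a powr p / p + b powr p * ((p-1)/p))"
    using assms by (intro mult_left_mono) auto
  also have "... = a powr p + b powr p * (p-1)" using assms by (simp add: field_simps)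
  finally show ?thesis
    using \<open>b powr (p-1) * b = b powr p\<close> by (simp add: algebra_simps)
qed

text \<open>The tangent line of the p-th power at the \<open>k\<close>-weighted mean of
  \<open>\<bar>f\<bar>\<close> is integrated against \<open>k\<close>; its linear term drops out.
  The weight is not normalised, and its total mass accounts for the factor with exponent
  \<open>p - 1\<close>.\<close>

lemma kernel_Jensen:
  fixes k f :: "'a \<Rightarrow> real"
  assumes "p > 1" and k: "integrable M k" "\<And>x. x \<in> space M \<Longrightarrow> k x \<ge> 0"
    and kf: "integrable M (\<lambda>x. k x * \<bar>f x\<bar>)" "integrable M (\<lambda>x. k x * \<bar>f x\<bar> powr p)"
  shows "\<bar>\<integral>x. k x * f x \<partial>M\<bar> powr p \<le> (\<integral>x. k x \<partial>M) powr (p - 1) * (\<integral>x. k x * \<bar>f x\<bar> powr p \<partial>M)"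
proof -
  define K where "K = (\<integral>x. k x \<partial>M)"
  define I where "I = (\<integral>x. k x * \<bar>f x\<bar> \<partial>M)"
  have I0: "I \<ge> 0" unfolding I_def using k by (intro integral_nonneg_AE) auto
  have K0: "K \<ge> 0" unfolding K_def using k by (intro integral_nonneg_AE) auto
  have R0: "(\<integral>x. k x * \<bar>f x\<bar> powr p \<partial>M) \<ge> 0" using k by (intro integral_nonneg_AE) auto
  have "norm (\<integral>x. k x * f x \<partial>M) \<le> (\<integral>x. norm (k x * f x) \<partial>M)"
    by (rule integral_norm_bound)
  also have "... = I" unfolding I_def
    by (rule lint_cong) (use k in \<open>auto simp: abs_mult\<close>)
  finally have le: "\<bar>\<integral>x. k x * f x \<partial>M\<bar> powr p \<le> I powr p"
    using assms(1) by (intro powr_mono2) auto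
  show ?thesis
  proof (cases "I = 0")
    case True
    then show ?thesis using le R0 by simp
  next
    case False
    then have "I > 0" using I0 by simp
    have "K > 0"
    proof (rule ccontr)
      assume "\<not> K > 0"
      then have "K = 0" using K0 by simp
      then have "AE x in M. k x = 0"
        unfolding K_def using k integral_nonneg_eq_0_iff_AE[OF k(1)] by auto
      then have "I = 0" unfolding I_def
        by (intro integral_eq_zero_AE) auto
      with False show False by simp
    qed
    define b where "b = I / K"
    have b: "b > 0" using \<open>I > 0\<close> \<open>K > 0\<close> by (simp add: b_def)
    have "(\<integral>x. k x * (b powr p + p * b powr (p-1) * (\<bar>f x\<bar> - b)) \<partial>M) \<le> (\<integral>x. k x * \<bar>f x\<bar> powr p \<partial>M)"
    proof (rule integral_mono)
      show "integrable M (\<lambda>x. k x * (b powr p + p * b powr (p-1) * (\<bar>f x\<bar> - b)))"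
      proof -
        have "integrable M (\<lambda>x. k x * (b powr p - p * b powr (p-1) * b) + p * b powr (p-1) * (k x * \<bar>f x\<bar>))"
          using k kf by auto
        then show ?thesis by (rule back_subst[where P="integrable M"]) (auto simp: algebra_simps)
      qed
      show "integrable M (\<lambda>x. k x * \<bar>f x\<bar> powr p)" by fact
      show "k x * (b powr p + p * b powr (p-1) * (\<bar>f x\<bar> - b)) \<le> k x * \<bar>f x\<bar> powr p" if "x \<in> space M" for x
        using k(2)[OF that] powr_tangent_le[of "\<bar>f x\<bar>" b p] b assms(1) by (intro mult_left_mono) auto
    qed
    also have "(\<integral>x. k x * (b powr p + p * b powr (p-1) * (\<bar>f x\<bar> - b)) \<partial>M)
        = (\<integral>x. k x * (b powr p - p * b powr (p-1) * b) + p * b powr (p-1) * (k x * \<bar>f x\<bar>) \<partial>M)"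
      by (rule lint_cong) (auto simp: algebra_simps)
    also have "... = K * (b powr p - p * b powr (p-1) * b) + p * b powr (p-1) * I"
      using k kf by (simp add: K_def I_def)
    also have "... = K * b powr p" using \<open>K > 0\<close> by (simp add: b_def field_simps)
    also have "b powr p = I powr p / K powr p" using I0 K0 by (simp add: b_def powr_divide)
    finally have "K * (I powr p / K powr p) \<le> (\<integral>x. k x * \<bar>f x\<bar> powr p \<partial>M)" .
    moreover have "K powr p = K * K powr (p-1)" using \<open>K > 0\<close> powr_add[of K 1 "p-1"] by simp
    ultimately have "I powr p / K powr (p-1) \<le> (\<integral>x. k x * \<bar>f x\<bar> powr p \<partial>M)"
      using \<open>K > 0\<close> by simp
    then have "I powr p \<le> K powr (p-1) * (\<integral>x. k x * \<bar>f x\<bar> powr p \<partial>M)"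
      using \<open>K > 0\<close> by (simp add: divide_le_eq mult.commute)
    then show ?thesis using le unfolding K_def by linarith
  qed
qed

text \<open>The mean value theorem bounds the difference quotients by \<open>B\<close>, and
  dominated convergence is applied along an arbitrary sequence tending to \<open>t0\<close>.\<close>

lemma has_real_derivative_integral:
  fixes f f' :: "real \<Rightarrow> 'a \<Rightarrow> real"
  assumes "e > 0"
    and int: "\<And>t. \<bar>t - t0\<bar> < e \<Longrightarrow> integrable M (f t)"
    and der: "\<And>t w. \<bar>t - t0\<bar> < e \<Longrightarrow> w \<in> space M \<Longrightarrow> ((\<lambda>t. f t w) has_real_derivative f' t w) (at t)"
    and B: "integrable M B" "\<And>t w. \<bar>t - t0\<bar> < e \<Longrightarrow> w \<in> space M \<Longrightarrow> \<bar>f' t w\<bar> \<le> B w"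
  shows "((\<lambda>t. \<integral>w. f t w \<partial>M) has_real_derivative (\<integral>w. f' t0 w \<partial>M)) (at t0)"
    and "integrable M (f' t0)"
proof -
  have lim: "(\<lambda>n. (f (X n) w - f t0 w) / (X n - t0)) \<longlonglongrightarrow> f' t0 w"
    if "X \<longlonglongrightarrow> t0" "\<And>n. X n \<noteq> t0" "w \<in> space M" for X w
  proof -
    have "((\<lambda>y. (f y w - f t0 w) / (y - t0)) \<longlongrightarrow> f' t0 w) (at t0)"
      using der[of t0 w] assms(1) that(3) by (simp add: has_field_derivative_iff)
    then show ?thesis using that(1,2) by (force simp: tendsto_at_iff_sequentially o_def)
  qed
  have bnd: "\<bar>(f t w - f t0 w) / (t - t0)\<bar> \<le> B w" if "\<bar>t - t0\<bar> < e" "t \<noteq> t0" "w \<in> space M" for t w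
  proof -
    have "\<bar>f t w - f t0 w\<bar> \<le> B w * \<bar>t - t0\<bar>"
    proof (rule field_differentiable_bound[of "ball t0 e" "\<lambda>t. f t w" "\<lambda>t. f' t w" "B w" t t0, simplified])
      show "((\<lambda>t. f t w) has_field_derivative f' z w) (at z within ball t0 e)" if "dist t0 z < e" for z
        using der[of z w] that \<open>w \<in> space M\<close> by (auto simp: dist_real_def abs_minus_commute intro: has_field_derivative_at_within)
    qed (use that B(2) in \<open>auto simp: dist_real_def abs_minus_commute\<close>)
    then show ?thesis using that by (simp add: abs_divide divide_le_eq)
  qed
  \<comment> \<open>Measurability of the derivative comes from its being the limit of difference
    quotients along one explicit sequence inside the neighbourhood.\<close>
  have meas: "f' t0 \<in> borel_measurable M"
  proof -
    define X where "X n = t0 + (e/2) * inverse (real (Suc n))" for n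
    have "(\<lambda>n. t0 + (e/2) * inverse (real (Suc n))) \<longlonglongrightarrow> t0 + (e/2) * 0"
      by (intro tendsto_intros LIMSEQ_inverse_real_of_nat)
    then have X: "X \<longlonglongrightarrow> t0" by (simp add: X_def[abs_def])
    have Xe: "\<bar>X n - t0\<bar> < e" "X n \<noteq> t0" for n
    proof -
      have "(e/2) * inverse (real (Suc n)) \<le> (e/2) * 1" using assms(1)
        by (intro mult_left_mono) (auto simp: inverse_le_1_iff)
      then show "\<bar>X n - t0\<bar> < e" using assms(1) by (simp add: X_def)
      show "X n \<noteq> t0" using assms(1) by (simp add: X_def)
    qed
    have [measurable]: "f t0 \<in> borel_measurable M" "f (X n) \<in> borel_measurable M" for n
      using int[OF Xe(1)[of n]] int[of t0] assms(1) by auto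
    have "(\<lambda>w. (f (X n) w - f t0 w) / (X n - t0)) \<in> borel_measurable M" for n
      by measurable
    then show ?thesis
      by (rule borel_measurable_LIMSEQ_metric) (rule lim[OF X Xe(2)])
  qed
  show "integrable M (f' t0)"
    by (rule lint_bound[OF B(1) meas]) (use B(2)[of t0] assms(1) in \<open>auto intro!: AE_I2 order_trans[OF _ abs_ge_self]\<close>)
  show "((\<lambda>t. \<integral>w. f t w \<partial>M) has_real_derivative (\<integral>w. f' t0 w \<partial>M)) (at t0)"
    unfolding has_field_derivative_iff tendsto_at_iff_sequentially
  proof (intro allI impI)
    fix X :: "nat \<Rightarrow> real" assume X: "\<forall>i. X i \<in> UNIV - {t0}" "X \<longlonglongrightarrow> t0"
    obtain N where N: "\<And>n. n \<ge> N \<Longrightarrow> \<bar>X n - t0\<bar> < e"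
      using X(2) assms(1) by (auto simp: LIMSEQ_iff)
    define Z where "Z n = X (n + N)" for n
    have Z: "Z \<longlonglongrightarrow> t0" "\<And>n. Z n \<noteq> t0" "\<And>n. \<bar>Z n - t0\<bar> < e"
      using X N unfolding Z_def by (auto intro: LIMSEQ_ignore_initial_segment)
    have *: "(\<lambda>n. \<integral>w. (f (Z n) w - f t0 w) / (Z n - t0) \<partial>M) \<longlonglongrightarrow> (\<integral>w. f' t0 w \<partial>M)"
    proof (rule integral_dominated_convergence[where w=B])
      have [measurable]: "f t0 \<in> borel_measurable M" "f (Z n) \<in> borel_measurable M" for n
        using int[OF Z(3)[of n]] int[of t0] assms(1) by auto
      show "(\<lambda>w. (f (Z n) w - f t0 w) / (Z n - t0)) \<in> borel_measurable M" for n
        by measurable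
      show "AE w in M. (\<lambda>n. (f (Z n) w - f t0 w) / (Z n - t0)) \<longlonglongrightarrow> f' t0 w"
        using lim[OF Z(1,2)] by auto
      show "AE w in M. norm ((f (Z n) w - f t0 w) / (Z n - t0)) \<le> B w" for n
        using bnd[OF Z(3) Z(2)] by auto
    qed (use meas B in auto)
    have eq: "(\<integral>w. (f (Z n) w - f t0 w) / (Z n - t0) \<partial>M) = ((\<integral>w. f (Z n) w \<partial>M) - (\<integral>w. f t0 w \<partial>M)) / (Z n - t0)" for n
      using int[OF Z(3)[of n]] int[of t0] assms(1) by (simp add: Z(2))
    have "(\<lambda>n. ((\<integral>w. f (Z n) w \<partial>M) - (\<integral>w. f t0 w \<partial>M)) / (Z n - t0)) \<longlonglongrightarrow> (\<integral>w. f' t0 w \<partial>M)"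
      using * unfolding eq .
    then show "((\<lambda>y. ((\<integral>w. f y w \<partial>M) - (\<integral>w. f t0 w \<partial>M)) / (y - t0)) \<circ> X) \<longlonglongrightarrow> (\<integral>w. f' t0 w \<partial>M)"
      unfolding Z_def o_def by (rule LIMSEQ_offset)
  qed
qed

section \<open>Completeness of the spaces of p-integrable functions\<close>

lemma integrable_norm_powr_diff:
  fixes f g :: "'a \<Rightarrow> 'b::euclidean_space"
  assumes "p \<ge> 1" "f \<in> borel_measurable M" "g \<in> borel_measurable M"
    "integrable M (\<lambda>x. norm (f x) powr p)" "integrable M (\<lambda>x. norm (g x) powr p)"
  shows "integrable M (\<lambda>x. norm (f x - g x) powr p)"
proof (rule lint_bound)
  show "integrable M (\<lambda>x. 2 powr (p-1) * (norm (f x) powr p + norm (g x) powr p))"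
    using assms by auto
  show "AE x in M. norm (norm (f x - g x) powr p) \<le> norm (2 powr (p-1) * (norm (f x) powr p + norm (g x) powr p))"
    using norm_add_powr_le[OF assms(1), of "f _" "- g _"] by (auto simp: abs_mult)
qed (use assms in measurable)

text \<open>Riesz-Fischer. Along a subsequence with consecutive distances of size
  \<open>2^(-k)\<close> the increments are absolutely summable almost everywhere, which gives the
  limit \<open>g\<close>; Fatou's lemma then carries the Cauchy estimate of the full sequence over
  to \<open>g\<close>.\<close>

lemma Lp_complete:
  fixes f :: "nat \<Rightarrow> 'a \<Rightarrow> 'b::euclidean_space"
  assumes "finite_measure M" "p \<ge> 1"
    and m [measurable]: "\<And>n. f n \<in> borel_measurable M"
    and i: "\<And>n. integrable M (\<lambda>x. norm (f n x) powr p)"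
    and cau: "\<And>e. e > 0 \<Longrightarrow> \<exists>N. \<forall>m\<ge>N. \<forall>n\<ge>N. (\<integral>x. norm (f m x - f n x) powr p \<partial>M) < e"
  obtains g where "g \<in> borel_measurable M" "integrable M (\<lambda>x. norm (g x) powr p)"
    "(\<lambda>n. \<integral>x. norm (f n x - g x) powr p \<partial>M) \<longlonglongrightarrow> 0"
proof -
  let ?I = "\<lambda>u v. \<integral>x. norm (u x - v x :: 'b) powr p \<partial>M"
  let ?J = "\<lambda>u v. \<integral>\<^sup>+x. ennreal (norm (u x - v x :: 'b) powr p) \<partial>M"
  interpret finite_measure M by fact
  have id: "integrable M (\<lambda>x. norm (f m x - f n x) powr p)" for m n
    by (rule integrable_norm_powr_diff) (use assms in auto)
  have "\<exists>r. strict_mono r \<and> (\<forall>k::nat. \<forall>m\<ge>r k. \<forall>n\<ge>r k. ?I (f m) (f n) < (1/2) powr (real k * p))"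
  proof -
    have "\<exists>N. \<forall>m\<ge>N. \<forall>n\<ge>N. ?I (f m) (f n) < (1/2) powr (real k * p)" for k :: nat
      by (rule cau) auto
    then obtain N where N: "\<And>k m n. m \<ge> N k \<Longrightarrow> n \<ge> N k \<Longrightarrow> ?I (f m) (f n) < (1/2) powr (real k * p)"
      by metis
    define r where "r k = (\<Sum>i\<le>k. N i) + k" for k
    have "strict_mono r" unfolding strict_mono_Suc_iff by (auto simp: r_def)
    moreover have "N k \<le> r k" for k
      unfolding r_def using member_le_sum[of k "{..k}" N] by auto
    ultimately show ?thesis using N by (meson order_trans)
  qed
  then obtain r where r: "strict_mono r"
    "\<And>k m n. m \<ge> r k \<Longrightarrow> n \<ge> r k \<Longrightarrow> ?I (f m) (f n) < (1/2) powr (real k * p)"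
    by blast
  define d where "d k x = norm (f (r (Suc k)) x - f (r k) x)" for k x
  have dm [measurable]: "d k \<in> borel_measurable M" for k unfolding d_def by measurable
  have dint: "(\<integral>\<^sup>+x. ennreal (d k x) \<partial>M) \<le> ennreal ((1/2)^k * (measure M (space M) + 1))" for k
  proof -
    \<comment> \<open>With this \<open>e\<close> both terms of \<open>le_eps_plus_powr\<close>
      integrate to a constant times \<open>2^(-k)\<close>.\<close>
    define e where "e = (1/2::real)^k"
    have e: "e > 0" by (simp add: e_def)
    have ek: "(1/2) powr (real k * p) = e powr p" by (simp add: e_def powr_powr flip: powr_realpow)
    have lt: "(\<integral>x. d k x powr p \<partial>M) \<le> e powr p"
      unfolding d_def ek[symmetric] using r(2)[of k "r (Suc k)" "r k"] r(1) by (simp add: strict_mono_less_eq less_imp_le)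
    have ii: "integrable M (\<lambda>x. e + e powr (1-p) * d k x powr p)"
      unfolding d_def using id by auto
    have "(\<integral>\<^sup>+x. ennreal (d k x) \<partial>M) \<le> (\<integral>\<^sup>+x. ennreal (e + e powr (1-p) * d k x powr p) \<partial>M)"
      by (intro nn_integral_mono ennreal_leI le_eps_plus_powr) (use e assms(2) in \<open>auto simp: d_def\<close>)
    also have "... = ennreal (\<integral>x. e + e powr (1-p) * d k x powr p \<partial>M)"
      by (rule nn_integral_eq_integral[OF ii]) (use e in auto)
    also have "(\<integral>x. e + e powr (1-p) * d k x powr p \<partial>M) = e * measure M (space M) + e powr (1-p) * (\<integral>x. d k x powr p \<partial>M)"
      using id by (simp add: d_def mult.commute)
    also have "ennreal ... \<le> ennreal (e * measure M (space M) + e powr (1-p) * e powr p)"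
      using lt by (intro ennreal_leI add_left_mono mult_left_mono) auto
    also have "e powr (1-p) * e powr p = e" using e by (simp flip: powr_add)
    finally show ?thesis by (simp add: e_def algebra_simps)
  qed
  have "(\<integral>\<^sup>+x. (\<Sum>k. ennreal (d k x)) \<partial>M) = (\<Sum>k. \<integral>\<^sup>+x. ennreal (d k x) \<partial>M)"
    by (rule nn_integral_suminf) auto
  also have "... \<le> (\<Sum>k. ennreal ((1/2)^k * (measure M (space M) + 1)))"
    by (intro suminf_le dint) auto
  also have "... < \<infinity>"
  proof -
    have "summable (\<lambda>k. (1/2::real)^k * (measure M (space M) + 1))" by (intro summable_mult2) auto
    then show ?thesis by (subst suminf_ennreal2) auto
  qed
  finally have "AE x in M. (\<Sum>k. ennreal (d k x)) \<noteq> \<infinity>"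
    by (intro nn_integral_PInf_AE) auto
  then have AEc: "AE x in M. convergent (\<lambda>k. f (r k) x)"
  proof (rule AE_mp, intro AE_I2 impI)
    fix x assume "(\<Sum>k. ennreal (d k x)) \<noteq> \<infinity>"
    then have "summable (\<lambda>k. d k x)"
      by (intro summable_suminf_not_top) (auto simp: d_def)
    then have "summable (\<lambda>k. f (r (Suc k)) x - f (r k) x)"
      unfolding d_def by (rule summable_norm_cancel)
    then have "convergent (\<lambda>n. \<Sum>k<n. f (r (Suc k)) x - f (r k) x)"
      by (simp add: summable_iff_convergent)
    then have "convergent (\<lambda>n. f (r n) x - f (r 0) x)"
      by (simp add: sum_lessThan_telescope[of "\<lambda>k. f (r k) x"])
    then have "convergent (\<lambda>n. f (r n) x - f (r 0) x + f (r 0) x)"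
      by (intro convergent_add convergent_const)
    then show "convergent (\<lambda>k. f (r k) x)" by simp
  qed
  define g where "g x = lim (\<lambda>k. f (r k) x)" for x
  have gm [measurable]: "g \<in> borel_measurable M"
    unfolding g_def by (rule borel_measurable_lim_metric) auto
  have gl: "AE x in M. (\<lambda>k. f (r k) x) \<longlonglongrightarrow> g x"
    using AEc by eventually_elim (auto simp: g_def convergent_LIMSEQ_iff)
  \<comment> \<open>Fatou's lemma, in the extended reals because integrability of the difference to
    the limit is itself drawn from this bound.\<close>
  have key: "?J (f n) g \<le> ennreal e"
    if "\<And>m. m \<ge> N \<Longrightarrow> ?I (f n) (f m) < e" for n N e
  proof -
    have "?J (f n) g = (\<integral>\<^sup>+x. liminf (\<lambda>k. ennreal (norm (f n x - f (r k) x) powr p)) \<partial>M)"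
    proof (rule nn_integral_cong_AE)
      show "AE x in M. ennreal (norm (f n x - g x) powr p) = liminf (\<lambda>k. ennreal (norm (f n x - f (r k) x) powr p))"
      proof (rule AE_mp[OF gl], intro AE_I2 impI)
        fix x assume elim: "(\<lambda>k. f (r k) x) \<longlonglongrightarrow> g x"
        have "(\<lambda>k. norm (f n x - f (r k) x) powr p) \<longlonglongrightarrow> norm (f n x - g x) powr p"
          by (rule tendsto_powr'[OF tendsto_norm[OF tendsto_diff[OF tendsto_const elim]] tendsto_const]) (use assms(2) in auto)
        then have "(\<lambda>k. ennreal (norm (f n x - f (r k) x) powr p)) \<longlonglongrightarrow> ennreal (norm (f n x - g x) powr p)"
          by (rule tendsto_ennrealI)
        then show "ennreal (norm (f n x - g x) powr p) = liminf (\<lambda>k. ennreal (norm (f n x - f (r k) x) powr p))"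
          using lim_imp_Liminf[OF trivial_limit_sequentially] by metis
      qed
    qed
    also have "... \<le> liminf (\<lambda>k. \<integral>\<^sup>+x. ennreal (norm (f n x - f (r k) x) powr p) \<partial>M)"
      by (rule nn_integral_liminf) measurable
    also have "... \<le> liminf (\<lambda>k. ennreal e)"
    proof (rule Liminf_mono)
      have "\<forall>\<^sub>F k in sequentially. r k \<ge> N"
        by (rule eventually_sequentiallyI[of N]) (meson seq_suble[OF r(1)] order_trans)
      then show "\<forall>\<^sub>F k in sequentially. ?J (f n) (f (r k)) \<le> ennreal e"
      proof eventually_elim
        case (elim k)
        have "?J (f n) (f (r k)) = ennreal (?I (f n) (f (r k)))"
          by (rule nn_integral_eq_integral[OF id]) auto
        then show ?case using that[OF elim] by (simp add: ennreal_leI less_imp_le)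
      qed
    qed
    finally show ?thesis by (simp add: Liminf_const)
  qed
  have intd: "integrable M (\<lambda>x. norm (f n x - g x) powr p)" if "\<And>m. m \<ge> N \<Longrightarrow> ?I (f n) (f m) < e" for n N e
    by (rule integrableI_bounded) (use le_less_trans[OF key[OF that]] in auto)
  obtain N1 where N1: "\<And>m n. m \<ge> N1 \<Longrightarrow> n \<ge> N1 \<Longrightarrow> ?I (f m) (f n) < 1"
    using cau[of 1] by auto
  have "integrable M (\<lambda>x. norm (f N1 x - (f N1 x - g x)) powr p)"
    by (rule integrable_norm_powr_diff[OF assms(2) _ _ i intd[of N1 N1 1]]) (use N1 in auto)
  then have gi: "integrable M (\<lambda>x. norm (g x) powr p)" by simp
  show thesis
  proof (rule that[OF gm gi], rule LIMSEQ_I)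
    fix e :: real assume "e > 0"
    then obtain N where N: "\<And>m n. m \<ge> N \<Longrightarrow> n \<ge> N \<Longrightarrow> ?I (f m) (f n) < e/2"
      using cau[of "e/2"] by auto
    have le: "?I (f n) g \<le> e/2" if "n \<ge> N" for n
    proof -
      have "ennreal (?I (f n) g) = ?J (f n) g"
        by (rule nn_integral_eq_integral[symmetric, OF intd[of N n "e/2"]]) (use N that in auto)
      also have "... \<le> ennreal (e/2)" by (rule key[of N]) (use N that in auto)
      finally show ?thesis using \<open>e > 0\<close> by (simp add: ennreal_le_iff)
    qed
    have "norm (?I (f n) g - 0) < e" if "n \<ge> N" for n
    proof -
      have "0 \<le> ?I (f n) g"
        by (intro integral_nonneg_AE) auto
      moreover have "?I (f n) g \<le> e/2" by (rule le[OF that])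
      ultimately show ?thesis using \<open>e > 0\<close> unfolding real_norm_def by linarith
    qed
    then show "\<exists>no. \<forall>n\<ge>no. norm (?I (f n) g - 0) < e"
      by blast
  qed
qed

section \<open>The surface measure\<close>

text \<open>The punctured ball whose radial image, with density 3, is \<open>sigmaS\<close>. It is
  treated on its own because its invariance under orthogonal maps is that of Lebesgue
  measure.\<close>

definition pball :: "(real^'n::{finite,wellorder}) measure" where
  "pball = restrict_space lborel (ball 0 1 - {0})"

lemma space_pball [simp]: "space pball = ball 0 1 - {0}"
  by (simp add: pball_def space_restrict_space)

lemma sets_pball: "sets (pball :: (real^'n::{finite,wellorder}) measure) = sets (restrict_space borel (ball 0 1 - {0}))"
  unfolding pball_def by (rule sets_restrict_space_cong) simp

lemma emeasure_pball: "emeasure (pball :: (real^'n::{finite,wellorder}) measure) (space pball) = emeasure lborel (ball 0 1 :: (real^'n::_) set)"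
proof -
  have "emeasure (pball :: (real^'n::_) measure) (space pball) = emeasure lborel (ball 0 1 - {0::real^'n::_})"
    unfolding pball_def by (subst emeasure_restrict_space) (auto simp: space_restrict_space)
  also have "... = emeasure lborel (ball 0 1 :: (real^'n::_) set)"
    by (rule emeasure_Diff_null_set) auto
  finally show ?thesis .
qed

lemma measurable_pball_borel: "(\<lambda>x. x) \<in> measurable (pball :: (real^'n::{finite,wellorder}) measure) borel"
proof -
  have "(\<lambda>x. x) \<in> measurable (restrict_space borel (ball 0 1 - {0::real^'n::_})) borel"
    by (rule measurable_restrict_space1) simp
  then show ?thesis using measurable_cong_sets[OF sets_pball refl, of borel] by blast
qed

lemma distr_pball:
  fixes T :: "real^'n::{finite,wellorder} \<Rightarrow> real^'n::_"
  assumes "orthogonal_transformation T"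
  shows "T \<in> measurable pball pball" "distr pball pball T = pball"
proof -
  let ?B = "ball 0 1 - {0::real^'n::_}"
  have bij: "bij T" and inv: "orthogonal_transformation (inv T)"
    using assms orthogonal_transformation_bij orthogonal_transformation_inv by blast+
  have nT: "norm (T x) = norm x" for x by (rule orthogonal_transformation_norm[OF assms])
  have T0: "T x = 0 \<longleftrightarrow> x = 0" for x using nT[of x] by auto
  have lin: "linear T" by (rule orthogonal_transformation_linear[OF assms])
  have Tb [measurable]: "T \<in> borel_measurable borel"
    by (intro borel_measurable_continuous_onI linear_continuous_on linear_conv_bounded_linear[THEN iffD1] lin)
  show mT: "T \<in> measurable pball pball"
  proof -
    have "T \<in> measurable (restrict_space borel ?B) (restrict_space borel ?B)"
      by (rule measurable_restrict_space3) (auto simp: nT T0)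
    then show ?thesis using measurable_cong_sets[OF sets_pball sets_pball] by blast
  qed
  show "distr pball pball T = pball"
  proof (rule measure_eqI)
    fix A assume "A \<in> sets (distr pball pball T)"
    then have A: "A \<in> sets pball" by simp
    then have A': "A \<in> sets borel" "A \<subseteq> ?B"
      by (auto simp: sets_pball sets_restrict_space)
    \<comment> \<open>Preimages become images under the inverse map, to which the invariance of
      Lebesgue measure applies.\<close>
    have eq: "T -` A \<inter> space pball = inv T ` A"
    proof -
      have "inv T ` A = T -` A" using bij_vimage_eq_inv_image[OF bij] by simp
      moreover have "T -` A \<subseteq> ?B" using A'(2) by (force simp: nT T0)
      ultimately show ?thesis by auto
    qed
    have lm: "A \<in> lmeasurable"
      by (rule bounded_set_imp_lmeasurable) (use A' in \<open>auto intro: bounded_subset[OF bounded_ball[of 0 1]]\<close>)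
    have lm2: "inv T ` A \<in> lmeasurable" by (rule measurable_orthogonal_image[OF inv lm])
    have b2: "inv T ` A \<in> sets borel"
    proof -
      have "T -` A \<in> sets borel" using measurable_sets[OF Tb A'(1)] by simp
      then show ?thesis using bij_vimage_eq_inv_image[OF bij, of A] by simp
    qed
    have "emeasure (distr pball pball T) A = emeasure pball (inv T ` A)"
      using emeasure_distr[OF mT A] eq by simp
    also have "... = emeasure lborel (inv T ` A)"
      unfolding pball_def by (rule emeasure_restrict_space) (use eq in auto)
    also have "... = emeasure lebesgue (inv T ` A)" using b2 by simp
    also have "... = ennreal (measure lebesgue (inv T ` A))"
      by (rule emeasure_eq_measure2[OF lm2])
    also have "... = ennreal (measure lebesgue A)"
      by (simp add: measure_orthogonal_image[OF inv lm])
    also have "... = emeasure lebesgue A"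
      by (rule emeasure_eq_measure2[OF lm, symmetric])
    also have "... = emeasure lborel A" using A' by simp
    also have "... = emeasure pball A"
      unfolding pball_def by (rule emeasure_restrict_space[symmetric]) (use A' in auto)
    finally show "emeasure (distr pball pball T) A = emeasure pball A" .
  qed simp
qed

section \<open>Total mass and rotation invariance of the surface measure\<close>

abbreviation sphere_integral :: "(R3 \<Rightarrow> 'b::{banach,second_countable_topology}) \<Rightarrow> 'b" (binder "\<ointegral>" 10)
  where "sphere_integral f \<equiv> integral\<^sup>L sigmaS f"

lemma space_sigmaS [simp]: "space sigmaS = sphere 0 1"
  by (simp add: sigmaS_def space_restrict_space)

lemma sets_sigmaS: "sets sigmaS = sets (restrict_space borel (sphere 0 1))"
  by (simp add: sigmaS_def)

lemma measurable_sigmaS_borel [measurable]: "(\<lambda>x. x) \<in> measurable sigmaS borel"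
proof -
  have "(\<lambda>x. x) \<in> measurable (restrict_space borel (sphere 0 1 :: R3 set)) borel"
    by (rule measurable_restrict_space1) simp
  then show ?thesis using measurable_cong_sets[OF sets_sigmaS refl, of borel] by blast
qed

lemma borel_measurable_sigmaS_I: "f \<in> borel_measurable borel \<Longrightarrow> f \<in> borel_measurable sigmaS"
  using measurable_compose[OF measurable_sigmaS_borel] by blast

lemma sphere_measurable:
  fixes f :: "R3 \<Rightarrow> 'a::topological_space"
  shows "continuous_on (sphere 0 1) f \<Longrightarrow> f \<in> borel_measurable sigmaS"
  using borel_measurable_continuous_on_restrict[of "sphere 0 1" f] measurable_cong_sets[OF sets_sigmaS refl, of borel] by blast

lemma measurable_normalize: "(\<lambda>x::R3. x /\<^sub>R norm x) \<in> measurable (density pball (\<lambda>_. 3)) (restrict_space borel (sphere 0 1))"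
proof -
  have "(\<lambda>x::R3. x /\<^sub>R norm x) \<in> measurable pball (restrict_space borel (sphere 0 1))"
  proof (rule measurable_restrict_space2)
    have "(\<lambda>x::R3. x /\<^sub>R norm x) \<in> borel_measurable borel" by measurable
    from measurable_compose[OF measurable_pball_borel this]
    show "(\<lambda>x::R3. x /\<^sub>R norm x) \<in> borel_measurable pball" .
  qed (auto simp: divide_simps)
  then show ?thesis by simp
qed

lemma sigmaS_eq: "sigmaS = distr (density pball (\<lambda>_. 3)) (restrict_space borel (sphere 0 1)) (\<lambda>x. x /\<^sub>R norm x)"
  unfolding sigmaS_def pball_def ..

text \<open>The density 3 turns the volume \<open>4 pi / 3\<close> of the ball into the area of the
  sphere.\<close>

lemma emeasure_sigmaS: "emeasure sigmaS (space sigmaS) = ennreal (4 * pi)"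
proof -
  have "emeasure sigmaS (space sigmaS) = emeasure (density (pball :: R3 measure) (\<lambda>_. 3)) (space pball)"
    unfolding sigmaS_eq using measurable_space[OF measurable_normalize]
    by (subst emeasure_distr[OF measurable_normalize]) (auto simp: space_restrict_space sets_restrict_space intro!: arg_cong[where f="emeasure _"])
  also have "... = 3 * emeasure (pball :: R3 measure) (space pball)"
    by (subst emeasure_density[OF _ sets.top]) (simp_all del: space_pball add: nn_integral_cmult)
  also have "... = 3 * ennreal (unit_ball_vol 3)"
    unfolding emeasure_pball by (subst emeasure_ball) auto
  also have "... = ennreal (4 * pi)"
    by (simp add: unit_ball_vol_numeral fact_numeral ennreal_mult[symmetric] flip: ennreal_numeral)
  finally show ?thesis .
qed

global_interpretation sigma: finite_measure sigmaS
  by (rule finite_measureI, unfold emeasure_sigmaS) simp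

lemma measure_sigmaS [simp]: "measure sigmaS (sphere 0 1) = 4 * pi"
  using emeasure_sigmaS by (simp add: measure_def)

lemma sphere_integrable_bounded:
  fixes f :: "R3 \<Rightarrow> 'a::{banach,second_countable_topology}"
  assumes "f \<in> borel_measurable sigmaS" "\<And>x. norm x = 1 \<Longrightarrow> norm (f x) \<le> B"
  shows "integrable sigmaS f"
  by (rule sigma.integrable_const_bound[of _ B]) (use assms in auto)

lemma sphere_integrable:
  fixes f :: "R3 \<Rightarrow> 'a::euclidean_space"
  assumes "continuous_on (sphere 0 1) f"
  shows "integrable sigmaS f"
proof -
  have "bounded (f ` sphere 0 1)"
    by (intro compact_imp_bounded compact_continuous_image assms) auto
  then obtain B where "\<And>x. x \<in> sphere 0 1 \<Longrightarrow> norm (f x) \<le> B"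
    unfolding bounded_iff by blast
  then show ?thesis
    by (intro sphere_integrable_bounded[of f B] sphere_measurable assms) auto
qed

text \<open>Radial projection commutes with orthogonal maps, so the invariance of the measure on the
  ball descends to the sphere.\<close>

lemma distr_sigmaS:
  assumes "orthogonal_transformation T"
  shows "T \<in> measurable sigmaS sigmaS" "distr sigmaS sigmaS T = sigmaS"
proof -
  let ?S = "restrict_space borel (sphere 0 1 :: R3 set)"
  let ?D = "density (pball :: R3 measure) (\<lambda>_. 3)"
  have nT: "norm (T x) = norm x" for x by (rule orthogonal_transformation_norm[OF assms])
  have lin: "linear T" by (rule orthogonal_transformation_linear[OF assms])
  have Tb [measurable]: "T \<in> borel_measurable borel"
    by (intro borel_measurable_continuous_onI linear_continuous_on linear_conv_bounded_linear[THEN iffD1] lin)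
  have mS: "T \<in> measurable ?S ?S"
    by (rule measurable_restrict_space3) (auto simp: nT)
  then show mT: "T \<in> measurable sigmaS sigmaS"
    using measurable_cong_sets[OF sets_sigmaS sets_sigmaS] by blast
  have dD: "distr ?D ?D T = ?D"
  proof (rule measure_eqI)
    fix A assume "A \<in> sets (distr ?D ?D T)"
    then have A: "A \<in> sets pball" by simp
    have v: "T -` A \<inter> space pball \<in> sets pball" by (rule measurable_sets[OF distr_pball(1)[OF assms] A])
    have "emeasure (distr ?D ?D T) A = emeasure ?D (T -` A \<inter> space pball)"
      using A distr_pball(1)[OF assms] by (subst emeasure_distr) auto
    also have "... = 3 * emeasure pball (T -` A \<inter> space pball)"
      using v by (subst emeasure_density) (auto simp: nn_integral_cmult)
    also have "emeasure pball (T -` A \<inter> space pball) = emeasure (distr pball pball T) A"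
      using A distr_pball(1)[OF assms] by (subst emeasure_distr) auto
    also have "3 * ... = emeasure ?D A"
      using A by (subst emeasure_density) (auto simp: nn_integral_cmult distr_pball(2)[OF assms])
    finally show "emeasure (distr ?D ?D T) A = emeasure ?D A" .
  qed simp
  have "distr sigmaS sigmaS T = distr (distr ?D ?S (\<lambda>x. x /\<^sub>R norm x)) ?S T"
    unfolding sigmaS_eq by (rule distr_cong) simp_all
  also have "... = distr ?D ?S (T \<circ> (\<lambda>x. x /\<^sub>R norm x))"
    by (rule distr_distr[OF mS measurable_normalize])
  also have "T \<circ> (\<lambda>x. x /\<^sub>R norm x) = (\<lambda>x. x /\<^sub>R norm x) \<circ> T"
    by (auto simp: fun_eq_iff nT linear_cmul[OF lin])
  also have "distr ?D ?S ((\<lambda>x. x /\<^sub>R norm x) \<circ> T) = distr (distr ?D ?D T) ?S (\<lambda>x. x /\<^sub>R norm x)"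
    by (rule distr_distr[symmetric, OF measurable_normalize]) (use distr_pball(1)[OF assms] in simp)
  also have "... = sigmaS" unfolding dD sigmaS_eq ..
  finally show "distr sigmaS sigmaS T = sigmaS" .
qed

lemma integral_sigmaS_orthogonal:
  fixes f :: "R3 \<Rightarrow> 'a::{banach,second_countable_topology}"
  assumes "orthogonal_transformation T" "f \<in> borel_measurable sigmaS"
  shows "(\<ointegral>x. f (T x)) = (\<ointegral>x. f x)"
  using integral_distr[OF distr_sigmaS(1)[OF assms(1)] assms(2)] distr_sigmaS(2)[OF assms(1)] by simp

section \<open>Polynomials and harmonic polynomials\<close>

lemma UNIV_3_cases: obtains "(i::3) = 1" | "i = 2" | "i = 3"
  using exhaust_3[of i] by blast

lemma pd_has_derivative:
  assumes "(f has_derivative f') (at x)"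
  shows "pd i f x = f' (axis i 1)"
proof -
  have "((\<lambda>t. x + t *\<^sub>R axis i (1::real)) has_derivative (\<lambda>t. t *\<^sub>R axis i 1)) (at 0)"
    by (auto intro!: derivative_eq_intros)
  then have "((\<lambda>t. f (x + t *\<^sub>R axis i 1)) has_derivative (\<lambda>t. f' (t *\<^sub>R axis i 1))) (at 0)"
    using has_derivative_compose[of "\<lambda>t. x + t *\<^sub>R axis i 1" _ 0 UNIV f f'] assms by simp
  moreover have "(\<lambda>t. f' (t *\<^sub>R axis i 1)) = (*) (f' (axis i 1))"
    using linear_cmul[OF has_derivative_linear[OF assms]] by (auto simp: mult.commute)
  ultimately show ?thesis
    unfolding pd_def by (intro DERIV_imp_deriv) (simp add: has_field_derivative_def)
qed

lemma grad_has_derivative: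
  assumes "(f has_derivative f') (at x)"
  shows "grad f x \<bullet> h = f' h"
proof -
  have lin: "linear f'" by (rule has_derivative_linear[OF assms])
  have "f' h = f' (\<Sum>i\<in>UNIV. h $ i *\<^sub>R axis i 1)"
    by (simp add: basis_expansion scalar_mult_eq_scaleR[symmetric])
  also have "... = (\<Sum>i\<in>UNIV. h $ i * f' (axis i 1))"
    by (simp add: linear_sum[OF lin] linear_cmul[OF lin])
  finally show ?thesis
    by (simp add: inner_vec_def grad_def pd_has_derivative[OF assms] mult.commute)
qed

lemma grad_eqI:
  assumes "(f has_derivative (\<lambda>h. g \<bullet> h)) (at x)"
  shows "grad f x = g"
  using grad_has_derivative[OF assms] by (metis vector_eq_ldot inner_commute)

lemma has_derivative_grad:
  "f differentiable (at x) \<Longrightarrow> (f has_derivative (\<lambda>h. grad f x \<bullet> h)) (at x)"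
  using grad_has_derivative by (metis (no_types, lifting) ext differentiable_def)

lemma grad_nth: "grad f x $ i = pd i f x"
  by (simp add: grad_def)

lemma has_derivative_vec_nth: "((\<lambda>x::R3. x $ i) has_derivative (\<lambda>h. h $ i)) F"
  by (rule bounded_linear_imp_has_derivative[OF bounded_linear_vec_nth])

text \<open>Single monomials, coefficient included, are the base case of the inductions below; the
  class is closed under partial derivatives and products.\<close>

definition monomial3 :: "real \<Rightarrow> nat \<Rightarrow> nat \<Rightarrow> nat \<Rightarrow> R3 \<Rightarrow> real" where
  "monomial3 c a b d = (\<lambda>x. c * (x$1)^a * (x$2)^b * (x$3)^d)"

lemma monomial3_differentiable: "monomial3 c a b d differentiable (at x)"
  unfolding monomial3_def
  by (intro differentiable_mult differentiable_power differentiable_const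
      differentiableI[OF has_derivative_vec_nth])

text \<open>At exponent 0 the truncated subtraction does no harm, since the new coefficient is then
  0.\<close>

lemma pd_monomial3:
  "pd 1 (monomial3 c a b d) = monomial3 (c * a) (a - 1) b d"
  "pd 2 (monomial3 c a b d) = monomial3 (c * b) a (b - 1) d"
  "pd 3 (monomial3 c a b d) = monomial3 (c * d) a b (d - 1)"
proof -
  have D: "(monomial3 c a b d has_derivative
    (\<lambda>h. c * (real a * x$1^(a-1) * h$1) * x$2^b * x$3^d + c * x$1^a * (real b * x$2^(b-1) * h$2) * x$3^d
       + c * x$1^a * x$2^b * (real d * x$3^(d-1) * h$3))) (at x)" for x
    unfolding monomial3_def
    by (rule derivative_eq_intros has_derivative_vec_nth refl | simp add: algebra_simps)+
  show "pd 1 (monomial3 c a b d) = monomial3 (c * a) (a - 1) b d"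
    "pd 2 (monomial3 c a b d) = monomial3 (c * b) a (b - 1) d"
    "pd 3 (monomial3 c a b d) = monomial3 (c * d) a b (d - 1)"
    unfolding fun_eq_iff pd_has_derivative[OF D] by (auto simp: axis_def monomial3_def)
qed

text \<open>Linear facts about polynomials reduce to single monomials, which keeps the triple sums
  of coefficients out of later proofs.\<close>

lemma poly3_induct [consumes 1, case_names zero add mono]:
  assumes "poly3 q" "P (\<lambda>_. 0)" "\<And>q r. P q \<Longrightarrow> P r \<Longrightarrow> P (\<lambda>x. q x + r x)"
    "\<And>c a b d. P (monomial3 c a b d)"
  shows "P q"
proof -
  obtain N c where "\<And>x. q x = (\<Sum>a<N. \<Sum>b<N. \<Sum>d<N. c a b d * (x$1)^a * (x$2)^b * (x$3)^d)"
    using assms(1) unfolding poly3_def by blast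
  then have q: "q = (\<lambda>x. \<Sum>a<N. \<Sum>b<N. \<Sum>d<N. monomial3 (c a b d) a b d x)"
    by (simp only: fun_eq_iff monomial3_def) simp
  have s: "P (\<lambda>x. \<Sum>a<M. g a x)" if "\<And>a. P (g a)" for g :: "nat \<Rightarrow> _" and M :: nat
    by (induction M) (auto intro: assms that)
  show ?thesis unfolding q by (intro s assms(4))
qed

lemma sum_delta3:
  fixes f :: "'a \<Rightarrow> 'b \<Rightarrow> 'c \<Rightarrow> real"
  assumes "finite A" "finite B" "finite C" "a \<in> A" "b \<in> B" "d \<in> C"
  shows "(\<Sum>i\<in>A. \<Sum>j\<in>B. \<Sum>k\<in>C. if i = a \<and> j = b \<and> k = d then f i j k else 0) = f a b d"
proof -
  have 1: "(\<Sum>k\<in>C. if i = a \<and> j = b \<and> k = d then f i j k else 0) = (if i = a \<and> j = b then f a b d else 0)" for i j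
    using assms by (cases "i = a \<and> j = b") (auto simp: sum.delta)
  have 2: "(\<Sum>j\<in>B. if i = a \<and> j = b then f a b d else 0) = (if i = a then f a b d else 0)" for i
    using assms by (cases "i = a") (auto simp: sum.delta)
  show ?thesis unfolding 1 2 using assms by (simp add: sum.delta)
qed

lemma poly3_monomial3: "poly3 (monomial3 c a b d)"
proof -
  define N where "N = Suc (max a (max b d))"
  have lt: "a < N" "b < N" "d < N" by (auto simp: N_def)
  have "monomial3 c a b d x = (\<Sum>i<N. \<Sum>j<N. \<Sum>k<N. (if i = a \<and> j = b \<and> k = d then c else 0) * (x$1)^i * (x$2)^j * (x$3)^k)" for x
  proof -
    have "(\<Sum>i<N. \<Sum>j<N. \<Sum>k<N. (if i = a \<and> j = b \<and> k = d then c else 0) * (x$1)^i * (x$2)^j * (x$3)^k)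
      = (\<Sum>i<N. \<Sum>j<N. \<Sum>k<N. if i = a \<and> j = b \<and> k = d then c * (x$1)^i * (x$2)^j * (x$3)^k else 0)"
      by (intro sum.cong refl) auto
    also have "... = monomial3 c a b d x"
      using lt by (subst sum_delta3) (auto simp: monomial3_def)
    finally show ?thesis ..
  qed
  then show ?thesis unfolding poly3_def
    by (intro exI[of _ N] exI[of _ "\<lambda>i j k. if i = a \<and> j = b \<and> k = d then c else 0"] allI)
qed

lemma poly3_add: assumes "poly3 q" "poly3 r" shows "poly3 (\<lambda>x. q x + r x)"
proof -
  obtain N c where q: "\<And>x. q x = (\<Sum>a<N. \<Sum>b<N. \<Sum>d<N. c a b d * (x$1)^a * (x$2)^b * (x$3)^d)"
    using assms(1) unfolding poly3_def by blast
  obtain M c' where r: "\<And>x. r x = (\<Sum>a<M. \<Sum>b<M. \<Sum>d<M. c' a b d * (x$1)^a * (x$2)^b * (x$3)^d)"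
    using assms(2) unfolding poly3_def by blast
  \<comment> \<open>The coefficient arrays are padded with zeros to a common size, one summation
    index at a time.\<close>
  have pad: "(\<Sum>a<N. \<Sum>b<N. \<Sum>d<N. c a b d * (x$1)^a * (x$2)^b * (x$3)^d) =
      (\<Sum>a<N+M. \<Sum>b<N+M. \<Sum>d<N+M. (if a < N \<and> b < N \<and> d < N then c a b d else 0) * (x$1)^a * (x$2)^b * (x$3)^d)"
    for N M :: nat and c :: "nat \<Rightarrow> nat \<Rightarrow> nat \<Rightarrow> real" and x :: R3
  proof -
    have "(\<Sum>a<N. \<Sum>b<N. \<Sum>d<N. c a b d * (x$1)^a * (x$2)^b * (x$3)^d)
      = (\<Sum>a<N. \<Sum>b<N. \<Sum>d<N. (if a < N \<and> b < N \<and> d < N then c a b d else 0) * (x$1)^a * (x$2)^b * (x$3)^d)"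
      by (intro sum.cong refl) auto
    also have "... = (\<Sum>a<N. \<Sum>b<N. \<Sum>d<N+M. (if a < N \<and> b < N \<and> d < N then c a b d else 0) * (x$1)^a * (x$2)^b * (x$3)^d)"
      by (intro sum.cong refl sum.mono_neutral_left) auto
    also have "... = (\<Sum>a<N. \<Sum>b<N+M. \<Sum>d<N+M. (if a < N \<and> b < N \<and> d < N then c a b d else 0) * (x$1)^a * (x$2)^b * (x$3)^d)"
      by (intro sum.cong refl sum.mono_neutral_left) auto
    also have "... = (\<Sum>a<N+M. \<Sum>b<N+M. \<Sum>d<N+M. (if a < N \<and> b < N \<and> d < N then c a b d else 0) * (x$1)^a * (x$2)^b * (x$3)^d)"
      by (intro sum.mono_neutral_left) auto
    finally show ?thesis .
  qed
  have "q x + r x = (\<Sum>a<N+M. \<Sum>b<N+M. \<Sum>d<N+M. ((if a < N \<and> b < N \<and> d < N then c a b d else 0)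
      + (if a < M \<and> b < M \<and> d < M then c' a b d else 0)) * (x$1)^a * (x$2)^b * (x$3)^d)" for x
    unfolding q r pad[where N=N and M=M and c=c and x=x] pad[where N=M and M=N and c=c' and x=x] add.commute[of M N]
    by (simp add: sum.distrib ring_distribs)
  then show ?thesis unfolding poly3_def
    by (intro exI[of _ "N + M"] exI[of _ "\<lambda>a b d. (if a < N \<and> b < N \<and> d < N then c a b d else 0)
      + (if a < M \<and> b < M \<and> d < M then c' a b d else 0)"] allI)
qed

lemma poly3_0: "poly3 (\<lambda>_. 0)"
  using poly3_monomial3[of 0 0 0 0] by (simp add: monomial3_def)

lemma poly3_const: "poly3 (\<lambda>_. c)"
  using poly3_monomial3[of c 0 0 0] by (simp add: monomial3_def)

lemma monomial3_mult: "monomial3 c a b d x * monomial3 c' a' b' d' x = monomial3 (c * c') (a + a') (b + b') (d + d') x"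
  by (simp add: monomial3_def power_add)

lemma poly3_mult: assumes "poly3 q" "poly3 r" shows "poly3 (\<lambda>x. q x * r x)"
  using assms(1)
proof (induction rule: poly3_induct)
  case (mono c a b d)
  show ?case
    using assms(2)
    by (induction rule: poly3_induct)
      (simp_all add: poly3_0 ring_distribs poly3_add monomial3_mult poly3_monomial3)
qed (simp_all add: poly3_0 ring_distribs poly3_add)

lemma poly3_coord: "poly3 (\<lambda>x. x $ i)"
  using exhaust_3[of i] poly3_monomial3[of 1 1 0 0] poly3_monomial3[of 1 0 1 0] poly3_monomial3[of 1 0 0 1]
  by (auto simp: monomial3_def)

lemma poly3_diff: "poly3 q \<Longrightarrow> poly3 r \<Longrightarrow> poly3 (\<lambda>x. q x - r x)"
  using poly3_add[of q "\<lambda>x. (-1) * r x"] poly3_mult[OF poly3_const[of "-1"], of r] by simp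

lemma poly3_sum: "(\<And>i. i \<in> A \<Longrightarrow> poly3 (f i)) \<Longrightarrow> poly3 (\<lambda>x. \<Sum>i\<in>A. f i x)"
  by (induction A rule: infinite_finite_induct) (auto intro: poly3_0 poly3_add)

lemma poly3_differentiable: "poly3 q \<Longrightarrow> q differentiable (at x)"
  by (induction rule: poly3_induct) (auto intro: monomial3_differentiable)

lemma poly3_continuous: "poly3 q \<Longrightarrow> continuous_on A q"
  by (meson poly3_differentiable differentiable_imp_continuous_within continuous_at_imp_continuous_on)

lemma poly3_borel [measurable_dest]: "poly3 q \<Longrightarrow> q \<in> borel_measurable borel"
  by (intro borel_measurable_continuous_onI poly3_continuous)

lemma pd_add:
  "q differentiable (at x) \<Longrightarrow> r differentiable (at x) \<Longrightarrow> pd i (\<lambda>x. q x + r x) x = pd i q x + pd i r x"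
  by (drule (1) has_derivative_add[OF has_derivative_grad has_derivative_grad])
     (simp add: pd_has_derivative grad_nth inner_axis inner_commute)

lemma pd_mult:
  "q differentiable (at x) \<Longrightarrow> r differentiable (at x) \<Longrightarrow> pd i (\<lambda>x. q x * r x) x = q x * pd i r x + pd i q x * r x"
  by (drule (1) has_derivative_mult[OF has_derivative_grad has_derivative_grad])
     (simp add: pd_has_derivative grad_nth inner_axis inner_commute)

lemma pd_const [simp]: "pd i (\<lambda>_. c) = (\<lambda>_. 0)"
  by (simp add: pd_def fun_eq_iff)

lemma pd_coord: "pd i (\<lambda>x. x $ j) x = (if i = j then 1 else 0)"
  by (simp add: pd_has_derivative[OF has_derivative_vec_nth] axis_def)

lemma poly3_pd_add: "poly3 q \<Longrightarrow> poly3 r \<Longrightarrow> pd i (\<lambda>x. q x + r x) = (\<lambda>x. pd i q x + pd i r x)"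
  by (auto simp: fun_eq_iff intro!: pd_add poly3_differentiable)

lemma poly3_pd_mult: "poly3 q \<Longrightarrow> poly3 r \<Longrightarrow> pd i (\<lambda>x. q x * r x) = (\<lambda>x. q x * pd i r x + pd i q x * r x)"
  by (auto simp: fun_eq_iff intro!: pd_mult poly3_differentiable)

lemma poly3_pd: assumes "poly3 q" shows "poly3 (pd i q)"
proof -
  have "poly3 q \<and> poly3 (pd i q)" using assms
  proof (induction rule: poly3_induct)
    case (mono c a b d)
    show ?case using exhaust_3[of i] by (auto simp: pd_monomial3 poly3_monomial3)
  qed (auto simp: poly3_0 poly3_pd_add intro: poly3_add)
  then show ?thesis ..
qed

lemma poly3_pd_cmult: "poly3 q \<Longrightarrow> pd i (\<lambda>x. c * q x) = (\<lambda>x. c * pd i q x)"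
  using poly3_pd_mult[OF poly3_const] by simp

lemma poly3_cmult: "poly3 q \<Longrightarrow> poly3 (\<lambda>x. c * q x)"
  by (rule poly3_mult[OF poly3_const])

lemma poly3_pd_diff: "poly3 q \<Longrightarrow> poly3 r \<Longrightarrow> pd i (\<lambda>x. q x - r x) = (\<lambda>x. pd i q x - pd i r x)"
  using poly3_pd_add[of q "\<lambda>x. (-1) * r x"] poly3_pd_cmult[of r i "-1"] poly3_cmult[of r "-1"] by simp

lemma poly3_pd_sum:
  "(\<And>k. k \<in> A \<Longrightarrow> poly3 (f k)) \<Longrightarrow> pd i (\<lambda>x. \<Sum>k\<in>A. f k x) = (\<lambda>x. \<Sum>k\<in>A. pd i (f k) x)"
proof (induction A rule: infinite_finite_induct)
  case (insert a A)
  then show ?case using poly3_pd_add[of "f a" "\<lambda>x. \<Sum>k\<in>A. f k x"] by (simp add: poly3_sum)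
qed auto

lemma poly3_pd_coord_mult: "poly3 q \<Longrightarrow> pd i (\<lambda>x. x $ j * q x) = (\<lambda>x. x $ j * pd i q x + (if i = j then q x else 0))"
  by (subst poly3_pd_mult[OF poly3_coord]) (auto simp: pd_coord fun_eq_iff)

lemma poly3_pd_commute: assumes "poly3 q" shows "pd i (pd j q) = pd j (pd i q)"
proof -
  have "poly3 q \<and> pd i (pd j q) = pd j (pd i q)" using assms
  proof (induction rule: poly3_induct)
    case (mono c a b d)
    show ?case using exhaust_3[of i] exhaust_3[of j]
      by (auto simp: pd_monomial3 poly3_monomial3 mult_ac)
  qed (auto simp: poly3_0 poly3_pd_add poly3_pd intro: poly3_add)
  then show ?thesis ..
qed

lemma lap_eq: "lap q x = pd 1 (pd 1 q) x + pd 2 (pd 2 q) x + pd 3 (pd 3 q) x"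
  by (simp add: lap_def sum_3)

lemma poly3_lap_add: "poly3 q \<Longrightarrow> poly3 r \<Longrightarrow> lap (\<lambda>x. q x + r x) = (\<lambda>x. lap q x + lap r x)"
  by (auto simp: lap_eq poly3_pd_add poly3_pd fun_eq_iff)

lemma poly3_lap_cmult: "poly3 q \<Longrightarrow> lap (\<lambda>x. c * q x) = (\<lambda>x. c * lap q x)"
  by (auto simp: lap_eq poly3_pd_cmult poly3_pd fun_eq_iff algebra_simps)

lemma poly3_lap_diff: "poly3 q \<Longrightarrow> poly3 r \<Longrightarrow> lap (\<lambda>x. q x - r x) = (\<lambda>x. lap q x - lap r x)"
  by (auto simp: lap_eq poly3_pd_diff poly3_pd fun_eq_iff)

lemma poly3_lap_pd: "poly3 q \<Longrightarrow> lap (pd i q) = pd i (lap q)"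
  unfolding lap_def[abs_def] by (subst poly3_pd_sum) (auto simp: poly3_pd poly3_pd_commute)

lemma poly3_lap_coord_mult: "poly3 q \<Longrightarrow> lap (\<lambda>x. x $ j * q x) = (\<lambda>x. x $ j * lap q x + 2 * pd j q x)"
  unfolding fun_eq_iff
  by (rule UNIV_3_cases[of j];
      simp add: lap_eq poly3_pd_coord_mult poly3_pd_add poly3_pd poly3_mult poly3_coord; simp add: algebra_simps)

section \<open>Homogeneous polynomials and the rotation fields\<close>

lemma hom_poly3_iff_monomial3: "hom_poly3 l q \<longleftrightarrow> (\<exists>c. q = (\<lambda>x. \<Sum>a\<le>l. \<Sum>b\<le>l. \<Sum>d\<le>l. if a + b + d = l then monomial3 (c a b d) a b d x else 0))"
  unfolding hom_poly3_def monomial3_def by (simp only: fun_eq_iff)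

lemma hom_poly3_induct [consumes 1, case_names zero add mono]:
  assumes "hom_poly3 l q" "P (\<lambda>_. 0)" "\<And>q r. P q \<Longrightarrow> P r \<Longrightarrow> P (\<lambda>x. q x + r x)"
    "\<And>c a b d. a + b + d = l \<Longrightarrow> P (monomial3 c a b d)"
  shows "P q"
proof -
  obtain c where q: "q = (\<lambda>x. \<Sum>a\<le>l. \<Sum>b\<le>l. \<Sum>d\<le>l. if a + b + d = l then monomial3 (c a b d) a b d x else 0)"
    using assms(1) unfolding hom_poly3_iff_monomial3 by blast
  have s: "P (\<lambda>x. \<Sum>a\<le>M. g a x)" if "\<And>a. P (g a)" for g :: "nat \<Rightarrow> _" and M :: nat
    by (induction M) (auto intro: assms that)
  have i: "P (\<lambda>x. if a + b + d = l then monomial3 (c a b d) a b d x else 0)" for a b d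
    by (cases "a + b + d = l") (auto intro: assms)
  show ?thesis unfolding q by (intro s i)
qed

lemma hom_poly3_poly3: "hom_poly3 l q \<Longrightarrow> poly3 q"
  by (induction rule: hom_poly3_induct) (auto intro: poly3_0 poly3_add poly3_monomial3)

lemma hom_poly3_0: "hom_poly3 l (\<lambda>_. 0)"
  unfolding hom_poly3_def by (rule exI[of _ "\<lambda>_ _ _. 0"]) (simp cong: if_cong)

lemma hom_poly3_add: "hom_poly3 l q \<Longrightarrow> hom_poly3 l r \<Longrightarrow> hom_poly3 l (\<lambda>x. q x + r x)"
  unfolding hom_poly3_def
proof (elim exE)
  fix c c' :: "nat \<Rightarrow> nat \<Rightarrow> nat \<Rightarrow> real"
  assume c: "\<forall>x. q x = (\<Sum>a\<le>l. \<Sum>b\<le>l. \<Sum>d\<le>l. if a + b + d = l then c a b d * (x$1)^a * (x$2)^b * (x$3)^d else 0)"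
    "\<forall>x. r x = (\<Sum>a\<le>l. \<Sum>b\<le>l. \<Sum>d\<le>l. if a + b + d = l then c' a b d * (x$1)^a * (x$2)^b * (x$3)^d else 0)"
  have "q x + r x = (\<Sum>a\<le>l. \<Sum>b\<le>l. \<Sum>d\<le>l. if a + b + d = l then (c a b d + c' a b d) * (x$1)^a * (x$2)^b * (x$3)^d else 0)" for x
    by (simp only: c[rule_format] sum.distrib[symmetric]) (intro sum.cong refl; simp add: ring_distribs)
  then show "\<exists>c. \<forall>x. q x + r x = (\<Sum>a\<le>l. \<Sum>b\<le>l. \<Sum>d\<le>l. if a + b + d = l then c a b d * (x$1)^a * (x$2)^b * (x$3)^d else 0)"
    by (intro exI[of _ "\<lambda>a b d. c a b d + c' a b d"]) simp
qed

lemma hom_poly3_monomial3: "hom_poly3 (a + b + d) (monomial3 c a b d)"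
proof -
  define N where "N = a + b + d"
  have "monomial3 c a b d x = (\<Sum>i\<le>N. \<Sum>j\<le>N. \<Sum>k\<le>N. if i + j + k = N then
      (if i = a \<and> j = b \<and> k = d then c else 0) * (x$1)^i * (x$2)^j * (x$3)^k else 0)" for x
  proof -
    have "(\<Sum>i\<le>N. \<Sum>j\<le>N. \<Sum>k\<le>N. if i + j + k = N then
        (if i = a \<and> j = b \<and> k = d then c else 0) * (x$1)^i * (x$2)^j * (x$3)^k else 0)
      = (\<Sum>i\<le>N. \<Sum>j\<le>N. \<Sum>k\<le>N. if i = a \<and> j = b \<and> k = d then c * (x$1)^i * (x$2)^j * (x$3)^k else 0)"
      by (intro sum.cong refl) (auto simp: N_def)
    also have "... = monomial3 c a b d x"
      by (subst sum_delta3) (auto simp: monomial3_def N_def)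
    finally show ?thesis ..
  qed
  then show ?thesis unfolding hom_poly3_def N_def[symmetric]
    by (intro exI[of _ "\<lambda>i j k. if i = a \<and> j = b \<and> k = d then c else 0"] allI)
qed

lemma hom_poly3_cmult: "hom_poly3 l q \<Longrightarrow> hom_poly3 l (\<lambda>x. k * q x)"
proof (induction rule: hom_poly3_induct)
  case (mono c a b d)
  then show ?case using hom_poly3_monomial3[of a b d "k * c"] by (simp add: monomial3_def mult_ac)
qed (auto simp: hom_poly3_0 hom_poly3_add ring_distribs)

lemma hom_poly3_diff: "hom_poly3 l q \<Longrightarrow> hom_poly3 l r \<Longrightarrow> hom_poly3 l (\<lambda>x. q x - r x)"
  using hom_poly3_add[of l q "\<lambda>x. (-1) * r x"] hom_poly3_cmult[of l r "-1"] by simp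

lemma hom_poly3_sum: "(\<And>i. i \<in> A \<Longrightarrow> hom_poly3 l (f i)) \<Longrightarrow> hom_poly3 l (\<lambda>x. \<Sum>i\<in>A. f i x)"
  by (induction A rule: infinite_finite_induct) (auto intro: hom_poly3_0 hom_poly3_add)

lemma hom_poly3_mult: assumes "hom_poly3 l q" "hom_poly3 m r" shows "hom_poly3 (l + m) (\<lambda>x. q x * r x)"
  using assms(1)
proof (induction rule: hom_poly3_induct)
  case (mono c a b d)
  show ?case
    using assms(2)
  proof (induction rule: hom_poly3_induct)
    case (mono c' a' b' d')
    then have "l + m = (a + a') + (b + b') + (d + d')" using \<open>a + b + d = l\<close> by simp
    then show ?case using hom_poly3_monomial3 by (simp only: monomial3_mult)
  qed (simp_all add: hom_poly3_0 ring_distribs hom_poly3_add)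
qed (simp_all add: hom_poly3_0 ring_distribs hom_poly3_add)

lemma hom_poly3_coord: "hom_poly3 1 (\<lambda>x. x $ i)"
  using exhaust_3[of i] hom_poly3_monomial3[of 1 0 0 1] hom_poly3_monomial3[of 0 1 0 1] hom_poly3_monomial3[of 0 0 1 1]
  by (auto simp: monomial3_def)

lemma hom_poly3_pd: assumes "hom_poly3 l q" shows "hom_poly3 (l - 1) (pd i q)"
proof -
  have "poly3 q \<and> hom_poly3 (l - 1) (pd i q)" using assms
  proof (induction rule: hom_poly3_induct)
    case (mono c a b d)
    have *: "monomial3 0 a b d = (\<lambda>_. 0)" for a b d by (simp add: monomial3_def)
    show ?case using exhaust_3[of i] mono
        hom_poly3_monomial3[of "a-1" b d] hom_poly3_monomial3[of a "b-1" d] hom_poly3_monomial3[of a b "d-1"]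
      by (cases "a = 0"; cases "b = 0"; cases "d = 0") (auto simp: pd_monomial3 poly3_monomial3 * hom_poly3_0)
  qed (auto simp: poly3_0 poly3_pd_add hom_poly3_0 intro: poly3_add hom_poly3_add)
  then show ?thesis ..
qed

lemma hom_poly3_euler: assumes "hom_poly3 l q" shows "x $ 1 * pd 1 q x + x $ 2 * pd 2 q x + x $ 3 * pd 3 q x = l * q x"
proof -
  have "poly3 q \<and> (\<forall>x. x $ 1 * pd 1 q x + x $ 2 * pd 2 q x + x $ 3 * pd 3 q x = l * q x)" using assms
  proof (induction rule: hom_poly3_induct)
    case (mono c a b d)
    have "x $ 1 * pd 1 (monomial3 c a b d) x = a * monomial3 c a b d x"
      "x $ 2 * pd 2 (monomial3 c a b d) x = b * monomial3 c a b d x"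
      "x $ 3 * pd 3 (monomial3 c a b d) x = d * monomial3 c a b d x" for x
      unfolding pd_monomial3 unfolding monomial3_def by (cases a, simp, simp) (cases b, simp, simp, cases d, simp, simp)
    then show ?case using mono by (auto simp: poly3_monomial3 algebra_simps)
  next
    case (add q r)
    have "x $ 1 * (pd 1 q x + pd 1 r x) + x $ 2 * (pd 2 q x + pd 2 r x) + x $ 3 * (pd 3 q x + pd 3 r x)
      = (x $ 1 * pd 1 q x + x $ 2 * pd 2 q x + x $ 3 * pd 3 q x) + (x $ 1 * pd 1 r x + x $ 2 * pd 2 r x + x $ 3 * pd 3 r x)" for x
      by (simp add: algebra_simps)
    then show ?case using add by (simp add: poly3_pd_add poly3_add distrib_left)
  qed (simp add: poly3_0)
  then show ?thesis by blast
qed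

lemma hom_poly3_lap: "hom_poly3 l q \<Longrightarrow> hom_poly3 (l - 2) (lap q)"
  unfolding lap_def[abs_def]
  by (intro hom_poly3_sum) (use hom_poly3_pd[of "l - 1"] hom_poly3_pd[of l] in \<open>simp add: numeral_2_eq_2\<close>)

lemma hom_poly3_scale: "hom_poly3 l q \<Longrightarrow> q (t *\<^sub>R x) = t ^ l * q x"
  by (induction rule: hom_poly3_induct)
     (auto simp: monomial3_def power_mult_distrib power_add algebra_simps)

text \<open>The derivative along the rotations about the i-th axis. It is tangential to spheres,
  preserves the degree of homogeneous polynomials and commutes with the Laplacian, so it acts on
  every \<open>Harm l\<close>.\<close>

definition ang :: "3 \<Rightarrow> (R3 \<Rightarrow> real) \<Rightarrow> R3 \<Rightarrow> real" where
  "ang i q x = cross3 x (grad q x) $ i"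

lemma ang_simps:
  "ang 1 q x = x $ 2 * pd 3 q x - x $ 3 * pd 2 q x"
  "ang 2 q x = x $ 3 * pd 1 q x - x $ 1 * pd 3 q x"
  "ang 3 q x = x $ 1 * pd 2 q x - x $ 2 * pd 1 q x"
  by (simp_all add: ang_def cross3_def grad_nth)

lemma ang_fun:
  "ang 1 q = (\<lambda>x. x $ 2 * pd 3 q x - x $ 3 * pd 2 q x)"
  "ang 2 q = (\<lambda>x. x $ 3 * pd 1 q x - x $ 1 * pd 3 q x)"
  "ang 3 q = (\<lambda>x. x $ 1 * pd 2 q x - x $ 2 * pd 1 q x)"
  by (simp_all add: fun_eq_iff ang_simps)

lemma poly3_ang: "poly3 q \<Longrightarrow> poly3 (ang i q)"
  by (rule UNIV_3_cases[of i]) (auto simp: ang_fun intro!: poly3_diff poly3_mult poly3_coord poly3_pd)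

lemma hom_poly3_0_pd: "hom_poly3 0 q \<Longrightarrow> pd i q = (\<lambda>_. 0)"
proof -
  assume "hom_poly3 0 q"
  then have "poly3 q \<and> pd i q = (\<lambda>_. 0)"
  proof (induction rule: hom_poly3_induct)
    case (mono c a b d)
    then show ?case by (auto simp: poly3_monomial3) (simp add: monomial3_def)
  qed (auto simp: poly3_0 poly3_add poly3_pd_add)
  then show ?thesis ..
qed

lemma hom_poly3_ang: assumes "hom_poly3 l q" shows "hom_poly3 l (ang i q)"
proof (cases "l = 0")
  case True
  have "ang i q = (\<lambda>_. 0)"
    by (rule UNIV_3_cases[of i]) (use hom_poly3_0_pd assms True in \<open>auto simp: ang_fun\<close>)
  then show ?thesis by (simp add: hom_poly3_0)
next
  case False
  then have "hom_poly3 l (\<lambda>x. x $ j * pd k q x)" for j k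
    using hom_poly3_mult[OF hom_poly3_coord hom_poly3_pd[OF assms], of j k] by simp
  then show ?thesis
    using exhaust_3[of i] by (elim disjE) (auto simp: ang_fun intro!: hom_poly3_diff)
qed

lemma poly3_lap_ang: "poly3 q \<Longrightarrow> lap (ang i q) = ang i (lap q)"
  by (rule UNIV_3_cases[of i])
     (simp_all add: ang_fun poly3_lap_diff poly3_lap_coord_mult poly3_lap_pd poly3_pd poly3_mult poly3_coord
       poly3_pd_commute[of q 3 2] poly3_pd_commute[of q 1 3] poly3_pd_commute[of q 2 1])

text \<open>With \<open>E\<close> the Euler operator, the sum of the squared rotation fields is
  \<open>|x|^2\<close> times the Laplacian minus \<open>E (E + 1)\<close>, and \<open>E\<close> is
  \<open>l\<close> here. On a harmonic polynomial only the eigenvalue \<open>-l(l+1)\<close> of the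
  spherical Laplacian is left.\<close>

lemma sum_ang_ang:
  assumes "hom_poly3 l q"
  shows "ang 1 (ang 1 q) x + ang 2 (ang 2 q) x + ang 3 (ang 3 q) x = (x \<bullet> x) * lap q x - real (l * (l + 1)) * q x"
proof -
  have p [simp]: "poly3 q" by (rule hom_poly3_poly3[OF assms])
  have e0: "x $ 1 * pd 1 q x + x $ 2 * pd 2 q x + x $ 3 * pd 3 q x = l * q x"
    by (rule hom_poly3_euler[OF assms])
  \<comment> \<open>Euler's identity for the derivatives, which have degree \<open>l - 1\<close>.
    For \<open>l = 0\<close> the truncated difference is 0 instead of -1, but then the derivatives
    vanish.\<close>
  have e1: "x $ 1 * pd 1 (pd j q) x + x $ 2 * pd 2 (pd j q) x + x $ 3 * pd 3 (pd j q) x = (real l - 1) * pd j q x" for j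
  proof (cases "l = 0")
    case True
    then show ?thesis using hom_poly3_0_pd assms by simp
  next
    case False
    then have "real (l - 1) = real l - 1" by simp
    then show ?thesis using hom_poly3_euler[OF hom_poly3_pd[OF assms, of j], of x] by (simp only:)
  qed
  note expand = poly3_pd_diff poly3_pd_coord_mult poly3_pd poly3_mult poly3_coord
  define A where "A i j = pd i (pd j q) x" for i j :: 3
  define D where "D i = pd i q x" for i
  have sym: "A 2 1 = A 1 2" "A 3 1 = A 1 3" "A 3 2 = A 2 3"
    by (auto simp: A_def poly3_pd_commute)
  have 1: "ang 1 (ang 1 q) x = x$2 * (x$2 * A 3 3 - (x$3 * A 3 2 + D 2)) - x$3 * ((x$2 * A 2 3 + D 3) - x$3 * A 2 2)"
    by (simp add: ang_fun expand A_def D_def)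
  have 2: "ang 2 (ang 2 q) x = x$3 * (x$3 * A 1 1 - (x$1 * A 1 3 + D 3)) - x$1 * ((x$3 * A 3 1 + D 1) - x$1 * A 3 3)"
    by (simp add: ang_fun expand A_def D_def)
  have 3: "ang 3 (ang 3 q) x = x$1 * (x$1 * A 2 2 - (x$2 * A 2 1 + D 1)) - x$2 * ((x$1 * A 1 2 + D 2) - x$2 * A 1 1)"
    by (simp add: ang_fun expand A_def D_def)
  have L: "lap q x = A 1 1 + A 2 2 + A 3 3" by (simp add: lap_eq A_def)
  have xx: "x \<bullet> x = x$1 * x$1 + x$2 * x$2 + x$3 * x$3" by (simp add: inner_vec_def sum_3)
  have E0: "x$1 * D 1 + x$2 * D 2 + x$3 * D 3 = l * q x" using e0 by (simp add: D_def)
  have E1: "x$1 * A 1 j + x$2 * A 2 j + x$3 * A 3 j = (real l - 1) * D j" for j using e1 by (simp add: A_def D_def)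
  have "ang 1 (ang 1 q) x + ang 2 (ang 2 q) x + ang 3 (ang 3 q) x = (x \<bullet> x) * lap q x
     - x$1 * (x$1 * A 1 1 + x$2 * A 2 1 + x$3 * A 3 1) - x$2 * (x$1 * A 1 2 + x$2 * A 2 2 + x$3 * A 3 2)
     - x$3 * (x$1 * A 1 3 + x$2 * A 2 3 + x$3 * A 3 3) - 2 * (x$1 * D 1 + x$2 * D 2 + x$3 * D 3)"
    unfolding 1 2 3 L xx sym by (simp add: algebra_simps)
  also have "... = (x \<bullet> x) * lap q x - (real l - 1) * (x$1 * D 1 + x$2 * D 2 + x$3 * D 3) - 2 * (l * q x)"
    unfolding E1 E0[symmetric] by (simp add: algebra_simps)
  also have "... = (x \<bullet> x) * lap q x - real (l * (l + 1)) * q x"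
    unfolding E0 by (simp add: algebra_simps)
  finally show ?thesis .
qed

section \<open>Harmonic polynomials and the decomposition of polynomials on the sphere\<close>

lemma lap_const [simp]: "lap (\<lambda>_. c) = (\<lambda>_. 0)"
  by (simp add: fun_eq_iff lap_def)

lemma HarmD: "Y \<in> Harm l \<Longrightarrow> hom_poly3 l Y" "Y \<in> Harm l \<Longrightarrow> poly3 Y" "Y \<in> Harm l \<Longrightarrow> lap Y = (\<lambda>_. 0)"
  unfolding Harm_def by (auto dest: hom_poly3_poly3)

lemma HarmI: "hom_poly3 l Y \<Longrightarrow> lap Y = (\<lambda>_. 0) \<Longrightarrow> Y \<in> Harm l"
  unfolding Harm_def by auto

lemma Harm_0: "(\<lambda>_. 0) \<in> Harm l"
  by (rule HarmI) (auto simp: hom_poly3_0 lap_def)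

lemma Harm_add: "Y \<in> Harm l \<Longrightarrow> Z \<in> Harm l \<Longrightarrow> (\<lambda>x. Y x + Z x) \<in> Harm l"
  by (rule HarmI) (auto simp: HarmD poly3_lap_add intro: hom_poly3_add HarmD)

lemma Harm_diff: "Y \<in> Harm l \<Longrightarrow> Z \<in> Harm l \<Longrightarrow> (\<lambda>x. Y x - Z x) \<in> Harm l"
  by (rule HarmI) (auto simp: HarmD poly3_lap_diff intro: hom_poly3_diff HarmD)

lemma Harm_cmult: "Y \<in> Harm l \<Longrightarrow> (\<lambda>x. c * Y x) \<in> Harm l"
  by (rule HarmI) (auto simp: HarmD poly3_lap_cmult intro: hom_poly3_cmult HarmD)

lemma Harm_ang: "Y \<in> Harm l \<Longrightarrow> ang i Y \<in> Harm l"
proof (rule HarmI)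
  assume "Y \<in> Harm l"
  then show "hom_poly3 l (ang i Y)" by (intro hom_poly3_ang HarmD)
  have "ang i (\<lambda>_. 0) = (\<lambda>_. 0)" by (rule UNIV_3_cases[of i]) (auto simp: ang_fun)
  with \<open>Y \<in> Harm l\<close> show "lap (ang i Y) = (\<lambda>_. 0)" by (simp add: poly3_lap_ang HarmD)
qed

lemma Harm_pd: "Y \<in> Harm l \<Longrightarrow> pd i Y \<in> Harm (l - 1)"
  by (rule HarmI[OF hom_poly3_pd[OF HarmD(1)]]) (auto simp: HarmD poly3_lap_pd)

lemma Harm_const: "(\<lambda>_. c) \<in> Harm 0"
  using hom_poly3_monomial3[of 0 0 0 c] by (intro HarmI) (auto simp: monomial3_def lap_def)

lemma Harm_0_const: "Y \<in> Harm 0 \<Longrightarrow> Y x = Y 0"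
  using hom_poly3_scale[of 0 Y 0 x] HarmD(1)[of Y 0] by simp

lemma lap_inner_mult:
  assumes "hom_poly3 n u"
  shows "lap (\<lambda>x. (x \<bullet> x) * u x) = (\<lambda>x. (6 + 4 * real n) * u x + (x \<bullet> x) * lap u x)"
proof
  fix x
  have p [simp]: "poly3 u" by (rule hom_poly3_poly3[OF assms])
  have c: "poly3 (\<lambda>x. x $ j * (x $ j * u x))" "poly3 (\<lambda>x. x $ j * u x)" for j by (intro poly3_mult poly3_coord p)+
  have eq: "(\<lambda>x. (x \<bullet> x) * u x) = (\<lambda>x. (x $ 1 * (x $ 1 * u x) + x $ 2 * (x $ 2 * u x)) + x $ 3 * (x $ 3 * u x))"
    by (auto simp: inner_vec_def sum_3 algebra_simps)
  have "lap (\<lambda>x. (x \<bullet> x) * u x) x = (x$1^2 + x$2^2 + x$3^2) * lap u x + 4 * (x $ 1 * pd 1 u x + x $ 2 * pd 2 u x + x $ 3 * pd 3 u x) + 6 * u x"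
    unfolding eq by (simp add: poly3_lap_add c poly3_add poly3_lap_coord_mult poly3_pd_coord_mult)
      (simp add: algebra_simps power2_eq_square)
  then show "lap (\<lambda>x. (x \<bullet> x) * u x) x = (6 + 4 * real n) * u x + (x \<bullet> x) * lap u x"
    unfolding hom_poly3_euler[OF assms] by (simp add: inner_vec_def sum_3 power2_eq_square algebra_simps)
qed

lemma hom_poly3_inner: "hom_poly3 2 (\<lambda>x. x \<bullet> x)"
proof -
  have "hom_poly3 (1 + 1) (\<lambda>x. \<Sum>i\<in>UNIV. x $ i * x $ i)"
    by (intro hom_poly3_sum hom_poly3_mult hom_poly3_coord)
  then show ?thesis by (simp add: inner_vec_def numeral_2_eq_2)
qed

lemma hom_poly3_inner_power: "hom_poly3 (2 * j) (\<lambda>x. (x \<bullet> x) ^ j)"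
proof (induction j)
  case 0 then show ?case using Harm_const[of 1] HarmD(1) by auto
next
  case (Suc j)
  then show ?case using hom_poly3_mult[OF hom_poly3_inner Suc] by simp
qed

lemma lap_inner_power_mult:
  assumes "hom_poly3 m r"
  shows "lap (\<lambda>x. (x \<bullet> x) ^ Suc j * r x)
    = (\<lambda>x. 2 * real (Suc j) * (2 * real (Suc j) + 1 + 2 * real m) * ((x \<bullet> x) ^ j * r x) + (x \<bullet> x) ^ Suc j * lap r x)"
proof (induction j)
  case 0
  then show ?case using lap_inner_mult[OF assms] by (auto simp: fun_eq_iff algebra_simps)
next
  case (Suc j)
  have h: "hom_poly3 (2 * Suc j + m) (\<lambda>x. (x \<bullet> x) ^ Suc j * r x)"
    by (rule hom_poly3_mult[OF hom_poly3_inner_power assms])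
  have eq: "(\<lambda>x. (x \<bullet> x) ^ Suc (Suc j) * r x) = (\<lambda>x. (x \<bullet> x) * ((x \<bullet> x) ^ Suc j * r x))"
    by (simp add: fun_eq_iff)
  show ?case unfolding eq lap_inner_mult[OF h] Suc
    by (auto simp: fun_eq_iff algebra_simps)
qed

text \<open>Surjectivity of \<open>s \<mapsto> \<Delta>(|x|\<^sup>2\<^sup>j s)\<close> onto \<open>|x|\<^sup>2\<^sup>j\<^sup>-\<^sup>2\<close> times homogeneous polynomials; the exponent is
  generalised so that the induction closes.\<close>
lemma lap_inner_power_surj:
  assumes "hom_poly3 m r"
  shows "\<exists>s. hom_poly3 m s \<and> lap (\<lambda>x. (x \<bullet> x) ^ Suc j * s x) = (\<lambda>x. (x \<bullet> x) ^ j * r x)"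
  using assms
proof (induction m arbitrary: r j rule: less_induct)
  case (less m)
  define c where "c = 2 * real (Suc j) * (2 * real (Suc j) + 1 + 2 * real m)"
  have c: "c > 0" by (simp add: c_def)
  \<comment> \<open>The first guess \<open>r / c\<close> leaves an error proportional to
    \<open>|x|^(2j+2)\<close> times \<open>lap r\<close>. Since \<open>lap r\<close> has degree
    \<open>m - 2\<close>, the induction hypothesis with the exponent raised by one supplies the
    correction \<open>t\<close>.\<close>
  have "\<exists>t. hom_poly3 m t \<and> lap (\<lambda>x. (x \<bullet> x) ^ Suc j * t x) = (\<lambda>x. (x \<bullet> x) ^ Suc j * lap r x)"
  proof (cases "m < 2")
    case True
    have "lap r = (\<lambda>_. 0)"
    proof -
      have "hom_poly3 0 (pd i r)" for i using hom_poly3_pd[OF less.prems, of i] True by (cases m) (auto simp: less_Suc_eq)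
      then show ?thesis using hom_poly3_0_pd unfolding lap_def[abs_def] by simp
    qed
    then show ?thesis using hom_poly3_0 by (intro exI[of _ "\<lambda>_. 0"]) (simp add: lap_def)
  next
    case False
    then obtain s where s: "hom_poly3 (m - 2) s" "lap (\<lambda>x. (x \<bullet> x) ^ Suc (Suc j) * s x) = (\<lambda>x. (x \<bullet> x) ^ Suc j * lap r x)"
      using less.IH[OF _ hom_poly3_lap[OF less.prems], of "Suc j"] by auto
    have e: "2 + (m - 2) = m" using False by simp
    have "hom_poly3 m (\<lambda>x. (x \<bullet> x) * s x)"
      using hom_poly3_mult[OF hom_poly3_inner s(1)] unfolding e .
    moreover have "(\<lambda>x. (x \<bullet> x) ^ Suc (Suc j) * s x) = (\<lambda>x. (x \<bullet> x) ^ Suc j * ((x \<bullet> x) * s x))"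
      by (simp add: fun_eq_iff)
    ultimately show ?thesis using s(2) by auto
  qed
  then obtain t where t: "hom_poly3 m t" "lap (\<lambda>x. (x \<bullet> x) ^ Suc j * t x) = (\<lambda>x. (x \<bullet> x) ^ Suc j * lap r x)"
    by blast
  have p: "poly3 (\<lambda>x. (x \<bullet> x) ^ Suc j * r x)" "poly3 (\<lambda>x. (x \<bullet> x) ^ Suc j * t x)"
    using hom_poly3_mult[OF hom_poly3_inner_power] less.prems t(1) hom_poly3_poly3 by blast+
  have "lap (\<lambda>x. (x \<bullet> x) ^ Suc j * ((1/c) * (r x - t x)))
     = lap (\<lambda>x. (1/c) * ((x \<bullet> x) ^ Suc j * r x - (x \<bullet> x) ^ Suc j * t x))"
    by (rule arg_cong[where f=lap]) (simp add: fun_eq_iff algebra_simps)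
  also have "... = (\<lambda>x. (1/c) * (lap (\<lambda>x. (x \<bullet> x) ^ Suc j * r x) x - lap (\<lambda>x. (x \<bullet> x) ^ Suc j * t x) x))"
    by (subst poly3_lap_cmult[OF poly3_diff[OF p]], subst poly3_lap_diff[OF p]) (rule refl)
  also have "... = (\<lambda>x. (x \<bullet> x) ^ j * r x)"
    unfolding t(2) lap_inner_power_mult[OF less.prems] c_def[symmetric] using c by (simp add: fun_eq_iff)
  finally show ?case
    using hom_poly3_cmult[OF hom_poly3_diff[OF less.prems t(1)], of "1/c"] by blast
qed

text \<open>A polynomial \<open>s\<close> such that \<open>|x|^2 s\<close> has the same Laplacian as
  \<open>q\<close> makes \<open>q - |x|^2 s\<close> harmonic. On the sphere the subtracted part
  equals \<open>s\<close>, of degree \<open>k - 2\<close>, and the argument repeats.\<close>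

lemma hom_poly3_harmonic_decomposition:
  assumes "hom_poly3 k q"
  shows "\<exists>Y. (\<forall>l. Y l \<in> Harm l) \<and> (\<forall>l>k. Y l = (\<lambda>_. 0)) \<and> (\<forall>x. norm x = 1 \<longrightarrow> q x = (\<Sum>l\<le>k. Y l x))"
  using assms
proof (induction k arbitrary: q rule: less_induct)
  case (less k)
  show ?case
  proof (cases "k < 2")
    case True
    have "hom_poly3 0 (pd i q)" for i using hom_poly3_pd[OF less.prems, of i] True by (cases k) (auto simp: less_Suc_eq)
    then have "lap q = (\<lambda>_. 0)" using hom_poly3_0_pd unfolding lap_def[abs_def] by simp
    then have "q \<in> Harm k" by (rule HarmI[OF less.prems])
    moreover have "(\<Sum>l\<le>k. (if l = k then q else (\<lambda>_. 0)) x) = q x" for x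
      using sum.remove[of "{..k}" k "\<lambda>l. (if l = k then q else (\<lambda>_. 0)) x"] by simp
    ultimately show ?thesis
      by (intro exI[of _ "\<lambda>l. if l = k then q else (\<lambda>_. 0)"]) (simp add: Harm_0)
  next
    case False
    then obtain s where s: "hom_poly3 (k - 2) s" "lap (\<lambda>x. (x \<bullet> x) * s x) = lap q"
      using lap_inner_power_surj[OF hom_poly3_lap[OF less.prems], of 0] by auto
    have e: "2 + (k - 2) = k" using False by simp
    have h: "hom_poly3 k (\<lambda>x. (x \<bullet> x) * s x)"
      using hom_poly3_mult[OF hom_poly3_inner s(1)] unfolding e .
    have H: "(\<lambda>x. q x - (x \<bullet> x) * s x) \<in> Harm k"
      by (rule HarmI[OF hom_poly3_diff[OF less.prems h]])
         (simp add: poly3_lap_diff[OF hom_poly3_poly3[OF less.prems] hom_poly3_poly3[OF h]] s(2))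
    obtain Y where Y: "\<forall>l. Y l \<in> Harm l" "\<forall>l>k-2. Y l = (\<lambda>_. 0)" "\<forall>x. norm x = 1 \<longrightarrow> s x = (\<Sum>l\<le>k-2. Y l x)"
      using less.IH[OF _ s(1)] False by auto
    define Z where "Z = Y(k := (\<lambda>x. q x - (x \<bullet> x) * s x))"
    have "q x = (\<Sum>l\<le>k. Z l x)" if "norm x = 1" for x
    proof -
      have "(\<Sum>l\<le>k. Z l x) = Z k x + (\<Sum>l<k. Z l x)" by (simp add: lessThan_Suc_atMost[symmetric])
      also have "(\<Sum>l<k. Z l x) = (\<Sum>l<k. Y l x)" by (rule sum.cong) (auto simp: Z_def)
      also have "... = (\<Sum>l\<le>k-2. Y l x)"
        by (rule sum.mono_neutral_right) (use False Y(2) in auto)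
      finally show ?thesis using Y(3) that by (simp add: Z_def norm_eq_1)
    qed
    then show ?thesis using Y H by (intro exI[of _ Z]) (auto simp: Z_def)
  qed
qed

theorem poly3_harmonic_decomposition:
  assumes "poly3 q"
  obtains N Y where "\<And>l. Y l \<in> Harm l" "\<And>x. norm x = 1 \<Longrightarrow> q x = (\<Sum>l<N. Y l x)"
proof -
  \<comment> \<open>That the components vanish from \<open>N\<close> on is carried along so that
    sums of different lengths can be added.\<close>
  have "\<exists>N Y. (\<forall>l. Y l \<in> Harm l) \<and> (\<forall>l\<ge>N. Y l = (\<lambda>_. 0)) \<and> (\<forall>x. norm x = 1 \<longrightarrow> q x = (\<Sum>l<N. Y l x))"
    using assms
  proof (induction rule: poly3_induct)
    case zero
    show ?case by (intro exI[of _ 0] exI[of _ "\<lambda>_ _. 0"]) (simp add: Harm_0)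
  next
    case (add q r)
    then obtain N Y M Z where Y: "\<forall>l. Y l \<in> Harm l" "\<forall>l\<ge>N. Y l = (\<lambda>_. 0)" "\<forall>x. norm x = 1 \<longrightarrow> q x = (\<Sum>l<N. Y l x)"
      and Z: "\<forall>l. Z l \<in> Harm l" "\<forall>l\<ge>M. Z l = (\<lambda>_. 0)" "\<forall>x. norm x = 1 \<longrightarrow> r x = (\<Sum>l<M. Z l x)"
      by blast
    have "(\<Sum>l<N. Y l x) = (\<Sum>l<N+M. Y l x)" "(\<Sum>l<M. Z l x) = (\<Sum>l<N+M. Z l x)" for x
      by (rule sum.mono_neutral_left; use Y(2) Z(2) in auto)+
    then show ?case using Y Z
      by (intro exI[of _ "N+M"] exI[of _ "\<lambda>l x. Y l x + Z l x"]) (auto simp: Harm_add sum.distrib)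
  next
    case (mono c a b d)
    from hom_poly3_harmonic_decomposition[OF hom_poly3_monomial3[of a b d c]]
    obtain Y where "\<forall>l. Y l \<in> Harm l" "\<forall>l>a+b+d. Y l = (\<lambda>_. 0)"
      "\<forall>x. norm x = 1 \<longrightarrow> monomial3 c a b d x = (\<Sum>l\<le>a+b+d. Y l x)" by blast
    then show ?case
      by (intro exI[of _ "Suc (a+b+d)"] exI[of _ Y]) (auto simp: lessThan_Suc_atMost)
  qed
  then show thesis using that by blast
qed

section \<open>Integration by parts on the sphere\<close>

text \<open>Rodrigues' formula for the rotation by the angle \<open>s\<close> about the unit vector
  \<open>e\<close>; in this form both orthogonality and the derivative in \<open>s\<close> are
  direct computations.\<close>

definition axis_rot :: "R3 \<Rightarrow> real \<Rightarrow> R3 \<Rightarrow> R3" where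
  "axis_rot e s x = cos s *\<^sub>R x + ((1 - cos s) * (e \<bullet> x)) *\<^sub>R e + sin s *\<^sub>R cross3 e x"

lemma orthogonal_axis_rot:
  assumes "norm e = 1"
  shows "orthogonal_transformation (axis_rot e s)"
proof -
  have ee: "e \<bullet> e = 1" using assms by (simp add: norm_eq_1)
  have lin: "linear (axis_rot e s)"
    by (rule linearI) (simp_all add: axis_rot_def algebra_simps cross_add_right cross_mult_right inner_add_right)
  have "norm (axis_rot e s x) = norm x" for x
  proof -
    define a where "a = e \<bullet> x"
    have xe: "x \<bullet> e = a" by (simp add: a_def inner_commute)
    have cc: "cross3 e x \<bullet> cross3 e x = x \<bullet> x - a\<^sup>2"
      using norm_cross_dot[of e x] assms by (simp add: a_def power2_norm_eq_inner)
    have z: "x \<bullet> cross3 e x = 0" "cross3 e x \<bullet> x = 0" "e \<bullet> cross3 e x = 0" "cross3 e x \<bullet> e = 0"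
      by (simp_all add: dot_cross_self inner_commute)
    have "axis_rot e s x \<bullet> axis_rot e s x
        = (cos s)\<^sup>2 * (x \<bullet> x) + 2 * cos s * (1 - cos s) * a\<^sup>2 + (1 - cos s)\<^sup>2 * a\<^sup>2 + (sin s)\<^sup>2 * (x \<bullet> x - a\<^sup>2)"
      unfolding axis_rot_def a_def[symmetric]
      by (simp add: inner_add_left inner_add_right z xe ee cc a_def[symmetric]) (simp add: algebra_simps power2_eq_square)
    also have "... = x \<bullet> x"
      unfolding sin_squared_eq by (simp add: algebra_simps power2_eq_square)
    finally show ?thesis by (simp add: norm_eq_sqrt_inner)
  qed
  with lin show ?thesis by (simp add: orthogonal_transformation)
qed

lemma axis_rot_0 [simp]: "axis_rot e 0 x = x"
  by (simp add: axis_rot_def)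

lemma cross3_axis_rot:
  assumes "norm e = 1"
  shows "cross3 e (axis_rot e s x) = (- sin s) *\<^sub>R x + (sin s * (e \<bullet> x)) *\<^sub>R e + cos s *\<^sub>R cross3 e x"
proof -
  have "cross3 e (cross3 e x) = (e \<bullet> x) *\<^sub>R e - (e \<bullet> e) *\<^sub>R x"
    by (simp add: cross3_simps) (use exhaust_3 in force)
  moreover have "e \<bullet> e = 1" using assms by (simp add: norm_eq_1)
  ultimately show ?thesis
    unfolding axis_rot_def cross_add_right cross_mult_right by (simp add: scaleR_diff_right)
qed

lemma has_vector_derivative_axis_rot:
  assumes "norm e = 1"
  shows "((\<lambda>s. axis_rot e s x) has_vector_derivative cross3 e (axis_rot e s x)) (at s)"
  unfolding cross3_axis_rot[OF assms] unfolding axis_rot_def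
  by (auto intro!: derivative_eq_intros)

lemma continuous_on_cross3 [continuous_intros]:
  fixes f g :: "'a::t2_space \<Rightarrow> R3"
  shows "continuous_on A f \<Longrightarrow> continuous_on A g \<Longrightarrow> continuous_on A (\<lambda>x. cross3 (f x) (g x))"
  by (rule continuous_on_cross)

lemma continuous_sphere_bound:
  fixes f :: "R3 \<Rightarrow> 'a::real_normed_vector"
  assumes "continuous_on (sphere 0 1) f"
  obtains B where "\<And>x. norm x = 1 \<Longrightarrow> norm (f x) \<le> B" "B > 0"
proof -
  have "bounded (f ` sphere 0 1)"
    by (intro compact_imp_bounded compact_continuous_image assms) auto
  then obtain B where "B > 0" "\<And>x. x \<in> sphere 0 1 \<Longrightarrow> norm (f x) \<le> B"
    unfolding bounded_pos by blast
  then show thesis using that by auto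
qed

text \<open>The integral of \<open>F\<close> composed with a rotation does not depend on the angle,
  and its derivative at angle 0 is the integral of the rotation field applied to \<open>F\<close>.
  Rotations stay on the sphere, so derivatives of \<open>F\<close> enter only there.\<close>

lemma sphere_integral_cross:
  assumes der: "\<And>x. norm x = 1 \<Longrightarrow> (F has_derivative (\<lambda>h. G x \<bullet> h)) (at x)"
    and cont: "continuous_on (sphere 0 1) G"
  shows "(\<ointegral>x. cross3 x (G x) $ i) = 0"
proof -
  define e where "e = (axis i 1 :: R3)"
  have e: "norm e = 1" by (simp add: e_def)
  have no: "norm (axis_rot e s x) = norm x" for s x
    by (rule orthogonal_transformation_norm[OF orthogonal_axis_rot[OF e]])
  have tr: "G y \<bullet> cross3 e y = cross3 y (G y) $ i" for y
  proof -
    have "G y \<bullet> cross3 e y = cross3 y (G y) \<bullet> e" by (simp add: cross3_simps)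
    then show ?thesis by (simp add: e_def inner_axis)
  qed
  have contF: "continuous_on (sphere 0 1) F"
    using der by (auto intro!: continuous_at_imp_continuous_on has_derivative_continuous)
  have contJ: "continuous_on (sphere 0 1) (\<lambda>x. cross3 x (G x) $ i)"
    by (intro continuous_intros cont)
  obtain B where B: "\<And>x. norm x = 1 \<Longrightarrow> norm (cross3 x (G x) $ i) \<le> B"
    using continuous_sphere_bound[OF contJ] by blast
  have inv: "(\<ointegral>x. F (axis_rot e s x)) = (\<ointegral>x. F x)" for s
    by (rule integral_sigmaS_orthogonal[OF orthogonal_axis_rot[OF e] sphere_measurable[OF contF]])
  have "((\<lambda>s. \<ointegral>x. F (axis_rot e s x)) has_real_derivative
      (\<ointegral>x. cross3 (axis_rot e 0 x) (G (axis_rot e 0 x)) $ i)) (at 0)"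
  proof (rule has_real_derivative_integral(1)[where e=1 and B="\<lambda>_. B"])
    show "integrable sigmaS (\<lambda>x. F (axis_rot e s x))" for s
    proof (rule sphere_integrable)
      show "continuous_on (sphere 0 1) (\<lambda>x. F (axis_rot e s x))"
        by (rule continuous_on_compose2[OF contF])
          (auto simp: no intro!: linear_continuous_on orthogonal_transformation_linear[OF orthogonal_axis_rot[OF e]]
            linear_conv_bounded_linear[THEN iffD1])
    qed
    show "((\<lambda>s. F (axis_rot e s x)) has_real_derivative cross3 (axis_rot e s x) (G (axis_rot e s x)) $ i) (at s)"
      if "x \<in> space sigmaS" for s x
    proof -
      have "((\<lambda>s. F (axis_rot e s x)) has_derivative (\<lambda>t. G (axis_rot e s x) \<bullet> (t *\<^sub>R cross3 e (axis_rot e s x)))) (at s)"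
        using has_derivative_compose[OF has_vector_derivative_axis_rot[OF e, unfolded has_vector_derivative_def] der] that
        by (auto simp: no)
      moreover have "(\<lambda>t. G (axis_rot e s x) \<bullet> (t *\<^sub>R cross3 e (axis_rot e s x))) = (*) (cross3 (axis_rot e s x) (G (axis_rot e s x)) $ i)"
        unfolding fun_eq_iff inner_scaleR_right tr by (simp add: mult.commute)
      ultimately show ?thesis by (simp only: has_field_derivative_def)
    qed
    show "\<bar>cross3 (axis_rot e s x) (G (axis_rot e s x)) $ i\<bar> \<le> B" if "x \<in> space sigmaS" for s x
      using B[of "axis_rot e s x"] that by (simp add: no)
  qed auto
  then have "((\<lambda>s. \<ointegral>x. F x) has_real_derivative (\<ointegral>x. cross3 x (G x) $ i)) (at 0)"
    by (simp add: inv)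
  then show ?thesis using DERIV_const DERIV_unique by blast
qed

lemma sphere_ibp:
  assumes "\<And>x. norm x = 1 \<Longrightarrow> (f has_derivative (\<lambda>h. F x \<bullet> h)) (at x)" "continuous_on (sphere 0 1) F"
    "\<And>x. norm x = 1 \<Longrightarrow> (g has_derivative (\<lambda>h. G x \<bullet> h)) (at x)" "continuous_on (sphere 0 1) G"
  shows "(\<ointegral>x. cross3 x (F x) $ i * g x) = - (\<ointegral>x. f x * cross3 x (G x) $ i)"
proof -
  have cf: "continuous_on (sphere 0 1) f" "continuous_on (sphere 0 1) g"
    using assms by (auto intro!: continuous_at_imp_continuous_on has_derivative_continuous)
  have "(\<ointegral>x. cross3 x (f x *\<^sub>R G x + g x *\<^sub>R F x) $ i) = 0"
    by (rule sphere_integral_cross[of "\<lambda>x. f x * g x"])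
      (auto intro!: continuous_intros cf assms(2,4) derivative_eq_intros assms(1,3) simp: algebra_simps)
  also have "(\<ointegral>x. cross3 x (f x *\<^sub>R G x + g x *\<^sub>R F x) $ i)
      = (\<ointegral>x. f x * cross3 x (G x) $ i + cross3 x (F x) $ i * g x)"
    by (simp add: cross_add_right cross_mult_right mult.commute)
  also have "... = (\<ointegral>x. f x * cross3 x (G x) $ i) + (\<ointegral>x. cross3 x (F x) $ i * g x)"
    by (intro lint_add sphere_integrable continuous_intros cf assms)
  finally show ?thesis by simp
qed

lemma poly3_has_derivative: "poly3 q \<Longrightarrow> (q has_derivative (\<lambda>h. grad q x \<bullet> h)) (at x)"
  by (rule has_derivative_grad[OF poly3_differentiable])

lemma poly3_grad_continuous: "poly3 q \<Longrightarrow> continuous_on A (grad q)"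
  unfolding grad_def by (intro continuous_on_vec_lambda poly3_continuous poly3_pd)

lemma ang_ibp:
  assumes "poly3 q" "poly3 r"
  shows "(\<ointegral>x. ang i q x * r x) = - (\<ointegral>x. q x * ang i r x)"
  unfolding ang_def
  by (rule sphere_ibp) (use assms poly3_has_derivative poly3_grad_continuous in auto)

lemma integrable_poly3: "poly3 q \<Longrightarrow> integrable sigmaS q"
  by (intro sphere_integrable poly3_continuous)

text \<open>Each rotation field is antisymmetric, and their squares sum to \<open>-l(l+1)\<close> on
  \<open>Y\<close>: Green's formula for the spherical Laplacian.\<close>

lemma integral_ang_ang:
  assumes "Y \<in> Harm l" "poly3 q"
  shows "(\<ointegral>x. (\<Sum>i\<in>UNIV. ang i Y x * ang i q x)) = real (l * (l + 1)) * (\<ointegral>x. Y x * q x)"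
proof -
  have Y: "poly3 Y" using assms by (rule_tac HarmD)
  have "(\<ointegral>x. (\<Sum>i\<in>UNIV. ang i Y x * ang i q x)) = (\<Sum>i\<in>UNIV. (\<ointegral>x. ang i Y x * ang i q x))"
    by (intro lint_sum integrable_poly3 poly3_mult poly3_ang Y assms)
  also have "... = (\<Sum>i\<in>UNIV. - (\<ointegral>x. ang i (ang i Y) x * q x))"
    by (intro sum.cong refl) (simp add: ang_ibp[OF poly3_ang[OF Y] assms(2)])
  also have "... = - (\<ointegral>x. (\<Sum>i\<in>UNIV. ang i (ang i Y) x * q x))"
    unfolding sum_negf by (intro arg_cong[where f=uminus] lint_sum[symmetric] integrable_poly3 poly3_mult poly3_ang Y assms)
  also have "... = - (\<ointegral>x. - real (l * (l + 1)) * (Y x * q x))"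
  proof -
    have "(\<Sum>i\<in>UNIV. ang i (ang i Y) x * q x) = - real (l * (l + 1)) * (Y x * q x)" for x
      unfolding sum_distrib_right[symmetric] sum_3 sum_ang_ang[OF HarmD(1)[OF assms(1)], of x]
      by (simp add: HarmD(3)[OF assms(1)] algebra_simps)
    then show ?thesis by simp
  qed
  also have "... = real (l * (l + 1)) * (\<ointegral>x. Y x * q x)"
    unfolding integral_mult_right_zero by (simp only: mult_minus_left minus_minus)
  finally show ?thesis .
qed

text \<open>The symmetric form in \<open>integral_ang_ang\<close> is evaluated from both sides; the
  eigenvalues \<open>l(l+1)\<close> and \<open>k(k+1)\<close> differ.\<close>

lemma Harm_orthogonal:
  assumes "Y \<in> Harm l" "Z \<in> Harm k" "l \<noteq> k"
  shows "(\<ointegral>x. Y x * Z x) = 0"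
proof -
  have "real (l * (l + 1)) * (\<ointegral>x. Y x * Z x) = (\<ointegral>x. (\<Sum>i\<in>UNIV. ang i Y x * ang i Z x))"
    using integral_ang_ang[OF assms(1) HarmD(2)[OF assms(2)]] by simp
  also have "... = (\<ointegral>x. (\<Sum>i\<in>UNIV. ang i Z x * ang i Y x))" by (simp add: mult.commute)
  also have "... = real (k * (k + 1)) * (\<ointegral>x. Y x * Z x)"
    using integral_ang_ang[OF assms(2) HarmD(2)[OF assms(1)]] by (simp add: mult.commute)
  finally have "(real (l * (l + 1)) - real (k * (k + 1))) * (\<ointegral>x. Y x * Z x) = 0"
    by (simp add: left_diff_distrib)
  moreover have "real (l * (l + 1)) \<noteq> real (k * (k + 1))"
  proof -
    have "l * (l + 1) < k * (k + 1)" if "l < k" for l k :: nat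
      using that by (intro mult_strict_mono) auto
    then show ?thesis using assms(3) unfolding of_nat_eq_iff by (metis less_irrefl linorder_neqE_nat)
  qed
  ultimately show ?thesis by simp
qed

section \<open>The tangential gradient and its integration by parts\<close>

lemma sgrad_eq:
  assumes "poly3 q" "norm x = 1"
  shows "sgrad q x = grad q x - (grad q x \<bullet> x) *\<^sub>R x"
proof -
  have x: "x \<bullet> x = 1" "x \<noteq> 0" using assms(2) by (auto simp: norm_eq_1)
  have d1: "((\<lambda>y. inverse (norm y)) has_derivative (\<lambda>h. - (x \<bullet> h))) (at x)"
  proof -
    have n: "((\<lambda>y. norm y) has_derivative (\<lambda>h. x \<bullet> h)) (at x)"
      using has_derivative_norm[OF x(2)] assms(2) by (simp add: sgn_div_norm inner_commute)
    then show ?thesis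
      using Deriv.has_derivative_inverse[OF _ n] assms(2) by simp
  qed
  have d2: "((\<lambda>y. y /\<^sub>R norm y) has_derivative (\<lambda>h. h - (x \<bullet> h) *\<^sub>R x)) (at x)"
    using has_derivative_scaleR[OF d1 has_derivative_ident] assms(2) by simp
  have "((\<lambda>y. q (y /\<^sub>R norm y)) has_derivative (\<lambda>h. grad q (x /\<^sub>R norm x) \<bullet> (h - (x \<bullet> h) *\<^sub>R x))) (at x)"
    using has_derivative_compose[OF d2 poly3_has_derivative[OF assms(1)]] .
  then have "((\<lambda>y. q (y /\<^sub>R norm y)) has_derivative (\<lambda>h. (grad q x - (grad q x \<bullet> x) *\<^sub>R x) \<bullet> h)) (at x)"
    using assms(2) by (simp add: inner_diff_right inner_diff_left mult.commute)
  then show ?thesis unfolding sgrad_def by (rule grad_eqI)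
qed

lemma cross_cross_grad:
  assumes "poly3 q" "norm x = 1"
  shows "sgrad q x = - cross3 x (cross3 x (grad q x))"
proof -
  have "cross3 x (cross3 x g) = (x \<bullet> g) *\<^sub>R x - (x \<bullet> x) *\<^sub>R g" for g :: R3
    by (simp add: cross3_simps) (use exhaust_3 in force)
  then show ?thesis using assms by (simp add: sgrad_eq norm_eq_1 inner_commute)
qed

text \<open>Writing the tangential gradient as \<open>- x \<times> (x \<times> \<nabla>q)\<close>
  expresses it by the rotation fields, for which integration by parts is known.\<close>

lemma sgrad_component:
  assumes "poly3 q" "norm x = 1"
  shows "sgrad q x $ 1 = x $ 3 * ang 2 q x - x $ 2 * ang 3 q x"
    "sgrad q x $ 2 = x $ 1 * ang 3 q x - x $ 3 * ang 1 q x"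
    "sgrad q x $ 3 = x $ 2 * ang 1 q x - x $ 1 * ang 2 q x"
  unfolding cross_cross_grad[OF assms] ang_def vector_uminus_component
  by (simp_all add: cross_components[of x "cross3 x (grad q x)"] mult.commute)

text \<open>In the formulas of \<open>sgrad_component\<close> the rotation fields, once moved, also
  fall on the coordinate factors. Each of the two terms then returns \<open>x $ i\<close>, and
  together they make the term with \<open>2 * r x\<close>, the mean curvature contribution.\<close>

lemma sgrad_ibp_component:
  assumes "poly3 q" "poly3 r"
  shows "(\<ointegral>x. r x * sgrad q x $ i) = (\<ointegral>x. q x * (2 * r x) * x $ i - q x * sgrad r x $ i)"
proof -
  have cong: "(\<ointegral>x. f x) = (\<ointegral>x. g x)" if "\<And>x. norm x = 1 \<Longrightarrow> f x = g x" for f g :: "R3 \<Rightarrow> real"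
    by (rule lint_cong) (use that in auto)
  \<comment> \<open>\<open>j\<close> and \<open>k\<close> are the other two indices, in the order
    that gives the signs in \<open>a\<close>.\<close>
  have main: "(\<ointegral>x. r x * sgrad q x $ i) = (\<ointegral>x. q x * (2 * r x) * x $ i - q x * sgrad r x $ i)"
    if E: "\<And>q x. poly3 q \<Longrightarrow> norm x = 1 \<Longrightarrow> sgrad q x $ i = x $ k * ang j q x - x $ j * ang k q x"
      and a: "\<And>x. ang j (\<lambda>x. x $ k) x = - x $ i" "\<And>x. ang k (\<lambda>x. x $ j) x = x $ i" for j k
  proof -
    have pk: "poly3 (\<lambda>x. r x * x $ m)" for m by (intro poly3_mult poly3_coord assms)
    have am: "ang m (\<lambda>x. r x * x $ n) x = r x * ang m (\<lambda>x. x $ n) x + x $ n * ang m r x" for m n x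
    proof -
      have "pd i (\<lambda>x. r x * x $ n) = (\<lambda>x. r x * pd i (\<lambda>x. x $ n) x + pd i r x * x $ n)" for i
        by (rule poly3_pd_mult[OF assms(2) poly3_coord])
      then show ?thesis using exhaust_3[of m] by (elim disjE) (simp_all add: ang_simps algebra_simps)
    qed
    have "(\<ointegral>x. r x * sgrad q x $ i) = (\<ointegral>x. r x * (x $ k * ang j q x - x $ j * ang k q x))"
      by (rule cong) (simp add: E assms)
    also have "... = (\<ointegral>x. ang j q x * (r x * x $ k) - ang k q x * (r x * x $ j))"
      by (simp add: algebra_simps)
    also have "... = (\<ointegral>x. ang j q x * (r x * x $ k)) - (\<ointegral>x. ang k q x * (r x * x $ j))"
      by (intro lint_diff integrable_poly3 poly3_mult poly3_ang assms poly3_coord)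
    also have "... = (\<ointegral>x. q x * ang k (\<lambda>x. r x * x $ j) x) - (\<ointegral>x. q x * ang j (\<lambda>x. r x * x $ k) x)"
      by (simp add: ang_ibp[OF assms(1) pk])
    also have "... = (\<ointegral>x. q x * ang k (\<lambda>x. r x * x $ j) x - q x * ang j (\<lambda>x. r x * x $ k) x)"
      by (intro lint_diff[symmetric] integrable_poly3 poly3_mult poly3_ang assms poly3_coord)
    also have "... = (\<ointegral>x. q x * (2 * r x) * x $ i - q x * (x $ k * ang j r x - x $ j * ang k r x))"
      unfolding am a by (simp add: algebra_simps)
    also have "... = (\<ointegral>x. q x * (2 * r x) * x $ i - q x * sgrad r x $ i)"
      by (rule cong) (simp add: E assms)
    finally show ?thesis .
  qed
  show ?thesis
  proof (rule UNIV_3_cases[of i])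
    assume "i = 1"
    then show ?thesis by (intro main[of 3 2]) (simp_all add: sgrad_component, simp_all add: ang_simps pd_coord)
  next
    assume "i = 2"
    then show ?thesis by (intro main[of 1 3]) (simp_all add: sgrad_component, simp_all add: ang_simps pd_coord)
  next
    assume "i = 3"
    then show ?thesis by (intro main[of 2 1]) (simp_all add: sgrad_component, simp_all add: ang_simps pd_coord)
  qed
qed

section \<open>The single layer potential of a spherical harmonic\<close>

lemma norm_diff_sphere_ge: "norm y = 1 \<Longrightarrow> 1 - norm x \<le> norm (x - y)"
  using norm_triangle_ineq2[of y x] by (simp add: norm_minus_commute)

lemma norm_diff_sphere_sq:
  assumes "norm e = 1" "norm y = 1"
  shows "(norm (r *\<^sub>R e - y))\<^sup>2 = 1 - 2 * r * (e \<bullet> y) + r\<^sup>2"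
  using assms unfolding power2_norm_eq_inner
  by (simp add: inner_diff_left inner_diff_right norm_eq_1 inner_commute power2_eq_square algebra_simps)

lemma has_derivative_inverse_norm_diff:
  assumes "a \<noteq> y"
  shows "((\<lambda>y. inverse (norm (a - y))) has_derivative (\<lambda>h. (inverse (norm (a - y)) ^ 3 *\<^sub>R (a - y)) \<bullet> h)) (at (y :: R3))"
proof -
  have n: "norm (a - y) \<noteq> 0" using assms by simp
  have "((\<lambda>y. norm (a - y)) has_derivative (\<lambda>h. (- h) \<bullet> sgn (a - y))) (at y)"
  proof (rule has_derivative_compose[of "\<lambda>y. a - y" "\<lambda>h. - h" y UNIV norm])
    show "((\<lambda>y. a - y) has_derivative uminus) (at y)" by (auto intro!: derivative_eq_intros)
    show "(norm has_derivative (\<lambda>h. h \<bullet> sgn (a - y))) (at (a - y))"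
      using has_derivative_norm[of "a - y"] assms by simp
  qed
  from Deriv.has_derivative_inverse[OF n this]
  show ?thesis
    by (simp add: sgn_div_norm power3_eq_cube inner_commute algebra_simps)
qed

lemma has_derivative_cross_component:
  "((\<lambda>y. cross3 y e $ i) has_derivative (\<lambda>h. cross3 e (axis i 1) \<bullet> h)) (at y)"
proof -
  have "(\<lambda>h. cross3 e (axis i 1) \<bullet> h) = (\<lambda>h. cross3 h e $ i)"
    using exhaust_3[of i] by (elim disjE) (auto simp: cross3_def inner_vec_def sum_3 axis_def algebra_simps)
  moreover have "linear (\<lambda>h. cross3 h e $ i)"
    by (rule linearI) (simp_all add: cross_add_left cross_mult_left)
  ultimately show ?thesis
    by (simp add: linear_imp_has_derivative)
qed

section \<open>The single layer integral of a spherical harmonic along a ray\<close>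

context
  fixes e :: R3 and l :: nat and Y :: "R3 \<Rightarrow> real"
  assumes e: "norm e = 1" and Y: "Y \<in> Harm l"
begin

private definition ker :: "real \<Rightarrow> R3 \<Rightarrow> real" where "ker r y = inverse (norm (r *\<^sub>R e - y))"
private definition w :: "real \<Rightarrow> real" where "w r = (\<ointegral>y. ker r y * Y y)"
private definition w' :: "real \<Rightarrow> real" where "w' r = (\<ointegral>y. (e \<bullet> y - r) * ker r y ^ 3 * Y y)"

private lemma ker_ne: "\<bar>r\<bar> < 1 \<Longrightarrow> norm y = 1 \<Longrightarrow> r *\<^sub>R e \<noteq> y"
  using e by auto

private lemma ker_pos: "\<bar>r\<bar> < 1 \<Longrightarrow> norm y = 1 \<Longrightarrow> ker r y > 0"
  using ker_ne unfolding ker_def by simp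

private lemma ker_sq: "\<bar>r\<bar> < 1 \<Longrightarrow> norm y = 1 \<Longrightarrow> (1 - 2 * r * (e \<bullet> y) + r\<^sup>2) * ker r y ^ 2 = 1"
  using ker_ne[of r y] unfolding ker_def norm_diff_sphere_sq[OF e, of y r, symmetric]
  by (simp add: power_inverse)

private lemma ker_le: "\<bar>r\<bar> \<le> R \<Longrightarrow> R < 1 \<Longrightarrow> norm y = 1 \<Longrightarrow> ker r y \<le> 1 / (1 - R)"
  using norm_diff_sphere_ge[of y "r *\<^sub>R e"] e unfolding ker_def
  by (simp add: inverse_eq_divide frac_le)

private lemma ker_cont: "\<bar>r\<bar> < 1 \<Longrightarrow> continuous_on (sphere 0 1) (ker r)"
  unfolding ker_def by (intro continuous_intros) (use ker_ne in auto)

private lemma Y_poly: "poly3 Y" by (rule HarmD[OF Y])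

private lemma ker_deriv:
  assumes "\<bar>r\<bar> < 1" "norm y = 1"
  shows "((\<lambda>r. ker r y) has_real_derivative (e \<bullet> y - r) * ker r y ^ 3) (at r)"
proof -
  have ne: "r *\<^sub>R e - y \<noteq> 0" using ker_ne[OF assms] by simp
  have "((\<lambda>r. norm (r *\<^sub>R e - y)) has_derivative (\<lambda>t. (t *\<^sub>R e) \<bullet> sgn (r *\<^sub>R e - y))) (at r)"
    by (rule has_derivative_compose[of "\<lambda>r. r *\<^sub>R e - y" "\<lambda>t. t *\<^sub>R e" r UNIV norm])
      (use has_derivative_norm[OF ne] in \<open>auto intro!: derivative_eq_intros\<close>)
  moreover have "(\<lambda>t. (t *\<^sub>R e) \<bullet> sgn (r *\<^sub>R e - y)) = (*) ((r - e \<bullet> y) * ker r y)"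
    using e by (auto simp: sgn_div_norm ker_def inner_diff_right norm_eq_1 algebra_simps)
  ultimately have "((\<lambda>r. norm (r *\<^sub>R e - y)) has_real_derivative (r - e \<bullet> y) * ker r y) (at r)"
    by (simp add: has_field_derivative_def)
  from DERIV_inverse'[OF this] ne show ?thesis
    by (simp add: ker_def[abs_def] power3_eq_cube algebra_simps)
qed

private lemma w_deriv:
  assumes "\<bar>r\<bar> < 1"
  shows "(w has_real_derivative w' r) (at r)"
proof -
  define R where "R = (1 + \<bar>r\<bar>) / 2"
  have R: "\<bar>r\<bar> < R" "R < 1" using assms by (auto simp: R_def)
  obtain B where B: "\<And>y. norm y = 1 \<Longrightarrow> \<bar>Y y\<bar> \<le> B" "B > 0"
    using continuous_sphere_bound[OF poly3_continuous[OF Y_poly]] by auto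
  have abs: "\<bar>t\<bar> < R" if "\<bar>t - r\<bar> < R - \<bar>r\<bar>" for t using that by linarith
  show ?thesis unfolding w_def[abs_def] w'_def
  proof (rule has_real_derivative_integral(1)[where e="R - \<bar>r\<bar>" and B="\<lambda>_. 2 * (1 / (1 - R))^3 * B"])
    fix t assume t: "\<bar>t - r\<bar> < R - \<bar>r\<bar>"
    then have t1: "\<bar>t\<bar> < R" "\<bar>t\<bar> < 1" using abs R by force+
    show "integrable sigmaS (\<lambda>y. ker t y * Y y)"
      by (intro sphere_integrable continuous_intros ker_cont poly3_continuous Y_poly t1)
    fix y assume "y \<in> space sigmaS"
    then have y: "norm y = 1" by simp
    show "((\<lambda>t. ker t y * Y y) has_real_derivative (e \<bullet> y - t) * ker t y ^ 3 * Y y) (at t)"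
      by (intro DERIV_cmult_right ker_deriv t1 y)
    have "\<bar>e \<bullet> y - t\<bar> \<le> 2" using Cauchy_Schwarz_ineq2[of e y] e y t1 by auto
    moreover have "\<bar>ker t y ^ 3\<bar> \<le> (1 / (1 - R)) ^ 3"
      using ker_le[of t R y] ker_pos[of t y] t1 R y by (auto simp: power_mono)
    ultimately show "\<bar>(e \<bullet> y - t) * ker t y ^ 3 * Y y\<bar> \<le> 2 * (1 / (1 - R))^3 * B"
      unfolding abs_mult using B(1)[OF y] R by (intro mult_mono) auto
  qed (use R in auto)
qed

text \<open>The integrand is the derivative of \<open>r^2\<close> times the radial derivative of the
  kernel. The relation \<open>ker_sq\<close> removes the square of \<open>e \<bullet> y - r\<close>
  and brings it to the form in which the rotations of \<open>ibp_identity\<close> produce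
  it.\<close>

private lemma w'_deriv:
  assumes "\<bar>r\<bar> < 1"
  shows "((\<lambda>r. r\<^sup>2 * w' r) has_real_derivative
     (\<ointegral>y. (2 * r * (e \<bullet> y) * ker r y ^ 3 - 3 * r\<^sup>2 * (1 - (e \<bullet> y)\<^sup>2) * ker r y ^ 5) * Y y)) (at r)"
proof -
  define R where "R = (1 + \<bar>r\<bar>) / 2"
  have R: "\<bar>r\<bar> < R" "R < 1" using assms by (auto simp: R_def)
  obtain B where B: "\<And>y. norm y = 1 \<Longrightarrow> \<bar>Y y\<bar> \<le> B" "B > 0"
    using continuous_sphere_bound[OF poly3_continuous[OF Y_poly]] by auto
  have abs: "\<bar>t\<bar> < R" if "\<bar>t - r\<bar> < R - \<bar>r\<bar>" for t using that by linarith
  define K where "K = 1 / (1 - R)"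
  have "K > 0" using R by (simp add: K_def)
  have eq: "(\<lambda>r. r\<^sup>2 * w' r) = (\<lambda>r. \<ointegral>y. r\<^sup>2 * (e \<bullet> y - r) * ker r y ^ 3 * Y y)"
    unfolding w'_def by (simp add: fun_eq_iff mult.assoc)
  show ?thesis unfolding eq
  proof (rule has_real_derivative_integral(1)[where e="R - \<bar>r\<bar>" and B="\<lambda>_. (2 * K^3 + 3 * K^5) * B"])
    fix t assume t: "\<bar>t - r\<bar> < R - \<bar>r\<bar>"
    then have t1: "\<bar>t\<bar> < R" "\<bar>t\<bar> < 1" using abs R by force+
    show "integrable sigmaS (\<lambda>y. t\<^sup>2 * (e \<bullet> y - t) * ker t y ^ 3 * Y y)"
      by (intro sphere_integrable continuous_intros ker_cont poly3_continuous Y_poly t1)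
    fix y assume "y \<in> space sigmaS"
    then have y: "norm y = 1" by simp
    have k2: "(e \<bullet> y - t)\<^sup>2 * ker t y ^ 2 = 1 - (1 - (e \<bullet> y)\<^sup>2) * ker t y ^ 2"
      using ker_sq[OF t1(2) y] by (simp add: power2_eq_square algebra_simps)
    have "((\<lambda>t. t\<^sup>2 * (e \<bullet> y - t) * ker t y ^ 3 * Y y) has_real_derivative
        (((2 * t) * (e \<bullet> y - t) + t\<^sup>2 * (-1)) * ker t y ^ 3
          + t\<^sup>2 * (e \<bullet> y - t) * (3 * ker t y ^ 2 * ((e \<bullet> y - t) * ker t y ^ 3))) * Y y) (at t)"
      by (rule derivative_eq_intros ker_deriv[OF t1(2) y] refl | simp add: algebra_simps)+
    moreover have "((2 * t) * (e \<bullet> y - t) + t\<^sup>2 * (-1)) * ker t y ^ 3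
          + t\<^sup>2 * (e \<bullet> y - t) * (3 * ker t y ^ 2 * ((e \<bullet> y - t) * ker t y ^ 3))
       = 2 * t * (e \<bullet> y) * ker t y ^ 3 - 3 * t\<^sup>2 * (1 - (e \<bullet> y)\<^sup>2) * ker t y ^ 5"
    proof -
      have "t\<^sup>2 * (e \<bullet> y - t) * (3 * ker t y ^ 2 * ((e \<bullet> y - t) * ker t y ^ 3))
        = 3 * t\<^sup>2 * ker t y ^ 3 * ((e \<bullet> y - t)\<^sup>2 * ker t y ^ 2)"
        by (simp add: power2_eq_square)
      also have "... = 3 * t\<^sup>2 * ker t y ^ 3 - 3 * t\<^sup>2 * (1 - (e \<bullet> y)\<^sup>2) * (ker t y ^ 3 * ker t y ^ 2)"
        unfolding k2 by (simp add: algebra_simps)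
      also have "ker t y ^ 3 * ker t y ^ 2 = ker t y ^ 5" by (simp flip: power_add)
      finally show ?thesis by (simp add: power2_eq_square algebra_simps)
    qed
    ultimately show "((\<lambda>t. t\<^sup>2 * (e \<bullet> y - t) * ker t y ^ 3 * Y y) has_real_derivative
        (2 * t * (e \<bullet> y) * ker t y ^ 3 - 3 * t\<^sup>2 * (1 - (e \<bullet> y)\<^sup>2) * ker t y ^ 5) * Y y) (at t)"
      by simp
    have k: "0 \<le> ker t y" "ker t y \<le> K"
      using ker_le[of t R y] ker_pos[of t y] t1 R y by (auto simp: K_def)
    have ey: "\<bar>e \<bullet> y\<bar> \<le> 1" using Cauchy_Schwarz_ineq2[of e y] e y by auto
    have tt: "\<bar>t\<bar> \<le> 1" using t1 by auto
    have "\<bar>2 * t * (e \<bullet> y) * ker t y ^ 3\<bar> \<le> 2 * 1 * 1 * K ^ 3"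
      unfolding abs_mult using k ey tt by (intro mult_mono) (auto simp: power_mono power_abs)
    moreover have "\<bar>3 * t\<^sup>2 * (1 - (e \<bullet> y)\<^sup>2) * ker t y ^ 5\<bar> \<le> 3 * 1 * 1 * K ^ 5"
    proof -
      have "t\<^sup>2 \<le> 1" "(e \<bullet> y)\<^sup>2 \<le> 1" using tt ey by (auto simp: abs_square_le_1)
      then show ?thesis
        unfolding abs_mult using k by (intro mult_mono) (auto simp: power_mono power_abs)
    qed
    ultimately have "\<bar>2 * t * (e \<bullet> y) * ker t y ^ 3 - 3 * t\<^sup>2 * (1 - (e \<bullet> y)\<^sup>2) * ker t y ^ 5\<bar> \<le> 2 * K^3 + 3 * K^5"
      by linarith
    then show "\<bar>(2 * t * (e \<bullet> y) * ker t y ^ 3 - 3 * t\<^sup>2 * (1 - (e \<bullet> y)\<^sup>2) * ker t y ^ 5) * Y y\<bar> \<le> (2 * K^3 + 3 * K^5) * B"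
      unfolding abs_mult using B(1)[of y] y \<open>K > 0\<close> by (intro mult_mono) auto
  qed (use R in auto)
qed

text \<open>The Newton kernel is harmonic, so the radial expression on the left is minus the sum of
  its squared rotations in \<open>y\<close>. Two integrations by parts move these to
  \<open>Y\<close>, where they act as \<open>-l(l+1)\<close>.\<close>

private lemma ibp_identity:
  assumes "\<bar>r\<bar> < 1"
  shows "(\<ointegral>y. (2 * r * (e \<bullet> y) * ker r y ^ 3 - 3 * r\<^sup>2 * (1 - (e \<bullet> y)\<^sup>2) * ker r y ^ 5) * Y y)
    = real (l * (l + 1)) * w r"
proof -
  let ?a = "r *\<^sub>R e"
  let ?F = "\<lambda>y. ker r y ^ 3 *\<^sub>R (?a - y)"
  \<comment> \<open>\<open>?h i\<close> is the i-th rotation field applied to the kernel, and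
    \<open>?H i\<close> is the gradient of \<open>?h i\<close>.\<close>
  let ?h = "\<lambda>i y. r * cross3 y e $ i * ker r y ^ 3"
  let ?H = "\<lambda>i y. (r * ker r y ^ 3) *\<^sub>R cross3 e (axis i 1) + (3 * r * cross3 y e $ i * ker r y ^ 5) *\<^sub>R (?a - y)"
  have kd: "(ker r has_derivative (\<lambda>h. ?F y \<bullet> h)) (at y)" if "norm y = 1" for y
    using has_derivative_inverse_norm_diff[OF ker_ne[OF assms that]] unfolding ker_def .
  have hd: "(?h i has_derivative (\<lambda>h. ?H i y \<bullet> h)) (at y)" if "norm y = 1" for y i
    by (rule derivative_eq_intros has_derivative_cross_component kd[OF that] refl)+
       (simp add: fun_eq_iff inner_add_left algebra_simps power2_eq_square eval_nat_numeral)
  have cF: "continuous_on (sphere 0 1) ?F" "continuous_on (sphere 0 1) (?H i)" for i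
    by (intro continuous_intros ker_cont assms)+
  have gY: "(Z has_derivative (\<lambda>h. grad Z y \<bullet> h)) (at y)" "continuous_on (sphere 0 1) (grad Z)" if "poly3 Z" for Z y
    using that by (auto intro: poly3_has_derivative poly3_grad_continuous)
  have cr: "cross3 y (?F y) $ i = ?h i y" for y i
    by (simp add: right_diff_distrib cross_mult_right Cross3.right_diff_distrib algebra_simps)
  have int: "integrable sigmaS (\<lambda>y. ?h i y * ang i Y y)" "integrable sigmaS (\<lambda>y. ker r y * ang i (ang i Y) y)"
     "integrable sigmaS (\<lambda>y. cross3 y (?H i y) $ i * Y y)" for i
    by (intro sphere_integrable continuous_intros ker_cont assms poly3_continuous poly3_ang Y_poly)+
  have A: "(\<ointegral>y. ?h i y * ang i Y y) = - (\<ointegral>y. ker r y * ang i (ang i Y) y)" for i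
    using sphere_ibp[of "ker r" ?F "ang i Y" "grad (ang i Y)" i, OF kd cF(1) gY[OF poly3_ang[OF Y_poly]]]
    unfolding cr ang_def[symmetric] by simp
  have B: "(\<ointegral>y. ?h i y * ang i Y y) = - (\<ointegral>y. cross3 y (?H i y) $ i * Y y)" for i
    using sphere_ibp[of "?h i" "?H i" Y "grad Y" i, OF hd cF(2) gY[OF Y_poly]]
    unfolding ang_def[symmetric] by simp
  have "(\<ointegral>y. (2 * r * (e \<bullet> y) * ker r y ^ 3 - 3 * r\<^sup>2 * (1 - (e \<bullet> y)\<^sup>2) * ker r y ^ 5) * Y y)
     = (\<ointegral>y. - (\<Sum>i\<in>UNIV. cross3 y (?H i y) $ i * Y y))"
  proof (rule lint_cong)
    fix y assume "y \<in> space sigmaS"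
    then have y: "y \<bullet> y = 1" by (simp add: norm_eq_1)
    have n2: "(\<Sum>i\<in>UNIV. cross3 y e $ i * cross3 y e $ i) = 1 - (e \<bullet> y)\<^sup>2"
    proof -
      have "(\<Sum>i\<in>UNIV. cross3 y e $ i * cross3 y e $ i) = (norm (cross3 y e))\<^sup>2"
        by (simp add: power2_norm_eq_inner inner_vec_def)
      also have "... = 1 - (e \<bullet> y)\<^sup>2"
        using norm_cross_dot[of y e] y e by (simp add: norm_eq_1[symmetric] inner_commute)
      finally show ?thesis .
    qed
    have t: "(\<Sum>i\<in>UNIV. cross3 y (cross3 e (axis i 1)) $ i) = - 2 * (e \<bullet> y)"
      by (simp add: sum_3 cross3_def axis_def inner_vec_def algebra_simps)
    have "(\<Sum>i\<in>UNIV. cross3 y (?H i y) $ i)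
       = (\<Sum>i\<in>UNIV. r * ker r y ^ 3 * cross3 y (cross3 e (axis i 1)) $ i + 3 * r\<^sup>2 * ker r y ^ 5 * (cross3 y e $ i * cross3 y e $ i))"
      by (intro sum.cong refl)
        (simp add: cross_add_right cross_mult_right Cross3.right_diff_distrib power2_eq_square algebra_simps)
    also have "... = r * ker r y ^ 3 * (\<Sum>i\<in>UNIV. cross3 y (cross3 e (axis i 1)) $ i)
       + 3 * r\<^sup>2 * ker r y ^ 5 * (\<Sum>i\<in>UNIV. cross3 y e $ i * cross3 y e $ i)"
      by (simp add: sum.distrib sum_distrib_left)
    finally have S: "(\<Sum>i\<in>UNIV. cross3 y (?H i y) $ i)
       = r * ker r y ^ 3 * (- 2 * (e \<bullet> y)) + 3 * r\<^sup>2 * ker r y ^ 5 * (1 - (e \<bullet> y)\<^sup>2)"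
      unfolding n2 t .
    then show "(2 * r * (e \<bullet> y) * ker r y ^ 3 - 3 * r\<^sup>2 * (1 - (e \<bullet> y)\<^sup>2) * ker r y ^ 5) * Y y
       = - (\<Sum>i\<in>UNIV. cross3 y (?H i y) $ i * Y y)"
      unfolding sum_distrib_right[symmetric] S by (simp add: algebra_simps)
  qed simp
  also have "... = (\<Sum>i\<in>UNIV. (\<ointegral>y. ?h i y * ang i Y y))"
    using int(3) by (simp add: B sum_negf)
  also have "... = (\<ointegral>y. - (\<Sum>i\<in>UNIV. ker r y * ang i (ang i Y) y))"
    using int(2) by (simp add: A sum_negf)
  also have "... = (\<ointegral>y. real (l * (l + 1)) * (ker r y * Y y))"
  proof -
    have "- (\<Sum>i\<in>UNIV. ker r y * ang i (ang i Y) y) = real (l * (l + 1)) * (ker r y * Y y)" for y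
      unfolding sum_distrib_left[symmetric] sum_3 sum_ang_ang[OF HarmD(1)[OF Y], of y]
      by (simp add: HarmD(3)[OF Y] algebra_simps)
    then show ?thesis by simp
  qed
  also have "... = real (l * (l + 1)) * w r"
    unfolding w_def by (rule integral_mult_right_zero)
  finally show ?thesis .
qed

text \<open>The equation \<open>(r^2 w')' = l(l+1) w\<close> has the solutions \<open>r^l\<close>
  and \<open>r^(-l-1)\<close>. Along it the quantity \<open>r^(l+1) (r w' - l w)\<close>, called
  \<open>\<phi>\<close>, is constant; it vanishes at 0, where \<open>w\<close> is regular, and this
  excludes the second solution.\<close>

private lemma w_euler: assumes "0 < r" "r < 1" shows "r * w' r = l * w r"
proof -
  define \<phi> where "\<phi> r = r ^ l * (r\<^sup>2 * w' r) - real l * r ^ (l + 1) * w r" for r :: real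
  have d: "(\<phi> has_real_derivative 0) (at r)" if "\<bar>r\<bar> < 1" for r
  proof -
    have D: "(\<phi> has_real_derivative (real l * r ^ (l - 1)) * (r\<^sup>2 * w' r) + (real (l * (l + 1)) * w r) * r ^ l
       - ((real l * (real (l + 1) * r ^ l)) * w r + w' r * (real l * r ^ (l + 1)))) (at r)"
      unfolding \<phi>_def
      by (rule DERIV_diff DERIV_mult w'_deriv[OF that, unfolded ibp_identity[OF that]] w_deriv[OF that] DERIV_pow DERIV_cmult
          | (rule DERIV_cong[OF DERIV_cmult[OF DERIV_pow]], simp) | rule DERIV_cong[OF DERIV_pow], simp)+
    have m: "(real l * r ^ (l - 1)) * (r\<^sup>2 * w' r) = w' r * (real l * r ^ (l + 1))"
      by (cases l) (auto simp: power2_eq_square)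
    show ?thesis using D unfolding m by (simp add: algebra_simps)
  qed
  have "\<phi> r = \<phi> 0"
    by (rule DERIV_isconst3[of "-1" 1]) (use assms d in auto)
  then have "r ^ l * r * (r * w' r - l * w r) = 0" by (simp add: \<phi>_def power2_eq_square algebra_simps)
  then show ?thesis using assms by simp
qed

private lemma w_power: obtains C where "\<And>r. 0 \<le> r \<Longrightarrow> r < 1 \<Longrightarrow> w r = C * r ^ l"
proof -
  define \<psi> where "\<psi> r = w r / r ^ l" for r
  have d: "(\<psi> has_real_derivative 0) (at r)" if "r > 0" "r < 1" for r
  proof -
    have "(\<psi> has_real_derivative (w' r * r ^ l - w r * (real l * r ^ (l - 1))) / (r ^ l * r ^ l)) (at r)"
      unfolding \<psi>_def
      by (rule DERIV_cong[OF DERIV_divide[OF w_deriv DERIV_pow]]) (use that in \<open>auto simp: power2_eq_square\<close>)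
    moreover have "w' r * r ^ l - w r * (real l * r ^ (l - 1)) = 0"
    proof -
      have "r * (w' r * r ^ l - w r * (real l * r ^ (l - 1))) = (r * w' r) * r ^ l - l * w r * (r * r ^ (l - 1))"
        by (simp add: algebra_simps)
      also have "... = 0" unfolding w_euler[OF that] by (cases l) auto
      finally show ?thesis using that by simp
    qed
    ultimately show ?thesis by simp
  qed
  define C where "C = \<psi> (1/2)"
  have pos: "w r = C * r ^ l" if "0 < r" "r < 1" for r
  proof -
    have "\<psi> r = \<psi> (1/2)" by (rule DERIV_isconst3[of 0 1]) (use that d in auto)
    then show ?thesis using that by (simp add: \<psi>_def C_def field_simps)
  qed
  moreover have "w 0 = C * 0 ^ l"
  proof -
    have "isCont w 0" using w_deriv[of 0] DERIV_isCont by auto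
    then have "(w \<longlongrightarrow> w 0) (at_right 0)" by (simp add: isCont_def filterlim_at_split)
    moreover have "((\<lambda>r. C * r ^ l) \<longlongrightarrow> C * 0 ^ l) (at_right 0)" by (intro tendsto_intros)
    then have "(w \<longlongrightarrow> C * 0 ^ l) (at_right 0)"
      by (rule Lim_transform_eventually) (auto intro!: eventually_at_rightI[of 0 1] pos[symmetric])
    ultimately show ?thesis by (rule tendsto_unique[rotated]) simp
  qed
  ultimately show thesis using that by (metis order_le_less)
qed

text \<open>The Poisson kernel is \<open>2 r d/dr + 1\<close> applied to the Newton kernel, over
  \<open>4 pi\<close>; on a multiple of \<open>r^l\<close> this gives the factor
  \<open>2l+1\<close>. The constant \<open>C\<close> is determined later from the boundary
  values.\<close>

lemma single_layer_radial:
  obtains C where "\<And>r. 0 \<le> r \<Longrightarrow> r < 1 \<Longrightarrow> (\<ointegral>y. inverse (norm (r *\<^sub>R e - y)) * Y y) = C * r ^ l"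
    and "\<And>r. 0 < r \<Longrightarrow> r < 1 \<Longrightarrow> Poisson Y (r *\<^sub>R e) = (2 * real l + 1) / (4 * pi) * C * r ^ l"
proof -
  obtain C where C: "\<And>r. 0 \<le> r \<Longrightarrow> r < 1 \<Longrightarrow> w r = C * r ^ l" using w_power by blast
  have "Poisson Y (r *\<^sub>R e) = (2 * real l + 1) / (4 * pi) * C * r ^ l" if "0 < r" "r < 1" for r
  proof -
    have r: "\<bar>r\<bar> < 1" using that by simp
    have "Poisson Y (r *\<^sub>R e) = (\<ointegral>y. 1 / (4 * pi) * (2 * r * ((e \<bullet> y - r) * ker r y ^ 3 * Y y) + ker r y * Y y))"
      unfolding Poisson_def
    proof (rule lint_cong)
      fix y assume "y \<in> space sigmaS"
      then have y: "norm y = 1" by simp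
      have "ker r y = (1 - 2 * r * (e \<bullet> y) + r\<^sup>2) * ker r y ^ 3"
        using ker_sq[OF r y] by (simp add: power2_eq_square power3_eq_cube)
      then have "2 * r * ((e \<bullet> y - r) * ker r y ^ 3) + ker r y = (1 - r\<^sup>2) * ker r y ^ 3"
        by (simp add: algebra_simps power2_eq_square)
      moreover have "Pker (r *\<^sub>R e) y = 1 / (4 * pi) * ((1 - r\<^sup>2) * ker r y ^ 3)"
        using e by (simp add: Pker_def ker_def inverse_eq_divide power_one_over)
      ultimately have "Pker (r *\<^sub>R e) y * Y y = 1 / (4 * pi) * (2 * r * ((e \<bullet> y - r) * ker r y ^ 3) + ker r y) * Y y"
        by simp
      then show "Pker (r *\<^sub>R e) y * Y y = 1 / (4 * pi) * (2 * r * ((e \<bullet> y - r) * ker r y ^ 3 * Y y) + ker r y * Y y)"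
        by (simp only: distrib_right mult.assoc)
    qed simp
    also have "... = 1 / (4 * pi) * (2 * r * w' r + w r)"
    proof -
      have "integrable sigmaS (\<lambda>y. (e \<bullet> y - r) * ker r y ^ 3 * Y y)" "integrable sigmaS (\<lambda>y. ker r y * Y y)"
        by (intro sphere_integrable continuous_intros ker_cont poly3_continuous Y_poly r)+
      then show ?thesis unfolding w_def w'_def by simp
    qed
    also have "2 * r * w' r + w r = (2 * real l + 1) * w r" using w_euler[OF that] by (simp add: algebra_simps)
    finally show ?thesis using C[of r] that by simp
  qed
  with C show thesis using that unfolding w_def ker_def by blast
qed

end

text \<open>For the harmonic 1 the constant is read off at the centre, where the kernel is
  1.\<close>

lemma single_layer_const:
  assumes "norm e = 1" "0 \<le> r" "r < 1"
  shows "(\<ointegral>y. inverse (norm (r *\<^sub>R e - y))) = 4 * pi"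
    and "0 < r \<Longrightarrow> (\<ointegral>y. Pker (r *\<^sub>R e) y) = 1"
proof -
  obtain C where C: "\<And>r. 0 \<le> r \<Longrightarrow> r < 1 \<Longrightarrow> (\<ointegral>y. inverse (norm (r *\<^sub>R e - y)) * 1) = C * r ^ 0"
    "\<And>r. 0 < r \<Longrightarrow> r < 1 \<Longrightarrow> Poisson (\<lambda>_. 1) (r *\<^sub>R e) = (2 * real 0 + 1) / (4 * pi) * C * r ^ 0"
    using single_layer_radial[OF assms(1) Harm_const[of 1]] by blast
  have "(\<ointegral>y. inverse (norm (0 *\<^sub>R e - y)) * 1) = (\<ointegral>y. 1)"
    by (rule lint_cong) auto
  then have "C = 4 * pi" using C(1)[of 0] by simp
  then show "(\<ointegral>y. inverse (norm (r *\<^sub>R e - y))) = 4 * pi"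
    "0 < r \<Longrightarrow> (\<ointegral>y. Pker (r *\<^sub>R e) y) = 1"
    using C(1)[of r] C(2)[of r] assms by (auto simp: Poisson_def)
qed

section \<open>The Poisson kernel as an approximate identity\<close>

lemma Pker_nonneg: "norm x < 1 \<Longrightarrow> Pker x y \<ge> 0"
  unfolding Pker_def by (intro divide_nonneg_nonneg mult_nonneg_nonneg) (auto simp: power_le_one)

lemma continuous_inverse_norm: "norm x < 1 \<Longrightarrow> continuous_on (sphere 0 1) (\<lambda>y. inverse (norm (x - y)))"
  by (intro continuous_intros) auto

lemma Pker_inverse: "Pker x y = (1 - (norm x)\<^sup>2) / (4 * pi) * inverse (norm (x - y)) ^ 3"
  by (simp add: Pker_def inverse_eq_divide power_one_over)

lemma continuous_Pker: "norm x < 1 \<Longrightarrow> continuous_on (sphere 0 1) (Pker x)"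
  unfolding Pker_inverse by (intro continuous_intros) auto

text \<open>Since \<open>r |e - y|^2\<close> equals \<open>|re - y|^2 - (1 - r)^2\<close>, the
  second moment is a combination of the two integrals in \<open>single_layer_const\<close>. Its
  smallness expresses the concentration of the kernel at \<open>e\<close>.\<close>

lemma Poisson_second_moment:
  assumes "norm e = 1" "0 < r" "r < 1"
  shows "(\<ointegral>y. Pker (r *\<^sub>R e) y * (norm (e - y))\<^sup>2) = 2 * (1 - r)"
proof -
  have n: "norm (r *\<^sub>R e) < 1" using assms by simp
  have "(\<ointegral>y. Pker (r *\<^sub>R e) y * (norm (e - y))\<^sup>2)
    = (\<ointegral>y. (1 - r\<^sup>2) / (4 * pi * r) * inverse (norm (r *\<^sub>R e - y)) - (1 - r)\<^sup>2 / r * Pker (r *\<^sub>R e) y)"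
  proof (rule lint_cong)
    fix y assume "y \<in> space sigmaS"
    then have y: "norm y = 1" by simp
    define s where "s = norm (r *\<^sub>R e - y)"
    have s: "s > 0" using y n unfolding s_def by auto
    have "s\<^sup>2 - (1 - r)\<^sup>2 = r * (norm (e - y))\<^sup>2"
      using norm_diff_sphere_sq[OF assms(1) y, of 1] norm_diff_sphere_sq[OF assms(1) y, of r]
      by (simp add: s_def) (simp add: power2_eq_square algebra_simps)
    then have "(norm (e - y))\<^sup>2 = (s\<^sup>2 - (1 - r)\<^sup>2) / r"
      using assms by simp
    moreover have "Pker (r *\<^sub>R e) y * s\<^sup>2 = (1 - r\<^sup>2) / (4 * pi) * inverse s"
      using s assms unfolding Pker_inverse s_def[symmetric]
      by (simp add: power2_eq_square power3_eq_cube field_simps)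
    ultimately show "Pker (r *\<^sub>R e) y * (norm (e - y))\<^sup>2
      = (1 - r\<^sup>2) / (4 * pi * r) * inverse (norm (r *\<^sub>R e - y)) - (1 - r)\<^sup>2 / r * Pker (r *\<^sub>R e) y"
      unfolding s_def[symmetric] by (simp add: diff_divide_distrib right_diff_distrib mult.commute)
  qed simp
  also have "... = (1 - r\<^sup>2) / (4 * pi * r) * (4 * pi) - (1 - r)\<^sup>2 / r * 1"
  proof -
    have i: "integrable sigmaS (\<lambda>y. inverse (norm (r *\<^sub>R e - y)))" "integrable sigmaS (Pker (r *\<^sub>R e))"
      by (intro sphere_integrable continuous_inverse_norm continuous_Pker n)+
    show ?thesis
      unfolding lint_diff[OF integrable_mult_right[OF i(1)] integrable_mult_right[OF i(2)]]
        integral_mult_right_zero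
      using single_layer_const[OF assms(1) _ assms(3)] assms(2) by simp
  qed
  also have "... = 2 * (1 - r)" using assms by (simp add: field_simps power2_eq_square)
  finally show ?thesis .
qed

lemma poly3_Lipschitz:
  assumes "poly3 q"
  obtains L where "L > 0" "\<And>x y. norm x \<le> 1 \<Longrightarrow> norm y \<le> 1 \<Longrightarrow> \<bar>q x - q y\<bar> \<le> L * norm (x - y)"
proof -
  have "bounded (grad q ` cball 0 1)"
    by (intro compact_imp_bounded compact_continuous_image poly3_grad_continuous assms) auto
  then obtain L where L: "L > 0" "\<And>x. norm x \<le> 1 \<Longrightarrow> norm (grad q x) \<le> L"
    unfolding bounded_pos by auto
  have "\<bar>q x - q y\<bar> \<le> L * norm (x - y)" if "norm x \<le> 1" "norm y \<le> 1" for x y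
  proof -
    have "norm (q x - q y) \<le> L * norm (x - y)"
    proof (rule differentiable_bound[where S="cball 0 1" and f' = "\<lambda>x h. grad q x \<bullet> h"])
      show "(q has_derivative (\<lambda>h. grad q z \<bullet> h)) (at z within cball 0 1)" for z
        by (rule has_derivative_at_withinI[OF poly3_has_derivative[OF assms]])
      show "onorm (\<lambda>h. grad q z \<bullet> h) \<le> L" if "z \<in> cball 0 1" for z
      proof (rule onorm_le)
        fix h :: R3
        have "\<bar>grad q z \<bullet> h\<bar> \<le> norm (grad q z) * norm h" by (rule Cauchy_Schwarz_ineq2)
        also have "... \<le> L * norm h" using L(2)[of z] that by (intro mult_right_mono) auto
        finally show "norm (grad q z \<bullet> h) \<le> L * norm h" by simp
      qed
    qed (use that in auto)
    then show ?thesis by simp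
  qed
  with L(1) show thesis using that by blast
qed

lemma Poisson_tendsto:
  assumes "poly3 q" "norm e = 1"
  shows "((\<lambda>r. Poisson q (r *\<^sub>R e)) \<longlongrightarrow> q e) (at_left 1)"
proof -
  obtain L where L: "L > 0" "\<And>x y. norm x \<le> 1 \<Longrightarrow> norm y \<le> 1 \<Longrightarrow> \<bar>q x - q y\<bar> \<le> L * norm (x - y)"
    using poly3_Lipschitz[OF assms(1)] by blast
  have bound: "norm (Poisson q (r *\<^sub>R e) - q e) \<le> 3 * L * sqrt (1 - r)" if r: "0 < r" "r < 1" for r
  proof -
    \<comment> \<open>This choice balances the contributions \<open>\<epsilon>\<close> and
      \<open>(1 - r) / \<epsilon>\<close> in the Lipschitz estimate.\<close>
    define \<epsilon> where "\<epsilon> = sqrt (1 - r)"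
    have \<epsilon>: "\<epsilon> > 0" "\<epsilon>\<^sup>2 = 1 - r" using r by (auto simp: \<epsilon>_def)
    have n: "norm (r *\<^sub>R e) < 1" using assms r by simp
    have cq: "continuous_on (sphere 0 1) q" by (rule poly3_continuous[OF assms(1)])
    note cont = sphere_integrable continuous_intros continuous_Pker[OF n] cq
    have "Poisson q (r *\<^sub>R e) - q e = (\<ointegral>y. Pker (r *\<^sub>R e) y * q y) - (\<ointegral>y. Pker (r *\<^sub>R e) y * q e)"
      using single_layer_const(2)[OF assms(2) _ r(2)] r by (simp add: Poisson_def)
    also have "... = (\<ointegral>y. Pker (r *\<^sub>R e) y * (q y - q e))"
      by (subst lint_diff[symmetric]) (auto intro!: cont simp: right_diff_distrib)
    also have "norm ... \<le> (\<ointegral>y. L * (Pker (r *\<^sub>R e) y * \<epsilon>) + L / \<epsilon> * (Pker (r *\<^sub>R e) y * (norm (e - y))\<^sup>2))"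
    proof (rule order_trans[OF integral_norm_bound], rule integral_mono)
      fix y assume "y \<in> space sigmaS"
      then have y: "norm y = 1" by simp
      have P: "Pker (r *\<^sub>R e) y \<ge> 0" by (rule Pker_nonneg[OF n])
      have "norm (e - y) \<le> \<epsilon> + (norm (e - y))\<^sup>2 / \<epsilon>"
      proof -
        have "0 \<le> (norm (e - y) - \<epsilon>)\<^sup>2 + norm (e - y) * \<epsilon>" using \<epsilon> by (intro add_nonneg_nonneg) auto
        then have "norm (e - y) * \<epsilon> \<le> \<epsilon>\<^sup>2 + (norm (e - y))\<^sup>2"
          by (simp add: power2_eq_square algebra_simps)
        then show ?thesis using \<epsilon>(1) by (simp add: field_simps power2_eq_square)
      qed
      then have "\<bar>q y - q e\<bar> \<le> L * (\<epsilon> + (norm (e - y))\<^sup>2 / \<epsilon>)"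
        using L(2)[of y e] y assms(2) L(1) by (smt (verit) mult_left_mono norm_minus_commute)
      then have "Pker (r *\<^sub>R e) y * \<bar>q y - q e\<bar> \<le> Pker (r *\<^sub>R e) y * (L * (\<epsilon> + (norm (e - y))\<^sup>2 / \<epsilon>))"
        by (rule mult_left_mono[OF _ P])
      then show "norm (Pker (r *\<^sub>R e) y * (q y - q e)) \<le> L * (Pker (r *\<^sub>R e) y * \<epsilon>) + L / \<epsilon> * (Pker (r *\<^sub>R e) y * (norm (e - y))\<^sup>2)"
        unfolding real_norm_def abs_mult abs_of_nonneg[OF P] by (simp add: algebra_simps)
    qed (use \<epsilon>(1) in \<open>auto intro!: cont\<close>)
    also have "... = L * \<epsilon> + L / \<epsilon> * (2 * (1 - r))"
    proof -
      have "integrable sigmaS (\<lambda>y. Pker (r *\<^sub>R e) y * \<epsilon>)" "integrable sigmaS (\<lambda>y. Pker (r *\<^sub>R e) y * (norm (e - y))\<^sup>2)"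
        by (intro cont)+
      then show ?thesis
        using single_layer_const(2)[OF assms(2) _ r(2)] r by (simp add: Poisson_second_moment[OF assms(2) r])
    qed
    also have "... = 3 * L * \<epsilon>" using \<epsilon> by (simp add: \<epsilon>(2)[symmetric] power2_eq_square)
    finally show ?thesis unfolding \<epsilon>_def .
  qed
  have "((\<lambda>r. 3 * L * sqrt (1 - r)) \<longlongrightarrow> 3 * L * sqrt (1 - 1)) (at_left 1)"
    by (intro tendsto_intros)
  then have "((\<lambda>r. 3 * L * sqrt (1 - r)) \<longlongrightarrow> 0) (at_left 1)" by simp
  then have "((\<lambda>r. Poisson q (r *\<^sub>R e) - q e) \<longlongrightarrow> 0) (at_left 1)"
    by (rule Lim_null_comparison[rotated])
       (rule eventually_at_leftI[of 0 1], use bound in auto)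
  then show ?thesis by (rule LIM_zero_cancel)
qed

text \<open>The boundary limit of the Poisson integral is \<open>Y e\<close>, which fixes the
  constant left open in \<open>single_layer_radial\<close>.\<close>

lemma single_layer_Harm_radial:
  assumes e: "norm e = 1" and Y: "Y \<in> Harm l"
  shows "0 \<le> r \<Longrightarrow> r < 1 \<Longrightarrow> (\<ointegral>y. inverse (norm (r *\<^sub>R e - y)) * Y y) = 4 * pi / (2 * real l + 1) * r ^ l * Y e"
    and "0 < r \<Longrightarrow> r < 1 \<Longrightarrow> Poisson Y (r *\<^sub>R e) = r ^ l * Y e"
proof -
  obtain C where C: "\<And>r. 0 \<le> r \<Longrightarrow> r < 1 \<Longrightarrow> (\<ointegral>y. inverse (norm (r *\<^sub>R e - y)) * Y y) = C * r ^ l"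
    "\<And>r. 0 < r \<Longrightarrow> r < 1 \<Longrightarrow> Poisson Y (r *\<^sub>R e) = (2 * real l + 1) / (4 * pi) * C * r ^ l"
    using single_layer_radial[OF e Y] by blast
  have "((\<lambda>r. (2 * real l + 1) / (4 * pi) * C * r ^ l) \<longlongrightarrow> (2 * real l + 1) / (4 * pi) * C * 1 ^ l) (at_left 1)"
    by (intro tendsto_intros)
  then have "((\<lambda>r. Poisson Y (r *\<^sub>R e)) \<longlongrightarrow> (2 * real l + 1) / (4 * pi) * C * 1 ^ l) (at_left 1)"
    by (rule Lim_transform_eventually) (auto intro!: eventually_at_leftI[of 0 1] simp: C(2))
  then have "(2 * real l + 1) / (4 * pi) * C = Y e"
    using tendsto_unique[OF _ Poisson_tendsto[OF HarmD(2)[OF Y] e]] by fastforce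
  then have "C = 4 * pi / (2 * real l + 1) * Y e" by (auto simp: field_simps)
  then show "0 \<le> r \<Longrightarrow> r < 1 \<Longrightarrow> (\<ointegral>y. inverse (norm (r *\<^sub>R e - y)) * Y y) = 4 * pi / (2 * real l + 1) * r ^ l * Y e"
    "0 < r \<Longrightarrow> r < 1 \<Longrightarrow> Poisson Y (r *\<^sub>R e) = r ^ l * Y e"
    using C(1)[of r] C(2)[of r] by auto
qed

lemma polar_decomp:
  obtains r e where "norm e = 1" "x = r *\<^sub>R e" "r = norm (x::R3)"
proof (cases "x = 0")
  case True
  then show thesis using that[of "axis 1 1" 0] by simp
next
  case False
  then show thesis using that[of "x /\<^sub>R norm x" "norm x"] by simp
qed

theorem single_layer_Harm:
  assumes "Y \<in> Harm l" "norm x < 1"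
  shows "(\<ointegral>y. inverse (norm (x - y)) * Y y) = 4 * pi / (2 * real l + 1) * Y x"
proof -
  obtain r e where e: "norm e = 1" "x = r *\<^sub>R e" "r = norm x" using polar_decomp by blast
  have r: "0 \<le> r" "r < 1" using e(3) assms(2) by auto
  have "Y x = r ^ l * Y e" by (simp add: e(2) hom_poly3_scale[OF HarmD(1)[OF assms(1)]])
  then show ?thesis using single_layer_Harm_radial(1)[OF e(1) assms(1) r]
    by (simp add: e(2)[symmetric])
qed

theorem Poisson_Harm:
  assumes "Y \<in> Harm l" "norm x < 1"
  shows "Poisson Y x = Y x"
proof -
  obtain r e where e: "norm e = 1" "x = r *\<^sub>R e" "r = norm x" using polar_decomp by blast
  show ?thesis
  proof (cases "x = 0")
    case False
    then have r: "r > 0" "r < 1" using e(3) assms(2) by auto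
    have "Y x = r ^ l * Y e" by (simp add: e(2) hom_poly3_scale[OF HarmD(1)[OF assms(1)]])
    then show ?thesis using single_layer_Harm_radial(2)[OF e(1) assms(1) r] by (simp add: e(2)[symmetric])
  next
    \<comment> \<open>The relation between the two kernels was derived for \<open>r > 0\<close>. At
      the centre the Poisson kernel is the single layer kernel over \<open>4 pi\<close>, and both
      sides vanish unless \<open>l = 0\<close>.\<close>
    case True
    have "Poisson Y 0 = (\<ointegral>y. 1 / (4 * pi) * (inverse (norm (0 - y)) * Y y))"
      unfolding Poisson_def by (rule lint_cong) (auto simp: Pker_def)
    also have "... = 1 / (4 * pi) * (4 * pi / (2 * real l + 1) * Y 0)"
      by (subst integral_mult_right_zero, subst single_layer_Harm[OF assms(1)]) auto
    also have "... = Y 0"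
      using hom_poly3_scale[OF HarmD(1)[OF assms(1)], of 0 0] by (cases l) auto
    finally show ?thesis using True by simp
  qed
qed

lemma Poisson_sum_Harm:
  assumes "\<And>l. Y l \<in> Harm l" "norm x < 1"
  shows "Poisson (\<lambda>y. \<Sum>l<N. Y l y) x = (\<Sum>l<N. Y l x)"
proof -
  have "Poisson (\<lambda>y. \<Sum>l<N. Y l y) x = (\<Sum>l<N. Poisson (Y l) x)"
    unfolding Poisson_def sum_distrib_left
    by (rule lint_sum)
       (intro sphere_integrable continuous_intros continuous_Pker poly3_continuous assms HarmD(2)[OF assms(1)])
  then show ?thesis by (simp add: Poisson_Harm[OF assms(1) assms(2)])
qed

lemma single_layer_sum_Harm:
  assumes "\<And>l. Y l \<in> Harm l" "norm x < 1"
  shows "(\<ointegral>y. inverse (norm (x - y)) * (\<Sum>l<N. Y l y)) = (\<Sum>l<N. 4 * pi / (2 * real l + 1) * Y l x)"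
proof -
  have "(\<ointegral>y. inverse (norm (x - y)) * (\<Sum>l<N. Y l y)) = (\<Sum>l<N. \<ointegral>y. inverse (norm (x - y)) * Y l y)"
    unfolding sum_distrib_left
    by (rule lint_sum)
       (intro sphere_integrable continuous_intros continuous_inverse_norm poly3_continuous assms HarmD(2)[OF assms(1)])
  then show ?thesis by (simp add: single_layer_Harm[OF assms(1) assms(2)])
qed

section \<open>Density of polynomials and the converse of the Hoelder inequality\<close>

text \<open>Inner and outer regularity squeeze the set between a compact and an open one, and
  Urysohn's lemma interpolates between them.\<close>

lemma continuous_approx_indicator:
  fixes e :: real
  assumes A: "A \<in> sets sigmaS" and e: "e > 0"
  shows "\<exists>c::R3 \<Rightarrow> real. continuous_on UNIV c \<and> (\<ointegral>x. \<bar>indicator A x - c x\<bar>) < e"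
proof -
  \<comment> \<open>\<open>sigmaS\<close> lives on the Borel sets of the sphere; regularity is
    applied to its image on the whole space.\<close>
  define N where "N = distr sigmaS borel (\<lambda>x::R3. x)"
  have sb: "sets N = sets borel" by (simp add: N_def)
  have fin: "emeasure N (space N) \<noteq> \<infinity>"
    unfolding N_def by (subst emeasure_distr) (use emeasure_sigmaS in auto)
  have mN: "g \<in> borel_measurable borel \<Longrightarrow> g \<in> borel_measurable N" for g :: "R3 \<Rightarrow> real"
    using measurable_cong_sets[OF sb refl, of borel] by blast
  interpret N: finite_measure N by (rule finite_measureI) (rule fin)
  obtain B where B: "B \<in> sets borel" "A = B \<inter> sphere 0 1"
    using A by (auto simp: sets_sigmaS sets_restrict_space)
  have eN: "integrable N g \<longleftrightarrow> integrable sigmaS g" "(\<integral>x. g x \<partial>N) = (\<ointegral>x. g x)"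
    if "g \<in> borel_measurable borel" for g :: "R3 \<Rightarrow> real"
    unfolding N_def by (auto intro!: integrable_distr_eq integral_distr that)
  define b where "b = measure N B"
  have b: "emeasure N B = ennreal b" by (simp add: b_def N.emeasure_eq_measure)
  have e2: "e/2 > 0" using e by simp
  have "\<exists>K. K \<subseteq> B \<and> compact K \<and> b - e/2 < measure N K"
  proof (cases "b < e/2")
    case True
    then show ?thesis by (intro exI[of _ "{}"]) auto
  next
    case False
    have "ennreal (b - e/2) < emeasure N B"
      unfolding b using e2 False by (intro ennreal_lessI) auto
    then have "\<exists>K\<in>{K. K \<subseteq> B \<and> compact K}. ennreal (b - e/2) < emeasure N K"
      unfolding inner_regular[OF sb fin B(1)] less_SUP_iff .
    then show ?thesis using False by (auto simp: N.emeasure_eq_measure ennreal_less_iff)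
  qed
  then obtain K where K: "K \<subseteq> B" "compact K" "b - e/2 < measure N K" by blast
  have "emeasure N B < ennreal (b + e/2)"
    unfolding b using e2 by (intro ennreal_lessI) (auto simp: b_def intro: add_nonneg_pos)
  then have "\<exists>U\<in>{U. B \<subseteq> U \<and> open U}. emeasure N U < ennreal (b + e/2)"
    unfolding outer_regular[OF sb fin B(1)] INF_less_iff .
  then obtain U where U: "B \<subseteq> U" "open U" "measure N U < b + e/2"
    by (auto simp: N.emeasure_eq_measure ennreal_less_iff)
  have KU: "K \<inter> (- U) = {}" "closed K" "closed (- U)" using K U compact_imp_closed by auto
  obtain c :: "R3 \<Rightarrow> real" where c: "continuous_on UNIV c" "\<And>x. c x \<in> closed_segment 1 0"
     "\<And>x. x \<in> K \<Longrightarrow> c x = 1" "\<And>x. x \<in> - U \<Longrightarrow> c x = 0"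
    using Urysohn[OF KU(2,3,1), of 1 0] by metis
  have c01: "0 \<le> c x" "c x \<le> 1" for x using c(2)[of x] by (auto simp: closed_segment_eq_real_ivl)
  have cm [measurable]: "c \<in> borel_measurable borel" by (rule borel_measurable_continuous_onI[OF c(1)])
  have [measurable]: "K \<in> sets borel" "U \<in> sets borel" "B \<in> sets borel" using KU(2) U(2) B(1) by auto
  have le: "\<bar>indicator B x - c x\<bar> \<le> indicator (U - K) x" for x
    using c01[of x] c(3,4)[of x] K(1) U(1) by (cases "x \<in> K"; cases "x \<in> B"; cases "x \<in> U") (auto simp: indicator_def)
  have "(\<ointegral>x. \<bar>indicator A x - c x\<bar>) = (\<ointegral>x. \<bar>indicator B x - c x\<bar>)"
    by (rule lint_cong) (auto simp: B(2) indicator_def)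
  also have "... = (\<integral>x. \<bar>indicator B x - c x\<bar> \<partial>N)" by (rule eN(2)[symmetric]) measurable
  also have "... \<le> (\<integral>x. indicator (U - K) x \<partial>N)"
  proof (rule integral_mono)
    show "integrable N (\<lambda>x. \<bar>indicator B x - c x\<bar>)"
    proof (rule N.integrable_const_bound[of _ 1])
      have "\<bar>indicator B x - c x\<bar> \<le> 1" for x
        using order_trans[OF le[of x] indicator_le_1] .
      then show "AE x in N. norm \<bar>indicator B x - c x\<bar> \<le> 1" by simp
      show "(\<lambda>x. \<bar>indicator B x - c x\<bar>) \<in> borel_measurable N" by (rule mN) measurable
    qed
    show "integrable N (indicator (U - K) :: R3 \<Rightarrow> real)"
      by (rule N.integrable_const_bound[of _ 1]) (auto intro!: mN split: split_indicator)
  qed (use le in auto)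
  also have "... = measure N (U - K)" by (simp add: N_def)
  also have "... = measure N U - measure N K"
    by (rule N.finite_measure_Diff) (use K U sb in auto)
  also have "... < e" using K(3) U(3) by linarith
  finally show ?thesis using c(1) by blast
qed

lemma continuous_borel_integrable:
  fixes c :: "R3 \<Rightarrow> real"
  shows "continuous_on UNIV c \<Longrightarrow> integrable sigmaS c"
  by (rule sphere_integrable) (rule continuous_on_subset[of UNIV c], auto)

lemma continuous_dense_L1:
  fixes f :: "R3 \<Rightarrow> real"
  assumes "integrable sigmaS f"
  shows "\<forall>e>0. \<exists>c. continuous_on UNIV c \<and> (\<ointegral>x. \<bar>f x - c x\<bar>) < e"
  using assms
proof (induction rule: integrable_induct)
  case (base A a)
  show ?case
  proof (intro allI impI)
    fix e :: real assume "e > 0"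
    then have "e / (\<bar>a\<bar> + 1) > 0" by (intro divide_pos_pos) auto
    then obtain c where c: "continuous_on UNIV c" "(\<ointegral>x. \<bar>indicator A x - c x\<bar>) < e / (\<bar>a\<bar> + 1)"
      using continuous_approx_indicator[OF base(1)] by blast
    have "(\<ointegral>x. \<bar>indicator A x *\<^sub>R a - c x * a\<bar>) = (\<ointegral>x. \<bar>indicator A x - c x\<bar> * \<bar>a\<bar>)"
      by (simp add: abs_mult[symmetric] left_diff_distrib)
    also have "... = (\<ointegral>x. \<bar>indicator A x - c x\<bar>) * \<bar>a\<bar>" by simp
    also have "... \<le> e / (\<bar>a\<bar> + 1) * \<bar>a\<bar>" using c(2) by (intro mult_right_mono) auto
    also have "... < e" using \<open>e > 0\<close> by (simp add: field_simps)
    finally show "\<exists>c. continuous_on UNIV c \<and> (\<ointegral>x. \<bar>indicator A x *\<^sub>R a - c x\<bar>) < e"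
      using c(1) by (intro exI[of _ "\<lambda>x. c x * a"]) (auto intro!: continuous_intros)
  qed
next
  case (add f g)
  show ?case
  proof (intro allI impI)
    fix e :: real assume "e > 0"
    then obtain c d where c: "continuous_on UNIV c" "(\<ointegral>x. \<bar>f x - c x\<bar>) < e/2"
      and d: "continuous_on UNIV d" "(\<ointegral>x. \<bar>g x - d x\<bar>) < e/2"
      using add.IH(1)[rule_format, of "e/2"] add.IH(2)[rule_format, of "e/2"] by auto
    have i: "integrable sigmaS (\<lambda>x. f x - c x)" "integrable sigmaS (\<lambda>x. g x - d x)"
      using add c d continuous_borel_integrable by auto
    have "(\<ointegral>x. \<bar>f x + g x - (c x + d x)\<bar>) \<le> (\<ointegral>x. \<bar>f x - c x\<bar> + \<bar>g x - d x\<bar>)"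
      by (rule integral_mono) (use i add c d continuous_borel_integrable in auto)
    also have "... < e" using i c d by simp
    finally show "\<exists>c. continuous_on UNIV c \<and> (\<ointegral>x. \<bar>f x + g x - c x\<bar>) < e"
      using c d by (intro exI[of _ "\<lambda>x. c x + d x"]) (auto intro!: continuous_intros)
  qed
next
  case (lim f s)
  show ?case
  proof (intro allI impI)
    fix e :: real assume "e > 0"
    have "(\<lambda>i. \<ointegral>x. \<bar>f x - s i x\<bar>) \<longlonglongrightarrow> (\<ointegral>x. 0)"
    proof (rule integral_dominated_convergence[where w="\<lambda>x. 3 * \<bar>f x\<bar>"])
      show "AE x in sigmaS. (\<lambda>i. \<bar>f x - s i x\<bar>) \<longlonglongrightarrow> 0"
      proof (rule AE_I2)
        fix x assume "x \<in> space sigmaS"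
        from lim.hyps(2)[OF this] have "(\<lambda>i. \<bar>f x - s i x\<bar>) \<longlonglongrightarrow> \<bar>f x - f x\<bar>"
          by (intro tendsto_intros)
        then show "(\<lambda>i. \<bar>f x - s i x\<bar>) \<longlonglongrightarrow> 0" by simp
      qed
      show "AE x in sigmaS. norm \<bar>f x - s i x\<bar> \<le> 3 * \<bar>f x\<bar>" for i
        by (rule AE_I2) (use lim.hyps(3)[of _ i] in fastforce)
    qed (use lim.hyps in auto)
    then have "\<exists>i. (\<ointegral>x. \<bar>f x - s i x\<bar>) < e/2"
      using \<open>e > 0\<close> order_tendstoD(2)[of _ 0 sequentially "e/2"] by (auto simp: eventually_sequentially)
    then obtain i where i: "(\<ointegral>x. \<bar>f x - s i x\<bar>) < e/2" by blast
    obtain c where c: "continuous_on UNIV c" "(\<ointegral>x. \<bar>s i x - c x\<bar>) < e/2"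
      using lim.IH[of i] \<open>e > 0\<close> half_gt_zero by blast
    have ii: "integrable sigmaS (\<lambda>x. \<bar>f x - s i x\<bar>)" "integrable sigmaS (\<lambda>x. \<bar>s i x - c x\<bar>)" "integrable sigmaS (\<lambda>x. \<bar>f x - c x\<bar>)"
      using lim.hyps c continuous_borel_integrable by auto
    have "(\<ointegral>x. \<bar>f x - c x\<bar>) \<le> (\<ointegral>x. \<bar>f x - s i x\<bar> + \<bar>s i x - c x\<bar>)"
      by (rule integral_mono) (use ii in auto)
    also have "... < e" using ii i c by simp
    finally show "\<exists>c. continuous_on UNIV c \<and> (\<ointegral>x. \<bar>f x - c x\<bar>) < e" using c(1) by blast
  qed
qed

lemma poly3_real_polynomial_function: "real_polynomial_function q \<Longrightarrow> poly3 q" for q :: "R3 \<Rightarrow> real"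
proof (induction rule: real_polynomial_function.induct)
  case (linear f)
  have l: "linear f" using linear bounded_linear.linear by blast
  have "f x = (\<Sum>i\<in>UNIV. f (axis i 1) * x $ i)" for x
  proof -
    have "f x = f (\<Sum>i\<in>UNIV. x $ i *\<^sub>R axis i 1)"
      by (simp add: basis_expansion scalar_mult_eq_scaleR[symmetric])
    then show ?thesis by (simp add: linear_sum[OF l] linear_cmul[OF l] mult.commute)
  qed
  then have "f = (\<lambda>x. \<Sum>i\<in>UNIV. f (axis i 1) * x $ i)" by (rule ext)
  moreover have "poly3 (\<lambda>x. \<Sum>i\<in>UNIV. f (axis i 1) * x $ i)"
    by (intro poly3_sum poly3_mult poly3_const poly3_coord)
  ultimately show ?case by simp
qed (auto intro: poly3_const poly3_add poly3_mult)

text \<open>The continuous approximation is cut off at \<open>K\<close> before Stone-Weierstrass is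
  applied. The uniform bound on the polynomials later turns \<open>L^1\<close> closeness into
  \<open>L^p\<close> closeness and permits dominated convergence.\<close>

lemma poly3_dense_bounded:
  assumes u: "u \<in> borel_measurable sigmaS" "\<And>x. norm x = 1 \<Longrightarrow> \<bar>u x\<bar> \<le> K" and e: "e > 0"
  obtains q where "poly3 q" "\<And>x. norm x = 1 \<Longrightarrow> \<bar>q x\<bar> \<le> K + 1" "(\<ointegral>x. \<bar>u x - q x\<bar>) < e"
proof -
  have ui: "integrable sigmaS u" by (rule sphere_integrable_bounded) (use u in auto)
  have K: "K \<ge> 0" using u(2)[of "axis 1 1"] by simp
  obtain c where c: "continuous_on UNIV c" "(\<ointegral>x. \<bar>u x - c x\<bar>) < e/2"
    using continuous_dense_L1[OF ui] e half_gt_zero by blast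
  define d where "d x = max (-K) (min K (c x))" for x
  have dc: "continuous_on UNIV d" unfolding d_def by (intro continuous_intros c)
  \<comment> \<open>Over the area \<open>4 pi\<close> a uniform error below
    \<open>e / (16 pi)\<close> costs at most \<open>e / 4\<close>.\<close>
  define \<epsilon> where "\<epsilon> = min 1 (e / (16 * pi))"
  have \<epsilon>: "\<epsilon> > 0" "\<epsilon> \<le> 1" "\<epsilon> \<le> e / (16 * pi)" using e by (auto simp: \<epsilon>_def)
  obtain q where q: "real_polynomial_function q" "\<And>x. x \<in> sphere 0 1 \<Longrightarrow> \<bar>d x - q x\<bar> < \<epsilon>"
    using Stone_Weierstrass_real_polynomial_function[OF compact_sphere continuous_on_subset[OF dc] \<epsilon>(1), of 0 1] by auto
  have qp: "poly3 q" by (rule poly3_real_polynomial_function[OF q(1)])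
  show thesis
  proof (rule that[OF qp])
    show "\<bar>q x\<bar> \<le> K + 1" if "norm x = 1" for x
    proof -
      have "\<bar>d x\<bar> \<le> K" using K by (auto simp: d_def)
      then show ?thesis using q(2)[of x] \<epsilon>(2) that by auto
    qed
    have ii: "integrable sigmaS (\<lambda>x. \<bar>u x - c x\<bar>)" using ui continuous_borel_integrable[OF c(1)] by auto
    have "(\<ointegral>x. \<bar>u x - q x\<bar>) \<le> (\<ointegral>x. \<bar>u x - c x\<bar> + \<epsilon>)"
    proof (rule integral_mono)
      show "\<bar>u x - q x\<bar> \<le> \<bar>u x - c x\<bar> + \<epsilon>" if "x \<in> space sigmaS" for x
        using q(2)[of x] u(2)[of x] that by (auto simp: d_def max_def min_def split: if_splits)
    qed (use ui ii integrable_poly3[OF qp] in auto)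
    also have "... = (\<ointegral>x. \<bar>u x - c x\<bar>) + 4 * pi * \<epsilon>" using ii by simp
    also have "4 * pi * \<epsilon> \<le> 4 * pi * (e / (16 * pi))" using \<epsilon> by (intro mult_left_mono) auto
    also have "... \<le> e/2" using e by simp
    finally show "(\<ointegral>x. \<bar>u x - q x\<bar>) < e" using c(2) by linarith
  qed
qed

lemma poly3_AE_approx:
  assumes u: "u \<in> borel_measurable sigmaS" "\<And>x. norm x = 1 \<Longrightarrow> \<bar>u x\<bar> \<le> K"
  obtains q where "\<And>n::nat. poly3 (q n)" "\<And>n x. norm x = 1 \<Longrightarrow> \<bar>q n x\<bar> \<le> K + 1"
    "AE x in sigmaS. (\<lambda>n. q n x) \<longlonglongrightarrow> u x"
proof -
  have "\<exists>q. poly3 q \<and> (\<forall>x. norm x = 1 \<longrightarrow> \<bar>q x\<bar> \<le> K + 1) \<and> (\<ointegral>x. \<bar>u x - q x\<bar>) < inverse (real (Suc n))" for n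
    using poly3_dense_bounded[OF u, of "inverse (real (Suc n))"] by (metis inverse_positive_iff_positive of_nat_0_less_iff zero_less_Suc)
  then obtain q where q: "\<And>n. poly3 (q n)" "\<And>n x. norm x = 1 \<Longrightarrow> \<bar>q n x\<bar> \<le> K + 1"
    "\<And>n. (\<ointegral>x. \<bar>u x - q n x\<bar>) < inverse (real (Suc n))" by metis
  have ui: "integrable sigmaS u" by (rule sphere_integrable_bounded) (use u in auto)
  have "(\<lambda>n. \<ointegral>x. norm (q n x - u x)) \<longlonglongrightarrow> 0"
  proof (rule tendsto_sandwich[OF _ _ tendsto_const LIMSEQ_inverse_real_of_nat])
    show "\<forall>\<^sub>F n in sequentially. 0 \<le> (\<ointegral>x. norm (q n x - u x))" by (auto intro!: always_eventually integral_nonneg_AE)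
    show "\<forall>\<^sub>F n in sequentially. (\<ointegral>x. norm (q n x - u x)) \<le> inverse (real (Suc n))"
      using q(3) by (auto intro!: always_eventually less_imp_le simp: abs_minus_commute)
  qed
  then obtain r where r: "strict_mono r" "AE x in sigmaS. (\<lambda>n. q (r n) x - u x) \<longlonglongrightarrow> 0"
    using tendsto_L1_AE_subseq[of sigmaS "\<lambda>n x. q n x - u x"] ui integrable_poly3[OF q(1)] by auto
  have "AE x in sigmaS. (\<lambda>n. q (r n) x) \<longlonglongrightarrow> u x"
    using r(2) by (rule AE_mp) (auto intro!: AE_I2 LIM_zero_cancel)
  then show thesis using that[of "\<lambda>n. q (r n)"] q by blast
qed

lemma Lp_imp_integrable:
  fixes f :: "R3 \<Rightarrow> 'a::euclidean_space"
  assumes "p \<ge> 1" "f \<in> borel_measurable sigmaS" "integrable sigmaS (\<lambda>x. norm (f x) powr p)"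
  shows "integrable sigmaS f"
proof (rule lint_bound)
  show "integrable sigmaS (\<lambda>x. 1 + norm (f x) powr p)" using assms by auto
  show "AE x in sigmaS. norm (f x) \<le> norm (1 + norm (f x) powr p)"
    using le_eps_plus_powr[of "norm (f _)" 1 p] assms(1) by (auto intro!: AE_I2)
qed (use assms in auto)

text \<open>After truncation the difference \<open>d\<close> between function and polynomial is
  bounded by some \<open>K\<close>, and then
  \<open>\<bar>d\<bar> powr p \<le> K powr (p - 1) * \<bar>d\<bar>\<close>; so density in
  \<open>L^1\<close> suffices.\<close>

theorem poly3_dense_Lp:
  assumes p: "p > 1" and f: "f \<in> borel_measurable sigmaS" "integrable sigmaS (\<lambda>x. \<bar>f x\<bar> powr p)" and e: "e > 0"
  obtains q where "poly3 q" "(\<ointegral>x. \<bar>f x - q x\<bar> powr p) < e"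
proof -
  define u where "u n x = max (- real n) (min (real n) (f x))" for n x
  have um [measurable]: "u n \<in> borel_measurable sigmaS" for n unfolding u_def using f(1) by measurable
  \<comment> \<open>Two errors of size \<open>\<delta>\<close> and the triangle factor
    \<open>2 powr (p - 1)\<close> add up to \<open>e\<close>.\<close>
  define \<delta> where "\<delta> = e / 2 powr p"
  have \<delta>: "\<delta> > 0" using e by (simp add: \<delta>_def)
  have "(\<lambda>n. \<ointegral>x. \<bar>f x - u n x\<bar> powr p) \<longlonglongrightarrow> (\<ointegral>x. 0)"
  proof (rule integral_dominated_convergence[where w="\<lambda>x. \<bar>f x\<bar> powr p"])
    show "AE x in sigmaS. (\<lambda>n. \<bar>f x - u n x\<bar> powr p) \<longlonglongrightarrow> 0"
    proof (rule AE_I2)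
      fix x
      obtain N where N: "\<bar>f x\<bar> \<le> real N" using real_arch_simple by blast
      have "f x - u n x = 0" if "n \<ge> N" for n
        using N that unfolding u_def by (auto simp: max_def min_def) 
      then have "\<forall>\<^sub>F n in sequentially. \<bar>f x - u n x\<bar> powr p = 0"
        by (intro eventually_sequentiallyI[of N]) simp
      then show "(\<lambda>n. \<bar>f x - u n x\<bar> powr p) \<longlonglongrightarrow> 0" by (rule tendsto_eventually)
    qed
    show "AE x in sigmaS. norm (\<bar>f x - u n x\<bar> powr p) \<le> \<bar>f x\<bar> powr p" for n
      by (rule AE_I2) (use p in \<open>auto simp: u_def max_def min_def intro!: powr_mono2\<close>)
  qed (use f in auto)
  then have "\<exists>n. (\<ointegral>x. \<bar>f x - u n x\<bar> powr p) < \<delta>"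
    using \<delta> order_tendstoD(2)[of _ 0 sequentially \<delta>] by (auto simp: eventually_sequentially)
  then obtain n where n: "(\<ointegral>x. \<bar>f x - u n x\<bar> powr p) < \<delta>" by blast
  define K where "K = 2 * real n + 1"
  have K: "K > 0" by (simp add: K_def)
  obtain q where q: "poly3 q" "\<And>x. norm x = 1 \<Longrightarrow> \<bar>q x\<bar> \<le> real n + 1" "(\<ointegral>x. \<bar>u n x - q x\<bar>) < \<delta> / K powr (p - 1)"
    by (rule poly3_dense_bounded[OF um, of n "real n" "\<delta> / K powr (p - 1)"]) (use \<delta> K in \<open>auto simp: u_def\<close>)
  have ub: "\<bar>u n x\<bar> \<le> real n" for x by (auto simp: u_def)
  have kb: "\<bar>u n x - q x\<bar> \<le> K" if "norm x = 1" for x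
    using ub[of x] q(2)[OF that] by (simp add: K_def)
  have uq: "\<bar>u n x - q x\<bar> powr p \<le> K powr (p-1) * \<bar>u n x - q x\<bar>" if "norm x = 1" for x
  proof -
    have "\<bar>u n x - q x\<bar> powr (p-1) * \<bar>u n x - q x\<bar> \<le> K powr (p-1) * \<bar>u n x - q x\<bar>"
      using p kb[OF that] by (intro mult_right_mono powr_mono2) auto
    moreover have "\<bar>u n x - q x\<bar> powr (p-1) * \<bar>u n x - q x\<bar> = \<bar>u n x - q x\<bar> powr p"
      using powr_add[of "\<bar>u n x - q x\<bar>" "p-1" 1] by (cases "u n x = q x") auto
    ultimately show ?thesis by simp
  qed
  have qm [measurable]: "q \<in> borel_measurable sigmaS" using integrable_poly3[OF q(1)] by auto
  have i1: "integrable sigmaS (\<lambda>x. \<bar>u n x - q x\<bar>)"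
    by (rule sphere_integrable_bounded[of _ K]) (measurable, use kb in auto)
  have i2: "integrable sigmaS (\<lambda>x. \<bar>u n x - q x\<bar> powr p)"
    by (rule lint_bound[OF integrable_mult_right[OF i1, of "K powr (p-1)"]])
      (use uq in \<open>auto intro!: AE_I2 simp: abs_mult\<close>)
  have un: "integrable sigmaS (\<lambda>x. \<bar>u n x\<bar> powr p)"
    by (rule sphere_integrable_bounded[of _ "real n powr p"]) (use ub p in \<open>auto intro!: powr_mono2\<close>)
  have i3: "integrable sigmaS (\<lambda>x. \<bar>f x - u n x\<bar> powr p)"
    using integrable_norm_powr_diff[of p f sigmaS "u n"] p f un by auto
  have i4: "integrable sigmaS (\<lambda>x. \<bar>f x - q x\<bar> powr p)"
  proof -
    have "integrable sigmaS (\<lambda>x. \<bar>q x\<bar> powr p)"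
      by (rule sphere_integrable_bounded[of _ "(real n + 1) powr p"]) (use q(2) p in \<open>auto intro!: powr_mono2\<close>)
    then show ?thesis using integrable_norm_powr_diff[of p f sigmaS q] p f by auto
  qed
  have "(\<ointegral>x. \<bar>f x - q x\<bar> powr p) \<le> (\<ointegral>x. 2 powr (p-1) * (\<bar>f x - u n x\<bar> powr p + \<bar>u n x - q x\<bar> powr p))"
  proof (rule integral_mono)
    show "\<bar>f x - q x\<bar> powr p \<le> 2 powr (p-1) * (\<bar>f x - u n x\<bar> powr p + \<bar>u n x - q x\<bar> powr p)" for x
      using norm_add_powr_le[of p "f x - u n x" "u n x - q x"] p by simp
  qed (use i2 i3 i4 in auto)
  also have "... = 2 powr (p-1) * ((\<ointegral>x. \<bar>f x - u n x\<bar> powr p) + (\<ointegral>x. \<bar>u n x - q x\<bar> powr p))"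
    using i2 i3 by simp
  also have "... < 2 powr (p-1) * (\<delta> + \<delta>)"
  proof -
    have "(\<ointegral>x. \<bar>u n x - q x\<bar> powr p) \<le> (\<ointegral>x. K powr (p-1) * \<bar>u n x - q x\<bar>)"
      by (rule integral_mono) (use i1 i2 uq in auto)
    also have "... \<le> K powr (p-1) * (\<delta> / K powr (p - 1))"
      using q(3) by (simp only: integral_mult_right_zero) (intro mult_left_mono; auto)
    also have "... = \<delta>" using K by simp
    finally show ?thesis using n by (intro mult_strict_left_mono add_less_le_mono) auto
  qed
  also have "... = e" by (simp add: \<delta>_def powr_diff)
  finally show thesis using that q(1) by blast
qed

text \<open>The bound is additive instead of multiplicative; replacing \<open>\<phi>\<close> by a multiple recovers the usual form.\<close>
theorem converse_Holder:
  fixes p q C :: real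
  assumes pq: "p > 1" "q > 1" "1/p + 1/q = 1" and C: "C > 0"
  shows "\<exists>K>0. \<forall>G A. integrable sigmaS G \<longrightarrow> A \<ge> 0 \<longrightarrow>
     (\<forall>\<phi>. poly3 \<phi> \<longrightarrow> \<bar>\<ointegral>x. G x * \<phi> x\<bar> \<le> C * (A + (\<ointegral>x. \<bar>\<phi> x\<bar> powr q))) \<longrightarrow>
     integrable sigmaS (\<lambda>x. \<bar>G x\<bar> powr p) \<and> (\<ointegral>x. \<bar>G x\<bar> powr p) \<le> K * A"
proof -
  \<comment> \<open>The scale at which \<open>C * t powr q = t / 2\<close>, so that the integral on
    the right can be absorbed on the left.\<close>
  define t where "t = (1 / (2 * C)) powr (p - 1)"
  have l: "t > 0" using C by (simp add: t_def)
  have qp: "(p - 1) * q = p" using pq by (simp add: field_simps)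
  have lq: "C * t powr q = t / 2"
  proof -
    have "t powr q = t * t powr (q - 1)" using l powr_add[of t 1 "q-1"] by simp
    also have "t powr (q - 1) = (1 / (2*C)) powr ((p - 1) * (q - 1))" by (simp add: t_def powr_powr)
    also have "(p - 1) * (q - 1) = 1" using qp pq by (simp add: algebra_simps)
    finally show ?thesis using C by simp
  qed
  show ?thesis
  proof (intro exI[of _ "2 * C / t"] conjI allI impI)
    show "2 * C / t > 0" using C l by simp
    fix G :: "R3 \<Rightarrow> real" and A :: real
    assume G: "integrable sigmaS G" and A: "A \<ge> 0"
      and test: "\<forall>\<phi>. poly3 \<phi> \<longrightarrow> \<bar>\<ointegral>x. G x * \<phi> x\<bar> \<le> C * (A + (\<ointegral>x. \<bar>\<phi> x\<bar> powr q))"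
    have Gm [measurable]: "G \<in> borel_measurable sigmaS" using G by auto
    \<comment> \<open>The hypothesis extends from polynomials to bounded measurable functions by
      dominated convergence.\<close>
    have bnd: "\<bar>\<ointegral>x. G x * u x\<bar> \<le> C * (A + (\<ointegral>x. \<bar>u x\<bar> powr q))"
      if u: "u \<in> borel_measurable sigmaS" "\<And>x. norm x = 1 \<Longrightarrow> \<bar>u x\<bar> \<le> K" for u K
    proof -
      obtain r where r: "\<And>n::nat. poly3 (r n)" "\<And>n x. norm x = 1 \<Longrightarrow> \<bar>r n x\<bar> \<le> K + 1"
        "AE x in sigmaS. (\<lambda>n. r n x) \<longlonglongrightarrow> u x" using poly3_AE_approx[OF u] by blast
      have [measurable]: "r n \<in> borel_measurable sigmaS" for n using integrable_poly3[OF r(1)] by auto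
      note u(1) [measurable]
      have L1: "(\<lambda>n. \<ointegral>x. G x * r n x) \<longlonglongrightarrow> (\<ointegral>x. G x * u x)"
      proof (rule integral_dominated_convergence[where w="\<lambda>x. \<bar>G x\<bar> * (K + 1)"])
        show "AE x in sigmaS. (\<lambda>n. G x * r n x) \<longlonglongrightarrow> G x * u x"
          using r(3) by eventually_elim (intro tendsto_intros)
        show "AE x in sigmaS. norm (G x * r n x) \<le> \<bar>G x\<bar> * (K + 1)" for n
          using r(2) by (auto intro!: AE_I2 mult_left_mono simp: abs_mult)
      qed (use G in auto)
      have L2: "(\<lambda>n. \<ointegral>x. \<bar>r n x\<bar> powr q) \<longlonglongrightarrow> (\<ointegral>x. \<bar>u x\<bar> powr q)"
      proof (rule integral_dominated_convergence[where w="\<lambda>x. (K + 1) powr q"])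
        show "AE x in sigmaS. (\<lambda>n. \<bar>r n x\<bar> powr q) \<longlonglongrightarrow> \<bar>u x\<bar> powr q"
          using r(3) by eventually_elim (rule tendsto_powr'[OF tendsto_rabs tendsto_const], assumption, use pq in auto)
        show "AE x in sigmaS. norm (\<bar>r n x\<bar> powr q) \<le> (K + 1) powr q" for n
          using r(2) pq by (auto intro!: AE_I2 powr_mono2)
      qed auto
      show ?thesis
        by (rule LIMSEQ_le[OF tendsto_rabs[OF L1] tendsto_mult[OF tendsto_const tendsto_add[OF tendsto_const L2]]])
          (use test r(1) in auto)
    qed
    define m where "m n x = min \<bar>G x\<bar> (real n)" for n x
    have mm [measurable]: "m n \<in> borel_measurable sigmaS" for n unfolding m_def by measurable
    have m0: "0 \<le> m n x" "m n x \<le> real n" "m n x \<le> \<bar>G x\<bar>" for n x by (auto simp: m_def)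
    have mi: "integrable sigmaS (\<lambda>x. m n x powr p)" for n
      by (rule sphere_integrable_bounded[of _ "real n powr p"]) (use m0 pq in \<open>auto intro!: powr_mono2\<close>)
    have key: "(\<ointegral>x. m n x powr p) \<le> 2 * C / t * A" for n
    proof -
      \<comment> \<open>The extremal function of Hoelder's inequality for the truncation
        \<open>m n\<close> of \<open>\<bar>G\<bar>\<close>, scaled by \<open>t\<close>. The
        truncation makes the integral that is to be absorbed finite.\<close>
      define u where "u x = t * (sgn (G x) * m n x powr (p - 1))" for x
      have um [measurable]: "u \<in> borel_measurable sigmaS" unfolding u_def by measurable
      define B where "B = t * real n powr (p - 1)"
      have ub: "\<bar>u x\<bar> \<le> t * real n powr (p - 1)" for x
        unfolding u_def using l m0[of n x] pq
        by (auto simp: abs_mult abs_sgn_eq intro!: powr_mono2)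
      have "t * (\<ointegral>x. m n x powr p) = (\<ointegral>x. t * m n x powr p)" by simp
      also have "... \<le> (\<ointegral>x. G x * u x)"
      proof (rule integral_mono)
        show "integrable sigmaS (\<lambda>x. G x * u x)"
          by (rule lint_bound[OF integrable_mult_left[OF integrable_abs[OF G], of B]])
            (auto simp: abs_mult intro!: AE_I2 mult_left_mono order_trans[OF ub[folded B_def] abs_ge_self])
        fix x
        have "m n x powr p = m n x * m n x powr (p - 1)"
          using m0(1)[of n x] powr_add[of "m n x" 1 "p-1"] by (cases "m n x = 0") auto
        also have "... \<le> \<bar>G x\<bar> * m n x powr (p - 1)" using m0[of n x] by (intro mult_right_mono) auto
        also have "... = G x * (sgn (G x) * m n x powr (p - 1))" by (simp add: abs_sgn)
        finally show "t * m n x powr p \<le> G x * u x" using l by (simp add: u_def)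
      qed (use mi in auto)
      also have "... \<le> C * (A + (\<ointegral>x. \<bar>u x\<bar> powr q))"
        using bnd[OF um ub] by linarith
      also have "(\<ointegral>x. \<bar>u x\<bar> powr q) \<le> (\<ointegral>x. t powr q * m n x powr p)"
      proof (rule integral_mono)
        show "integrable sigmaS (\<lambda>x. \<bar>u x\<bar> powr q)"
          by (rule sphere_integrable_bounded[of _ "B powr q"]) (use ub[folded B_def] pq in \<open>auto intro!: powr_mono2\<close>)
        fix x
        have "\<bar>u x\<bar> \<le> t * m n x powr (p - 1)"
          unfolding u_def using l by (auto simp: abs_mult abs_sgn_eq)
        then have "\<bar>u x\<bar> powr q \<le> (t * m n x powr (p - 1)) powr q" using pq by (intro powr_mono2) auto
        also have "... = t powr q * m n x powr p"
          using l by (simp add: powr_mult powr_powr qp)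
        finally show "\<bar>u x\<bar> powr q \<le> t powr q * m n x powr p" .
      qed (use mi in auto)
      finally have "t * (\<ointegral>x. m n x powr p) \<le> C * A + C * t powr q * (\<ointegral>x. m n x powr p)"
        using C by (simp add: distrib_left)
      then have "t / 2 * (\<ointegral>x. m n x powr p) \<le> C * A" unfolding lq by (simp add: field_simps)
      then show ?thesis using l by (simp add: field_simps)
    qed
    have "(\<integral>\<^sup>+x. ennreal (\<bar>G x\<bar> powr p) \<partial>sigmaS) = (\<integral>\<^sup>+x. liminf (\<lambda>n. ennreal (m n x powr p)) \<partial>sigmaS)"
    proof (rule nn_integral_cong)
      fix x
      obtain N where N: "\<bar>G x\<bar> \<le> real N" using real_arch_simple by blast
      have "\<forall>\<^sub>F n in sequentially. ennreal (m n x powr p) = ennreal (\<bar>G x\<bar> powr p)"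
        by (rule eventually_sequentiallyI[of N]) (use N in \<open>auto simp: m_def min_def\<close>)
      then have "(\<lambda>n. ennreal (m n x powr p)) \<longlonglongrightarrow> ennreal (\<bar>G x\<bar> powr p)" by (rule tendsto_eventually)
      then show "ennreal (\<bar>G x\<bar> powr p) = liminf (\<lambda>n. ennreal (m n x powr p))"
        using lim_imp_Liminf[OF trivial_limit_sequentially] by metis
    qed
    also have "... \<le> liminf (\<lambda>n. \<integral>\<^sup>+x. ennreal (m n x powr p) \<partial>sigmaS)" by (rule nn_integral_liminf) measurable
    also have "... \<le> liminf (\<lambda>n::nat. ennreal (2 * C / t * A))"
    proof (rule Liminf_mono, rule always_eventually, rule allI)
      fix n
      have "(\<integral>\<^sup>+x. ennreal (m n x powr p) \<partial>sigmaS) = ennreal (\<ointegral>x. m n x powr p)"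
        by (rule nn_integral_eq_integral[OF mi]) auto
      then show "(\<integral>\<^sup>+x. ennreal (m n x powr p) \<partial>sigmaS) \<le> ennreal (2 * C / t * A)" using key[of n] by (simp add: ennreal_leI)
    qed
    finally have fin: "(\<integral>\<^sup>+x. ennreal (\<bar>G x\<bar> powr p) \<partial>sigmaS) \<le> ennreal (2 * C / t * A)" by (simp add: Liminf_const)
    show "integrable sigmaS (\<lambda>x. \<bar>G x\<bar> powr p)"
      by (rule integrableI_bounded) (use le_less_trans[OF fin] in auto)
    then have "ennreal (\<ointegral>x. \<bar>G x\<bar> powr p) \<le> ennreal (2 * C / t * A)"
      using fin nn_integral_eq_integral[of sigmaS "\<lambda>x. \<bar>G x\<bar> powr p"] by simp
    then show "(\<ointegral>x. \<bar>G x\<bar> powr p) \<le> 2 * C / t * A"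
      using C l A by (subst (asm) ennreal_le_iff) auto
  qed
qed

section \<open>Multipliers\<close>

abbreviation hsum :: "nat \<Rightarrow> (nat \<Rightarrow> R3 \<Rightarrow> 'b::comm_monoid_add) \<Rightarrow> R3 \<Rightarrow> 'b" where
  "hsum N Y \<equiv> \<lambda>x. \<Sum>l<N. Y l x"

text \<open>The eigenvalue of the single layer operator on the spherical harmonics of degree \<open>l\<close>.\<close>
abbreviation slm :: "nat \<Rightarrow> real" where
  "slm l \<equiv> 1 / (2 * real l + 1)"

text \<open>The p-th power of the norm rather than the norm: roots are avoided at the price of the
  factor \<open>2 powr (p - 1)\<close> in the triangle inequality.\<close>

definition Lpow :: "real \<Rightarrow> (R3 \<Rightarrow> 'b::euclidean_space) \<Rightarrow> real" where
  "Lpow p f = (\<ointegral>x. norm (f x) powr p)"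

definition inLp :: "real \<Rightarrow> (R3 \<Rightarrow> 'b::euclidean_space) \<Rightarrow> bool" where
  "inLp p f \<longleftrightarrow> f \<in> borel_measurable sigmaS \<and> integrable sigmaS (\<lambda>x. norm (f x) powr p)"

lemma Lpow_nonneg [simp]: "Lpow p f \<ge> 0"
  unfolding Lpow_def by (intro integral_nonneg_AE) auto

lemma Lpow_cong: "(\<And>x. norm x = 1 \<Longrightarrow> f x = g x) \<Longrightarrow> Lpow p f = Lpow p g"
  unfolding Lpow_def by (rule lint_cong) auto

lemma inLp_cong: "(\<And>x. norm x = 1 \<Longrightarrow> f x = g x) \<Longrightarrow> inLp p f = inLp p g"
  unfolding inLp_def
  by (intro conj_cong measurable_cong Bochner_Integration.integrable_cong refl) auto

lemma continuous_inLp: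
  assumes "continuous_on (sphere 0 1) f" "p \<ge> 0"
  shows "inLp p f"
proof -
  obtain B where B: "\<And>x. norm x = 1 \<Longrightarrow> norm (f x) \<le> B" using continuous_sphere_bound[OF assms(1)] by blast
  have [measurable]: "f \<in> borel_measurable sigmaS" by (rule sphere_measurable[OF assms(1)])
  have "integrable sigmaS (\<lambda>x. norm (f x) powr p)"
    by (rule sphere_integrable_bounded[of _ "B powr p"]) (measurable, use B assms(2) in \<open>auto intro!: powr_mono2\<close>)
  then show ?thesis by (simp add: inLp_def)
qed

lemma inLp_add: "p \<ge> 1 \<Longrightarrow> inLp p f \<Longrightarrow> inLp p g \<Longrightarrow> inLp p (\<lambda>x. f x + g x)"
  unfolding inLp_def using integrable_norm_powr_diff[of p f sigmaS "\<lambda>x. - g x"] by auto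

lemma inLp_scaleR: "inLp p f \<Longrightarrow> inLp p (\<lambda>x. c *\<^sub>R f x)"
  unfolding inLp_def by (auto simp: powr_mult)

lemma inLp_diff: "p \<ge> 1 \<Longrightarrow> inLp p f \<Longrightarrow> inLp p g \<Longrightarrow> inLp p (\<lambda>x. f x - g x)"
  unfolding inLp_def using integrable_norm_powr_diff[of p f sigmaS g] by auto

lemma inLp_integrable: "p \<ge> 1 \<Longrightarrow> inLp p f \<Longrightarrow> integrable sigmaS f"
  unfolding inLp_def using Lp_imp_integrable by blast

lemma Lpow_scaleR: "Lpow p (\<lambda>x. c *\<^sub>R f x) = \<bar>c\<bar> powr p * Lpow p f"
  unfolding Lpow_def by (simp add: powr_mult)

lemma Lpow_mono:
  assumes "p \<ge> 0" "inLp p f" "inLp p g" "\<And>x. norm x = 1 \<Longrightarrow> norm (f x) \<le> norm (g x)"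
  shows "Lpow p f \<le> Lpow p g"
  unfolding Lpow_def by (rule integral_mono) (use assms in \<open>auto simp: inLp_def intro!: powr_mono2\<close>)

lemma Lpow_add_le:
  assumes "p \<ge> 1" "inLp p f" "inLp p g"
  shows "Lpow p (\<lambda>x. f x + g x) \<le> 2 powr (p - 1) * (Lpow p f + Lpow p g)"
proof -
  have "Lpow p (\<lambda>x. f x + g x) \<le> (\<ointegral>x. 2 powr (p - 1) * (norm (f x) powr p + norm (g x) powr p))"
    unfolding Lpow_def
    by (rule integral_mono) (use assms inLp_add[OF assms] norm_add_powr_le[OF assms(1)] in \<open>auto simp: inLp_def\<close>)
  also have "... = 2 powr (p - 1) * (Lpow p f + Lpow p g)"
    unfolding Lpow_def using assms by (simp add: inLp_def)
  finally show ?thesis .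
qed

lemma Lpow_uminus: "Lpow p (\<lambda>x. - f x) = Lpow p f"
  by (simp add: Lpow_def)

lemma Lpow_diff_commute: "Lpow p (\<lambda>x. f x - g x) = Lpow p (\<lambda>x. g x - f x)"
  by (simp add: Lpow_def norm_minus_commute)

lemma Lpow_diff_le:
  assumes "p \<ge> 1" "inLp p f" "inLp p g"
  shows "Lpow p (\<lambda>x. f x - g x) \<le> 2 powr (p - 1) * (Lpow p f + Lpow p g)"
  using Lpow_add_le[of p f "\<lambda>x. - g x"] assms by (simp add: Lpow_uminus inLp_def)

section \<open>Integral operators with symmetric kernels\<close>

lemma measurable_pair_sigmaS:
  assumes "f \<in> borel_measurable (borel :: (R3 \<times> R3) measure)"
  shows "f \<in> borel_measurable (sigmaS \<Otimes>\<^sub>M sigmaS)"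
proof -
  have "(\<lambda>z. (fst z, snd z)) \<in> measurable (sigmaS \<Otimes>\<^sub>M sigmaS) (borel \<Otimes>\<^sub>M borel)"
    by (rule measurable_Pair)
      (rule measurable_compose[OF measurable_fst measurable_sigmaS_borel] measurable_compose[OF measurable_snd measurable_sigmaS_borel])+
  then show ?thesis using measurable_compose[OF _ assms] by (simp add: borel_prod)
qed

global_interpretation sigma2: pair_sigma_finite sigmaS sigmaS ..

lemma integrable_pair_sigmaS_bounded:
  fixes f :: "R3 \<times> R3 \<Rightarrow> real"
  assumes "f \<in> borel_measurable (sigmaS \<Otimes>\<^sub>M sigmaS)" "\<And>x y. norm x = 1 \<Longrightarrow> norm y = 1 \<Longrightarrow> \<bar>f (x, y)\<bar> \<le> B"
  shows "integrable (sigmaS \<Otimes>\<^sub>M sigmaS) f"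
proof -
  interpret F: finite_measure "sigmaS \<Otimes>\<^sub>M sigmaS"
    by (rule finite_measure_pair_measure) unfold_locales
  show ?thesis
    by (rule F.integrable_const_bound[of _ B]) (use assms in \<open>auto intro!: AE_I2 simp: space_pair_measure\<close>)
qed

text \<open>Schur's test: Jensen's inequality in \<open>y\<close>, then Fubini, where symmetry turns
  the column integrals into the row integrals \<open>\<kappa>\<close>.\<close>

lemma symmetric_kernel_Lpow_le:
  fixes k :: "R3 \<Rightarrow> R3 \<Rightarrow> real"
  assumes p: "p > 1"
    and km: "(\<lambda>z. k (fst z) (snd z)) \<in> borel_measurable borel"
    and kb: "\<And>x y. norm x = 1 \<Longrightarrow> norm y = 1 \<Longrightarrow> 0 \<le> k x y \<and> k x y \<le> B"
    and ksym: "\<And>x y. norm x = 1 \<Longrightarrow> norm y = 1 \<Longrightarrow> k x y = k y x"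
    and kint: "\<And>x. norm x = 1 \<Longrightarrow> (\<ointegral>y. k x y) = \<kappa>"
    and f: "f \<in> borel_measurable borel" "\<And>x. norm x = 1 \<Longrightarrow> \<bar>f x\<bar> \<le> A"
  shows "Lpow p (\<lambda>x. \<ointegral>y. k x y * f y) \<le> \<kappa> powr p * Lpow p f"
proof -
  have A: "A \<ge> 0" using f(2)[of "axis 1 1"] by simp
  have B: "B \<ge> 0" using kb[of "axis 1 1" "axis 1 1"] by simp
  have \<kappa>0: "\<kappa> \<ge> 0"
  proof -
    have e: "norm (axis 1 1 :: R3) = 1" by simp
    have "0 \<le> (\<ointegral>y. k (axis 1 1) y)"
      by (rule integral_nonneg_AE, rule AE_I2) (use kb[OF e] in simp)
    then show ?thesis unfolding kint[OF e] .
  qed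
  note km' = measurable_pair_sigmaS[OF km]
  have k1 [measurable]: "k x \<in> borel_measurable borel" for x
  proof -
    have "(\<lambda>y. (x, y)) \<in> borel_measurable borel" by (intro borel_measurable_continuous_onI continuous_intros)
    from measurable_compose[OF this km] show ?thesis by simp
  qed
  note ks = borel_measurable_sigmaS_I[OF k1] and fs = borel_measurable_sigmaS_I[OF f(1)]
  have [measurable]: "k x \<in> borel_measurable sigmaS" "f \<in> borel_measurable sigmaS" for x by (rule ks fs)+
  have fp: "\<bar>f y\<bar> powr p \<le> A powr p" if "norm y = 1" for y using f(2)[OF that] p by (intro powr_mono2) auto
  have i1: "integrable sigmaS (k x)" "integrable sigmaS (\<lambda>y. k x y * \<bar>f y\<bar>)" "integrable sigmaS (\<lambda>y. k x y * \<bar>f y\<bar> powr p)"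
    if x: "norm x = 1" for x
  proof -
    show "integrable sigmaS (k x)"
      by (rule sphere_integrable_bounded[of _ B]) (use kb[OF x] in auto)
    show "integrable sigmaS (\<lambda>y. k x y * \<bar>f y\<bar>)"
      by (rule sphere_integrable_bounded[of _ "B * A"]) (use kb[OF x] f(2) B in \<open>auto simp: abs_mult intro!: mult_mono\<close>)
    show "integrable sigmaS (\<lambda>y. k x y * \<bar>f y\<bar> powr p)"
      by (rule sphere_integrable_bounded[of _ "B * A powr p"]) (use kb[OF x] fp B in \<open>auto simp: abs_mult intro!: mult_mono\<close>)
  qed
  have f2: "(\<lambda>z. \<bar>f (snd z)\<bar> powr p) \<in> borel_measurable (sigmaS \<Otimes>\<^sub>M sigmaS)"
    using measurable_compose[OF measurable_snd fs] by measurable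
  have i2: "integrable (sigmaS \<Otimes>\<^sub>M sigmaS) (\<lambda>(x, y). k x y * \<bar>f y\<bar> powr p)"
    by (rule integrable_pair_sigmaS_bounded[of _ "B * A powr p"])
      (use km' f2 kb fp B in \<open>auto simp: case_prod_unfold abs_mult intro!: mult_mono\<close>)
  have km2: "(\<lambda>(x, y). k x y * f y) \<in> borel_measurable (sigmaS \<Otimes>\<^sub>M sigmaS)"
    unfolding case_prod_unfold using km' measurable_compose[OF measurable_snd fs] by measurable
  have m2: "(\<lambda>x. \<ointegral>y. k x y * f y) \<in> borel_measurable sigmaS"
    using sigma.borel_measurable_lebesgue_integral[OF km2] by simp
  have i3: "integrable sigmaS (\<lambda>x. \<ointegral>y. k x y * \<bar>f y\<bar> powr p)"
    using sigma2.integrable_fst'[OF i2] by simp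
  have pt: "norm (\<ointegral>y. k x y * f y) powr p \<le> \<kappa> powr (p - 1) * (\<ointegral>y. k x y * \<bar>f y\<bar> powr p)"
    if x: "norm x = 1" for x
    using kernel_Jensen[OF p i1(1)[OF x] _ i1(2,3)[OF x]] kb[OF x] by (simp add: kint[OF x])
  have "Lpow p (\<lambda>x. \<ointegral>y. k x y * f y) \<le> (\<ointegral>x. \<kappa> powr (p - 1) * (\<ointegral>y. k x y * \<bar>f y\<bar> powr p))"
    unfolding Lpow_def
  proof (rule integral_mono)
    show "integrable sigmaS (\<lambda>x. norm (\<ointegral>y. k x y * f y) powr p)"
    proof (rule lint_bound[OF integrable_mult_right[OF i3, of "\<kappa> powr (p - 1)"]])
      show "AE x in sigmaS. norm (norm (\<ointegral>y. k x y * f y) powr p)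
          \<le> norm (\<kappa> powr (p - 1) * (\<ointegral>y. k x y * \<bar>f y\<bar> powr p))"
        by (rule AE_I2) (use order_trans[OF pt abs_ge_self] in simp)
    qed (use m2 in measurable)
  qed (use i3 pt in auto)
  also have "... = \<kappa> powr (p - 1) * (\<ointegral>x. (\<ointegral>y. k x y * \<bar>f y\<bar> powr p))"
    by simp
  also have "(\<ointegral>x. (\<ointegral>y. k x y * \<bar>f y\<bar> powr p)) = (\<ointegral>y. (\<ointegral>x. k x y * \<bar>f y\<bar> powr p))"
    using sigma2.Fubini_integral[OF i2] by simp
  also have "... = (\<ointegral>y. \<kappa> * \<bar>f y\<bar> powr p)"
  proof (rule lint_cong)
    fix y assume "y \<in> space sigmaS"
    then have y: "norm y = 1" by simp
    have "(\<ointegral>x. k x y * \<bar>f y\<bar> powr p) = (\<ointegral>x. k y x * \<bar>f y\<bar> powr p)"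
      by (rule lint_cong) (use ksym[OF _ y] in auto)
    then show "(\<ointegral>x. k x y * \<bar>f y\<bar> powr p) = \<kappa> * \<bar>f y\<bar> powr p" by (simp add: kint[OF y])
  qed simp
  also have "\<kappa> powr (p - 1) * (\<ointegral>y. \<kappa> * \<bar>f y\<bar> powr p) = \<kappa> powr p * Lpow p f"
    using \<kappa>0 powr_add[of \<kappa> 1 "p - 1"] by (cases "\<kappa> = 0") (auto simp: Lpow_def)
  finally show ?thesis .
qed

lemma Harm_continuous: "Y \<in> Harm l \<Longrightarrow> continuous_on A Y"
  by (rule poly3_continuous[OF HarmD(2)])

lemma Lpow_coeff_tendsto:
  fixes Y :: "nat \<Rightarrow> R3 \<Rightarrow> 'b::euclidean_space"
  assumes p: "p > 0" and Y: "\<And>l. continuous_on (sphere 0 1) (Y l)" and a: "\<And>l. (\<lambda>j. a j l) \<longlonglongrightarrow> b l"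
  shows "(\<lambda>j::nat. Lpow p (\<lambda>x. \<Sum>l<N. a j l *\<^sub>R Y l x)) \<longlonglongrightarrow> Lpow p (\<lambda>x. \<Sum>l<N. b l *\<^sub>R Y l x)"
proof -
  have "\<exists>K. \<forall>j. \<bar>a j l\<bar> \<le> K" for l
    using convergent_imp_Bseq[OF convergentI[OF a[of l]]] by (auto simp: Bseq_def)
  then obtain K where K: "\<And>j l. \<bar>a j l\<bar> \<le> K l" by metis
  have "\<exists>B. \<forall>x. norm x = 1 \<longrightarrow> norm (Y l x) \<le> B" for l
    using continuous_sphere_bound[OF Y[of l]] by metis
  then obtain B where B: "\<And>l x. norm x = 1 \<Longrightarrow> norm (Y l x) \<le> B l" by metis
  have [measurable]: "Y l \<in> borel_measurable sigmaS" for l by (rule sphere_measurable[OF Y])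
  show ?thesis unfolding Lpow_def
  proof (rule integral_dominated_convergence[where w="\<lambda>x. (\<Sum>l<N. K l * B l) powr p"])
    show "AE x in sigmaS. (\<lambda>j. norm (\<Sum>l<N. a j l *\<^sub>R Y l x) powr p) \<longlonglongrightarrow> norm (\<Sum>l<N. b l *\<^sub>R Y l x) powr p"
      by (rule AE_I2, rule tendsto_powr'[OF tendsto_norm[OF tendsto_sum[OF tendsto_scaleR[OF a tendsto_const]]] tendsto_const])
        (use p in auto)
    have "norm (\<Sum>l<N. a j l *\<^sub>R Y l x) \<le> (\<Sum>l<N. K l * B l)" if "norm x = 1" for j x
      by (rule order_trans[OF norm_sum], rule sum_mono)
        (use K B that in \<open>auto intro!: mult_mono intro: order_trans[OF abs_ge_zero]\<close>)
    then show "AE x in sigmaS. norm (norm (\<Sum>l<N. a j l *\<^sub>R Y l x) powr p) \<le> (\<Sum>l<N. K l * B l) powr p" for j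
      using p by (auto intro!: AE_I2 powr_mono2)
  qed auto
qed

lemma radial_tendsto: "(\<lambda>j. (1 - inverse (real (Suc (Suc j)))) ^ l) \<longlonglongrightarrow> 1"
proof -
  have "(\<lambda>j. (1 - inverse (real (Suc (Suc j)))) ^ l) \<longlonglongrightarrow> (1 - 0) ^ l"
    by (intro tendsto_intros LIMSEQ_Suc[OF LIMSEQ_inverse_real_of_nat])
  then show ?thesis by simp
qed

lemma radial_bounds: "1 - inverse (real (Suc (Suc j))) \<in> {1/2..<1}"
  by (auto simp: field_simps)

text \<open>The kernels in use are bounded only for \<open>r < 1\<close>. On a finite sum, estimates
  uniform in \<open>r\<close> survive the limit \<open>r \<rightarrow> 1\<close>.\<close>

lemma Lpow_radial_limit:
  fixes Y :: "nat \<Rightarrow> R3 \<Rightarrow> 'b::euclidean_space"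
  assumes p: "p > 0" and Y: "\<And>l. continuous_on (sphere 0 1) (Y l)"
    and b: "\<And>r. 1/2 \<le> r \<Longrightarrow> r < 1 \<Longrightarrow> Lpow p (\<lambda>x. \<Sum>l<N. r ^ l *\<^sub>R Y l x) \<le> B"
  shows "Lpow p (hsum N Y) \<le> B"
proof -
  have "(\<lambda>j. Lpow p (\<lambda>x. \<Sum>l<N. (1 - inverse (real (Suc (Suc j)))) ^ l *\<^sub>R Y l x)) \<longlonglongrightarrow> Lpow p (\<lambda>x. \<Sum>l<N. 1 *\<^sub>R Y l x)"
    by (rule Lpow_coeff_tendsto[OF p Y radial_tendsto])
  then have "Lpow p (\<lambda>x. \<Sum>l<N. 1 *\<^sub>R Y l x) \<le> B"
    by (rule LIMSEQ_le_const2) (use radial_bounds b in auto)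
  then show ?thesis by simp
qed

lemma norm_diff_sphere_commute: "norm (x::R3) = 1 \<Longrightarrow> norm y = 1 \<Longrightarrow> norm (r *\<^sub>R x - y) = norm (r *\<^sub>R y - x)"
  by (rule power2_eq_imp_eq) (simp_all add: norm_diff_sphere_sq inner_commute)

lemma integral_sum_Harm:
  assumes "\<And>l. Y l \<in> Harm l" "N > 0"
  shows "(\<ointegral>x. (\<Sum>l<N. Y l x)) = 4 * pi * Y 0 0"
proof -
  have "(\<ointegral>x. (\<Sum>l<N. Y l x)) = (\<Sum>l<N. \<ointegral>x. Y l x * 1)"
    by (subst lint_sum) (auto intro!: sphere_integrable Harm_continuous[OF assms(1)])
  also have "... = (\<Sum>l<N. if l = 0 then 4 * pi * Y 0 0 else 0)"
  proof (rule sum.cong)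
    fix l
    show "(\<ointegral>x. Y l x * 1) = (if l = 0 then 4 * pi * Y 0 0 else 0)"
    proof (cases "l = 0")
      case True
      have "(\<ointegral>x. Y 0 x * 1) = (\<ointegral>x. Y 0 0)"
        by (rule lint_cong) (simp, simp only: mult_1_right, rule Harm_0_const[OF assms(1)])
      then show ?thesis using True by simp
    qed (use Harm_orthogonal[OF assms(1) Harm_const[of 1], of l] in simp)
  qed simp
  also have "... = 4 * pi * Y 0 0" using assms(2) by (simp add: sum.delta)
  finally show ?thesis .
qed

text \<open>The distances involved are at most 2, so the kernel is at least 1/2. Subtracting
  \<open>c = 1/2\<close> leaves it nonnegative, halves its total mass and does not affect functions
  of mean zero, which is what \<open>Y 0 0 = 0\<close> says; \<open>c = 0\<close> is the case
  without a condition on the mean.\<close>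

lemma single_layer_Lpow_aux:
  assumes p: "p > 1" and Y: "\<And>l. Y l \<in> Harm l" and c: "c = 0 \<or> Y 0 0 = 0 \<and> c = 1/2"
  shows "Lpow p (\<lambda>x. \<Sum>l<N. slm l * Y l x) \<le> (1 - c) powr p * Lpow p (hsum N Y)"
proof -
  define f where "f x = (\<Sum>l<N. Y l x)" for x
  have cf: "continuous_on A f" for A unfolding f_def by (intro continuous_intros Harm_continuous[OF Y])
  have cf0: "c * (\<ointegral>y. f y) = 0"
  proof (cases "N = 0")
    case False
    then show ?thesis using c integral_sum_Harm[OF Y, of N] by (auto simp: f_def)
  qed (simp add: f_def)
  obtain A where A: "\<And>x. norm x = 1 \<Longrightarrow> norm (f x) \<le> A" using continuous_sphere_bound[OF cf] by blast
  have main: "Lpow p (\<lambda>x. \<Sum>l<N. r ^ l *\<^sub>R (slm l * Y l x)) \<le> (1 - c) powr p * Lpow p f"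
    if r: "1/2 \<le> r" "r < 1" for r
  proof -
    define k where "k x y = (1 / (4 * pi)) * (inverse (norm (r *\<^sub>R x - y)) - c)" for x y :: R3
    have n: "norm (r *\<^sub>R x) < 1" if "norm x = 1" for x :: R3 using that r by simp
    have ci: "continuous_on (sphere 0 1) (\<lambda>y. inverse (norm (r *\<^sub>R x - y)))" if "norm x = 1" for x :: R3
      by (rule continuous_inverse_norm[OF n[OF that]])
    have "Lpow p (\<lambda>x. \<ointegral>y. k x y * f y) \<le> (1 - c) powr p * Lpow p f"
    proof (rule symmetric_kernel_Lpow_le[OF p, where B="(1 / (4 * pi)) * (1 / (1 - r))" and A=A])
      have "(\<lambda>z::R3 \<times> R3. norm (r *\<^sub>R fst z - snd z)) \<in> borel_measurable borel"
        by (intro borel_measurable_continuous_onI continuous_intros)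
      then show "(\<lambda>z. k (fst z) (snd z)) \<in> borel_measurable borel" unfolding k_def by measurable
      show "0 \<le> k x y \<and> k x y \<le> (1 / (4 * pi)) * (1 / (1 - r))" if x: "norm x = 1" and y: "norm y = 1" for x y
      proof -
        have "norm (r *\<^sub>R x - y) \<ge> 1 - r" using norm_diff_sphere_ge[OF y, of "r *\<^sub>R x"] x r by simp
        then have u: "inverse (norm (r *\<^sub>R x - y)) \<le> 1 / (1 - r)" using r by (simp add: inverse_eq_divide frac_le)
        have "norm (r *\<^sub>R x - y) \<le> r + 1" using norm_triangle_ineq4[of "r *\<^sub>R x" y] x y r by simp
        moreover have "norm (r *\<^sub>R x - y) > 0" using n[OF x] y by auto
        ultimately have "inverse (norm (r *\<^sub>R x - y)) \<ge> 1/2" using r by (simp add: field_simps)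
        then have "inverse (norm (r *\<^sub>R x - y)) - c \<ge> 0" "inverse (norm (r *\<^sub>R x - y)) - c \<le> 1 / (1 - r)"
          using c u by auto
        then show ?thesis unfolding k_def by (intro conjI mult_nonneg_nonneg mult_left_mono) auto
      qed
      show "k x y = k y x" if "norm x = 1" "norm y = 1" for x y
        unfolding k_def norm_diff_sphere_commute[OF that] ..
      show "(\<ointegral>y. k x y) = 1 - c" if x: "norm x = 1" for x
      proof -
        have "(\<ointegral>y. k x y) = (1 / (4 * pi)) * ((\<ointegral>y. inverse (norm (r *\<^sub>R x - y))) - (\<ointegral>y. c))"
          unfolding k_def by (subst lint_diff[symmetric])
            (auto intro!: sphere_integrable ci[OF x] simp del: lint_diff)
        also have "... = (1 / (4 * pi)) * ((4 * pi) * (1 - c))"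
          using single_layer_const(1)[OF x, of r] r by (simp add: right_diff_distrib)
        finally show ?thesis by simp
      qed
    qed (use A borel_measurable_continuous_onI[OF cf] in auto)
    also have "Lpow p (\<lambda>x. \<ointegral>y. k x y * f y) = Lpow p (\<lambda>x. \<Sum>l<N. r ^ l *\<^sub>R (slm l * Y l x))"
    proof (rule Lpow_cong)
      fix x :: R3 assume x: "norm x = 1"
      have "(\<ointegral>y. k x y * f y) = (\<ointegral>y. (1 / (4 * pi)) * (inverse (norm (r *\<^sub>R x - y)) * f y) - (1 / (4 * pi)) * (c * f y))"
        by (simp add: k_def algebra_simps)
      also have "... = (1 / (4 * pi)) * (\<ointegral>y. inverse (norm (r *\<^sub>R x - y)) * f y) - (1 / (4 * pi)) * (c * (\<ointegral>y. f y))"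
        by (subst lint_diff)
          (auto intro!: integrable_mult_right sphere_integrable continuous_intros ci[OF x] cf
            simp del: times_divide_eq_left mult_1_left)
      also have "... = (1 / (4 * pi)) * (\<Sum>l<N. 4 * pi / (2 * real l + 1) * Y l (r *\<^sub>R x))"
        unfolding cf0 unfolding f_def using single_layer_sum_Harm[OF Y n[OF x]] by simp
      also have "... = (\<Sum>l<N. r ^ l *\<^sub>R (slm l * Y l x))"
        unfolding sum_distrib_left by (intro sum.cong refl) (simp add: hom_poly3_scale[OF HarmD(1)[OF Y]])
      finally show "(\<ointegral>y. k x y * f y) = (\<Sum>l<N. r ^ l *\<^sub>R (slm l * Y l x))" .
    qed
    finally show ?thesis .
  qed
  have "continuous_on (sphere 0 1) (\<lambda>x. slm l * Y l x)" for l
    by (intro continuous_intros Harm_continuous[OF Y])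
  from Lpow_radial_limit[OF _ this main] p show ?thesis by (simp add: f_def[abs_def])
qed

lemmas single_layer_Lpow_le = single_layer_Lpow_aux[where c=0, simplified]
lemmas single_layer_Lpow_le_half = single_layer_Lpow_aux[where c="1/2", simplified]

text \<open>One constant serves all finite harmonic sums. As \<open>T\<close> depends on the degree,
  multipliers and differential operators normalised by \<open>2l+1\<close> are covered
  alike.\<close>

definition harm_bounded :: "real \<Rightarrow> (nat \<Rightarrow> (R3 \<Rightarrow> real) \<Rightarrow> R3 \<Rightarrow> 'b::euclidean_space) \<Rightarrow> bool" where
  "harm_bounded p T \<longleftrightarrow> (\<exists>C\<ge>0. \<forall>N Y. (\<forall>l. Y l \<in> Harm l) \<longrightarrow>
     Lpow p (\<lambda>x. \<Sum>l<N. T l (Y l) x) \<le> C * Lpow p (hsum N Y))"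

abbreviation mult_bounded :: "real \<Rightarrow> (nat \<Rightarrow> real) \<Rightarrow> bool" where
  "mult_bounded p m \<equiv> harm_bounded p (\<lambda>l Y x. m l * Y x)"

section \<open>Calculus of bounded multipliers\<close>

lemma harm_boundedI:
  assumes "\<And>N Y. (\<And>l. Y l \<in> Harm l) \<Longrightarrow> Lpow p (\<lambda>x. \<Sum>l<N. T l (Y l) x) \<le> C * Lpow p (hsum N Y)"
  shows "harm_bounded p T"
  unfolding harm_bounded_def
proof (intro exI[of _ "\<bar>C\<bar>"] conjI allI impI)
  fix N and Y :: "nat \<Rightarrow> R3 \<Rightarrow> real" assume "\<forall>l. Y l \<in> Harm l"
  then have "Lpow p (\<lambda>x. \<Sum>l<N. T l (Y l) x) \<le> C * Lpow p (hsum N Y)" by (intro assms) auto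
  also have "... \<le> \<bar>C\<bar> * Lpow p (hsum N Y)" by (intro mult_right_mono) auto
  finally show "Lpow p (\<lambda>x. \<Sum>l<N. T l (Y l) x) \<le> \<bar>C\<bar> * Lpow p (hsum N Y)" .
qed simp

lemma harm_boundedE:
  assumes "harm_bounded p T"
  obtains C where "C \<ge> 0" "\<And>N Y. (\<And>l. Y l \<in> Harm l) \<Longrightarrow> Lpow p (\<lambda>x. \<Sum>l<N. T l (Y l) x) \<le> C * Lpow p (hsum N Y)"
  using assms unfolding harm_bounded_def by blast

lemma harm_bounded_mult:
  assumes "harm_bounded p T" "mult_bounded p m"
  shows "harm_bounded p (\<lambda>l Y. T l (\<lambda>x. m l * Y x))"
proof -
  obtain C where C: "C \<ge> 0" "\<And>N Y. (\<And>l. Y l \<in> Harm l) \<Longrightarrow> Lpow p (\<lambda>x. \<Sum>l<N. T l (Y l) x) \<le> C * Lpow p (hsum N Y)"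
    using assms(1) by (rule harm_boundedE) blast
  obtain D where D: "D \<ge> 0" "\<And>N Y. (\<And>l. Y l \<in> Harm l) \<Longrightarrow> Lpow p (\<lambda>x. \<Sum>l<N. m l * Y l x) \<le> D * Lpow p (hsum N Y)"
    using assms(2) by (rule harm_boundedE) blast
  show ?thesis
  proof (rule harm_boundedI[where C="C * D"])
    fix N and Y :: "nat \<Rightarrow> R3 \<Rightarrow> real" assume Y: "\<And>l. Y l \<in> Harm l"
    have "Lpow p (\<lambda>x. \<Sum>l<N. T l (\<lambda>x. m l * Y l x) x) \<le> C * Lpow p (\<lambda>x. \<Sum>l<N. m l * Y l x)"
      by (rule C(2)) (rule Harm_cmult[OF Y])
    also have "... \<le> C * (D * Lpow p (hsum N Y))" by (intro mult_left_mono D(2) Y C)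
    finally show "Lpow p (\<lambda>x. \<Sum>l<N. T l (\<lambda>x. m l * Y l x) x) \<le> C * D * Lpow p (hsum N Y)" by simp
  qed
qed

lemma harm_bounded_add:
  assumes "p \<ge> 1" "harm_bounded p T" "harm_bounded p U"
    and cont: "\<And>l Y. Y \<in> Harm l \<Longrightarrow> continuous_on (sphere 0 1) (T l Y)" "\<And>l Y. Y \<in> Harm l \<Longrightarrow> continuous_on (sphere 0 1) (U l Y)"
  shows "harm_bounded p (\<lambda>l Y x. T l Y x + U l Y x)"
proof -
  obtain C where C: "C \<ge> 0" "\<And>N Y. (\<And>l. Y l \<in> Harm l) \<Longrightarrow> Lpow p (\<lambda>x. \<Sum>l<N. T l (Y l) x) \<le> C * Lpow p (hsum N Y)"
    using assms(2) by (rule harm_boundedE) blast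
  obtain D where D: "D \<ge> 0" "\<And>N Y. (\<And>l. Y l \<in> Harm l) \<Longrightarrow> Lpow p (\<lambda>x. \<Sum>l<N. U l (Y l) x) \<le> D * Lpow p (hsum N Y)"
    using assms(3) by (rule harm_boundedE) blast
  show ?thesis
  proof (rule harm_boundedI[where C="2 powr (p - 1) * (C + D)"])
    fix N and Y :: "nat \<Rightarrow> R3 \<Rightarrow> real" assume Y: "\<And>l. Y l \<in> Harm l"
    have "Lpow p (\<lambda>x. \<Sum>l<N. T l (Y l) x + U l (Y l) x) \<le> 2 powr (p - 1) * (Lpow p (\<lambda>x. \<Sum>l<N. T l (Y l) x) + Lpow p (\<lambda>x. \<Sum>l<N. U l (Y l) x))"
      unfolding sum.distrib
      by (rule Lpow_add_le) (use assms(1) in \<open>auto intro!: continuous_inLp continuous_intros cont Y\<close>)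
    also have "... \<le> 2 powr (p - 1) * (C * Lpow p (hsum N Y) + D * Lpow p (hsum N Y))"
      by (intro mult_left_mono add_mono C(2) D(2) Y) auto
    finally show "Lpow p (\<lambda>x. \<Sum>l<N. T l (Y l) x + U l (Y l) x) \<le> 2 powr (p - 1) * (C + D) * Lpow p (hsum N Y)"
      by (simp add: algebra_simps)
  qed
qed

lemma mult_bounded_add: "p \<ge> 1 \<Longrightarrow> mult_bounded p m \<Longrightarrow> mult_bounded p k \<Longrightarrow> mult_bounded p (\<lambda>l. m l + k l)"
  using harm_bounded_add[of p "\<lambda>l Y x. m l * Y x" "\<lambda>l Y x. k l * Y x"]
  by (simp add: ring_distribs Harm_continuous continuous_intros)

lemma mult_bounded_const: "mult_bounded p (\<lambda>_. c)"
proof (rule harm_boundedI[where C="\<bar>c\<bar> powr p"])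
  fix N and Y :: "nat \<Rightarrow> R3 \<Rightarrow> real"
  show "Lpow p (\<lambda>x. \<Sum>l<N. c * Y l x) \<le> \<bar>c\<bar> powr p * Lpow p (hsum N Y)"
    using Lpow_scaleR[of p c "\<lambda>x. \<Sum>l<N. Y l x"] by (simp add: sum_distrib_left)
qed

lemma mult_bounded_mult: "mult_bounded p m \<Longrightarrow> mult_bounded p k \<Longrightarrow> mult_bounded p (\<lambda>l. m l * k l)"
  using harm_bounded_mult[of p "\<lambda>l Y x. m l * Y x" k] by (simp add: mult.assoc)

lemma mult_bounded_cong: "mult_bounded p m \<Longrightarrow> (\<And>l. m l = k l) \<Longrightarrow> mult_bounded p k"
  by (subst ext[of k m]) auto

lemma mult_bounded_single_layer: "p > 1 \<Longrightarrow> mult_bounded p (\<lambda>l. 1 / (2 * real l + 1))"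
  by (rule harm_boundedI[where C=1]) (use single_layer_Lpow_le in auto)

text \<open>The mean is the integral operator with the constant kernel
  \<open>1 / (4 pi)\<close>.\<close>

lemma mult_bounded_mean: assumes p: "p > 1" shows "mult_bounded p (\<lambda>l. if l = 0 then 1 else 0)"
proof (rule harm_boundedI[where C=1])
  fix N and Y :: "nat \<Rightarrow> R3 \<Rightarrow> real" assume Y: "\<And>l. Y l \<in> Harm l"
  define f where "f x = (\<Sum>l<N. Y l x)" for x
  have cf: "continuous_on A f" for A unfolding f_def by (intro continuous_intros Harm_continuous[OF Y])
  obtain A where A: "\<And>x. norm x = 1 \<Longrightarrow> norm (f x) \<le> A" using continuous_sphere_bound[OF cf] by blast
  have "Lpow p (\<lambda>x. \<ointegral>y. 1 / (4 * pi) * f y) \<le> 1 powr p * Lpow p f"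
    by (rule symmetric_kernel_Lpow_le[OF p, where B="1 / (4 * pi)" and A=A])
      (use A borel_measurable_continuous_onI[OF cf] in auto)
  moreover have "(\<ointegral>y. 1 / (4 * pi) * f y) = (\<Sum>l<N. (if l = 0 then 1 else 0) * Y l x)" for x
  proof (cases "N = 0")
    case False
    have "(\<Sum>l<N. (if l = 0 then 1 else 0) * Y l x) = (\<Sum>l<N. if l = 0 then Y 0 x else 0)"
      by (rule sum.cong) auto
    also have "... = Y 0 0" using False Harm_0_const[OF Y, of x] by simp
    finally show ?thesis using integral_sum_Harm[OF Y, of N] False by (simp add: f_def)
  qed (simp add: f_def)
  ultimately show "Lpow p (\<lambda>x. \<Sum>l<N. (if l = 0 then 1 else 0) * Y l x) \<le> 1 * Lpow p (hsum N Y)"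
    unfolding f_def by simp
qed

lemma mult_bounded_nonconst: assumes "p > 1" shows "mult_bounded p (\<lambda>l. if l = 0 then 0 else 1)"
  by (rule mult_bounded_cong[OF mult_bounded_add[OF _ mult_bounded_const[of p 1]
      mult_bounded_mult[OF mult_bounded_const[of p "-1"] mult_bounded_mean[OF assms]]]]) (use assms in auto)

text \<open>On mean-zero functions the single layer operator contracts by the factor \<open>1/2\<close>, so that a multiplier
  solving \<open>m = S(2 + \<epsilon> m)\<close> with \<open>\<epsilon> = \<plusminus>1\<close> is bounded.\<close>
lemma mult_bounded_fixpoint:
  assumes p: "p > 1" and m: "m 0 = 0" "\<And>l. l > 0 \<Longrightarrow> m l = (2 + \<epsilon> * m l) / (2 * real l + 1)" and eps: "\<bar>\<epsilon>\<bar> = 1"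
  shows "mult_bounded p m"
proof -
  have bd: "Lpow p (\<lambda>x. \<Sum>l<N. m l * Y l x) \<le> 2 powr p * Lpow p (hsum N Y)"
    if Y: "\<And>l. Y l \<in> Harm l" and Y0: "Y 0 = (\<lambda>_. 0)" for N Y
  proof -
    define X where "X x = (\<Sum>l<N. m l * Y l x)" for x
    define f where "f x = (\<Sum>l<N. Y l x)" for x
    \<comment> \<open>The fixed point equation says that the multiplied sum \<open>X\<close> is the
      single layer operator applied to the sum of these \<open>Z l\<close>, which itself contains
      \<open>X\<close>.\<close>
    define Z where "Z l x = 2 * Y l x + \<epsilon> * (m l * Y l x)" for l x
    have Z: "Z l \<in> Harm l" for l unfolding Z_def[abs_def] by (intro Harm_add Harm_cmult Y)
    have in1: "inLp p f" "inLp p X" unfolding f_def X_def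
      using p by (auto intro!: continuous_inLp continuous_intros Harm_continuous[OF Y])
    have "X x = (\<Sum>l<N. slm l * Z l x)" for x
      unfolding X_def
    proof (intro sum.cong refl)
      fix l show "m l * Y l x = slm l * Z l x"
      proof (cases "l = 0")
        case False
        then have "m l * Y l x = ((2 + \<epsilon> * m l) / (2 * real l + 1)) * Y l x" using m(2)[of l] by simp
        then show ?thesis by (simp add: Z_def algebra_simps add_divide_distrib)
      qed (simp add: Z_def m Y0)
    qed
    then have "Lpow p X = Lpow p (\<lambda>x. \<Sum>l<N. slm l * Z l x)" by presburger
    also have "... \<le> (1/2) powr p * Lpow p (hsum N Z)"
      using single_layer_Lpow_le_half[OF p Z] by (simp add: Z_def Y0 m)
    also have "(hsum N Z) = (\<lambda>x. 2 *\<^sub>R f x + \<epsilon> *\<^sub>R X x)"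
      by (simp add: Z_def f_def X_def sum.distrib sum_distrib_left fun_eq_iff)
    also have "Lpow p (\<lambda>x. 2 *\<^sub>R f x + \<epsilon> *\<^sub>R X x) \<le> 2 powr (p - 1) * (2 powr p * Lpow p f + Lpow p X)"
      using Lpow_add_le[of p "\<lambda>x. 2 *\<^sub>R f x" "\<lambda>x. \<epsilon> *\<^sub>R X x"] p in1 eps
      by (simp add: inLp_scaleR Lpow_scaleR del: real_scaleR_def)
    \<comment> \<open>The contraction factor \<open>(1/2) powr p\<close> against the triangle factor
      \<open>2 powr (p - 1)\<close> leaves exactly 1/2 in front of \<open>Lpow p X\<close>, which is
      then absorbed.\<close>
    finally have "Lpow p X \<le> (1/2) powr p * (2 powr (p - 1) * (2 powr p * Lpow p f + Lpow p X))"
      by simp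
    also have "... = (1/2) * (2 powr p * Lpow p f + Lpow p X)"
      by (simp add: powr_divide powr_diff)
    finally show ?thesis unfolding X_def f_def by (simp add: algebra_simps)
  qed
  have "mult_bounded p (\<lambda>l. m l * (if l = 0 then 0 else 1))"
  proof -
    obtain D where D: "D \<ge> 0" "\<And>N Y. (\<And>l. Y l \<in> Harm l) \<Longrightarrow>
        Lpow p (\<lambda>x. \<Sum>l<N. (if l = 0 then 0 else 1) * Y l x) \<le> D * Lpow p (hsum N Y)"
      using mult_bounded_nonconst[OF p] by (rule harm_boundedE) blast
    show ?thesis
    proof (rule harm_boundedI[where C="2 powr p * D"])
      fix N and Y :: "nat \<Rightarrow> R3 \<Rightarrow> real" assume Y: "\<And>l. Y l \<in> Harm l"
      have "Lpow p (\<lambda>x. \<Sum>l<N. m l * ((if l = 0 then 0 else 1) * Y l x)) \<le> 2 powr p * Lpow p (\<lambda>x. \<Sum>l<N. (if l = 0 then 0 else 1) * Y l x)"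
        by (rule bd, rule Harm_cmult[OF Y]) simp
      also have "... \<le> 2 powr p * (D * Lpow p (hsum N Y))" by (intro mult_left_mono D(2) Y) auto
      finally show "Lpow p (\<lambda>x. \<Sum>l<N. m l * (if l = 0 then 0 else 1) * Y l x) \<le> 2 powr p * D * Lpow p (hsum N Y)"
        by (simp add: mult.assoc)
    qed
  qed
  then show ?thesis by (rule mult_bounded_cong) (use m in auto)
qed

text \<open>\<open>m = 1/l\<close> solves \<open>(2l+1) m = 2 + m\<close>; with the opposite sign,
  as in the next lemma, the solution is \<open>1/(l+1)\<close>.\<close>

lemma mult_bounded_inverse: "p > 1 \<Longrightarrow> mult_bounded p (\<lambda>l. if l = 0 then 0 else 1 / real l)"
  by (rule mult_bounded_fixpoint[where \<epsilon>=1]) (auto simp: eq_divide_eq distrib_left)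

lemma mult_bounded_inverse_Suc: "p > 1 \<Longrightarrow> mult_bounded p (\<lambda>l. if l = 0 then 0 else 1 / (real l + 1))"
  by (rule mult_bounded_fixpoint[where \<epsilon>="-1"]) (auto simp: divide_simps)

text \<open>The multiplier \<open>d = 2\<ell>+1 - 2\<surd>(\<ell>(\<ell>+1))\<close> is the smaller root of \<open>d = S(1 + d\<^sup>2)/2\<close>
  and is reached by iterating from \<open>0\<close>; every iterate is a contraction.\<close>
fun sqrt_iter :: "nat \<Rightarrow> nat \<Rightarrow> real" where
  "sqrt_iter 0 l = 0"
| "sqrt_iter (Suc j) l = (1 + (sqrt_iter j l)\<^sup>2) / (2 * (2 * real l + 1))"

definition sqrt_defect :: "nat \<Rightarrow> real" where
  "sqrt_defect l = 2 * real l + 1 - 2 * sqrt (real l * (real l + 1))"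

lemma sqrt_iter_bounds: "0 \<le> sqrt_iter j l \<and> sqrt_iter j l \<le> 1"
proof (induction j)
  case (Suc j)
  then have "(sqrt_iter j l)\<^sup>2 \<le> 1" by (simp add: power_le_one)
  then show ?case by (auto simp: divide_le_eq)
qed simp

lemma sqrt_iter_tendsto: "(\<lambda>j. sqrt_iter j l) \<longlonglongrightarrow> sqrt_defect l"
proof -
  have inc: "incseq (\<lambda>j. sqrt_iter j l)"
  proof (rule incseq_SucI)
    fix j show "sqrt_iter j l \<le> sqrt_iter (Suc j) l"
    proof (induction j)
      case (Suc j)
      then have "(sqrt_iter j l)\<^sup>2 \<le> (sqrt_iter (Suc j) l)\<^sup>2" using sqrt_iter_bounds by (intro power_mono) auto
      then show ?case unfolding sqrt_iter.simps(2)[of "Suc j"] sqrt_iter.simps(2)[of j] by (intro divide_right_mono) auto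
    qed simp
  qed
  obtain x where x: "(\<lambda>j. sqrt_iter j l) \<longlonglongrightarrow> x"
    by (rule incseq_convergent[OF inc, of 1]) (use sqrt_iter_bounds in auto)
  \<comment> \<open>The bound makes \<open>2l+1 - x\<close> nonnegative, which selects the smaller
    root.\<close>
  have x1: "x \<le> 1" by (rule LIMSEQ_le_const2[OF x]) (use sqrt_iter_bounds in auto)
  have "(\<lambda>j. sqrt_iter (Suc j) l) \<longlonglongrightarrow> (1 + x\<^sup>2) / (2 * (2 * real l + 1))"
    unfolding sqrt_iter.simps by (intro tendsto_intros x) auto
  then have fx: "x = (1 + x\<^sup>2) / (2 * (2 * real l + 1))" by (rule LIMSEQ_unique[OF LIMSEQ_Suc[OF x]])
  have a: "(2 * real l + 1 - x)\<^sup>2 = (2 * sqrt (real l * (real l + 1)))\<^sup>2"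
    using fx by (simp add: field_simps power2_eq_square)
  have b: "2 * real l + 1 - x \<ge> 0" using x1 by simp
  have "2 * real l + 1 - x = 2 * sqrt (real l * (real l + 1))"
    by (rule power2_eq_imp_eq[OF a b]) simp
  then have "sqrt_defect l = x" unfolding sqrt_defect_def by linarith
  then show ?thesis using x by simp
qed

text \<open>The single layer operator is a contraction, convexity handles the mean of two functions,
  and the square of an iterate is that iterate applied twice. So each iterate hands contractivity on
  to the next and, on a finite sum, to the limit.\<close>

lemma mult_bounded_sqrt_defect: assumes p: "p > 1" shows "mult_bounded p sqrt_defect"
proof (rule harm_boundedI[where C=1])
  fix N and Y :: "nat \<Rightarrow> R3 \<Rightarrow> real" assume Y: "\<And>l. Y l \<in> Harm l"
  have it: "Lpow p (\<lambda>x. \<Sum>l<N. sqrt_iter j l * Y l x) \<le> Lpow p (hsum N Y)" if "\<And>l. Y l \<in> Harm l" for j Y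
    using that
  proof (induction j arbitrary: Y)
    case 0
    then show ?case using p by (simp add: Lpow_def[of p "\<lambda>x. 0"])
  next
    case (Suc j)
    note Y = Suc.prems
    define f where "f x = (\<Sum>l<N. Y l x)" for x
    define g where "g x = (\<Sum>l<N. (sqrt_iter j l)\<^sup>2 * Y l x)" for x
    define Z where "Z l x = (1/2) * (Y l x + (sqrt_iter j l)\<^sup>2 * Y l x)" for l x
    have Z: "Z l \<in> Harm l" for l unfolding Z_def[abs_def] by (intro Harm_add Harm_cmult Y)
    have in1: "inLp p f" "inLp p g" unfolding f_def g_def
      using p by (auto intro!: continuous_inLp continuous_intros Harm_continuous[OF Y])
    have "Lpow p (\<lambda>x. \<Sum>l<N. sqrt_iter (Suc j) l * Y l x) = Lpow p (\<lambda>x. \<Sum>l<N. slm l * Z l x)"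
    proof (rule Lpow_cong, rule sum.cong)
      have "((1 + s) / (2 * D)) * y = (1 / D) * ((1/2) * (y + s * y))" for s y D :: real
        by (cases "D = 0") (auto simp: field_simps)
      then show "sqrt_iter (Suc j) l * Y l x = slm l * Z l x" for l x
        unfolding Z_def sqrt_iter.simps .
    qed simp
    also have "... \<le> Lpow p (hsum N Z)" using single_layer_Lpow_le[OF p Z] by simp
    also have "(hsum N Z) = (\<lambda>x. (f x + g x) / 2)"
      by (simp add: Z_def f_def g_def sum.distrib sum_divide_distrib[symmetric] fun_eq_iff)
    also have "Lpow p (\<lambda>x. (f x + g x) / 2) \<le> (\<ointegral>x. (\<bar>f x\<bar> powr p + \<bar>g x\<bar> powr p) / 2)"
      unfolding Lpow_def real_norm_def
    proof (rule integral_mono)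
      show "integrable sigmaS (\<lambda>x. \<bar>(f x + g x) / 2\<bar> powr p)"
        using inLp_scaleR[OF inLp_add[OF _ in1], of "1/2"] p by (simp add: inLp_def)
    qed (use in1 p powr_mean_le in \<open>auto simp: inLp_def\<close>)
    also have "... = (Lpow p f + Lpow p g) / 2" using in1 by (simp add: Lpow_def inLp_def)
    also have "Lpow p g \<le> Lpow p (\<lambda>x. \<Sum>l<N. sqrt_iter j l * Y l x)"
      using Suc.IH[of "\<lambda>l x. sqrt_iter j l * Y l x"] Harm_cmult[OF Y] by (simp add: g_def[abs_def] power2_eq_square mult.assoc)
    also have "... \<le> Lpow p f" unfolding f_def by (rule Suc.IH[OF Y])
    finally show ?case by (simp add: f_def[abs_def])
  qed
  have "(\<lambda>j. Lpow p (\<lambda>x. \<Sum>l<N. sqrt_iter j l *\<^sub>R Y l x)) \<longlonglongrightarrow> Lpow p (\<lambda>x. \<Sum>l<N. sqrt_defect l *\<^sub>R Y l x)"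
    by (rule Lpow_coeff_tendsto[OF _ Harm_continuous[OF Y] sqrt_iter_tendsto]) (use p in simp)
  then have "Lpow p (\<lambda>x. \<Sum>l<N. sqrt_defect l *\<^sub>R Y l x) \<le> Lpow p (hsum N Y)"
    by (rule LIMSEQ_le_const2) (use it[OF Y] in auto)
  then show "Lpow p (\<lambda>x. \<Sum>l<N. sqrt_defect l * Y l x) \<le> 1 * Lpow p (hsum N Y)" by simp
qed

section \<open>A Bellman function\<close>

lemma has_derivative_powr_const:
  fixes f :: "'a::real_normed_vector \<Rightarrow> real"
  assumes "(f has_derivative f') (at x)" "f x > 0"
  shows "((\<lambda>x. f x powr a) has_derivative (\<lambda>h. a * f x powr (a - 1) * f' h)) (at x)"
proof -
  have "((\<lambda>y. y powr a) has_derivative (*) (a * f x powr (a - 1))) (at (f x))"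
    using has_real_derivative_powr[OF assms(2), of a] by (simp add: has_field_derivative_def)
  from has_derivative_compose[OF assms(1) this] show ?thesis by simp
qed

text \<open>A smooth substitute for \<open>\<bar>u\<bar> powr a\<close>, which for
  \<open>1 < a < 2\<close> has no second derivative at 0. The parameter \<open>e\<close> disappears
  only after integration. \<open>reg_powr1\<close> and \<open>reg_powr2\<close> are the first two
  derivatives.\<close>

definition reg_powr :: "real \<Rightarrow> real \<Rightarrow> real \<Rightarrow> real" where
  "reg_powr e a u = (u\<^sup>2 + e) powr (a / 2)"

definition reg_powr1 :: "real \<Rightarrow> real \<Rightarrow> real \<Rightarrow> real" where
  "reg_powr1 e a u = a * u * (u\<^sup>2 + e) powr (a / 2 - 1)"

definition reg_powr2 :: "real \<Rightarrow> real \<Rightarrow> real \<Rightarrow> real" where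
  "reg_powr2 e a u = a * (u\<^sup>2 + e) powr (a / 2 - 1) + a * (a - 2) * u\<^sup>2 * (u\<^sup>2 + e) powr (a / 2 - 2)"

lemma reg_pos: "e > 0 \<Longrightarrow> u\<^sup>2 + e > (0::real)"
  by (simp add: add_nonneg_pos)

lemma reg_powr_pos: "e > 0 \<Longrightarrow> reg_powr e a u > 0"
  using reg_pos[of e u] by (simp add: reg_powr_def)

lemma has_derivative_reg_powr:
  assumes e: "e > 0" and f: "(f has_derivative f') (at x)"
  shows "((\<lambda>x. reg_powr e a (f x)) has_derivative (\<lambda>h. reg_powr1 e a (f x) * f' h)) (at x)"
    and "((\<lambda>x. reg_powr1 e a (f x)) has_derivative (\<lambda>h. reg_powr2 e a (f x) * f' h)) (at x)"
proof -
  have p: "((\<lambda>x. ((f x)\<^sup>2 + e) powr b) has_derivative (\<lambda>h. b * ((f x)\<^sup>2 + e) powr (b - 1) * (2 * f x * f' h))) (at x)" for b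
    by (rule has_derivative_powr_const) (auto intro!: derivative_eq_intros f reg_pos[OF e])
  show "((\<lambda>x. reg_powr e a (f x)) has_derivative (\<lambda>h. reg_powr1 e a (f x) * f' h)) (at x)"
    unfolding reg_powr_def reg_powr1_def by (rule has_derivative_eq_rhs[OF p]) auto
  have "((\<lambda>x. a * f x * ((f x)\<^sup>2 + e) powr (a / 2 - 1)) has_derivative
     (\<lambda>h. a * f x * ((a / 2 - 1) * ((f x)\<^sup>2 + e) powr (a / 2 - 1 - 1) * (2 * f x * f' h)) + a * f' h * ((f x)\<^sup>2 + e) powr (a / 2 - 1))) (at x)"
    by (rule has_derivative_mult[OF has_derivative_mult_right[OF f] p])
  then show "((\<lambda>x. reg_powr1 e a (f x)) has_derivative (\<lambda>h. reg_powr2 e a (f x) * f' h)) (at x)"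
    unfolding reg_powr1_def reg_powr2_def
    by (rule has_derivative_eq_rhs) (auto simp: fun_eq_iff field_simps power2_eq_square)
qed

lemma continuous_on_reg:
  assumes "e > 0" "continuous_on A f"
  shows "continuous_on A (\<lambda>x. reg_powr e a (f x))" "continuous_on A (\<lambda>x. reg_powr1 e a (f x))"
    "continuous_on A (\<lambda>x. reg_powr2 e a (f x))"
  unfolding reg_powr_def reg_powr1_def reg_powr2_def
  by (intro continuous_intros assms(2); use reg_pos[OF assms(1)] in \<open>auto simp: less_imp_neq[symmetric]\<close>)+

text \<open>The term \<open>(s + t)\<^sup>\<kappa> v\<^sup>2\<close> behaves like \<open>|u|\<^sup>2\<^sup>-\<^sup>p v\<^sup>2\<close> where \<open>|v|\<^sup>q \<le> |u|\<^sup>p\<close>;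
  its negative second derivative in \<open>u\<close> is absorbed by that of \<open>|u|\<^sup>p\<close>.\<close>
lemma bellman_Hessian_ge:
  fixes a b u v p q e :: real
  assumes p: "1 < p" "p \<le> 2" "1/p + 1/q = 1" "q \<ge> 2" and e: "e > 0"
  defines "\<kappa> \<equiv> 1 - 2/q" and "N \<equiv> reg_powr e p u + reg_powr e q v" and "\<omega> \<equiv> (u\<^sup>2 + e) powr (p/2 - 1)"
  shows "\<omega> * a\<^sup>2 + b\<^sup>2 / \<omega> \<le> 25 / (p * (p - 1)) * reg_powr2 e p u * a\<^sup>2
     + 2 * N powr \<kappa> * b\<^sup>2
     + 4 * v * \<kappa> * N powr (\<kappa> - 1) * b * (reg_powr1 e p u * a + reg_powr1 e q v * b)
     + v\<^sup>2 * (\<kappa> * N powr (\<kappa> - 1) * (reg_powr2 e p u * a\<^sup>2 + reg_powr2 e q v * b\<^sup>2)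
           + \<kappa> * (\<kappa> - 1) * N powr (\<kappa> - 2) * (reg_powr1 e p u * a + reg_powr1 e q v * b)\<^sup>2)"
    (is "_ \<le> ?R")
proof -
  define w where "w = u\<^sup>2 + e"
  define z where "z = v\<^sup>2 + e"
  have w: "w > 0" "u\<^sup>2 \<le> w" and z: "z > 0" "v\<^sup>2 \<le> z" using e reg_pos by (auto simp: w_def z_def)
  define s s1 s2 t t1 t2 where "s = reg_powr e p u" and "s1 = reg_powr1 e p u" and "s2 = reg_powr2 e p u"
    and "t = reg_powr e q v" and "t1 = reg_powr1 e q v" and "t2 = reg_powr2 e q v"
  note defs = this
  have N: "N = s + t" by (simp add: N_def defs)
  have st: "s > 0" "t > 0" "s \<le> N" "t \<le> N" "N > 0"
    using reg_powr_pos[OF e] by (auto simp: N_def defs add_pos_pos add.commute intro: less_imp_le)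
  have k: "0 \<le> \<kappa>" "\<kappa> \<le> 1" "1 - \<kappa> = 2 / q" using p by (auto simp: \<kappa>_def)
  have om: "\<omega> > 0" using w by (simp add: \<omega>_def w_def)
  have s1: "s1 = p * u * \<omega>" by (simp add: defs reg_powr1_def \<omega>_def)
  have wm: "w * w powr (c - 1) = w powr c" for c using w powr_add[of w 1 "c-1"] by simp
  have zm: "z * z powr (c - 1) = z powr c" for c using z powr_add[of z 1 "c-1"] by simp
  have swom: "s = w * \<omega>" using wm[of "p/2"] by (simp add: defs reg_powr_def \<omega>_def w_def)
  \<comment> \<open>Strict convexity of the regularised power: the term with the factor
    \<open>p - 2\<close>, which is not positive, is estimated by
    \<open>u\<^sup>2 \<le> w\<close>.\<close>
  have s2: "s2 \<ge> p * (p - 1) * \<omega>"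
  proof -
    have "u\<^sup>2 * w powr (p/2 - 2) \<le> w * w powr (p/2 - 1 - 1)" using w by (intro mult_mono) auto
    also have "... = \<omega>" unfolding wm by (simp add: \<omega>_def w_def)
    finally have "p * (2 - p) * (u\<^sup>2 * w powr (p/2 - 2)) \<le> p * (2 - p) * \<omega>" using p by (intro mult_left_mono) auto
    then show ?thesis unfolding defs reg_powr2_def w_def[symmetric] \<omega>_def by (simp add: algebra_simps)
  qed
  have s1sq: "s1\<^sup>2 \<le> 4 * s * \<omega>"
  proof -
    have "s1\<^sup>2 = p\<^sup>2 * \<omega>\<^sup>2 * u\<^sup>2" by (simp add: s1 power_mult_distrib)
    also have "... \<le> 2\<^sup>2 * \<omega>\<^sup>2 * w" using p w om by (intro mult_mono power_mono) auto
    finally show ?thesis by (simp add: swom power2_eq_square mult_ac)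
  qed
  have t2: "t2 \<ge> 0" unfolding defs reg_powr2_def using p by (intro add_nonneg_nonneg mult_nonneg_nonneg) auto
  have vt1: "0 \<le> v * t1" "v * t1 \<le> q * N"
  proof -
    have e1: "v * t1 = q * (v\<^sup>2 * z powr (q/2 - 1))" by (simp add: defs reg_powr1_def z_def power2_eq_square)
    then show "0 \<le> v * t1" using p by simp
    have "v\<^sup>2 * z powr (q/2 - 1) \<le> z * z powr (q/2 - 1)" using z by (intro mult_right_mono) auto
    also have "... = t" unfolding zm by (simp add: defs reg_powr_def z_def)
    finally show "v * t1 \<le> q * N" unfolding e1 using st p by (intro mult_mono) auto
  qed
  define A where "A = N powr (\<kappa> - 2)"
  have A: "A > 0" "N powr (\<kappa> - 1) = N * A" "N powr \<kappa> = N\<^sup>2 * A"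
    using st powr_add[of N 1 "\<kappa> - 2"] powr_add[of N 2 "\<kappa> - 2"] by (auto simp: A_def)
  \<comment> \<open>\<open>v\<^sup>2\<close> is at most \<open>t powr (2/q)\<close>, and
    \<open>N\<close> dominates both \<open>s\<close> and \<open>t\<close>. Working with
    \<open>s + t\<close> rather than the larger of the two avoids a case distinction and keeps the
    function smooth.\<close>
  have v2: "v\<^sup>2 * s * A \<le> 1"
  proof -
    have "v\<^sup>2 \<le> z" by (rule z)
    also have "z = t powr (1 - \<kappa>)" using z p unfolding k(3) by (simp add: defs reg_powr_def powr_powr z_def)
    also have "... \<le> N powr (1 - \<kappa>)" using st k p by (intro powr_mono2) auto
    finally have "v\<^sup>2 * s * A \<le> N powr (1 - \<kappa>) * N * A" using st A by (intro mult_mono) auto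
    also have "... = N powr (1 - \<kappa>) * N powr (\<kappa> - 1)" by (simp add: A)
    also have "... = 1" using st by (simp flip: powr_add)
    finally show ?thesis .
  qed
  \<comment> \<open>Conjugacy of the exponents gives \<open>\<kappa> = 2/p - 1\<close>, for which
    \<open>s powr \<kappa>\<close> is exactly \<open>1 / \<omega>\<close>.\<close>
  have iom: "1 / \<omega> \<le> N powr \<kappa>"
  proof -
    have q: "\<kappa> = 2/p - 1" using p by (simp add: \<kappa>_def field_simps)
    have "1 / \<omega> = w powr (1 - p/2)" using powr_minus_divide[of w "p/2 - 1"] by (simp add: \<omega>_def w_def)
    also have "1 - p/2 = p/2 * \<kappa>" using p by (simp add: q field_simps)
    also have "w powr (p/2 * \<kappa>) = s powr \<kappa>" by (simp add: defs reg_powr_def powr_powr w_def)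
    also have "... \<le> N powr \<kappa>" using st k by (intro powr_mono2) auto
    finally show ?thesis .
  qed
  have sq: "(s1 * a + t1 * b)\<^sup>2 \<le> 2 * (s1\<^sup>2 * a\<^sup>2 + t1\<^sup>2 * b\<^sup>2)"
    using sum_squares_bound[of "s1*a" "t1*b"] unfolding power2_sum power_mult_distrib by argo
  \<comment> \<open>Completing the square: the mixed term costs one of the two copies of
    \<open>N powr \<kappa> * b\<^sup>2\<close> and a multiple of
    \<open>s1\<^sup>2 * a\<^sup>2\<close>.\<close>
  have cross: "- (N\<^sup>2 * A * b\<^sup>2) - 4 * \<kappa>\<^sup>2 * v\<^sup>2 * A * s1\<^sup>2 * a\<^sup>2 \<le> 4 * v * \<kappa> * (N * A) * b * (s1 * a)"
  proof -
    have "0 \<le> A * (N * b + 2 * \<kappa> * v * s1 * a)\<^sup>2" using A by simp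
    then show ?thesis by (simp add: algebra_simps power2_eq_square)
  qed
  have h1: "v\<^sup>2 * A * (s1\<^sup>2 * a\<^sup>2) \<le> 4 * \<omega> * a\<^sup>2"
  proof -
    have "v\<^sup>2 * A * (s1\<^sup>2 * a\<^sup>2) \<le> v\<^sup>2 * A * ((4 * s * \<omega>) * a\<^sup>2)"
      using s1sq A by (intro mult_left_mono mult_right_mono) auto
    also have "... = (v\<^sup>2 * s * A) * (4 * \<omega> * a\<^sup>2)" by simp
    also have "... \<le> 1 * (4 * \<omega> * a\<^sup>2)" using om by (intro mult_right_mono v2) auto
    finally show ?thesis by simp
  qed
  \<comment> \<open>The negative term in \<open>t1\<^sup>2\<close> carries the factor
    \<open>1 - \<kappa> = 2/q\<close>. Together with \<open>v * t1 \<le> q * N\<close> this lets the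
    positive term in \<open>v * t1 * b\<^sup>2\<close> absorb it.\<close>
  have h2: "(1 - \<kappa>) * (v\<^sup>2 * A * (t1\<^sup>2 * b\<^sup>2)) \<le> 2 * v * t1 * N * A * b\<^sup>2"
  proof -
    have "(1 - \<kappa>) * (v\<^sup>2 * A * (t1\<^sup>2 * b\<^sup>2)) = (2 / q) * ((v * t1) * (v * t1)) * (A * b\<^sup>2)"
      by (simp add: k power2_eq_square)
    also have "... \<le> (2 / q) * ((v * t1) * (q * N)) * (A * b\<^sup>2)"
      using vt1 A p by (intro mult_right_mono mult_left_mono) auto
    also have "... = 2 * v * t1 * N * A * b\<^sup>2" using p by simp
    finally show ?thesis .
  qed
  \<comment> \<open>The constant 25 is 16 + 8 + 1. By \<open>h1\<close> the completed square costs
    at most \<open>16 \<omega> a\<^sup>2\<close> and the negative second derivative of the power of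
    \<open>N\<close> at most \<open>8 \<omega> a\<^sup>2\<close>; one copy of
    \<open>\<omega> a\<^sup>2\<close> remains.\<close>
  have e1: "24 * \<omega> * a\<^sup>2 + \<omega> * a\<^sup>2 \<le> 25 / (p * (p - 1)) * s2 * a\<^sup>2"
  proof -
    have "25 / (p * (p - 1)) * (p * (p - 1) * \<omega>) * a\<^sup>2 \<le> 25 / (p * (p - 1)) * s2 * a\<^sup>2"
      using s2 p by (intro mult_right_mono mult_left_mono) auto
    then show ?thesis using p by simp
  qed
  have kk: "\<kappa> * (1 - \<kappa>) \<le> 1" "\<kappa>\<^sup>2 \<le> 1" using k(1,2) mult_mono[of \<kappa> 1 "1 - \<kappa>" 1] by (auto simp: power_le_one)
  have X0: "0 \<le> v\<^sup>2 * A * (s1\<^sup>2 * a\<^sup>2)" using A by simp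
  have a1: "2 * \<kappa> * (1 - \<kappa>) * (v\<^sup>2 * A * (s1\<^sup>2 * a\<^sup>2)) \<le> 2 * (v\<^sup>2 * A * (s1\<^sup>2 * a\<^sup>2))"
    using mult_right_mono[OF kk(1) X0] by simp
  have a2: "4 * \<kappa>\<^sup>2 * (v\<^sup>2 * A * (s1\<^sup>2 * a\<^sup>2)) \<le> 4 * (v\<^sup>2 * A * (s1\<^sup>2 * a\<^sup>2))"
    using mult_right_mono[OF kk(2) X0] by simp
  have a3: "2 * \<kappa> * ((1 - \<kappa>) * (v\<^sup>2 * A * (t1\<^sup>2 * b\<^sup>2))) \<le> 2 * \<kappa> * (2 * v * t1 * N * A * b\<^sup>2)"
    using h2 k by (intro mult_left_mono) auto
  have a4: "- (v\<^sup>2 * (\<kappa> * (1 - \<kappa>) * A * (2 * (s1\<^sup>2 * a\<^sup>2 + t1\<^sup>2 * b\<^sup>2)))) \<le> v\<^sup>2 * (\<kappa> * (\<kappa> - 1) * A * (s1 * a + t1 * b)\<^sup>2)"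
  proof -
    have "v\<^sup>2 * (\<kappa> * (1 - \<kappa>) * A * (s1 * a + t1 * b)\<^sup>2) \<le> v\<^sup>2 * (\<kappa> * (1 - \<kappa>) * A * (2 * (s1\<^sup>2 * a\<^sup>2 + t1\<^sup>2 * b\<^sup>2)))"
      using sq k(1,2) A(1) by (intro mult_left_mono mult_nonneg_nonneg) auto
    then show ?thesis by (simp add: algebra_simps)
  qed
  have a5: "0 \<le> v\<^sup>2 * (\<kappa> * (N * A) * (s2 * a\<^sup>2 + t2 * b\<^sup>2))"
  proof -
    have "s2 \<ge> 0" using s2 p om by (smt (verit) mult_nonneg_nonneg)
    then show ?thesis using k(1,2) st A(1) t2 by (intro mult_nonneg_nonneg add_nonneg_nonneg) auto
  qed
  have "b\<^sup>2 / \<omega> = (1 / \<omega>) * b\<^sup>2" by simp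
  also have "... \<le> N\<^sup>2 * A * b\<^sup>2" unfolding A(3)[symmetric] by (intro mult_right_mono iom) auto
  finally have b: "b\<^sup>2 / \<omega> \<le> N\<^sup>2 * A * b\<^sup>2" .
  have R: "?R = 25 / (p * (p - 1)) * s2 * a\<^sup>2 + 2 * (N\<^sup>2 * A * b\<^sup>2)
     + 4 * v * \<kappa> * (N * A) * b * (s1 * a) + 2 * \<kappa> * (2 * v * t1 * N * A * b\<^sup>2)
     + v\<^sup>2 * (\<kappa> * (N * A) * (s2 * a\<^sup>2 + t2 * b\<^sup>2)) + v\<^sup>2 * (\<kappa> * (\<kappa> - 1) * A * (s1 * a + t1 * b)\<^sup>2)"
    unfolding A(2,3) A_def[symmetric] defs[symmetric] by (simp add: algebra_simps power2_eq_square)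
  have "- (v\<^sup>2 * (\<kappa> * (1 - \<kappa>) * A * (2 * (s1\<^sup>2 * a\<^sup>2 + t1\<^sup>2 * b\<^sup>2)))) = 
     - (2 * \<kappa> * (1 - \<kappa>) * (v\<^sup>2 * A * (s1\<^sup>2 * a\<^sup>2))) - 2 * \<kappa> * ((1 - \<kappa>) * (v\<^sup>2 * A * (t1\<^sup>2 * b\<^sup>2)))"
    by (simp add: algebra_simps)
  moreover have "4 * \<kappa>\<^sup>2 * v\<^sup>2 * A * s1\<^sup>2 * a\<^sup>2 = 4 * \<kappa>\<^sup>2 * (v\<^sup>2 * A * (s1\<^sup>2 * a\<^sup>2))" by simp
  ultimately show ?thesis unfolding R using b e1 h1 cross a1 a2 a3 a4 a5 by linarith
qed

definition bellman_N :: "real \<Rightarrow> real \<Rightarrow> real \<Rightarrow> real \<Rightarrow> real \<Rightarrow> real" where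
  "bellman_N p q e u v = reg_powr e p u + reg_powr e q v"

definition bellman :: "real \<Rightarrow> real \<Rightarrow> real \<Rightarrow> real \<Rightarrow> real \<Rightarrow> real" where
  "bellman p q e u v = 25 / (p * (p - 1)) * reg_powr e p u + bellman_N p q e u v powr (1 - 2/q) * v\<^sup>2"

text \<open>The derivative of \<open>bellman\<close> at \<open>(u, v)\<close> in the direction
  \<open>(a, b)\<close>; \<open>bellman2\<close> is the second derivative as a bilinear form in
  \<open>(a, b)\<close> and \<open>(a', b')\<close>. Written out, their linearity in the directions
  is plain algebra.\<close>

definition bellman1 :: "real \<Rightarrow> real \<Rightarrow> real \<Rightarrow> real \<Rightarrow> real \<Rightarrow> real \<Rightarrow> real \<Rightarrow> real" where
  "bellman1 p q e u v a b = 25 / (p * (p - 1)) * reg_powr1 e p u * a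
     + (1 - 2/q) * bellman_N p q e u v powr (1 - 2/q - 1) * (reg_powr1 e p u * a + reg_powr1 e q v * b) * v\<^sup>2
     + 2 * v * b * bellman_N p q e u v powr (1 - 2/q)"

definition bellman2 :: "real \<Rightarrow> real \<Rightarrow> real \<Rightarrow> real \<Rightarrow> real \<Rightarrow> real \<Rightarrow> real \<Rightarrow> real \<Rightarrow> real \<Rightarrow> real" where
  "bellman2 p q e u v a b a' b' = 25 / (p * (p - 1)) * reg_powr2 e p u * a * a'
     + 2 * bellman_N p q e u v powr (1 - 2/q) * b * b'
     + 2 * v * (1 - 2/q) * bellman_N p q e u v powr (1 - 2/q - 1) *
         (b * (reg_powr1 e p u * a' + reg_powr1 e q v * b') + b' * (reg_powr1 e p u * a + reg_powr1 e q v * b))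
     + v\<^sup>2 * ((1 - 2/q) * bellman_N p q e u v powr (1 - 2/q - 1) * (reg_powr2 e p u * a * a' + reg_powr2 e q v * b * b')
         + (1 - 2/q) * (1 - 2/q - 1) * bellman_N p q e u v powr (1 - 2/q - 2) *
           (reg_powr1 e p u * a + reg_powr1 e q v * b) * (reg_powr1 e p u * a' + reg_powr1 e q v * b'))"

section \<open>Derivatives, Hessian and size of the Bellman function\<close>

lemma bellman_N_pos: "e > 0 \<Longrightarrow> bellman_N p q e u v > 0"
  unfolding bellman_N_def by (intro add_pos_pos reg_powr_pos)

lemma has_derivative_bellman_N_powr:
  assumes e: "e > 0" and U: "(U has_derivative U') (at x)" and V: "(V has_derivative V') (at x)"
  shows "((\<lambda>x. bellman_N p q e (U x) (V x) powr c) has_derivative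
    (\<lambda>h. c * bellman_N p q e (U x) (V x) powr (c - 1) * (reg_powr1 e p (U x) * U' h + reg_powr1 e q (V x) * V' h))) (at x)"
proof (rule has_derivative_powr_const)
  show "((\<lambda>x. bellman_N p q e (U x) (V x)) has_derivative (\<lambda>h. reg_powr1 e p (U x) * U' h + reg_powr1 e q (V x) * V' h)) (at x)"
    unfolding bellman_N_def by (intro has_derivative_add has_derivative_reg_powr[OF e] U V)
qed (rule bellman_N_pos[OF e])

lemma has_derivative_bellman:
  assumes e: "e > 0" and U: "(U has_derivative U') (at x)" and V: "(V has_derivative V') (at x)"
  shows "((\<lambda>x. bellman p q e (U x) (V x)) has_derivative (\<lambda>h. bellman1 p q e (U x) (V x) (U' h) (V' h))) (at x)"
  unfolding bellman_def bellman1_def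
  by (rule has_derivative_eq_rhs[OF has_derivative_add[OF has_derivative_mult_right[OF has_derivative_reg_powr(1)[OF e U]]
        has_derivative_mult[OF has_derivative_bellman_N_powr[OF e U V] has_derivative_power[OF V]]]])
     (simp add: fun_eq_iff mult_ac)

lemma has_derivative_bellman1:
  assumes e: "e > 0" and U: "(U has_derivative U') (at x)" and V: "(V has_derivative V') (at x)"
    and X: "(X has_derivative X') (at x)" and Z: "(Z has_derivative Z') (at x)"
  shows "((\<lambda>x. bellman1 p q e (U x) (V x) (X x) (Z x)) has_derivative
    (\<lambda>h. bellman2 p q e (U x) (V x) (U' h) (V' h) (X x) (Z x) + bellman1 p q e (U x) (V x) (X' h) (Z' h))) (at x)"
proof -
  define \<kappa> where "\<kappa> = 1 - 2/q"
  have k: "1 - 2/q - 1 - 1 = \<kappa> - 2" "1 - 2/q - 1 = \<kappa> - 1" "1 - 2/q - 2 = \<kappa> - 2" "1 - 2/q = \<kappa>" by (auto simp: \<kappa>_def)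
  note dU = has_derivative_reg_powr(2)[OF e U] and dV = has_derivative_reg_powr(2)[OF e V] and dN = has_derivative_bellman_N_powr[OF e U V]
  show ?thesis
    unfolding bellman1_def
    by (rule has_derivative_eq_rhs[OF has_derivative_add[OF has_derivative_add[OF has_derivative_mult[OF has_derivative_mult_right[OF dU] X]
      has_derivative_mult[OF has_derivative_mult[OF has_derivative_mult_right[OF dN] has_derivative_add[OF has_derivative_mult[OF dU X] has_derivative_mult[OF dV Z]]]
        has_derivative_power[OF V]]] has_derivative_mult[OF has_derivative_mult[OF has_derivative_mult_right[OF V] Z] dN]]])
       (simp add: fun_eq_iff bellman2_def k, algebra?)
qed

lemma continuous_on_bellman:
  assumes e: "e > 0" and "continuous_on A U" "continuous_on A V"
  shows "continuous_on A (\<lambda>x. bellman p q e (U x) (V x))"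
    "continuous_on A X \<Longrightarrow> continuous_on A Z \<Longrightarrow> continuous_on A (\<lambda>x. bellman1 p q e (U x) (V x) (X x) (Z x))"
    "continuous_on A X \<Longrightarrow> continuous_on A Z \<Longrightarrow> continuous_on A X' \<Longrightarrow> continuous_on A Z' \<Longrightarrow>
      continuous_on A (\<lambda>x. bellman2 p q e (U x) (V x) (X x) (Z x) (X' x) (Z' x))"
proof -
  have N: "continuous_on A (\<lambda>x. bellman_N p q e (U x) (V x) powr c)" for c
  proof (rule continuous_on_powr[OF _ continuous_on_const])
    show "continuous_on A (\<lambda>x. bellman_N p q e (U x) (V x))"
      unfolding bellman_N_def by (intro continuous_on_add continuous_on_reg e assms)
    show "\<forall>x\<in>A. bellman_N p q e (U x) (V x) \<noteq> 0" using bellman_N_pos[OF e, of p q] by (metis less_irrefl)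
  qed
  note R = continuous_on_reg[OF e assms(2)] continuous_on_reg[OF e assms(3)]
  show "continuous_on A (\<lambda>x. bellman p q e (U x) (V x))"
    unfolding bellman_def by (intro continuous_on_add continuous_on_mult continuous_on_power continuous_on_const R N assms(2,3))
  show "continuous_on A X \<Longrightarrow> continuous_on A Z \<Longrightarrow> continuous_on A (\<lambda>x. bellman1 p q e (U x) (V x) (X x) (Z x))"
    unfolding bellman1_def by (intro continuous_on_add continuous_on_mult continuous_on_power continuous_on_const R N assms(2,3))
  show "continuous_on A X \<Longrightarrow> continuous_on A Z \<Longrightarrow> continuous_on A X' \<Longrightarrow> continuous_on A Z' \<Longrightarrow>
      continuous_on A (\<lambda>x. bellman2 p q e (U x) (V x) (X x) (Z x) (X' x) (Z' x))"
    unfolding bellman2_def by (intro continuous_on_add continuous_on_mult continuous_on_power continuous_on_const R N assms(2,3))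
qed

lemma conjugate_exponent_ge_2:
  fixes p q :: real
  assumes "1 < p" "p \<le> 2" "1/p + 1/q = 1"
  shows "q \<ge> 2"
proof -
  have "1/p \<ge> 1/2" "1/p < 1" using assms by (auto simp: field_simps)
  then have "1/q \<le> 1/2" "0 < 1/q" using assms(3) by linarith+
  then have "2 * (1/q) \<le> 1" "q > 0" by (simp_all only: zero_less_divide_1_iff)
  then show ?thesis by (simp add: field_simps)
qed

text \<open>The Hessian is bounded below with the reciprocal weights \<open>\<omega>\<close> and
  \<open>1 / \<omega>\<close> on the two components. With one component taken from each direction,
  the inequality of arithmetic and geometric means removes the weight. This is what lets a rotation
  of \<open>u\<close> be paired with a radial derivative of \<open>v\<close>.\<close>

lemma bellman2_ge:
  assumes p: "1 < p" "p \<le> 2" "1/p + 1/q = 1" and e: "e > 0"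
  shows "2 * \<bar>a\<bar> * \<bar>b'\<bar> \<le> bellman2 p q e u v a b a b + bellman2 p q e u v a' b' a' b'"
    "0 \<le> bellman2 p q e u v a b a b"
proof -
  define \<omega> where "\<omega> = (u\<^sup>2 + e) powr (p/2 - 1)"
  have om: "\<omega> > 0" using reg_pos[OF e, of u] by (simp add: \<omega>_def)
  have q: "q \<ge> 2" by (rule conjugate_exponent_ge_2[OF p])
  have *: "\<omega> * a\<^sup>2 + b\<^sup>2 / \<omega> \<le> bellman2 p q e u v a b a b" for a b
  proof -
    define k K where "k = 1 - 2/q" and "K = 25 / (p * (p - 1))"
    show ?thesis
      using bellman_Hessian_ge[OF p q e, where u=u and v=v and a=a and b=b, folded \<omega>_def k_def K_def]
      unfolding bellman2_def bellman_N_def k_def[symmetric] K_def[symmetric]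
      by (simp add: algebra_simps power2_eq_square)
  qed
  have nn: "0 \<le> \<omega> * a\<^sup>2" "0 \<le> b\<^sup>2 / \<omega>" for a b using om by auto
  show "0 \<le> bellman2 p q e u v a b a b" using *[of a b] nn(1)[of a] nn(2)[of b] by linarith
  have "2 * \<bar>a\<bar> * \<bar>b'\<bar> \<le> \<omega> * a\<^sup>2 + b'\<^sup>2 / \<omega>"
  proof -
    have "0 \<le> (\<omega> * \<bar>a\<bar> - \<bar>b'\<bar>)\<^sup>2 / \<omega>" using om by simp
    also have "... = \<omega> * a\<^sup>2 + b'\<^sup>2 / \<omega> - 2 * \<bar>a\<bar> * \<bar>b'\<bar>"
      using om by (simp add: power2_diff power_mult_distrib field_simps) (simp add: power2_eq_square)
    finally show ?thesis by simp
  qed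
  then show "2 * \<bar>a\<bar> * \<bar>b'\<bar> \<le> bellman2 p q e u v a b a b + bellman2 p q e u v a' b' a' b'"
    using *[of a b] *[of a' b'] nn(2)[of b] nn(1)[of a'] by linarith
qed

text \<open>Since \<open>v\<^sup>2\<close> is at most \<open>N powr (2/q)\<close>, the second term
  of \<open>bellman\<close> is at most \<open>N\<close>. The factor \<open>2 powr (q/2)\<close>
  serves both exponents because \<open>p \<le> q\<close>.\<close>

lemma bellman_bounds:
  assumes p: "1 < p" "p \<le> 2" "1/p + 1/q = 1" and e: "e > 0"
  shows "0 \<le> bellman p q e u v"
    "bellman p q e u v \<le> (25 / (p * (p - 1)) + 1) * 2 powr (q/2) * (\<bar>u\<bar> powr p + \<bar>v\<bar> powr q + e powr (p/2) + e powr (q/2))"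
proof -
  show "0 \<le> bellman p q e u v"
    unfolding bellman_def using p reg_powr_pos[OF e, of p u] by (intro add_nonneg_nonneg mult_nonneg_nonneg) auto
  have q: "q \<ge> 2" by (rule conjugate_exponent_ge_2[OF p])
  have rb: "reg_powr e a x \<le> 2 powr (q/2) * (\<bar>x\<bar> powr a + e powr (a/2))" if a: "0 < a" "a \<le> q" for a x
  proof -
    have "reg_powr e a x \<le> (2 * max (x\<^sup>2) e) powr (a/2)"
      unfolding reg_powr_def using e a by (intro powr_mono2) auto
    also have "... = 2 powr (a/2) * max (x\<^sup>2) e powr (a/2)" using e by (simp add: powr_mult)
    also have "... \<le> 2 powr (q/2) * (\<bar>x\<bar> powr a + e powr (a/2))"
    proof (intro mult_mono powr_mono)
      have "(x\<^sup>2) powr (a/2) = \<bar>x\<bar> powr a"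
      proof (cases "x = 0")
        case False
        then have "x\<^sup>2 = \<bar>x\<bar> powr 2" by simp
        then show ?thesis by (simp only: powr_powr) simp
      qed (use a in simp)
      then show "max (x\<^sup>2) e powr (a/2) \<le> \<bar>x\<bar> powr a + e powr (a/2)" by (auto simp: max_def)
    qed (use a in auto)
    finally show ?thesis .
  qed
  define N where "N = bellman_N p q e u v"
  have N: "N > 0" "reg_powr e p u \<le> N" "reg_powr e q v \<le> N"
    using bellman_N_pos[OF e] reg_powr_pos[OF e, of p u] reg_powr_pos[OF e, of q v] by (auto simp: N_def bellman_N_def)
  have "v\<^sup>2 \<le> reg_powr e q v powr (2/q)" using q e by (simp add: reg_powr_def powr_powr)
  also have "... \<le> N powr (2/q)" using N q reg_powr_pos[OF e, of q v] by (intro powr_mono2) auto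
  finally have "N powr (1 - 2/q) * v\<^sup>2 \<le> N powr (1 - 2/q) * N powr (2/q)" by (intro mult_left_mono) auto
  also have "... = N" using N by (simp flip: powr_add)
  finally have "bellman p q e u v \<le> 25 / (p * (p - 1)) * N + N"
    unfolding bellman_def N_def[symmetric] using N p by (intro add_mono mult_left_mono) auto
  also have "... = (25 / (p * (p - 1)) + 1) * N" by (simp add: algebra_simps)
  also have "... \<le> (25 / (p * (p - 1)) + 1) * (2 powr (q/2) * (\<bar>u\<bar> powr p + e powr (p/2)) + 2 powr (q/2) * (\<bar>v\<bar> powr q + e powr (q/2)))"
    unfolding N_def bellman_N_def using p q by (intro mult_left_mono add_mono rb) auto
  finally show "bellman p q e u v \<le> (25 / (p * (p - 1)) + 1) * 2 powr (q/2) * (\<bar>u\<bar> powr p + \<bar>v\<bar> powr q + e powr (p/2) + e powr (q/2))"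
    unfolding distrib_left[symmetric] mult.assoc by (simp only: add_ac)
qed

section \<open>The Riesz transforms\<close>

lemma has_real_derivative_sphere_integral:
  fixes f f' :: "real \<Rightarrow> R3 \<Rightarrow> real"
  assumes f: "\<And>r. continuous_on (sphere 0 1) (f r)"
    and der: "\<And>r x. norm x = 1 \<Longrightarrow> ((\<lambda>r. f r x) has_real_derivative f' r x) (at r)"
    and f': "continuous_on (UNIV \<times> sphere 0 1) (\<lambda>z. f' (fst z) (snd z))"
  shows "((\<lambda>r. \<ointegral>x. f r x) has_real_derivative (\<ointegral>x. f' r x)) (at r)"
proof -
  have "bounded ((\<lambda>z. f' (fst z) (snd z)) ` ({r - 1..r + 1} \<times> sphere 0 1))"
    by (intro compact_imp_bounded compact_continuous_image compact_Times continuous_on_subset[OF f']) auto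
  then obtain B where B: "\<forall>z \<in> {r - 1..r + 1} \<times> sphere 0 1. norm (f' (fst z) (snd z)) \<le> B"
    unfolding bounded_iff ball_simps by blast
  have B': "\<bar>f' s x\<bar> \<le> B" if "\<bar>s - r\<bar> < 1" "norm x = 1" for s x
    using bspec[OF B, of "(s, x)"] that by (auto simp: abs_diff_less_iff)
  show ?thesis
  proof (rule has_real_derivative_integral(1)[where e=1 and B="\<lambda>_. B"])
    show "integrable sigmaS (f s)" for s by (rule sphere_integrable[OF f])
  qed (use der B' in auto)
qed

lemma ang_has_derivative:
  assumes "(F has_derivative F') (at x)"
  shows "ang i F x = F' (cross3 (axis i 1) x)"
proof -
  have "ang i F x = cross3 x (grad F x) \<bullet> axis i 1" by (simp add: ang_def inner_axis)
  also have "... = grad F x \<bullet> cross3 (axis i 1) x" by (simp add: cross3_simps)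
  finally show ?thesis using grad_has_derivative[OF assms] by simp
qed

lemma poly3_has_derivative_ang:
  "poly3 q \<Longrightarrow> grad q x \<bullet> cross3 (axis i 1) x = ang i q x"
  using ang_has_derivative[OF poly3_has_derivative] by simp

lemma poly3_ang_sum:
  fixes c :: "nat \<Rightarrow> real"
  assumes "\<And>l. poly3 (Y l)"
  shows "ang i (\<lambda>x. \<Sum>l<N. c l * Y l x) = (\<lambda>x. \<Sum>l<N. c l * ang i (Y l) x)"
proof -
  have "pd j (\<lambda>x. \<Sum>l<N. c l * Y l x) x = (\<Sum>l<N. c l * pd j (Y l) x)" for j x
    by (subst poly3_pd_sum) (auto intro!: poly3_cmult assms simp: poly3_pd_cmult assms)
  then show ?thesis
    using exhaust_3[of i]
    by (intro ext, elim disjE)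
       (simp_all add: ang_simps sum_distrib_left right_diff_distrib sum_subtractf mult.left_commute)
qed

lemma sum_ang_ang_Harm:
  assumes Y: "\<And>l. Y l \<in> Harm l" and x: "norm x = 1"
  shows "(\<Sum>i\<in>UNIV. ang i (ang i (\<lambda>x. \<Sum>l<N. c l * Y l x)) x) = - (\<Sum>l<N. real l * (real l + 1) * (c l * Y l x))"
proof -
  have P: "poly3 (Y l)" for l by (rule HarmD(2)[OF Y])
  have "c l * ang 1 (ang 1 (Y l)) x + c l * ang 2 (ang 2 (Y l)) x + c l * ang 3 (ang 3 (Y l)) x
      = - (real l * (real l + 1) * (c l * Y l x))" for l
  proof -
    have s: "ang 1 (ang 1 (Y l)) x + ang 2 (ang 2 (Y l)) x + ang 3 (ang 3 (Y l)) x = - (real l * (real l + 1) * Y l x)"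
      using sum_ang_ang[OF HarmD(1)[OF Y], of l x] HarmD(3)[OF Y, of l] x by (simp add: norm_eq_1 distrib_left)
    show ?thesis using arg_cong[OF s, of "\<lambda>t. c l * t"] unfolding distrib_left mult_minus_right by (simp only: mult_ac)
  qed
  note * = this
  show ?thesis
    unfolding poly3_ang_sum[OF P] poly3_ang_sum[OF poly3_ang[OF P]] sum_3 sum.distrib[symmetric] * sum_negf[symmetric] ..
qed

lemma bellman1_linear:
  "bellman1 p q e u v (a + a') (b + b') = bellman1 p q e u v a b + bellman1 p q e u v a' b'"
  "bellman1 p q e u v (c * a) (c * b) = c * bellman1 p q e u v a b"
  unfolding bellman1_def by (simp_all only: distrib_left distrib_right mult_ac add_ac)

lemma bellman2_scale: "bellman2 p q e u v (c * a) (c * b) a' b' = c * bellman2 p q e u v a b a' b'"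
  unfolding bellman2_def by (simp only: distrib_left distrib_right mult_ac)

text \<open>The integrand is the i-th rotation field applied twice to the Bellman function of
  \<open>U\<close> and \<open>V\<close>, so its integral vanishes by rotation invariance.\<close>

lemma bellman_ang_integral:
  assumes e: "e > 0" and U: "poly3 U" and V: "poly3 V"
  shows "(\<ointegral>x. bellman2 p q e (U x) (V x) (ang i U x) (ang i V x) (ang i U x) (ang i V x)
     + bellman1 p q e (U x) (V x) (ang i (ang i U) x) (ang i (ang i V) x)) = 0"
proof -
  define F where "F x = bellman1 p q e (U x) (V x) (ang i U x) (ang i V x)" for x
  note P = U V poly3_ang[OF U, of i] poly3_ang[OF V, of i]
  have dF: "(F has_derivative (\<lambda>h. bellman2 p q e (U x) (V x) (grad U x \<bullet> h) (grad V x \<bullet> h) (ang i U x) (ang i V x)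
     + bellman1 p q e (U x) (V x) (grad (ang i U) x \<bullet> h) (grad (ang i V) x \<bullet> h))) (at x)" for x
    unfolding F_def by (intro has_derivative_bellman1[OF e] poly3_has_derivative P)
  have cg: "continuous_on (sphere 0 1) (grad F)"
  proof (subst continuous_on_componentwise, intro ballI)
    fix b :: R3 assume "b \<in> Basis"
    have "grad F x \<bullet> b = bellman2 p q e (U x) (V x) (grad U x \<bullet> b) (grad V x \<bullet> b) (ang i U x) (ang i V x)
     + bellman1 p q e (U x) (V x) (grad (ang i U) x \<bullet> b) (grad (ang i V) x \<bullet> b)" for x
      by (rule grad_has_derivative[OF dF])
    then show "continuous_on (sphere 0 1) (\<lambda>x. grad F x \<bullet> b)"
      by (simp only:) (intro continuous_on_add continuous_on_bellman[OF e] continuous_on_inner continuous_on_const poly3_continuous poly3_grad_continuous P)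
  qed
  have "(\<ointegral>x. cross3 x (grad F x) $ i) = 0"
    by (rule sphere_integral_cross[where F=F, OF has_derivative_grad cg]) (use dF in \<open>auto simp: differentiable_def\<close>)
  then show ?thesis
    unfolding ang_def[symmetric] ang_has_derivative[OF dF] poly3_has_derivative_ang[OF U] poly3_has_derivative_ang[OF V]
      poly3_has_derivative_ang[OF P(3)] poly3_has_derivative_ang[OF P(4)] .
qed

lemma continuous_Harm_sums:
  fixes c :: "nat \<Rightarrow> real \<Rightarrow> real"
  assumes "\<And>l. poly3 (Y l)" "\<And>l. continuous_on UNIV (c l)"
  shows "continuous_on A (\<lambda>z. \<Sum>l<N. c l (fst z) * Y l (snd z))"
  by (intro continuous_on_sum continuous_on_mult continuous_on_compose2[OF assms(2)] 
      continuous_on_compose2[OF poly3_continuous[OF assms(1), where A=UNIV]] continuous_on_fst continuous_on_snd continuous_on_id) auto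

lemma integral_Harm_sums:
  assumes Y: "\<And>l. Y l \<in> Harm l" and Z: "\<And>l. Z l \<in> Harm l"
  shows "(\<ointegral>x. (\<Sum>l<N. c l * Y l x) * (\<Sum>l<N. d l * Z l x)) = (\<Sum>l<N. c l * d l * (\<ointegral>x. Y l x * Z l x))"
proof -
  have i: "integrable sigmaS (\<lambda>x. c l * Y l x * (d k * Z k x))" for l k
    by (intro integrable_poly3 poly3_mult poly3_cmult HarmD(2)[OF Y] HarmD(2)[OF Z])
  have "(\<ointegral>x. (\<Sum>l<N. c l * Y l x) * (\<Sum>l<N. d l * Z l x))
    = (\<Sum>l<N. \<Sum>k<N. \<ointegral>x. c l * Y l x * (d k * Z k x))"
    unfolding sum_product by (simp add: lint_sum integrable_sum i)
  also have "... = (\<Sum>l<N. \<Sum>k<N. (c l * d k) * (\<ointegral>x. Y l x * Z k x))"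
    unfolding integral_mult_right_zero[symmetric] by (simp only: mult_ac)
  also have "... = (\<Sum>l<N. \<Sum>k<N. if l = k then c l * d l * (\<ointegral>x. Y l x * Z l x) else 0)"
    using Harm_orthogonal[OF Y Z] by (intro sum.cong refl) auto
  finally show ?thesis by simp
qed

text \<open>With \<open>u\<close>, \<open>v\<close> the harmonic extensions, \<open>\<phi>(r) = \<integral>B(u(r\<eta>), v(r\<eta>))d\<sigma>\<close> satisfies
  \<open>(r\<^sup>2\<phi>')' = \<integral>Hess B\<close>, which dominates \<open>2\<bar>A\<bar>\<close> where \<open>A(r) = \<integral>(r\<partial>\<^sub>rv)(J\<^sub>iu)d\<sigma>\<close>;
  the function \<open>a(r) = \<Sum>r\<^sup>2\<^sup>lb\<^sub>l/(2(2l+1))\<close> solves \<open>(r\<^sup>2a')' = A\<close>.\<close>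
lemma harmonic_bilinear_le_bellman:
  fixes p q e :: real and Y Z :: "nat \<Rightarrow> R3 \<Rightarrow> real"
  assumes p: "1 < p" "p \<le> 2" "1/p + 1/q = 1" and e: "e > 0"
    and Y: "\<And>l. Y l \<in> Harm l" and Z: "\<And>l. Z l \<in> Harm l"
  shows "\<bar>\<ointegral>x. (\<Sum>l<N. Z l x) * (\<Sum>l<N. slm l * ang i (Y l) x)\<bar>
     \<le> (\<ointegral>x. bellman p q e (\<Sum>l<N. Y l x) (\<Sum>l<N. Z l x))"
proof -
  note PY = HarmD(2)[OF Y] and PZ = HarmD(2)[OF Z]
  define S where "S c X x = (\<Sum>l<N. c l * X l x)" for c and X :: "nat \<Rightarrow> R3 \<Rightarrow> real" and x
  \<comment> \<open>Coefficients of the harmonic extensions and their radial derivatives: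
    \<open>c1\<close> and \<open>c2\<close> arise by \<open>r d/dr\<close>, while \<open>d1\<close>
    and \<open>d2\<close> are the plain derivatives of \<open>c0\<close> and \<open>c1\<close>, so
    that nothing is divided by \<open>r\<close> at 0.\<close>
  define c0 c1 c2 d1 d2 :: "real \<Rightarrow> nat \<Rightarrow> real" where
    "c0 = (\<lambda>r l. r ^ l)" and "c1 = (\<lambda>r l. real l * r ^ l)" and "c2 = (\<lambda>r l. real l * real l * r ^ l)"
    and "d1 = (\<lambda>r l. real l * r ^ (l - 1))" and "d2 = (\<lambda>r l. real l * (real l * r ^ (l - 1)))"
  have rd: "r * d1 r l = c1 r l" "r * d2 r l = c2 r l" for r l
    by (cases l; simp add: d1_def c1_def d2_def c2_def)+
  have rdS: "r * S (d1 r) X x = S (c1 r) X x" "r * S (d2 r) X x = S (c2 r) X x" for r X x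
    unfolding S_def sum_distrib_left by (simp_all only: mult.assoc[symmetric] rd)
  have pS: "poly3 (S c X)" if "\<And>l. poly3 (X l)" for c X
    unfolding S_def[abs_def] by (intro poly3_sum poly3_cmult that)
  note cS = poly3_continuous[OF pS[OF PY], where A="sphere 0 1"] poly3_continuous[OF pS[OF PZ], where A="sphere 0 1"]
  have cc: "continuous_on UNIV (\<lambda>r. c0 r l)" "continuous_on UNIV (\<lambda>r. c1 r l)" "continuous_on UNIV (\<lambda>r. c2 r l)"
    "continuous_on UNIV (\<lambda>r. d1 r l)" "continuous_on UNIV (\<lambda>r. d2 r l)" for l
    unfolding c0_def c1_def c2_def d1_def d2_def by (intro continuous_intros)+
  have jS0: "(\<And>l. continuous_on UNIV (\<lambda>r. c r l)) \<Longrightarrow> (\<And>l. poly3 (X l)) \<Longrightarrow> continuous_on A (\<lambda>z. S (c (fst z)) X (snd z))"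
    for c :: "real \<Rightarrow> nat \<Rightarrow> real" and X and A
    unfolding S_def by (rule continuous_Harm_sums[where c="\<lambda>l r. c r l"])
  note jS = jS0[OF cc(1) PY] jS0[OF cc(2) PY] jS0[OF cc(4) PY] jS0[OF cc(5) PY] jS0[OF cc(1) PZ] jS0[OF cc(2) PZ] jS0[OF cc(4) PZ] jS0[OF cc(5) PZ]
  have dS: "((\<lambda>r. S (c0 r) X x) has_real_derivative S (d1 r) X x) (at r)"
    "((\<lambda>r. S (c1 r) X x) has_real_derivative S (d2 r) X x) (at r)" for X x r
    unfolding S_def c0_def c1_def d1_def d2_def by (auto intro!: derivative_eq_intros sum.cong simp: mult_ac)
  note dS' = dS[unfolded has_field_derivative_def]
  \<comment> \<open>\<open>\<phi>1\<close> is the derivative of \<open>\<phi>\<close>,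
    \<open>P\<close> is \<open>r\<close> times that derivative, and \<open>P1\<close> is the
    integrand of the derivative of \<open>P\<close>.\<close>
  define \<phi> where "\<phi> r = (\<ointegral>x. bellman p q e (S (c0 r) Y x) (S (c0 r) Z x))" for r
  define \<phi>1 where "\<phi>1 r = (\<ointegral>x. bellman1 p q e (S (c0 r) Y x) (S (c0 r) Z x) (S (d1 r) Y x) (S (d1 r) Z x))" for r
  define P where "P r = (\<ointegral>x. bellman1 p q e (S (c0 r) Y x) (S (c0 r) Z x) (S (c1 r) Y x) (S (c1 r) Z x))" for r
  define P1 where "P1 r x = bellman2 p q e (S (c0 r) Y x) (S (c0 r) Z x) (S (d1 r) Y x) (S (d1 r) Z x) (S (c1 r) Y x) (S (c1 r) Z x)
     + bellman1 p q e (S (c0 r) Y x) (S (c0 r) Z x) (S (d2 r) Y x) (S (d2 r) Z x)" for r x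
  have dphi: "(\<phi> has_real_derivative \<phi>1 r) (at r)" for r
    unfolding \<phi>_def[abs_def] \<phi>1_def
  proof (rule has_real_derivative_sphere_integral)
    show "continuous_on (sphere 0 1) (\<lambda>x. bellman p q e (S (c0 r) Y x) (S (c0 r) Z x))" for r
      by (intro continuous_on_bellman[OF e] cS)
    show "((\<lambda>r. bellman p q e (S (c0 r) Y x) (S (c0 r) Z x)) has_real_derivative
        bellman1 p q e (S (c0 r) Y x) (S (c0 r) Z x) (S (d1 r) Y x) (S (d1 r) Z x)) (at r)" for r x
      unfolding has_field_derivative_def
      by (rule has_derivative_eq_rhs[OF has_derivative_bellman[OF e dS'(1) dS'(1)]])
         (simp add: fun_eq_iff bellman1_linear(2)[symmetric] mult.commute)
    show "continuous_on (UNIV \<times> sphere 0 1) (\<lambda>z. bellman1 p q e (S (c0 (fst z)) Y (snd z)) (S (c0 (fst z)) Z (snd z))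
        (S (d1 (fst z)) Y (snd z)) (S (d1 (fst z)) Z (snd z)))"
      by (intro continuous_on_bellman[OF e] jS)
  qed
  have dP: "(P has_real_derivative (\<ointegral>x. P1 r x)) (at r)" for r
    unfolding P_def[abs_def]
  proof (rule has_real_derivative_sphere_integral)
    show "continuous_on (sphere 0 1) (\<lambda>x. bellman1 p q e (S (c0 r) Y x) (S (c0 r) Z x) (S (c1 r) Y x) (S (c1 r) Z x))" for r
      by (intro continuous_on_bellman[OF e] cS)
    show "((\<lambda>r. bellman1 p q e (S (c0 r) Y x) (S (c0 r) Z x) (S (c1 r) Y x) (S (c1 r) Z x)) has_real_derivative P1 r x) (at r)" for r x
      unfolding has_field_derivative_def P1_def
      by (rule has_derivative_eq_rhs[OF has_derivative_bellman1[OF e dS'(1) dS'(1) dS'(2) dS'(2)]])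
         (simp add: fun_eq_iff mult.commute bellman1_linear(2) bellman2_scale distrib_left)
    show "continuous_on (UNIV \<times> sphere 0 1) (\<lambda>z. P1 (fst z) (snd z))"
      unfolding P1_def by (intro continuous_on_add continuous_on_bellman[OF e] jS)
  qed
  have rphi: "r * \<phi>1 r = P r" for r
    unfolding \<phi>1_def P_def integral_mult_right_zero[symmetric] bellman1_linear(2)[symmetric] rdS ..
  define u v where "u r = S (c0 r) Y" and "v r = S (c0 r) Z" for r
  define H where "H r j x = bellman2 p q e (u r x) (v r x) (ang j (u r) x) (ang j (v r) x) (ang j (u r) x) (ang j (v r) x)" for r j x
  define HE where "HE r x = bellman2 p q e (u r x) (v r x) (S (c1 r) Y x) (S (c1 r) Z x) (S (c1 r) Y x) (S (c1 r) Z x)" for r x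
  have puv: "poly3 (u r)" "poly3 (v r)" for r unfolding u_def v_def by (intro pS PY PZ)+
  have cH: "continuous_on (sphere 0 1) (H r j)" "continuous_on (sphere 0 1) (HE r)" for r j
    unfolding H_def[abs_def] HE_def[abs_def] by (intro continuous_on_bellman[OF e] poly3_continuous poly3_ang puv pS PY PZ)+
  \<comment> \<open>The left side is the derivative of \<open>r * P r\<close>, that is of
    \<open>r^2 \<phi>'\<close>. The first order terms combine by harmonicity: the \<open>c1\<close>
    and \<open>c2\<close> sums together are minus the sum of the squared rotations
    (\<open>KE\<close>), and \<open>bellman_ang_integral\<close> exchanges these for Hessian
    terms.\<close>
  have Q: "P r + r * (\<ointegral>x. P1 r x) = (\<ointegral>x. HE r x + (\<Sum>j\<in>UNIV. H r j x))" for r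
  proof -
    define K where "K j x = bellman1 p q e (u r x) (v r x) (ang j (ang j (u r)) x) (ang j (ang j (v r)) x)" for j x
    have cK: "continuous_on (sphere 0 1) (K j)" for j
      unfolding K_def[abs_def] by (intro continuous_on_bellman[OF e] poly3_continuous poly3_ang puv)
    have P1c: "continuous_on (sphere 0 1) (P1 r)"
      unfolding P1_def[abs_def] by (intro continuous_on_add continuous_on_bellman[OF e] cS)
    have KE: "(\<Sum>j\<in>UNIV. K j x) = - bellman1 p q e (u r x) (v r x) (S (c1 r) Y x + S (c2 r) Y x) (S (c1 r) Z x + S (c2 r) Z x)"
      if x: "norm x = 1" for x
    proof -
      have "S (c1 r) X x + S (c2 r) X x = (\<Sum>l<N. real l * (real l + 1) * (c0 r l * X l x))" for X
        unfolding S_def sum.distrib[symmetric] by (intro sum.cong) (auto simp: c0_def c1_def c2_def algebra_simps)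
      then have *: "(\<Sum>j\<in>UNIV. ang j (ang j (S (c0 r) X)) x) = - (S (c1 r) X x + S (c2 r) X x)" if "\<And>l. X l \<in> Harm l" for X
        using sum_ang_ang_Harm[OF that x, of "c0 r" N] by (simp add: S_def[abs_def])
      have "(\<Sum>j\<in>UNIV. K j x) = bellman1 p q e (u r x) (v r x) (\<Sum>j\<in>UNIV. ang j (ang j (u r)) x) (\<Sum>j\<in>UNIV. ang j (ang j (v r)) x)"
        by (simp add: K_def sum_3 bellman1_linear(1))
      also have "... = bellman1 p q e (u r x) (v r x) (-1 * (S (c1 r) Y x + S (c2 r) Y x)) (-1 * (S (c1 r) Z x + S (c2 r) Z x))"
        by (simp add: u_def v_def * Y Z)
      finally show ?thesis unfolding bellman1_linear(2) by simp
    qed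
    have "P r + r * (\<ointegral>x. P1 r x) = (\<ointegral>x. bellman1 p q e (u r x) (v r x) (S (c1 r) Y x) (S (c1 r) Z x) + r * P1 r x)"
      unfolding P_def u_def v_def
      by (subst lint_add)
         (auto intro!: sphere_integrable integrable_mult_right P1c continuous_on_bellman e cS)
    also have "... = (\<ointegral>x. HE r x - (\<Sum>j\<in>UNIV. K j x))"
    proof (rule lint_cong)
      fix x assume "x \<in> space sigmaS"
      then have x: "norm x = 1" by simp
      have "r * P1 r x = HE r x + bellman1 p q e (u r x) (v r x) (S (c2 r) Y x) (S (c2 r) Z x)"
        unfolding P1_def distrib_left bellman2_scale[symmetric] bellman1_linear(2)[symmetric] rdS HE_def u_def v_def ..
      then show "bellman1 p q e (u r x) (v r x) (S (c1 r) Y x) (S (c1 r) Z x) + r * P1 r x = HE r x - (\<Sum>j\<in>UNIV. K j x)"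
        unfolding KE[OF x] bellman1_linear(1) by simp
    qed simp
    also have "... = (\<ointegral>x. HE r x + (\<Sum>j\<in>UNIV. H r j x)) - (\<ointegral>x. (\<Sum>j\<in>UNIV. H r j x + K j x))"
      by (subst lint_diff[symmetric])
         (auto intro!: sphere_integrable continuous_on_add continuous_on_sum cH cK simp: sum.distrib simp del: lint_diff)
    also have "(\<ointegral>x. (\<Sum>j\<in>UNIV. H r j x + K j x)) = (\<Sum>j\<in>UNIV. \<ointegral>x. H r j x + K j x)"
      by (rule lint_sum) (intro sphere_integrable continuous_on_add cH cK)
    also have "... = 0" unfolding H_def K_def by (simp add: bellman_ang_integral[OF e puv])
    finally show ?thesis by simp
  qed
  define b where "b l = (\<ointegral>x. Z l x * ang i (Y l) x)" for l
  have orth: "(\<ointegral>x. (\<Sum>l<N. c l * Z l x) * (\<Sum>l<N. d l * ang i (Y l) x)) = (\<Sum>l<N. c l * d l * b l)" for c d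
    unfolding b_def by (rule integral_Harm_sums[OF Z Harm_ang[OF Y]])
  \<comment> \<open>On \<open>r^(2l)\<close> the operator \<open>a \<mapsto> (r^2 a')'\<close> is
    multiplication by \<open>2l(2l+1)\<close>, so the denominators leave \<open>l\<close> times
    \<open>b l\<close> times \<open>r^(2l)\<close>; at \<open>r = 1\<close>, twice \<open>a\<close>
    is the bilinear form to be bounded.\<close>
  define a where "a r = (\<Sum>l<N. b l / (2 * (2 * real l + 1)) * r ^ (2 * l))" for r :: real
  define a1 where "a1 r = (\<Sum>l<N. b l / (2 * (2 * real l + 1)) * (real (2 * l) * r ^ (2 * l - 1)))" for r :: real
  define A where "A r = (\<Sum>l<N. b l / (2 * (2 * real l + 1)) * (real (2 * l) * r ^ (2 * l)))" for r :: real
  define A1 where "A1 r = (\<Sum>l<N. b l / (2 * (2 * real l + 1)) * (real (2 * l) * (real (2 * l) * r ^ (2 * l - 1))))" for r :: real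
  have da: "(a has_real_derivative a1 r) (at r)" "(A has_real_derivative A1 r) (at r)" for r
    unfolding a_def[abs_def] A_def[abs_def] a1_def A1_def by (auto intro!: derivative_eq_intros sum.cong simp: mult_ac)
  have rr: "real (2 * l) * (r * r ^ (2 * l - 1)) = real (2 * l) * r ^ (2 * l)" for r :: real and l by (cases l) auto
  have ra: "r * a1 r = A r" for r
    unfolding a1_def A_def sum_distrib_left rr[of _ r, symmetric] by (intro sum.cong refl) (simp only: mult_ac)
  have EA: "A r + r * A1 r = (\<ointegral>x. S (c1 r) Z x * ang i (u r) x)" for r
  proof -
    have "A r + r * A1 r = (\<Sum>l<N. c1 r l * c0 r l * b l)"
      unfolding A_def A1_def sum_distrib_left sum.distrib[symmetric]
    proof (intro sum.cong refl)
      fix l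
      define K where "K = b l / (2 * (2 * real l + 1))"
      have gen: "K * (n * R) + K * n * (n * R) = K * n * (n + 1) * R" for n R :: real
        by (simp add: algebra_simps)
      have "r * (K * (real (2 * l) * (real (2 * l) * r ^ (2 * l - 1)))) = K * real (2 * l) * (real (2 * l) * (r * r ^ (2 * l - 1)))"
        by (simp only: mult_ac)
      then have "K * (real (2 * l) * r ^ (2 * l)) + r * (K * (real (2 * l) * (real (2 * l) * r ^ (2 * l - 1))))
         = K * real (2 * l) * (real (2 * l) + 1) * r ^ (2 * l)"
        unfolding rr by (simp only: gen)
      also have "K * real (2 * l) * (real (2 * l) + 1) = real l * b l"
        by (simp add: K_def divide_simps)
      also have "real l * b l * r ^ (2 * l) = c1 r l * c0 r l * b l" by (simp add: c1_def c0_def power_add mult_2)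
      finally show "b l / (2 * (2 * real l + 1)) * (real (2 * l) * r ^ (2 * l)) + r * (b l / (2 * (2 * real l + 1)) * (real (2 * l) * (real (2 * l) * r ^ (2 * l - 1))))
         = c1 r l * c0 r l * b l" unfolding K_def .
    qed
    then show ?thesis unfolding orth[symmetric] u_def S_def[abs_def] poly3_ang_sum[OF PY] .
  qed
  have main: "0 \<le> \<phi> 1 + \<tau> * (2 * a 1)" if \<tau>: "\<bar>\<tau>\<bar> = 1" for \<tau>
  proof -
    have lower: "0 \<le> (\<ointegral>x. HE r x + (\<Sum>j\<in>UNIV. H r j x)) + \<tau> * (2 * (\<ointegral>x. S (c1 r) Z x * ang i (u r) x))" for r
    proof -
      have "0 \<le> (\<ointegral>x. HE r x + (\<Sum>j\<in>UNIV. H r j x) + \<tau> * (2 * (S (c1 r) Z x * ang i (u r) x)))"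
      proof (rule Bochner_Integration.integral_nonneg)
        fix x
        have "\<bar>\<tau> * (2 * (S (c1 r) Z x * ang i (u r) x))\<bar> = 2 * \<bar>ang i (u r) x\<bar> * \<bar>S (c1 r) Z x\<bar>"
          using \<tau> by (simp add: abs_mult)
        also have "... \<le> H r i x + HE r x"
          unfolding H_def HE_def by (rule bellman2_ge(1)[OF p e])
        also have "... \<le> (\<Sum>j\<in>UNIV. H r j x) + HE r x"
          by (intro add_right_mono member_le_sum) (auto simp: H_def bellman2_ge(2)[OF p e])
        finally show "0 \<le> HE r x + (\<Sum>j\<in>UNIV. H r j x) + \<tau> * (2 * (S (c1 r) Z x * ang i (u r) x))" by linarith
      qed
      also have "... = (\<ointegral>x. HE r x + (\<Sum>j\<in>UNIV. H r j x)) + \<tau> * (2 * (\<ointegral>x. S (c1 r) Z x * ang i (u r) x))"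
        by (subst lint_add)
           (auto intro!: sphere_integrable continuous_intros cH cS poly3_continuous[OF poly3_ang[OF puv(1)]])
      finally show ?thesis .
    qed
    \<comment> \<open>\<open>R\<close> is \<open>r^2\<close> times the derivative of
      \<open>\<phi> + 2 \<tau> a\<close>. It vanishes at 0 and does not decrease, hence
      \<open>\<phi> + 2 \<tau> a\<close> does not decrease on the unit interval.\<close>
    define R where "R r = r * (P r + \<tau> * (2 * A r))" for r
    have dR: "(R has_real_derivative P r + \<tau> * (2 * A r) + r * ((\<ointegral>x. P1 r x) + \<tau> * (2 * A1 r))) (at r)" for r
      unfolding R_def[abs_def] by (auto intro!: derivative_eq_intros dP da)
    have R0: "R r \<ge> 0" if r: "0 \<le> r" for r
    proof -
      have "R 0 \<le> R r"
      proof (rule DERIV_nonneg_imp_nondecreasing[OF r])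
        fix s
        have "P s + \<tau> * (2 * A s) + s * ((\<ointegral>x. P1 s x) + \<tau> * (2 * A1 s))
          = (P s + s * (\<ointegral>x. P1 s x)) + \<tau> * (2 * (A s + s * A1 s))" by (simp add: algebra_simps)
        also have "... \<ge> 0" unfolding Q EA by (rule lower)
        finally show "\<exists>y. (R has_real_derivative y) (at s) \<and> 0 \<le> y" using dR by blast
      qed
      then show ?thesis by (simp add: R_def)
    qed
    define F where "F r = \<phi> r + \<tau> * (2 * a r)" for r
    have dF: "(F has_real_derivative \<phi>1 r + \<tau> * (2 * a1 r)) (at r)" for r
      unfolding F_def[abs_def] by (auto intro!: derivative_eq_intros dphi da)
    have "F 0 \<le> F 1"
    proof (rule DERIV_nonneg_imp_increasing_open[of 0 1])
      fix r :: real assume r: "0 < r" "r < 1"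
      have "R r = r\<^sup>2 * (\<phi>1 r + \<tau> * (2 * a1 r))"
        unfolding R_def rphi[symmetric] ra[symmetric] by (simp add: algebra_simps power2_eq_square)
      then have "\<phi>1 r + \<tau> * (2 * a1 r) \<ge> 0" using R0[of r] r by (simp add: zero_le_mult_iff)
      then show "\<exists>y. (F has_real_derivative y) (at r) \<and> 0 \<le> y" using dF by blast
    qed (auto intro!: continuous_at_imp_continuous_on DERIV_isCont[OF dF])
    \<comment> \<open>Since \<open>0 ^ 0 = 1\<close>, the term of degree 0 survives at the centre;
      its coefficient vanishes because rotation fields kill constants.\<close>
    moreover have "a 0 = 0"
    proof -
      have "ang i (Y 0) = (\<lambda>_. 0)"
        using exhaust_3[of i] hom_poly3_0_pd[OF HarmD(1)[OF Y]] by (elim disjE) (auto simp: ang_fun)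
      then have "b 0 = 0" by (simp add: b_def)
      then show ?thesis unfolding a_def by (intro sum.neutral) (auto simp: power_0_left)
    qed
    moreover have "\<phi> 0 \<ge> 0" unfolding \<phi>_def by (intro Bochner_Integration.integral_nonneg bellman_bounds(1)[OF p e])
    ultimately show ?thesis by (simp add: F_def)
  qed
  have "\<bar>2 * a 1\<bar> \<le> \<phi> 1" using main[of 1] main[of "-1"] by simp
  moreover have "2 * a 1 = (\<ointegral>x. (\<Sum>l<N. Z l x) * (\<Sum>l<N. slm l * ang i (Y l) x))"
  proof -
    have "2 * (b l / (2 * (2 * real l + 1)) * 1 ^ (2 * l)) = 1 * slm l * b l" for l
      by (simp add: divide_simps)
    then have "2 * a 1 = (\<Sum>l<N. 1 * slm l * b l)" unfolding a_def sum_distrib_left by presburger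
    then show ?thesis unfolding orth[symmetric] by (simp only: mult_1_left)
  qed
  moreover have "\<phi> 1 = (\<ointegral>x. bellman p q e (\<Sum>l<N. Y l x) (\<Sum>l<N. Z l x))"
    by (simp add: \<phi>_def S_def c0_def)
  ultimately show ?thesis by simp
qed

text \<open>The regularisation ends here: the constant from \<open>bellman_bounds\<close> does not
  depend on \<open>e\<close>, and the extra terms tend to 0 with it.\<close>

lemma harmonic_bilinear_bound:
  fixes p q :: real
  assumes p: "1 < p" "p \<le> 2" "1/p + 1/q = 1"
  obtains C where "C > 0" "\<And>i N Y Z. (\<And>l. Y l \<in> Harm l) \<Longrightarrow> (\<And>l. Z l \<in> Harm l) \<Longrightarrow>
    \<bar>\<ointegral>x. (\<Sum>l<N. Z l x) * (\<Sum>l<N. slm l * ang i (Y l) x)\<bar>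
      \<le> C * (Lpow p (hsum N Y) + Lpow q (hsum N Z))"
proof -
  have q: "q \<ge> 2" by (rule conjugate_exponent_ge_2[OF p])
  define C where "C = (25 / (p * (p - 1)) + 1) * 2 powr (q/2)"
  have C: "C > 0" using p by (auto simp: C_def intro!: mult_pos_pos add_pos_pos)
  show thesis
  proof (rule that[OF C])
    fix i N and Y Z :: "nat \<Rightarrow> R3 \<Rightarrow> real"
    assume Y: "\<And>l. Y l \<in> Harm l" and Z: "\<And>l. Z l \<in> Harm l"
    define u where "u x = (\<Sum>l<N. Y l x)" for x
    define v where "v x = (\<Sum>l<N. Z l x)" for x
    define X where "X = \<bar>\<ointegral>x. v x * (\<Sum>l<N. slm l * ang i (Y l) x)\<bar>"
    have cu: "continuous_on A u" "continuous_on A v" for A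
      unfolding u_def v_def by (intro continuous_on_sum Harm_continuous[OF Y] Harm_continuous[OF Z])+
    have iu: "integrable sigmaS (\<lambda>x. \<bar>u x\<bar> powr p)" "integrable sigmaS (\<lambda>x. \<bar>v x\<bar> powr q)"
      using continuous_inLp[OF cu(1), of p] continuous_inLp[OF cu(2), of q] p q by (auto simp: inLp_def)
    have le: "X \<le> C * (Lpow p u + Lpow q v + 4 * pi * (e powr (p/2) + e powr (q/2)))" if e: "e > 0" for e
    proof -
      have "X \<le> (\<ointegral>x. bellman p q e (u x) (v x))"
        unfolding X_def u_def v_def by (rule harmonic_bilinear_le_bellman[OF p e Y Z])
      also have "... \<le> (\<ointegral>x. C * (\<bar>u x\<bar> powr p + \<bar>v x\<bar> powr q + (e powr (p/2) + e powr (q/2))))"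
      proof (rule integral_mono)
        show "integrable sigmaS (\<lambda>x. bellman p q e (u x) (v x))"
          by (intro sphere_integrable continuous_on_bellman[OF e] cu)
        show "bellman p q e (u x) (v x) \<le> C * (\<bar>u x\<bar> powr p + \<bar>v x\<bar> powr q + (e powr (p/2) + e powr (q/2)))" for x
          using bellman_bounds(2)[OF p e, of "u x" "v x"] by (simp add: C_def add.assoc)
      qed (use iu in auto)
      also have "... = C * (Lpow p u + Lpow q v + 4 * pi * (e powr (p/2) + e powr (q/2)))"
        using iu by (simp add: Lpow_def)
      finally show ?thesis .
    qed
    have "((\<lambda>e. C * (Lpow p u + Lpow q v + 4 * pi * (e powr (p/2) + e powr (q/2)))) \<longlongrightarrow>
      C * (Lpow p u + Lpow q v + 4 * pi * (0 powr (p/2) + 0 powr (q/2)))) (at_right 0)"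
      by (intro tendsto_intros tendsto_powr') (use p q in \<open>auto intro!: eventually_at_rightI[of 0 1]\<close>)
    then have "X \<le> C * (Lpow p u + Lpow q v + 4 * pi * (0 powr (p/2) + 0 powr (q/2)))"
      by (rule tendsto_lowerbound) (auto intro!: eventually_at_rightI[of 0 1] le)
    then show "\<bar>\<ointegral>x. (\<Sum>l<N. Z l x) * (\<Sum>l<N. slm l * ang i (Y l) x)\<bar>
      \<le> C * (Lpow p (hsum N Y) + Lpow q (hsum N Z))"
      by (simp add: X_def u_def[abs_def] v_def[abs_def])
  qed
qed

text \<open>Padding with zero components brings two sums to the same length without changing their
  values.\<close>

definition trunc_Harm :: "nat \<Rightarrow> (nat \<Rightarrow> R3 \<Rightarrow> real) \<Rightarrow> nat \<Rightarrow> R3 \<Rightarrow> real" where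
  "trunc_Harm N Y l = (if l < N then Y l else (\<lambda>_. 0))"

lemma trunc_Harm: "Y l \<in> Harm l \<Longrightarrow> trunc_Harm N Y l \<in> Harm l"
  by (simp add: trunc_Harm_def Harm_0)

lemma sum_trunc_Harm:
  assumes "N \<le> M" "\<And>l. T l (\<lambda>_. 0) = (\<lambda>_. 0)"
  shows "(\<Sum>l<M. T l (trunc_Harm N Y l) x) = (\<Sum>l<N. T l (Y l) x)"
proof -
  have "(\<Sum>l<N. T l (Y l) x) = (\<Sum>l<N. T l (trunc_Harm N Y l) x)" by (simp add: trunc_Harm_def)
  also have "... = (\<Sum>l<M. T l (trunc_Harm N Y l) x)"
    by (rule sum.mono_neutral_left) (use assms in \<open>auto simp: trunc_Harm_def\<close>)
  finally show ?thesis ..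
qed

lemmas sum_trunc_Harm_id = sum_trunc_Harm[where T="\<lambda>_ Y. Y", simplified]

lemma converse_Holder_harmonic:
  fixes p q C :: real
  assumes pq: "p > 1" "q > 1" "1/p + 1/q = 1" and C: "C > 0"
  obtains K where "K > 0" "\<And>G A. integrable sigmaS G \<Longrightarrow> A \<ge> 0 \<Longrightarrow>
     (\<And>N Y. (\<And>l. Y l \<in> Harm l) \<Longrightarrow> \<bar>\<ointegral>x. G x * (\<Sum>l<N. Y l x)\<bar> \<le> C * (A + Lpow q (hsum N Y))) \<Longrightarrow>
     inLp p G \<and> Lpow p G \<le> K * A"
proof -
  obtain K where K: "K > 0" "\<forall>G A. integrable sigmaS G \<longrightarrow> A \<ge> 0 \<longrightarrow>
     (\<forall>\<phi>. poly3 \<phi> \<longrightarrow> \<bar>\<ointegral>x. G x * \<phi> x\<bar> \<le> C * (A + (\<ointegral>x. \<bar>\<phi> x\<bar> powr q))) \<longrightarrow>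
     integrable sigmaS (\<lambda>x. \<bar>G x\<bar> powr p) \<and> (\<ointegral>x. \<bar>G x\<bar> powr p) \<le> K * A"
    using converse_Holder[OF pq C] by blast
  show thesis
  proof (rule that[OF K(1)])
    fix G :: "R3 \<Rightarrow> real" and A :: real
    assume G: "integrable sigmaS G" and A: "A \<ge> 0"
      and t: "\<And>N Y. (\<And>l. Y l \<in> Harm l) \<Longrightarrow> \<bar>\<ointegral>x. G x * (\<Sum>l<N. Y l x)\<bar> \<le> C * (A + Lpow q (hsum N Y))"
    have "\<bar>\<ointegral>x. G x * \<phi> x\<bar> \<le> C * (A + (\<ointegral>x. \<bar>\<phi> x\<bar> powr q))" if \<phi>: "poly3 \<phi>" for \<phi>
    proof -
      obtain N Y where Y: "\<And>l. Y l \<in> Harm l" "\<And>x. norm x = 1 \<Longrightarrow> \<phi> x = (\<Sum>l<N. Y l x)"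
        by (rule poly3_harmonic_decomposition[OF \<phi>]) (rule that)
      have "(\<ointegral>x. G x * \<phi> x) = (\<ointegral>x. G x * (\<Sum>l<N. Y l x))"
        by (rule lint_cong) (auto simp: Y(2))
      moreover have "(\<ointegral>x. \<bar>\<phi> x\<bar> powr q) = Lpow q (hsum N Y)"
        unfolding Lpow_def by (rule lint_cong) (auto simp: Y(2))
      ultimately show ?thesis using t[OF Y(1)] by simp
    qed
    then show "inLp p G \<and> Lpow p G \<le> K * A" using K(2) G A borel_measurable_integrable[OF G] unfolding inLp_def Lpow_def real_norm_def by simp
  qed
qed

lemma conjugate_exponent:
  fixes p :: real
  assumes "p > 1"
  obtains q where "q > 1" "1/p + 1/q = 1" "p > 2 \<Longrightarrow> q \<le> 2"
proof (rule that[of "p / (p - 1)"])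
  show "p / (p - 1) \<le> 2" if "p > 2" using that by (simp add: field_simps)
qed (use assms in \<open>auto simp: field_simps\<close>)

lemma ang_0 [simp]: "ang i (\<lambda>_. 0) = (\<lambda>_. 0)"
  using exhaust_3[of i] by (elim disjE) (auto simp: ang_fun)

text \<open>For \<open>p > 2\<close> the two functions exchange their roles, \<open>J\<^sub>i\<close> being antisymmetric.\<close>
lemma harm_bounded_ang:
  assumes p: "p > 1"
  shows "harm_bounded p (\<lambda>l Y x. slm l * ang i Y x)"
proof -
  define T where "T l Y x = slm l * ang i Y x" for l Y x
  have T0: "T l (\<lambda>_. 0) = (\<lambda>_. 0)" for l by (simp add: T_def[abs_def])
  have cT: "continuous_on (sphere 0 1) (T l Y)" if "Y \<in> Harm l" for l Y
    unfolding T_def[abs_def] by (intro continuous_on_mult continuous_on_const poly3_continuous poly3_ang HarmD(2)[OF that])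
  obtain q where q: "q > 1" "1/p + 1/q = 1" "p > 2 \<Longrightarrow> q \<le> 2" using conjugate_exponent[OF p] by blast
  have "\<exists>C>0. \<forall>N Y Z. (\<forall>l. Y l \<in> Harm l) \<longrightarrow> (\<forall>l. Z l \<in> Harm l) \<longrightarrow>
     \<bar>\<ointegral>x. (\<Sum>l<N. T l (Y l) x) * (\<Sum>l<N. Z l x)\<bar> \<le> C * (Lpow p (hsum N Y) + Lpow q (hsum N Z))"
  proof (cases "p \<le> 2")
    case True
    obtain C where C: "C > 0" "\<And>i N Y Z. (\<And>l. Y l \<in> Harm l) \<Longrightarrow> (\<And>l. Z l \<in> Harm l) \<Longrightarrow>
      \<bar>\<ointegral>x. (\<Sum>l<N. Z l x) * (\<Sum>l<N. slm l * ang i (Y l) x)\<bar>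
        \<le> C * (Lpow p (hsum N Y) + Lpow q (hsum N Z))"
      using harmonic_bilinear_bound[OF p True q(2)] by blast
    show ?thesis
    proof (intro exI[of _ C] conjI allI impI C(1))
      fix N and Y Z :: "nat \<Rightarrow> R3 \<Rightarrow> real" assume "\<forall>l. Y l \<in> Harm l" "\<forall>l. Z l \<in> Harm l"
      moreover have "(\<ointegral>x. (\<Sum>l<N. T l (Y l) x) * (\<Sum>l<N. Z l x)) = (\<ointegral>x. (\<Sum>l<N. Z l x) * (\<Sum>l<N. T l (Y l) x))"
        by (simp only: mult.commute)
      ultimately show "\<bar>\<ointegral>x. (\<Sum>l<N. T l (Y l) x) * (\<Sum>l<N. Z l x)\<bar> \<le> C * (Lpow p (hsum N Y) + Lpow q (hsum N Z))"
        using C(2)[of Y Z N i] by (simp only: T_def)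
    qed
  next
    case False
    then have q2: "q \<le> 2" "1/q + 1/p = 1" using q by auto
    obtain C where C: "C > 0" "\<And>i N Y Z. (\<And>l. Y l \<in> Harm l) \<Longrightarrow> (\<And>l. Z l \<in> Harm l) \<Longrightarrow>
      \<bar>\<ointegral>x. (\<Sum>l<N. Z l x) * (\<Sum>l<N. slm l * ang i (Y l) x)\<bar>
        \<le> C * (Lpow q (hsum N Y) + Lpow p (hsum N Z))"
      using harmonic_bilinear_bound[OF q(1) q2] by blast
    have "(\<ointegral>x. (\<Sum>l<N. T l (Y l) x) * (\<Sum>l<N. Z l x)) = - (\<ointegral>x. (\<Sum>l<N. Y l x) * (\<Sum>l<N. T l (Z l) x))"
      if Y: "\<And>l. Y l \<in> Harm l" and Z: "\<And>l. Z l \<in> Harm l" for N Y Z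
    proof -
      have "(\<ointegral>x. (\<Sum>l<N. T l (Y l) x) * (\<Sum>l<N. Z l x)) = (\<Sum>l<N. 1 / (2 * real l + 1) * 1 * (\<ointegral>x. ang i (Y l) x * Z l x))"
        using integral_Harm_sums[where Y="\<lambda>l. ang i (Y l)" and Z=Z and c="\<lambda>l. 1 / (2 * real l + 1)" and d="\<lambda>_. 1" and N=N, OF Harm_ang[OF Y] Z]
        by (simp add: T_def)
      also have "... = - (\<Sum>l<N. 1 * slm l * (\<ointegral>x. Y l x * ang i (Z l) x))"
        unfolding sum_negf[symmetric] by (intro sum.cong refl) (simp add: ang_ibp HarmD(2)[OF Y] HarmD(2)[OF Z])
      also have "... = - (\<ointegral>x. (\<Sum>l<N. Y l x) * (\<Sum>l<N. T l (Z l) x))"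
        using integral_Harm_sums[where Y=Y and Z="\<lambda>l. ang i (Z l)" and c="\<lambda>_. 1" and d="\<lambda>l. 1 / (2 * real l + 1)" and N=N, OF Y Harm_ang[OF Z]]
        by (simp add: T_def)
      finally show ?thesis .
    qed
    note eq = this
    show ?thesis
    proof (intro exI[of _ C] conjI allI impI C(1))
      fix N and Y Z :: "nat \<Rightarrow> R3 \<Rightarrow> real" assume Y: "\<forall>l. Y l \<in> Harm l" and Z: "\<forall>l. Z l \<in> Harm l"
      show "\<bar>\<ointegral>x. (\<Sum>l<N. T l (Y l) x) * (\<Sum>l<N. Z l x)\<bar> \<le> C * (Lpow p (hsum N Y) + Lpow q (hsum N Z))"
        unfolding eq[OF spec[OF Y] spec[OF Z]] abs_minus_cancel
        using C(2)[OF spec[OF Z] spec[OF Y], of N i] by (simp only: T_def add.commute)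
    qed
  qed
  then obtain C where C: "C > 0" "\<forall>N Y Z. (\<forall>l. Y l \<in> Harm l) \<longrightarrow> (\<forall>l. Z l \<in> Harm l) \<longrightarrow>
     \<bar>\<ointegral>x. (\<Sum>l<N. T l (Y l) x) * (\<Sum>l<N. Z l x)\<bar> \<le> C * (Lpow p (hsum N Y) + Lpow q (hsum N Z))"
    by blast
  obtain K where K: "K > 0" "\<And>G A. integrable sigmaS G \<Longrightarrow> A \<ge> 0 \<Longrightarrow>
     (\<And>N Y. (\<And>l. Y l \<in> Harm l) \<Longrightarrow> \<bar>\<ointegral>x. G x * (\<Sum>l<N. Y l x)\<bar> \<le> C * (A + Lpow q (hsum N Y))) \<Longrightarrow>
     inLp p G \<and> Lpow p G \<le> K * A"
    using converse_Holder_harmonic[OF p q(1,2) C(1)] by blast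
  have "harm_bounded p T"
  proof (rule harm_boundedI[where C=K])
    fix N and Y :: "nat \<Rightarrow> R3 \<Rightarrow> real" assume Y: "\<And>l. Y l \<in> Harm l"
    have "inLp p (\<lambda>x. \<Sum>l<N. T l (Y l) x) \<and> Lpow p (\<lambda>x. \<Sum>l<N. T l (Y l) x) \<le> K * Lpow p (hsum N Y)"
    proof (rule K(2))
      show "integrable sigmaS (\<lambda>x. \<Sum>l<N. T l (Y l) x)"
        by (intro sphere_integrable continuous_on_sum cT Y)
      fix M and Z :: "nat \<Rightarrow> R3 \<Rightarrow> real" assume Z: "\<And>l. Z l \<in> Harm l"
      have "\<bar>\<ointegral>x. (\<Sum>l<max N M. T l (trunc_Harm N Y l) x) * (\<Sum>l<max N M. trunc_Harm M Z l x)\<bar>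
        \<le> C * (Lpow p (\<lambda>x. \<Sum>l<max N M. trunc_Harm N Y l x) + Lpow q (\<lambda>x. \<Sum>l<max N M. trunc_Harm M Z l x))"
        by (rule C(2)[rule_format]) (intro trunc_Harm Y Z)+
      then show "\<bar>\<ointegral>x. (\<Sum>l<N. T l (Y l) x) * (\<Sum>l<M. Z l x)\<bar>
        \<le> C * (Lpow p (hsum N Y) + Lpow q (hsum M Z))"
        by (simp only: sum_trunc_Harm[where T=T, OF max.cobounded1 T0] sum_trunc_Harm_id[OF max.cobounded1] sum_trunc_Harm_id[OF max.cobounded2])
    qed simp
    then show "Lpow p (\<lambda>x. \<Sum>l<N. T l (Y l) x) \<le> K * Lpow p (hsum N Y)" ..
  qed
  then show ?thesis unfolding T_def .
qed

lemma harm_bounded_vec: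
  fixes T :: "nat \<Rightarrow> (R3 \<Rightarrow> real) \<Rightarrow> R3 \<Rightarrow> R3"
  assumes p: "p \<ge> 1" and cT: "\<And>l Y. Y \<in> Harm l \<Longrightarrow> continuous_on (sphere 0 1) (T l Y)"
    and b: "\<And>i. harm_bounded p (\<lambda>l Y x. T l Y x $ i)"
  shows "harm_bounded p T"
proof -
  have "\<forall>i. \<exists>C\<ge>0. \<forall>N Y. (\<forall>l. Y l \<in> Harm l) \<longrightarrow> Lpow p (\<lambda>x. \<Sum>l<N. T l (Y l) x $ i) \<le> C * Lpow p (hsum N Y)"
    using b unfolding harm_bounded_def by blast
  from choice[OF this] obtain C where "\<forall>i. C i \<ge> 0 \<and> (\<forall>N Y. (\<forall>l. Y l \<in> Harm l) \<longrightarrow> Lpow p (\<lambda>x. \<Sum>l<N. T l (Y l) x $ i) \<le> C i * Lpow p (hsum N Y))"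
    ..
  then have C: "\<And>i N Y. (\<And>l. Y l \<in> Harm l) \<Longrightarrow> Lpow p (\<lambda>x. \<Sum>l<N. T l (Y l) x $ i) \<le> C i * Lpow p (hsum N Y)"
    by blast
  show ?thesis
  proof (rule harm_boundedI[where C="3 powr p * (\<Sum>i\<in>UNIV. C i)"])
    fix N and Y :: "nat \<Rightarrow> R3 \<Rightarrow> real" assume Y: "\<And>l. Y l \<in> Harm l"
    define f where "f x = (\<Sum>l<N. T l (Y l) x)" for x
    have cf: "continuous_on (sphere 0 1) f" unfolding f_def by (intro continuous_on_sum cT Y)
    have i: "inLp p f" "inLp p (\<lambda>x. f x $ i)" for i
      using p by (auto intro!: continuous_inLp cf continuous_on_component)
    have pt: "norm v powr p \<le> 3 powr p * (\<Sum>i\<in>UNIV. norm (v $ i) powr p)" for v :: R3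
    proof -
      define m where "m = Max (range (\<lambda>i. norm (v $ i)))"
      have m: "norm (v $ i) \<le> m" for i unfolding m_def by (rule Max_ge) auto
      have "m \<in> range (\<lambda>i. norm (v $ i))" unfolding m_def by (rule Max_in) auto
      then obtain j where j: "m = norm (v $ j)" by blast
      have "norm v \<le> (\<Sum>i\<in>UNIV. norm (v $ i))" by (simp add: norm_le_l1_cart)
      also have "... \<le> 3 * m" using m[of 1] m[of 2] m[of 3] by (simp add: sum_3)
      finally have "norm v powr p \<le> (3 * m) powr p" using p by (intro powr_mono2) auto
      also have "... = 3 powr p * norm (v $ j) powr p" using j by (simp add: powr_mult)
      also have "... \<le> 3 powr p * (\<Sum>i\<in>UNIV. norm (v $ i) powr p)" by (intro mult_left_mono member_le_sum) auto
      finally show ?thesis .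
    qed
    have "Lpow p f \<le> (\<ointegral>x. 3 powr p * (\<Sum>i\<in>UNIV. norm (f x $ i) powr p))"
      unfolding Lpow_def using i pt by (intro integral_mono) (auto simp: inLp_def)
    also have "... = 3 powr p * (\<Sum>i\<in>UNIV. Lpow p (\<lambda>x. f x $ i))"
      using i by (simp add: Lpow_def inLp_def lint_sum)
    also have "... \<le> 3 powr p * (\<Sum>i\<in>UNIV. C i * Lpow p (hsum N Y))"
      using C[OF Y] by (intro mult_left_mono sum_mono) (auto simp: f_def)
    finally show "Lpow p (\<lambda>x. \<Sum>l<N. T l (Y l) x) \<le> 3 powr p * (\<Sum>i\<in>UNIV. C i) * Lpow p (hsum N Y)"
      by (simp add: f_def[abs_def] sum_distrib_right mult.assoc)
  qed
qed

section \<open>Derivatives of the Poisson and the elastic kernel\<close>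

text \<open>The gradient of the Poisson kernel in \<open>x\<close>; \<open>PkH i\<close> is the
  gradient of its i-th component, a row of the Hessian.\<close>

definition PkG :: "R3 \<Rightarrow> R3 \<Rightarrow> R3" where
  "PkG x y = (1 / (4 * pi)) *\<^sub>R ((- 2 * inverse (norm (x - y)) ^ 3) *\<^sub>R x
     - (3 * (1 - x \<bullet> x) * inverse (norm (x - y)) ^ 5) *\<^sub>R (x - y))"

definition PkH :: "3 \<Rightarrow> R3 \<Rightarrow> R3 \<Rightarrow> R3" where
  "PkH i x y = (1 / (4 * pi)) *\<^sub>R ((- 2 * inverse (norm (x - y)) ^ 3 - 3 * (1 - x \<bullet> x) * inverse (norm (x - y)) ^ 5) *\<^sub>R axis i 1
     + (6 * x $ i * inverse (norm (x - y)) ^ 5 + 15 * (1 - x \<bullet> x) * (x - y) $ i * inverse (norm (x - y)) ^ 7) *\<^sub>R (x - y)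
     + (6 * (x - y) $ i * inverse (norm (x - y)) ^ 5) *\<^sub>R x)"

lemma has_derivative_inverse_norm:
  assumes "x \<noteq> y"
  shows "((\<lambda>x. inverse (norm (x - y))) has_derivative (\<lambda>h. - (inverse (norm (x - y)) ^ 3) * ((x - y) \<bullet> h))) (at (x :: R3))"
proof -
  have "((\<lambda>x. inverse (norm (y - x))) has_derivative (\<lambda>h. (inverse (norm (y - x)) ^ 3 *\<^sub>R (y - x)) \<bullet> h)) (at x)"
    by (rule has_derivative_inverse_norm_diff) (use assms in auto)
  moreover have "(\<lambda>h. (inverse (norm (y - x)) ^ 3 *\<^sub>R (y - x)) \<bullet> h) = (\<lambda>h. - (inverse (norm (x - y)) ^ 3) * ((x - y) \<bullet> h))"
    by (simp add: fun_eq_iff norm_minus_commute inner_diff_left algebra_simps)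
  ultimately show ?thesis by (simp add: norm_minus_commute)
qed

lemma has_derivative_inner_self: "((\<lambda>x. x \<bullet> x) has_derivative (\<lambda>h. 2 * (x \<bullet> h))) (at (x :: R3))"
  by (rule has_derivative_eq_rhs[OF has_derivative_inner[OF has_derivative_ident has_derivative_ident]]) (simp add: inner_commute)

lemma Pker_has_derivative:
  assumes "x \<noteq> y"
  shows "((\<lambda>x. Pker x y) has_derivative (\<lambda>h. PkG x y \<bullet> h)) (at x)"
proof -
  note d = has_derivative_inverse_norm[OF assms]
  define \<rho> where "\<rho> = inverse (norm (x - y))"
  have "((\<lambda>x. (1 / (4 * pi)) * ((1 - x \<bullet> x) * inverse (norm (x - y)) ^ 3)) has_derivative
     (\<lambda>h. (1 / (4 * pi)) * ((1 - x \<bullet> x) * (of_nat 3 * (- (\<rho> ^ 3) * ((x - y) \<bullet> h)) * \<rho> ^ (3 - 1)) + (0 - 2 * (x \<bullet> h)) * \<rho> ^ 3))) (at x)"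
    unfolding \<rho>_def
    by (intro has_derivative_mult_right has_derivative_mult has_derivative_power d has_derivative_diff has_derivative_const has_derivative_inner_self)
  moreover have "(1 / (4 * pi)) * ((1 - x \<bullet> x) * (of_nat 3 * (- (\<rho> ^ 3) * ((x - y) \<bullet> h)) * \<rho> ^ (3 - 1)) + (0 - 2 * (x \<bullet> h)) * \<rho> ^ 3) = PkG x y \<bullet> h" for h
    unfolding PkG_def \<rho>_def[symmetric] by (simp add: inner_diff_left algebra_simps eval_nat_numeral)
  ultimately show ?thesis
    by (simp add: Pker_inverse power2_norm_eq_inner mult.assoc)
qed

lemma PkG_has_derivative:
  assumes "x \<noteq> y"
  shows "((\<lambda>x. PkG x y $ i) has_derivative (\<lambda>h. PkH i x y \<bullet> h)) (at x)"
proof -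
  note d = has_derivative_inverse_norm[OF assms]
  define \<rho> where "\<rho> = inverse (norm (x - y))"
  have "((\<lambda>x. (1 / (4 * pi)) * (- 2 * inverse (norm (x - y)) ^ 3 * x $ i - 3 * (1 - x \<bullet> x) * inverse (norm (x - y)) ^ 5 * (x $ i - y $ i))) has_derivative
     (\<lambda>h. (1 / (4 * pi)) * ((- 2 * \<rho> ^ 3 * h $ i + - 2 * (of_nat 3 * (- (\<rho> ^ 3) * ((x - y) \<bullet> h)) * \<rho> ^ (3 - 1)) * x $ i)
       - (3 * (1 - x \<bullet> x) * \<rho> ^ 5 * (h $ i - 0)
          + (3 * (1 - x \<bullet> x) * (of_nat 5 * (- (\<rho> ^ 3) * ((x - y) \<bullet> h)) * \<rho> ^ (5 - 1)) + 3 * (0 - 2 * (x \<bullet> h)) * \<rho> ^ 5) * (x $ i - y $ i))))) (at x)"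
    unfolding \<rho>_def
    by (intro has_derivative_mult_right has_derivative_mult has_derivative_power d has_derivative_diff has_derivative_const
        has_derivative_inner_self has_derivative_vec_nth)
  moreover have "(1 / (4 * pi)) * ((- 2 * \<rho> ^ 3 * h $ i + - 2 * (of_nat 3 * (- (\<rho> ^ 3) * ((x - y) \<bullet> h)) * \<rho> ^ (3 - 1)) * x $ i)
       - (3 * (1 - x \<bullet> x) * \<rho> ^ 5 * (h $ i - 0)
          + (3 * (1 - x \<bullet> x) * (of_nat 5 * (- (\<rho> ^ 3) * ((x - y) \<bullet> h)) * \<rho> ^ (5 - 1)) + 3 * (0 - 2 * (x \<bullet> h)) * \<rho> ^ 5) * (x $ i - y $ i)))
     = PkH i x y \<bullet> h" for h
  proof -
    have a: "axis i 1 \<bullet> h = h $ i" by (simp add: inner_axis')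
    show ?thesis
      unfolding PkH_def \<rho>_def[symmetric] inner_scaleR_left inner_add_left a
      by (simp add: algebra_simps eval_nat_numeral)
  qed
  ultimately show ?thesis by (simp add: PkG_def)
qed

lemma continuous_on_kernels:
  assumes "continuous_on A f" "continuous_on A g" "\<And>x. x \<in> A \<Longrightarrow> f x \<noteq> g x"
  shows "continuous_on A (\<lambda>x. PkG (f x) (g x))" "continuous_on A (\<lambda>x. PkH i (f x) (g x))"
  unfolding PkG_def PkH_def by (intro continuous_intros assms; use assms(3) in force)+

lemma bounded_cball_sphere:
  fixes f :: "R3 \<Rightarrow> R3 \<Rightarrow> 'b::real_normed_vector"
  assumes "continuous_on (ball 0 1 \<times> sphere 0 1) (\<lambda>z. f (fst z) (snd z))" "R < 1"
  obtains C where "C > 0" "\<And>x y. norm x \<le> R \<Longrightarrow> norm y = 1 \<Longrightarrow> norm (f x y) \<le> C"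
proof -
  have "bounded ((\<lambda>z. f (fst z) (snd z)) ` (cball 0 R \<times> sphere 0 1))"
    by (intro compact_imp_bounded compact_continuous_image compact_Times continuous_on_subset[OF assms(1)]) (use assms(2) in auto)
  then obtain C where C: "C > 0" "\<forall>z\<in>cball 0 R \<times> sphere 0 1. norm (f (fst z) (snd z)) \<le> C"
    unfolding bounded_pos ball_simps by blast
  show thesis by (rule that[OF C(1)]) (use bspec[OF C(2), of "(_, _)"] in auto)
qed

text \<open>Differentiation under the integral along a coordinate line. The dominating function may
  depend on the radius \<open>R < 1\<close>, as suits kernels that blow up at the sphere.\<close>

lemma pd_integral:
  fixes k :: "R3 \<Rightarrow> 'w \<Rightarrow> real" and g :: "R3 \<Rightarrow> 'w \<Rightarrow> R3"
  assumes x: "norm x < 1"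
    and int: "\<And>y. norm y < 1 \<Longrightarrow> integrable M (k y)"
    and der: "\<And>y w. norm y < 1 \<Longrightarrow> w \<in> space M \<Longrightarrow> ((\<lambda>y. k y w) has_derivative (\<lambda>h. g y w \<bullet> h)) (at y)"
    and B: "\<And>R. R < 1 \<Longrightarrow> \<exists>B. integrable M B \<and> (\<forall>y w. norm y \<le> R \<longrightarrow> w \<in> space M \<longrightarrow> norm (g y w) \<le> B w)"
  shows "pd i (\<lambda>y. \<integral>w. k y w \<partial>M) x = (\<integral>w. g x w $ i \<partial>M)" "integrable M (\<lambda>w. g x w $ i)"
proof -
  define e where "e = (1 - norm x) / 2"
  have e: "e > 0" "norm x + e < 1" using x by (auto simp: e_def field_simps)
  obtain B where B: "integrable M B" "\<And>y w. norm y \<le> norm x + e \<Longrightarrow> w \<in> space M \<Longrightarrow> norm (g y w) \<le> B w"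
    using assms(4)[OF e(2)] by blast
  have n: "norm (x + t *\<^sub>R axis i 1) \<le> norm x + e" if "\<bar>t\<bar> < e" for t
    using norm_triangle_ineq[of x "t *\<^sub>R axis i 1"] that by simp
  have n1: "norm (x + t *\<^sub>R axis i 1) < 1" if "\<bar>t\<bar> < e" for t
    by (rule le_less_trans[OF n[OF that] e(2)])
  have d: "((\<lambda>t. k (x + t *\<^sub>R axis i 1) w) has_real_derivative g (x + t *\<^sub>R axis i 1) w $ i) (at t)"
    if t: "\<bar>t\<bar> < e" and w: "w \<in> space M" for t w
  proof -
    have "((\<lambda>t. x + t *\<^sub>R axis i 1) has_derivative (\<lambda>s. s *\<^sub>R axis i 1)) (at t)" by (auto intro!: derivative_eq_intros)
    from has_derivative_compose[OF this der[OF n1[OF t] w]]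
    have "((\<lambda>t. k (x + t *\<^sub>R axis i 1) w) has_derivative (\<lambda>s. g (x + t *\<^sub>R axis i 1) w \<bullet> (s *\<^sub>R axis i 1))) (at t)" .
    then show ?thesis by (simp add: has_field_derivative_def inner_axis mult.commute[of _ "g _ _ $ i"])
  qed
  have b: "\<bar>g (x + t *\<^sub>R axis i 1) w $ i\<bar> \<le> B w" if "\<bar>t\<bar> < e" "w \<in> space M" for t w
    using order_trans[OF component_le_norm_cart B(2)[OF n[OF that(1)] that(2)]] .
  have "((\<lambda>t. \<integral>w. k (x + t *\<^sub>R axis i 1) w \<partial>M) has_real_derivative (\<integral>w. g (x + 0 *\<^sub>R axis i 1) w $ i \<partial>M)) (at 0)"
    "integrable M (\<lambda>w. g (x + 0 *\<^sub>R axis i 1) w $ i)"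
    by (rule has_real_derivative_integral[OF e(1), where B=B and f="\<lambda>t. k (x + t *\<^sub>R axis i 1)" and ?t0.0=0
        and f'="\<lambda>t w. g (x + t *\<^sub>R axis i 1) w $ i"]; use int n1 d b B(1) in auto)+
  then show "pd i (\<lambda>y. \<integral>w. k y w \<partial>M) x = (\<integral>w. g x w $ i \<partial>M)" "integrable M (\<lambda>w. g x w $ i)"
    unfolding pd_def by (auto intro: DERIV_imp_deriv)
qed

lemma pd_cong_ball:
  assumes "\<And>y. norm y < 1 \<Longrightarrow> f y = g y" "norm x < 1"
  shows "pd i f x = pd i g x"
  unfolding pd_def
proof (rule deriv_cong_ev)
  have "((\<lambda>t. norm (x + t *\<^sub>R axis i (1::real))) \<longlongrightarrow> norm (x + 0 *\<^sub>R axis i (1::real))) (nhds 0)"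
    by (intro tendsto_intros filterlim_ident)
  then have "\<forall>\<^sub>F t in nhds 0. norm (x + t *\<^sub>R axis i (1::real)) < 1"
    by (rule order_tendstoD) (use assms(2) in simp)
  then show "\<forall>\<^sub>F t in nhds 0. f (x + t *\<^sub>R axis i 1) = g (x + t *\<^sub>R axis i 1)"
    by eventually_elim (rule assms(1))
qed simp

lemma sphere_kernel_integrable:
  assumes F: "integrable sigmaS F" and k: "continuous_on (sphere 0 1) k"
  shows "integrable sigmaS (\<lambda>y. k y * F y :: real)"
proof -
  obtain B where B: "\<And>x. norm x = 1 \<Longrightarrow> norm (k x) \<le> B" using continuous_sphere_bound[OF k] by blast
  show ?thesis
  proof (rule lint_bound)
    show "integrable sigmaS (\<lambda>y. B * F y)" using F by simp
    show "(\<lambda>y. k y * F y) \<in> borel_measurable sigmaS"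
      using sphere_measurable[OF k] F by measurable
    show "AE y in sigmaS. norm (k y * F y) \<le> norm (B * F y)"
      by (rule AE_I2) (use order_trans[OF B abs_ge_self] in \<open>auto simp: abs_mult intro!: mult_right_mono\<close>)
  qed
qed

lemma ball_sphere_ne: "norm x < 1 \<Longrightarrow> norm y = 1 \<Longrightarrow> x \<noteq> y"
  by auto

lemma pd_Poisson:
  assumes F: "integrable sigmaS F" and x: "norm x < 1"
  shows "pd i (Poisson F) x = (\<ointegral>y. PkG x y $ i * F y)"
    and "pd j (pd i (Poisson F)) x = (\<ointegral>y. PkH i x y $ j * F y)"
proof -
  have cG: "continuous_on (sphere 0 1) (PkG x)" "continuous_on (sphere 0 1) (PkH i x)" if "norm x < 1" for x i
    by (intro continuous_on_kernels continuous_intros; use that in force)+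
  have cc: "continuous_on (ball 0 1 \<times> sphere 0 1) (\<lambda>z. PkG (fst z) (snd z))"
    "continuous_on (ball 0 1 \<times> sphere 0 1) (\<lambda>z. PkH i (fst z) (snd z))" for i
    by (intro continuous_on_kernels continuous_intros; force)+
  have main: "pd j (\<lambda>y. \<ointegral>w. k y w * F w) x = (\<ointegral>w. (F w *\<^sub>R g x w) $ j)"
    if x: "norm x < 1" and ck: "\<And>y. norm y < 1 \<Longrightarrow> continuous_on (sphere 0 1) (k y)"
      and cg: "continuous_on (ball 0 1 \<times> sphere 0 1) (\<lambda>z. g (fst z) (snd z))"
      and d: "\<And>y w. norm y < 1 \<Longrightarrow> norm w = 1 \<Longrightarrow> ((\<lambda>y. k y w) has_derivative (\<lambda>h. g y w \<bullet> h)) (at y)"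
    for j x and k :: "R3 \<Rightarrow> R3 \<Rightarrow> real" and g :: "R3 \<Rightarrow> R3 \<Rightarrow> R3"
  proof (rule pd_integral(1)[OF x])
    show "integrable sigmaS (\<lambda>w. k y w * F w)" if "norm y < 1" for y
      by (rule sphere_kernel_integrable[OF F ck[OF that]])
    show "((\<lambda>y. k y w * F w) has_derivative (\<lambda>h. (F w *\<^sub>R g y w) \<bullet> h)) (at y)" if "norm y < 1" "w \<in> space sigmaS" for y w
      by (rule has_derivative_eq_rhs[OF has_derivative_mult_left[OF d]]) (use that in \<open>auto simp: mult.commute\<close>)
    fix R :: real assume "R < 1"
    from cg this obtain C where C: "C > 0" "\<And>x y. norm x \<le> R \<Longrightarrow> norm y = 1 \<Longrightarrow> norm (g x y) \<le> C"
      by (rule bounded_cball_sphere) (rule that)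
    show "\<exists>B. integrable sigmaS B \<and> (\<forall>y w. norm y \<le> R \<longrightarrow> w \<in> space sigmaS \<longrightarrow> norm (F w *\<^sub>R g y w) \<le> B w)"
      using C F by (intro exI[of _ "\<lambda>w. \<bar>F w\<bar> * C"]) (auto intro!: mult_left_mono)
  qed
  have p1: "pd i (Poisson F) x = (\<ointegral>y. PkG x y $ i * F y)" if x: "norm x < 1" for x
    unfolding Poisson_def
    by (subst main[OF x continuous_Pker cc(1) Pker_has_derivative[OF ball_sphere_ne]]) (auto simp: mult.commute)
  then show "pd i (Poisson F) x = (\<ointegral>y. PkG x y $ i * F y)" using x by simp
  have "pd j (pd i (Poisson F)) x = pd j (\<lambda>x. \<ointegral>y. PkG x y $ i * F y) x"
    by (rule pd_cong_ball[OF p1 x])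
  also have "... = (\<ointegral>y. PkH i x y $ j * F y)"
    by (subst main[OF x continuous_on_component[OF cG(1)] cc(2) PkG_has_derivative[OF ball_sphere_ne]]) (auto simp: mult.commute)
  finally show "pd j (pd i (Poisson F)) x = (\<ointegral>y. PkH i x y $ j * F y)" .
qed

section \<open>Integrals over dilations and the order of the kernels at the origin\<close>

definition unit_interval :: "real measure" where
  "unit_interval = restrict_space lborel {0<..<1}"

lemma space_unit_interval [simp]: "space unit_interval = {0<..<1}"
  by (simp add: unit_interval_def space_restrict_space)

global_interpretation unit_interval: finite_measure unit_interval
proof (rule finite_measureI)
  have "emeasure unit_interval (space unit_interval) = emeasure lborel {0<..<1::real}"
    unfolding unit_interval_def by (subst emeasure_restrict_space) (auto simp: space_restrict_space)
  then show "emeasure unit_interval (space unit_interval) \<noteq> \<infinity>" by simp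
qed

lemma sets_unit_interval: "sets unit_interval = sets (restrict_space borel {0<..<1})"
  unfolding unit_interval_def by (rule sets_restrict_space_cong) simp

lemma measurable_unit_interval_continuous:
  fixes f :: "real \<Rightarrow> 'a::topological_space"
  shows "continuous_on {0<..<1} f \<Longrightarrow> f \<in> borel_measurable unit_interval"
  using borel_measurable_continuous_on_restrict[of "{0<..<1}" f] measurable_cong_sets[OF sets_unit_interval refl, of borel] by blast

lemma measurable_unit_interval_borel: "(\<lambda>x. x) \<in> measurable unit_interval borel"
  by (rule measurable_unit_interval_continuous) (intro continuous_intros)

lemma integrable_unit_interval:
  fixes f :: "real \<Rightarrow> real"
  assumes "continuous_on {0<..<1} f" "\<And>t. 0 < t \<Longrightarrow> t < 1 \<Longrightarrow> \<bar>f t\<bar> \<le> B"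
  shows "integrable unit_interval f"
  by (rule unit_interval.integrable_const_bound[of _ B])
     (use assms in \<open>auto intro!: AE_I2 measurable_unit_interval_continuous\<close>)

text \<open>The weight may be singular at 0: vanishing of \<open>f\<close> to order
  \<open>m + 1\<close> at the origin keeps the integrand bounded. Differentiation produces a factor
  \<open>t\<close> and lowers the order by one, so the lemma can be applied again to the gradient
  with the weight \<open>t * w t\<close>.\<close>

lemma pd_dilation_integral:
  fixes f :: "R3 \<Rightarrow> real" and F :: "R3 \<Rightarrow> R3"
  assumes x: "norm x < 1"
    and der: "\<And>x. norm x < 1 \<Longrightarrow> (f has_derivative (\<lambda>h. F x \<bullet> h)) (at x)"
    and cF: "continuous_on (ball 0 1) F"
    and B: "\<And>R. R < 1 \<Longrightarrow> \<exists>C\<ge>0. \<forall>x. norm x \<le> R \<longrightarrow> \<bar>f x\<bar> \<le> C * norm x ^ Suc m \<and> norm (F x) \<le> C * norm x ^ m"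
    and w: "continuous_on {0<..<1} w" "\<And>t. 0 < t \<Longrightarrow> t < 1 \<Longrightarrow> 0 \<le> w t \<and> t ^ Suc m * w t \<le> 1"
  shows "pd i (\<lambda>x. \<integral>t. f (t *\<^sub>R x) * w t \<partial>unit_interval) x = (\<integral>t. F (t *\<^sub>R x) $ i * (t * w t) \<partial>unit_interval)"
proof -
  have n: "norm (t *\<^sub>R y) \<le> norm y" "norm (t *\<^sub>R y) < 1" if "0 < t" "t < 1" "norm y < 1" for t and y :: R3
    using mult_left_le_one_le[of "norm y" t] that by auto
  have pw: "norm (t *\<^sub>R y) ^ k \<le> t ^ k" if "0 < t" "t < 1" "norm y < 1" for t k and y :: R3
  proof -
    have "t * norm y \<le> t" using that by simp
    then show ?thesis using that by (intro power_mono) auto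
  qed
  have cf: "continuous_on (ball 0 1) f"
    using der by (auto intro!: continuous_at_imp_continuous_on has_derivative_continuous)
  have cd: "continuous_on {0<..<1} (\<lambda>t. t *\<^sub>R y)" "(\<lambda>t. t *\<^sub>R y) ` {0<..<1} \<subseteq> ball 0 1" if "norm y < 1" for y :: R3
    using n that by (auto intro!: continuous_intros)
  have "pd i (\<lambda>x. \<integral>t. f (t *\<^sub>R x) * w t \<partial>unit_interval) x = (\<integral>t. ((t * w t) *\<^sub>R F (t *\<^sub>R x)) $ i \<partial>unit_interval)"
  proof (rule pd_integral(1)[OF x])
    fix y :: R3 assume y: "norm y < 1"
    obtain C where C: "C \<ge> 0" "\<And>x. norm x \<le> norm y \<Longrightarrow> \<bar>f x\<bar> \<le> C * norm x ^ Suc m"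
      using B[OF y] by blast
    show "integrable unit_interval (\<lambda>t. f (t *\<^sub>R y) * w t)"
    proof (rule integrable_unit_interval[where B=C])
      show "continuous_on {0<..<1} (\<lambda>t. f (t *\<^sub>R y) * w t)"
        by (intro continuous_on_mult w continuous_on_compose2[OF cf cd[OF y]])
      fix t :: real assume t: "0 < t" "t < 1"
      have "\<bar>f (t *\<^sub>R y) * w t\<bar> \<le> (C * norm (t *\<^sub>R y) ^ Suc m) * w t"
        using C(2)[OF n(1)[OF t y]] w(2)[OF t] unfolding abs_mult by (intro mult_mono) auto
      also have "... \<le> (C * t ^ Suc m) * w t"
        using pw[OF t y, of "Suc m"] w(2)[OF t] C(1) by (intro mult_right_mono mult_left_mono) auto
      also have "... = C * (t ^ Suc m * w t)" by simp
      also have "... \<le> C * 1" using w(2)[OF t] C(1) by (intro mult_left_mono) auto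
      finally show "\<bar>f (t *\<^sub>R y) * w t\<bar> \<le> C" by simp
    qed
  next
    fix y :: R3 and t assume y: "norm y < 1" and "t \<in> space unit_interval"
    then have t: "0 < t" "t < 1" by auto
    have "((\<lambda>y. t *\<^sub>R y) has_derivative (\<lambda>h. t *\<^sub>R h)) (at y)" by (auto intro!: derivative_eq_intros)
    from has_derivative_mult_left[OF has_derivative_compose[OF this der[OF n(2)[OF t y]]], of "w t"]
    show "((\<lambda>y. f (t *\<^sub>R y) * w t) has_derivative (\<lambda>h. ((t * w t) *\<^sub>R F (t *\<^sub>R y)) \<bullet> h)) (at y)"
      by (rule has_derivative_eq_rhs) (simp add: fun_eq_iff mult_ac)
  next
    fix R :: real assume R: "R < 1"
    then obtain C where C: "C \<ge> 0" "\<And>x. norm x \<le> R \<Longrightarrow> norm (F x) \<le> C * norm x ^ m" using B by blast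
    show "\<exists>B. integrable unit_interval B \<and> (\<forall>y t. norm y \<le> R \<longrightarrow> t \<in> space unit_interval \<longrightarrow> norm ((t * w t) *\<^sub>R F (t *\<^sub>R y)) \<le> B t)"
    proof (intro exI[of _ "\<lambda>_. C"] conjI allI impI)
      fix y :: R3 and t assume y: "norm y \<le> R" and "t \<in> space unit_interval"
      then have t: "0 < t" "t < 1" by auto
      have y1: "norm y < 1" using y R by simp
      have "norm ((t * w t) *\<^sub>R F (t *\<^sub>R y)) \<le> (t * w t) * (C * norm (t *\<^sub>R y) ^ m)"
        using C(2)[OF order_trans[OF n(1)[OF t y1] y]] w(2)[OF t] t unfolding norm_scaleR by (intro mult_mono) auto
      also have "... \<le> (t * w t) * (C * t ^ m)"
        using pw[OF t y1, of m] w(2)[OF t] C(1) t by (intro mult_left_mono) auto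
      also have "... = C * (t ^ Suc m * w t)" by simp
      also have "... \<le> C * 1" using w(2)[OF t] C(1) by (intro mult_left_mono) auto
      finally show "norm ((t * w t) *\<^sub>R F (t *\<^sub>R y)) \<le> C" by simp
    qed simp
  qed
  then show ?thesis by (simp add: mult.commute)
qed

lemma gradient_growth:
  fixes f :: "R3 \<Rightarrow> real"
  assumes der: "\<And>y. norm y \<le> norm x \<Longrightarrow> (f has_derivative (\<lambda>h. F y \<bullet> h)) (at y)"
    and B: "\<And>y. norm y \<le> norm x \<Longrightarrow> norm (F y) \<le> B"
  shows "\<bar>f x - f 0\<bar> \<le> B * norm x"
proof -
  have "norm (f x - f 0) \<le> B * norm (x - 0)"
  proof (rule differentiable_bound[of "cball 0 (norm x)" f "\<lambda>y h. F y \<bullet> h"])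
    show "(f has_derivative (\<lambda>h. F y \<bullet> h)) (at y within cball 0 (norm x))" if "y \<in> cball 0 (norm x)" for y
      using der that by (auto intro: has_derivative_at_withinI)
    show "onorm (\<lambda>h. F y \<bullet> h) \<le> B" if "y \<in> cball 0 (norm x)" for y
    proof (rule onorm_le)
      fix h show "norm (F y \<bullet> h) \<le> B * norm h"
        using order_trans[OF Cauchy_Schwarz_ineq2[of "F y" h] mult_right_mono[OF B]] that by auto
    qed
  qed auto
  then show ?thesis by simp
qed

text \<open>The bracket in the integrand of \<open>PhiL\<close> together with its factor
  \<open>1 / (4 pi)\<close>: the Poisson kernel minus its first order Taylor polynomial at the
  origin. It vanishes there to second order, and its Hessian is that of the Poisson kernel.\<close>

definition elK :: "R3 \<Rightarrow> R3 \<Rightarrow> real" where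
  "elK x y = Pker x y - 1 / (4 * pi) - 3 / (4 * pi) * (y \<bullet> x)"

definition elG :: "R3 \<Rightarrow> R3 \<Rightarrow> R3" where
  "elG x y = PkG x y - (3 / (4 * pi)) *\<^sub>R y"

lemma elK_has_derivative:
  assumes "x \<noteq> y"
  shows "((\<lambda>x. elK x y) has_derivative (\<lambda>h. elG x y \<bullet> h)) (at x)"
    and "((\<lambda>x. elG x y $ i) has_derivative (\<lambda>h. PkH i x y \<bullet> h)) (at x)"
proof -
  show "((\<lambda>x. elK x y) has_derivative (\<lambda>h. elG x y \<bullet> h)) (at x)"
    unfolding elK_def
    by (rule has_derivative_eq_rhs[OF has_derivative_diff[OF has_derivative_diff[OF Pker_has_derivative[OF assms] has_derivative_const]
         has_derivative_mult_right[OF has_derivative_inner_right[OF has_derivative_ident]]]])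
       (simp add: elG_def inner_diff_left fun_eq_iff)
  show "((\<lambda>x. elG x y $ i) has_derivative (\<lambda>h. PkH i x y \<bullet> h)) (at x)"
    unfolding elG_def vector_minus_component
    by (rule has_derivative_eq_rhs[OF has_derivative_diff[OF PkG_has_derivative[OF assms] has_derivative_const]]) simp
qed

text \<open>The Hessian is bounded on smaller balls; two applications of the mean value inequality
  from the origin, where \<open>elK\<close> and \<open>elG\<close> vanish, give the orders. The
  factor 3 comes from adding up components.\<close>

lemma elastic_growth:
  assumes "R < 1"
  shows "\<exists>C\<ge>0. \<forall>x y. norm x \<le> R \<longrightarrow> norm y = 1 \<longrightarrow> (\<forall>i. norm (PkH i x y) \<le> C) \<and>
    norm (elG x y) \<le> 3 * C * norm x \<and> \<bar>elK x y\<bar> \<le> 3 * C * (norm x)\<^sup>2"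
proof -
  have cc: "continuous_on (ball 0 1 \<times> sphere 0 1) (\<lambda>z. PkH i (fst z) (snd z))" for i
    by (intro continuous_on_kernels continuous_intros; force)
  have "\<exists>C>0. \<forall>x y. norm x \<le> R \<longrightarrow> norm y = 1 \<longrightarrow> norm (PkH i x y) \<le> C" for i
    by (rule bounded_cball_sphere[OF cc assms, of i]) blast
  then obtain C where C: "\<And>i. C i > 0" "\<And>i x y. norm x \<le> R \<Longrightarrow> norm y = 1 \<Longrightarrow> norm (PkH i x y) \<le> C i"
    by metis
  define D where "D = Max (range C)"
  have CD: "C i \<le> D" for i unfolding D_def by (rule Max_ge) auto
  have D: "D \<ge> 0" "\<And>i x y. norm x \<le> R \<Longrightarrow> norm y = 1 \<Longrightarrow> norm (PkH i x y) \<le> D"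
    using C CD by (meson less_imp_le order_trans, meson order_trans)
  have z: "elG 0 y = 0" "elK 0 y = 0" if "norm y = 1" for y
    using that by (auto simp: elG_def PkG_def elK_def Pker_def)
  have ne: "x \<noteq> y" if "norm x \<le> R" "norm y = 1" for x y :: R3 using that assms by auto
  have G: "norm (elG x y) \<le> 3 * D * norm x" if x: "norm x \<le> R" "norm y = 1" for x y
  proof -
    have "\<bar>elG x y $ i - elG 0 y $ i\<bar> \<le> D * norm x" for i
      by (rule gradient_growth[OF elK_has_derivative(2) D(2)]) (use ne x in auto)
    then have c: "\<bar>elG x y $ i\<bar> \<le> D * norm x" for i by (simp add: z x)
    have "norm (elG x y) \<le> (\<Sum>i\<in>UNIV. \<bar>elG x y $ i\<bar>)" by (rule norm_le_l1_cart)
    also have "... \<le> 3 * D * norm x" using c[of 1] c[of 2] c[of 3] by (simp add: sum_3)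
    finally show ?thesis .
  qed
  have K: "\<bar>elK x y\<bar> \<le> 3 * D * (norm x)\<^sup>2" if x: "norm x \<le> R" "norm y = 1" for x y
  proof -
    have "\<bar>elK x y - elK 0 y\<bar> \<le> 3 * D * norm x * norm x"
    proof (rule gradient_growth[OF elK_has_derivative(1)])
      fix w :: R3 assume w: "norm w \<le> norm x"
      show "norm (elG w y) \<le> 3 * D * norm x"
        by (rule order_trans[OF G mult_left_mono[OF w]]) (use w x D in auto)
    qed (use ne x in auto)
    then show ?thesis by (simp add: z x power2_eq_square)
  qed
  show ?thesis using D G K by blast
qed

locale lame_constants =
  fixes lam mu :: real
  assumes mu: "mu > 0" and lam: "2 * mu + lam > 0"
begin

abbreviation "\<alpha> \<equiv> alpha_L lam mu"

lemma alpha: "0 < \<alpha>" "\<alpha> < 1"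
  using mu lam by (auto simp: alpha_L_def field_simps)

text \<open>The weight \<open>t powr (1 - \<alpha>)\<close> that remains after two differentiations
  of \<open>PhiL\<close>, in the shape in which \<open>pd_dilation_integral\<close> delivers it. It
  is bounded because \<open>\<alpha> < 1\<close>.\<close>

definition elw :: "real \<Rightarrow> real" where
  "elw t = t * (t * t powr (- 1 - \<alpha>))"

lemma elw_eq: "0 < t \<Longrightarrow> elw t = t powr (1 - \<alpha>)"
proof -
  assume t: "0 < t"
  have "t powr (1 - \<alpha>) = t powr (1 + (1 + (- 1 - \<alpha>)))" by simp
  also have "... = elw t" using t unfolding elw_def powr_add by simp
  finally show ?thesis by simp
qed

lemma elw_bounds: "0 < t \<Longrightarrow> t < 1 \<Longrightarrow> 0 \<le> elw t \<and> elw t \<le> 1"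
  using powr_mono2[of "1 - \<alpha>" t 1] alpha by (simp add: elw_eq)

lemma PhiL_eq:
  assumes x: "norm x < 1" and y: "norm y = 1"
  shows "PhiL lam mu x y = (\<integral>t. elK (t *\<^sub>R x) y * t powr (- 1 - \<alpha>) \<partial>unit_interval)"
proof -
  have e: "einterval 0 1 = {0<..<1::real}" by (auto simp: einterval_def)
  have "(\<integral>t. elK (t *\<^sub>R x) y * t powr (- 1 - \<alpha>) \<partial>unit_interval)
    = (\<integral>t. 1 / (4 * pi) * (((1 - t^2 * (norm x)^2) / (1 - 2 * t * (x \<bullet> y) + t^2 * (norm x)^2) powr (3/2)
                     - 1 - 3 * t * (x \<bullet> y)) / t powr (1 + \<alpha>)) \<partial>unit_interval)"
  proof (rule lint_cong)
    fix t assume "t \<in> space unit_interval"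
    then have t: "0 < t" "t < 1" by auto
    have ne: "t *\<^sub>R x \<noteq> y" using x y t mult_left_le_one_le[of "norm x" t] by (intro ball_sphere_ne) auto
    have sq: "1 - 2 * t * (x \<bullet> y) + t^2 * (norm x)^2 = (norm (t *\<^sub>R x - y))\<^sup>2"
      using y unfolding power2_norm_eq_inner
      by (simp add: inner_diff_left inner_diff_right norm_eq_1 inner_commute power2_eq_square algebra_simps)
    have "(norm (t *\<^sub>R x - y))\<^sup>2 = norm (t *\<^sub>R x - y) powr 2" using ne by simp
    then have "(norm (t *\<^sub>R x - y))\<^sup>2 powr (3/2) = norm (t *\<^sub>R x - y) powr 3"
      by (simp only: powr_powr) simp
    then have p3: "(norm (t *\<^sub>R x - y))\<^sup>2 powr (3/2) = norm (t *\<^sub>R x - y) ^ 3" using ne by simp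
    have tp: "t powr (- 1 - \<alpha>) = 1 / t powr (1 + \<alpha>)"
      using powr_minus_divide[of t "1 + \<alpha>"] by simp
    show "elK (t *\<^sub>R x) y * t powr (- 1 - \<alpha>) = 1 / (4 * pi) * (((1 - t^2 * (norm x)^2) / (1 - 2 * t * (x \<bullet> y) + t^2 * (norm x)^2) powr (3/2)
                     - 1 - 3 * t * (x \<bullet> y)) / t powr (1 + \<alpha>))"
      unfolding sq p3 tp elK_def Pker_def
      by (simp add: power_mult_distrib inner_commute diff_divide_distrib mult_ac)
  qed simp
  also have "... = PhiL lam mu x y"
    unfolding PhiL_def interval_lebesgue_integral_def set_lebesgue_integral_def e unit_interval_def integral_mult_right_zero
    by (subst integral_restrict_space) auto
  finally show ?thesis ..
qed

text \<open>\<open>pd_dilation_integral\<close> is used with \<open>m = 1\<close> and then with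
  \<open>m = 0\<close>, each time gaining a factor \<open>t\<close>; the singular weight of
  \<open>PhiL\<close> thereby becomes \<open>elw\<close>.\<close>

lemma pd_PhiL:
  assumes x: "norm x < 1" and y: "norm y = 1"
  shows "pd i (\<lambda>z. PhiL lam mu z y) x = (\<integral>t. elG (t *\<^sub>R x) y $ i * (t * t powr (- 1 - \<alpha>)) \<partial>unit_interval)"
    and "pd j (\<lambda>w. pd i (\<lambda>z. PhiL lam mu z y) w) x = (\<integral>t. PkH i (t *\<^sub>R x) y $ j * elw t \<partial>unit_interval)"
proof -
  have cG: "continuous_on (ball 0 1) (\<lambda>x. elG x y)" "continuous_on (ball 0 1) (\<lambda>x. PkH i x y)" for i
    unfolding elG_def by (intro continuous_on_kernels continuous_intros; use y in force)+
  have cw: "continuous_on {0<..<1} (\<lambda>t. t powr (- 1 - \<alpha>))"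
    by (intro continuous_intros) auto
  have w: "0 \<le> t powr (- 1 - \<alpha>) \<and> t ^ Suc 1 * t powr (- 1 - \<alpha>) \<le> 1"
    "0 \<le> t * t powr (- 1 - \<alpha>) \<and> t ^ Suc 0 * (t * t powr (- 1 - \<alpha>)) \<le> 1" if "0 < t" "t < 1" for t
    using elw_bounds[OF that] that by (auto simp: elw_def power2_eq_square mult.assoc)
  have p1: "pd i (\<lambda>z. PhiL lam mu z y) x = (\<integral>t. elG (t *\<^sub>R x) y $ i * (t * t powr (- 1 - \<alpha>)) \<partial>unit_interval)"
    if x: "norm x < 1" for x
  proof -
    have "pd i (\<lambda>z. PhiL lam mu z y) x = pd i (\<lambda>x. \<integral>t. elK (t *\<^sub>R x) y * t powr (- 1 - \<alpha>) \<partial>unit_interval) x"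
      by (rule pd_cong_ball[OF PhiL_eq[OF _ y] x])
    also have "... = (\<integral>t. elG (t *\<^sub>R x) y $ i * (t * t powr (- 1 - \<alpha>)) \<partial>unit_interval)"
    proof (rule pd_dilation_integral[OF x _ cG(1) _ cw w(1)])
      show "((\<lambda>x. elK x y) has_derivative (\<lambda>h. elG x y \<bullet> h)) (at x)" if "norm x < 1" for x
        by (rule elK_has_derivative(1)[OF ball_sphere_ne[OF that y]])
      fix R :: real assume "R < 1"
      from elastic_growth[OF this] obtain C where C: "C \<ge> 0" "\<And>x. norm x \<le> R \<Longrightarrow> norm (elG x y) \<le> 3 * C * norm x \<and> \<bar>elK x y\<bar> \<le> 3 * C * (norm x)\<^sup>2"
        using y by blast
      show "\<exists>C\<ge>0. \<forall>x. norm x \<le> R \<longrightarrow> \<bar>elK x y\<bar> \<le> C * norm x ^ Suc 1 \<and> norm (elG x y) \<le> C * norm x ^ 1"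
        using C by (intro exI[of _ "3 * C"]) (auto simp: numeral_2_eq_2)
    qed
    finally show ?thesis .
  qed
  then show "pd i (\<lambda>z. PhiL lam mu z y) x = (\<integral>t. elG (t *\<^sub>R x) y $ i * (t * t powr (- 1 - \<alpha>)) \<partial>unit_interval)"
    using x by simp
  have "pd j (\<lambda>w. pd i (\<lambda>z. PhiL lam mu z y) w) x = pd j (\<lambda>x. \<integral>t. elG (t *\<^sub>R x) y $ i * (t * t powr (- 1 - \<alpha>)) \<partial>unit_interval) x"
    by (rule pd_cong_ball[OF p1 x])
  also have "... = (\<integral>t. PkH i (t *\<^sub>R x) y $ j * (t * (t * t powr (- 1 - \<alpha>))) \<partial>unit_interval)"
  proof (rule pd_dilation_integral[where m=0, OF x _ cG(2) _ _ w(2)])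
    show "((\<lambda>x. elG x y $ i) has_derivative (\<lambda>h. PkH i x y \<bullet> h)) (at x)" if "norm x < 1" for x
      by (rule elK_has_derivative(2)[OF ball_sphere_ne[OF that y]])
    show "continuous_on {0<..<1} (\<lambda>t. t * t powr (- 1 - \<alpha>))" by (intro continuous_on_mult continuous_on_id cw)
    fix R :: real assume "R < 1"
    from elastic_growth[OF this] obtain C where C: "C \<ge> 0" "\<And>x. norm x \<le> R \<Longrightarrow> norm (elG x y) \<le> 3 * C * norm x \<and> norm (PkH i x y) \<le> C"
      using y by blast
    have "\<bar>elG x y $ i\<bar> \<le> 3 * C * norm x ^ Suc 0 \<and> norm (PkH i x y) \<le> 3 * C * norm x ^ 0" if "norm x \<le> R" for x
      using C(2)[OF that] C(1) order_trans[OF component_le_norm_cart, of "elG x y" _ i] by auto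
    then show "\<exists>C\<ge>0. \<forall>x. norm x \<le> R \<longrightarrow> \<bar>elG x y $ i\<bar> \<le> C * norm x ^ Suc 0 \<and> norm (PkH i x y) \<le> C * norm x ^ 0"
      using C(1) by (intro exI[of _ "3 * C"]) auto
  qed
  finally show "pd j (\<lambda>w. pd i (\<lambda>z. PhiL lam mu z y) w) x = (\<integral>t. PkH i (t *\<^sub>R x) y $ j * elw t \<partial>unit_interval)"
    by (simp add: elw_def)
qed

end

section \<open>The elastic kernel as an integral operator\<close>

lemma borel_measurable_vec_nth [measurable (raw)]:
  fixes f :: "'a \<Rightarrow> real^'n"
  assumes "f \<in> borel_measurable M"
  shows "(\<lambda>x. f x $ i) \<in> borel_measurable M"
proof -
  have "(\<lambda>v::real^'n. v $ i) \<in> borel_measurable borel" by (intro borel_measurable_continuous_onI continuous_intros)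
  from measurable_compose[OF assms this] show ?thesis .
qed

lemma borel_measurable_vecI:
  fixes f :: "'a \<Rightarrow> real^'n"
  assumes "\<And>i. (\<lambda>x. f x $ i) \<in> borel_measurable M"
  shows "f \<in> borel_measurable M"
  by (subst borel_measurable_euclidean_space) (use assms in \<open>auto simp: Basis_vec_def inner_axis\<close>)

lemma integral_vec_nth:
  fixes f :: "'a \<Rightarrow> real^'n"
  assumes "integrable M f"
  shows "(\<integral>x. f x \<partial>M) $ i = (\<integral>x. f x $ i \<partial>M)" "integrable M (\<lambda>x. f x $ i)"
  using integral_bounded_linear[OF bounded_linear_vec_nth[of i] assms]
    integrable_bounded_linear[OF bounded_linear_vec_nth[of i] assms] by simp_all

context lame_constants
begin

abbreviation "\<kappa> x \<equiv> beta_L lam mu * (1 - (norm (x::R3))\<^sup>2)"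

lemma Lker_eq:
  assumes "norm x < 1" "norm y = 1"
  shows "Lker lam mu x y $ i $ j = \<kappa> x * (\<integral>t. PkH j (t *\<^sub>R x) y $ i * elw t \<partial>unit_interval)"
  unfolding Lker_def by (simp add: pd_PhiL(2)[OF assms])

lemma measurable_PkH:
  "(\<lambda>z. PkH j (snd z *\<^sub>R x) (fst z) $ i * elw (snd z)) \<in> borel_measurable (sigmaS \<Otimes>\<^sub>M unit_interval)"
proof -
  have [measurable]: "fst \<in> borel_measurable (sigmaS \<Otimes>\<^sub>M unit_interval)" "snd \<in> borel_measurable (sigmaS \<Otimes>\<^sub>M unit_interval)"
    using measurable_compose[OF measurable_fst measurable_sigmaS_borel] measurable_compose[OF measurable_snd measurable_unit_interval_borel] by simp_all
  show ?thesis unfolding PkH_def elw_def by measurable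
qed

lemma PkH_elw_bounded:
  assumes x: "norm x < 1"
  obtains C where "C \<ge> 0" "\<And>i j t y. 0 < t \<Longrightarrow> t < 1 \<Longrightarrow> norm y = 1 \<Longrightarrow> \<bar>PkH j (t *\<^sub>R x) y $ i * elw t\<bar> \<le> C"
proof -
  obtain C where C: "C \<ge> 0" "\<And>w y i. norm w \<le> norm x \<Longrightarrow> norm y = 1 \<Longrightarrow> norm (PkH i w y) \<le> C"
    using elastic_growth[OF x] by blast
  show thesis
  proof (rule that[OF C(1)])
    fix i j and t :: real and y :: R3 assume t: "0 < t" "t < 1" and y: "norm y = 1"
    have "norm (t *\<^sub>R x) \<le> norm x" using t mult_left_le_one_le[of "norm x" t] by auto
    then have "\<bar>PkH j (t *\<^sub>R x) y $ i\<bar> \<le> C" using order_trans[OF component_le_norm_cart C(2)] y by blast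
    then have "\<bar>PkH j (t *\<^sub>R x) y $ i\<bar> * \<bar>elw t\<bar> \<le> C * 1"
      using elw_bounds[OF t] C(1) by (intro mult_mono) auto
    then show "\<bar>PkH j (t *\<^sub>R x) y $ i * elw t\<bar> \<le> C" by (simp add: abs_mult)
  qed
qed

lemma measurable_PkH_fst: "norm y = 1 \<Longrightarrow> (\<lambda>t. PkH j (t *\<^sub>R x) y $ i * elw t) \<in> borel_measurable unit_interval"
  using measurable_compose[OF measurable_Pair1' measurable_PkH[of j x i], of y] by simp

text \<open>For fixed \<open>x\<close> this bound makes \<open>Pe\<close> continuous under
  \<open>L^p\<close> convergence of the boundary field.\<close>

lemma Lker_bounded:
  assumes x: "norm x < 1"
  obtains C where "C \<ge> 0" "\<And>y v. norm y = 1 \<Longrightarrow> norm (Lker lam mu x y *v v) \<le> C * norm v"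
proof -
  obtain C where C: "C \<ge> 0" "\<And>i j t y. 0 < t \<Longrightarrow> t < 1 \<Longrightarrow> norm y = 1 \<Longrightarrow> \<bar>PkH j (t *\<^sub>R x) y $ i * elw t\<bar> \<le> C"
    by (rule PkH_elw_bounded[OF x]) (rule that)
  define D where "D = \<bar>\<kappa> x\<bar> * (C * measure unit_interval {0<..<1})"
  have D: "D \<ge> 0" using C by (simp add: D_def)
  have b: "\<bar>Lker lam mu x y $ i $ j\<bar> \<le> D" if y: "norm y = 1" for y i j
  proof -
    have i: "integrable unit_interval (\<lambda>t. PkH j (t *\<^sub>R x) y $ i * elw t)"
      by (rule unit_interval.integrable_const_bound[OF _ measurable_PkH_fst[OF y]]) (use C(2) y in \<open>auto intro!: AE_I2\<close>)
    have "\<bar>\<integral>t. PkH j (t *\<^sub>R x) y $ i * elw t \<partial>unit_interval\<bar> \<le> (\<integral>t. \<bar>PkH j (t *\<^sub>R x) y $ i * elw t\<bar> \<partial>unit_interval)"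
      by (rule integral_abs_bound)
    also have "... \<le> (\<integral>t. C \<partial>unit_interval)"
      by (rule integral_mono) (use i C(2) y in auto)
    finally show ?thesis
      unfolding Lker_eq[OF x y] D_def abs_mult by (intro mult_left_mono) (auto simp: mult.commute)
  qed
  show thesis
  proof (rule that[of "9 * D"])
    fix y v :: R3 assume y: "norm y = 1"
    have "\<bar>(Lker lam mu x y *v v) $ i\<bar> \<le> 3 * D * norm v" for i
    proof -
      have "\<bar>(Lker lam mu x y *v v) $ i\<bar> \<le> (\<Sum>j\<in>UNIV. \<bar>Lker lam mu x y $ i $ j * v $ j\<bar>)"
        by (simp add: matrix_vector_mult_def sum_abs)
      also have "... \<le> (\<Sum>j\<in>(UNIV::3 set). D * norm v)"
        unfolding abs_mult by (intro sum_mono mult_mono b y component_le_norm_cart D) auto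
      finally show ?thesis by simp
    qed
    note c = this
    have "norm (Lker lam mu x y *v v) \<le> (\<Sum>i\<in>UNIV. \<bar>(Lker lam mu x y *v v) $ i\<bar>)" by (rule norm_le_l1_cart)
    also have "... \<le> 9 * D * norm v" using c[of 1] c[of 2] c[of 3] by (simp add: sum_3)
    finally show "norm (Lker lam mu x y *v v) \<le> 9 * D * norm v" .
  qed (use D in simp)
qed

lemma measurable_Lker:
  assumes x: "norm x < 1" and f: "f \<in> borel_measurable sigmaS"
  shows "(\<lambda>y. Lker lam mu x y *v f y) \<in> borel_measurable sigmaS"
proof (rule borel_measurable_vecI)
  fix i
  have m: "(\<lambda>y. \<integral>t. PkH j (t *\<^sub>R x) y $ i * elw t \<partial>unit_interval) \<in> borel_measurable sigmaS" for j
    by (rule unit_interval.borel_measurable_lebesgue_integral) (use measurable_PkH in \<open>simp add: case_prod_unfold\<close>)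
  have "(\<lambda>y. \<Sum>j\<in>UNIV. (\<kappa> x * (\<integral>t. PkH j (t *\<^sub>R x) y $ i * elw t \<partial>unit_interval)) * f y $ j) \<in> borel_measurable sigmaS"
    using m f by measurable
  then show "(\<lambda>y. (Lker lam mu x y *v f y) $ i) \<in> borel_measurable sigmaS"
    by (rule measurable_cong[THEN iffD1, rotated]) (auto simp: matrix_vector_mult_def Lker_eq[OF x])
qed

text \<open>Fubini's theorem writes the contribution of \<open>Lker\<close> as a weighted integral
  over \<open>t\<close> of the gradient of the divergence at \<open>t x\<close>, which is zero; the
  Poisson part reproduces \<open>V\<close>.\<close>

lemma Pe_harmonic:
  assumes x: "norm x < 1"
    and V: "\<And>j. poly3 (V j)" "\<And>j y. norm y < 1 \<Longrightarrow> Poisson (V j) y = V j y"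
    and div: "\<And>y. (\<Sum>j\<in>UNIV. pd j (V j) y) = 0"
    and v: "\<And>y j. norm y = 1 \<Longrightarrow> v y $ j = V j y"
  shows "Pe lam mu v x = (\<chi> j. V j x)" "PoissonV v x = (\<chi> j. V j x)"
proof -
  define w where "w y = (\<chi> j. V j y)" for y :: R3
  have vw: "v y = w y" if "norm y = 1" for y using v[OF that] by (simp add: w_def vec_eq_iff)
  have cw: "continuous_on A w" for A
    unfolding w_def by (intro continuous_on_vec_lambda poly3_continuous V)
  have wm: "w \<in> borel_measurable sigmaS" by (rule sphere_measurable[OF cw])
  obtain B where B: "\<And>y. norm y = 1 \<Longrightarrow> norm (w y) \<le> B" "B > 0" using continuous_sphere_bound[OF cw] by blast
  have i1: "integrable sigmaS (\<lambda>y. Pker x y *\<^sub>R w y)"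
    by (intro sphere_integrable continuous_intros continuous_Pker cw x)
  obtain C where C: "C \<ge> 0" "\<And>y v. norm y = 1 \<Longrightarrow> norm (Lker lam mu x y *v v) \<le> C * norm v"
    by (rule Lker_bounded[OF x]) (rule that)
  have i2: "integrable sigmaS (\<lambda>y. Lker lam mu x y *v w y)"
    by (rule sphere_integrable_bounded[OF measurable_Lker[OF x wm], of "C * B"])
       (use C B in \<open>blast intro: order_trans mult_left_mono\<close>)
  have P: "PoissonV w x = (\<chi> j. V j x)"
    unfolding PoissonV_def vec_eq_iff integral_vec_nth(1)[OF i1]
    using V(2)[OF x] by (simp add: w_def Poisson_def)
  have "(\<ointegral>y. Lker lam mu x y *v w y) $ i = 0" for i
  proof -
    obtain D where D: "D \<ge> 0" "\<And>i j t y. 0 < t \<Longrightarrow> t < 1 \<Longrightarrow> norm y = 1 \<Longrightarrow> \<bar>PkH j (t *\<^sub>R x) y $ i * elw t\<bar> \<le> D"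
      by (rule PkH_elw_bounded[OF x]) (rule that)
    define h where "h j y t = PkH j (t *\<^sub>R x) y $ i * elw t * V j y" for j y t
    have hm: "(\<lambda>z. h j (fst z) (snd z)) \<in> borel_measurable (sigmaS \<Otimes>\<^sub>M unit_interval)" for j
      unfolding h_def using measurable_PkH measurable_compose[OF measurable_fst sphere_measurable[OF poly3_continuous[OF V(1)]]]
      by measurable
    interpret pair_sigma_finite sigmaS unit_interval ..
    interpret F: finite_measure "sigmaS \<Otimes>\<^sub>M unit_interval"
      by (rule finite_measure_pair_measure) unfold_locales
    have hi: "integrable (sigmaS \<Otimes>\<^sub>M unit_interval) (\<lambda>(y, t). h j y t)" for j
    proof (rule F.integrable_const_bound[of _ "D * B"])
      show "AE z in sigmaS \<Otimes>\<^sub>M unit_interval. norm (case z of (y, t) \<Rightarrow> h j y t) \<le> D * B"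
      proof (rule AE_I2, clarify)
        fix y t assume "(y, t) \<in> space (sigmaS \<Otimes>\<^sub>M unit_interval)"
        then have y: "norm y = 1" "0 < t" "t < 1" by (auto simp: space_pair_measure)
        have "\<bar>V j y\<bar> \<le> B" using order_trans[OF component_le_norm_cart B(1)[OF y(1)], of j] by (simp add: w_def)
        then show "norm (h j y t) \<le> D * B"
          unfolding h_def real_norm_def abs_mult[of _ "V j y"] using D y by (intro mult_mono) auto
      qed
    qed (use hm in \<open>simp add: case_prod_unfold\<close>)
    \<comment> \<open>Integrating the Hessian of the Poisson kernel against \<open>V j\<close> gives
      the Hessian of the Poisson integral, hence of \<open>V j\<close> itself; the sum over
      \<open>j\<close> is the i-th derivative of the divergence.\<close>
    have inner: "(\<Sum>j\<in>UNIV. \<ointegral>y. h j y t) = 0" if t: "0 < t" "t < 1" for t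
    proof -
      have n: "norm (t *\<^sub>R x) < 1" using t x mult_left_le_one_le[of "norm x" t] by auto
      have "(\<ointegral>y. h j y t) = elw t * pd i (pd j (V j)) (t *\<^sub>R x)" for j
      proof -
        have "(\<ointegral>y. h j y t) = elw t * (\<ointegral>y. PkH j (t *\<^sub>R x) y $ i * V j y)"
          unfolding h_def integral_mult_right_zero[symmetric] by (simp only: mult_ac)
        also have "(\<ointegral>y. PkH j (t *\<^sub>R x) y $ i * V j y) = pd i (pd j (Poisson (V j))) (t *\<^sub>R x)"
          by (rule pd_Poisson(2)[OF integrable_poly3[OF V(1)] n, symmetric])
        also have "... = pd i (pd j (V j)) (t *\<^sub>R x)"
          by (rule pd_cong_ball[OF pd_cong_ball[OF V(2)] n])
        finally show ?thesis .
      qed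
      then have "(\<Sum>j\<in>UNIV. \<ointegral>y. h j y t) = elw t * (\<Sum>j\<in>UNIV. pd i (pd j (V j)) (t *\<^sub>R x))"
        by (simp add: sum_distrib_left)
      also have "(\<Sum>j\<in>UNIV. pd i (pd j (V j)) (t *\<^sub>R x)) = pd i (\<lambda>y. \<Sum>j\<in>UNIV. pd j (V j) y) (t *\<^sub>R x)"
        by (simp add: poly3_pd_sum poly3_pd V)
      also have "... = 0" by (simp add: div)
      finally show ?thesis by simp
    qed
    have "(\<ointegral>y. Lker lam mu x y *v w y) $ i = (\<ointegral>y. (\<Sum>j\<in>UNIV. \<kappa> x * (\<integral>t. h j y t \<partial>unit_interval)))"
      unfolding integral_vec_nth(1)[OF i2]
      by (rule lint_cong) (auto simp: matrix_vector_mult_def Lker_eq[OF x] w_def h_def intro!: sum.cong mult.assoc)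
    also have "... = (\<Sum>j\<in>UNIV. \<kappa> x * (\<ointegral>y. (\<integral>t. h j y t \<partial>unit_interval)))"
      using integrable_fst'[OF hi] by (subst lint_sum) auto
    also have "... = (\<Sum>j\<in>UNIV. \<kappa> x * (\<integral>t. (\<ointegral>y. h j y t) \<partial>unit_interval))"
      by (simp add: Fubini_integral[OF hi])
    also have "... = \<kappa> x * (\<integral>t. (\<Sum>j\<in>UNIV. \<ointegral>y. h j y t) \<partial>unit_interval)"
      using integrable_snd[OF hi] by (subst lint_sum) (auto simp: sum_distrib_left)
    also have "(\<integral>t. (\<Sum>j\<in>UNIV. \<ointegral>y. h j y t) \<partial>unit_interval) = (\<integral>t. 0 \<partial>unit_interval)"
      by (rule lint_cong) (use inner in auto)
    finally show ?thesis by simp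
  qed
  then have L0: "(\<ointegral>y. Lker lam mu x y *v w y) = 0" by (simp add: vec_eq_iff)
  have "Pe lam mu v x = (\<ointegral>y. Pker x y *\<^sub>R w y + Lker lam mu x y *v w y)"
    unfolding Pe_def by (rule lint_cong) (auto simp: vw)
  also have "... = PoissonV w x"
    unfolding lint_add[OF i1 i2] L0 PoissonV_def by simp
  finally show "Pe lam mu v x = (\<chi> j. V j x)" by (simp add: P)
  have "PoissonV v x = PoissonV w x"
    unfolding PoissonV_def by (rule lint_cong) (auto simp: vw)
  then show "PoissonV v x = (\<chi> j. V j x)" by (simp add: P)
qed

end

section \<open>Convergence in the mean\<close>

definition Lp_tendsto :: "real \<Rightarrow> (nat \<Rightarrow> R3 \<Rightarrow> 'b::euclidean_space) \<Rightarrow> (R3 \<Rightarrow> 'b) \<Rightarrow> bool" where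
  "Lp_tendsto p u f \<longleftrightarrow> (\<forall>n. inLp p (u n)) \<and> inLp p f \<and> (\<lambda>n. Lpow p (\<lambda>x. u n x - f x)) \<longlonglongrightarrow> 0"

text \<open>\<open>\<Phi>\<close> stands for a fixed kernel applied to the boundary value. Its
  linear bound and \<open>le_eps_plus_powr\<close> control the difference of the integrals by a
  multiple of \<open>e\<close> plus a multiple of the p-th power distance.\<close>

lemma Lp_tendsto_integral:
  fixes \<Phi> :: "R3 \<Rightarrow> 'a::euclidean_space \<Rightarrow> 'b::euclidean_space"
  assumes p: "p \<ge> 1" and u: "Lp_tendsto p u f"
    and diff: "\<And>y a b. norm y = 1 \<Longrightarrow> \<Phi> y (a - b) = \<Phi> y a - \<Phi> y b"
    and bound: "\<And>y a. norm y = 1 \<Longrightarrow> norm (\<Phi> y a) \<le> C * norm a"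
    and meas: "\<And>g. g \<in> borel_measurable sigmaS \<Longrightarrow> (\<lambda>y. \<Phi> y (g y)) \<in> borel_measurable sigmaS"
  shows "(\<lambda>n. \<ointegral>y. \<Phi> y (u n y)) \<longlonglongrightarrow> (\<ointegral>y. \<Phi> y (f y))"
proof -
  have un: "inLp p (u n)" and f: "inLp p f" for n using u by (auto simp: Lp_tendsto_def)
  have int: "integrable sigmaS (\<lambda>y. \<Phi> y (g y))" if g: "inLp p g" for g
  proof (rule lint_bound)
    show "integrable sigmaS (\<lambda>y. C * norm (g y))" using inLp_integrable[OF p g] by simp
    show "(\<lambda>y. \<Phi> y (g y)) \<in> borel_measurable sigmaS" using g meas by (auto simp: inLp_def)
    show "AE y in sigmaS. norm (\<Phi> y (g y)) \<le> norm (C * norm (g y))"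
      by (rule AE_I2) (use order_trans[OF bound abs_ge_self] in auto)
  qed
  have d: "inLp p (\<lambda>y. u n y - f y)" for n by (rule inLp_diff[OF p un f])
  define a where "a n = Lpow p (\<lambda>x. u n x - f x)" for n
  have a0: "a \<longlonglongrightarrow> 0" using u by (simp add: Lp_tendsto_def a_def[abs_def])
  have C0: "C \<ge> 0"
  proof -
    obtain b :: 'a where b: "b \<in> Basis" using nonempty_Basis by blast
    have "norm (\<Phi> (axis 1 1) b) \<le> C * norm b" by (rule bound) simp
    then show ?thesis using order_trans[OF norm_ge_zero] b by force
  qed
  have le: "norm ((\<ointegral>y. \<Phi> y (u n y)) - (\<ointegral>y. \<Phi> y (f y))) \<le> C * (4 * pi * e + e powr (1 - p) * a n)"
    if e: "e > 0" for n e
  proof -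
    have "norm ((\<ointegral>y. \<Phi> y (u n y)) - (\<ointegral>y. \<Phi> y (f y))) = norm (\<ointegral>y. \<Phi> y (u n y) - \<Phi> y (f y))"
      by (simp add: int un f)
    also have "... \<le> (\<ointegral>y. norm (\<Phi> y (u n y) - \<Phi> y (f y)))" by (rule integral_norm_bound)
    also have "... \<le> (\<ointegral>y. C * (e + e powr (1 - p) * norm (u n y - f y) powr p))"
    proof (rule integral_mono)
      show "integrable sigmaS (\<lambda>y. norm (\<Phi> y (u n y) - \<Phi> y (f y)))" using int un f by simp
      show "integrable sigmaS (\<lambda>y. C * (e + e powr (1 - p) * norm (u n y - f y) powr p))"
        using d by (auto simp: inLp_def)
      fix y assume "y \<in> space sigmaS"
      then have y: "norm y = 1" by simp
      have "norm (\<Phi> y (u n y) - \<Phi> y (f y)) \<le> C * norm (u n y - f y)"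
        using bound[OF y, of "u n y - f y"] by (simp add: diff[OF y])
      also have "... \<le> C * (e + e powr (1 - p) * norm (u n y - f y) powr p)"
        using le_eps_plus_powr[of "norm (u n y - f y)" e p] e p C0 by (intro mult_left_mono) auto
      finally show "norm (\<Phi> y (u n y) - \<Phi> y (f y)) \<le> C * (e + e powr (1 - p) * norm (u n y - f y) powr p)" .
    qed
    also have "... = C * (4 * pi * e + e powr (1 - p) * a n)"
      using d by (simp add: inLp_def a_def Lpow_def)
    finally show ?thesis .
  qed
  show ?thesis
  proof (rule LIMSEQ_I)
    fix r :: real assume r: "r > 0"
    define e where "e = r / (2 * (4 * pi * (C + 1)))"
    have e: "e > 0" using r C0 by (simp add: e_def)
    have Ce: "C * (4 * pi * e) < r / 2 + r / 4"
    proof -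
      have "C * (4 * pi * e) \<le> (C + 1) * (4 * pi * e)" using e by (intro mult_right_mono) auto
      also have "... = r / 2" using C0 by (simp add: e_def divide_simps)
      finally show ?thesis using r by simp
    qed
    have "(\<lambda>n. C * (e powr (1 - p) * a n)) \<longlonglongrightarrow> C * (e powr (1 - p) * 0)" by (intro tendsto_intros a0)
    then obtain N where N: "\<And>n. n \<ge> N \<Longrightarrow> \<bar>C * (e powr (1 - p) * a n)\<bar> < r / 4"
      using LIMSEQ_D[of "\<lambda>n. C * (e powr (1 - p) * a n)" 0 "r / 4"] r by auto
    have "norm ((\<ointegral>y. \<Phi> y (u n y)) - (\<ointegral>y. \<Phi> y (f y))) < r" if "n \<ge> N" for n
      using le[OF e, of n] N[OF that] Ce by (simp add: distrib_left)
    then show "\<exists>N. \<forall>n\<ge>N. norm ((\<ointegral>y. \<Phi> y (u n y)) - (\<ointegral>y. \<Phi> y (f y))) < r" by blast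
  qed
qed

lemma Lp_tendsto_Cauchy:
  fixes u :: "nat \<Rightarrow> R3 \<Rightarrow> 'b::euclidean_space"
  assumes p: "p \<ge> 1" and u: "\<And>n. inLp p (u n)" and C: "C \<ge> 0" and a: "a \<longlonglongrightarrow> 0"
    and le: "\<And>m n. Lpow p (\<lambda>x. u m x - u n x) \<le> C * (a m + a n)"
  shows "\<exists>f. Lp_tendsto p u f"
proof -
  have cau: "\<exists>N. \<forall>m\<ge>N. \<forall>n\<ge>N. (\<ointegral>x. norm (u m x - u n x) powr p) < e" if e: "e > 0" for e
  proof -
    obtain N where N: "\<And>n. n \<ge> N \<Longrightarrow> \<bar>a n\<bar> < e / (2 * (C + 1))"
      using LIMSEQ_D[OF a, of "e / (2 * (C + 1))"] e C by auto
    have "Lpow p (\<lambda>x. u m x - u n x) < e" if "m \<ge> N" "n \<ge> N" for m n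
    proof -
      have "C * (a m + a n) \<le> C * (e / (2 * (C + 1)) + e / (2 * (C + 1)))"
        using N[OF that(1)] N[OF that(2)] C by (intro mult_left_mono) auto
      also have "e / (2 * (C + 1)) + e / (2 * (C + 1)) = e / (C + 1)" using C by (simp add: divide_simps)
      also have "C * (e / (C + 1)) = C * e / (C + 1)" by simp
      also have "... < e" using C e by (simp add: field_simps)
      finally show ?thesis using le[of m n] by simp
    qed
    then show ?thesis unfolding Lpow_def by blast
  qed
  obtain g where "g \<in> borel_measurable sigmaS" "integrable sigmaS (\<lambda>x. norm (g x) powr p)"
    "(\<lambda>n. \<ointegral>x. norm (u n x - g x) powr p) \<longlonglongrightarrow> 0"
    by (rule Lp_complete[OF sigma.finite_measure_axioms p _ _ cau]) (use u in \<open>auto simp: inLp_def\<close>)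
  then show ?thesis using u unfolding Lp_tendsto_def inLp_def Lpow_def by blast
qed

lemma Lp_tendsto_Cauchy_bound:
  assumes "p \<ge> 1" "Lp_tendsto p u f"
  shows "Lpow p (\<lambda>x. u m x - u n x) \<le> 2 powr (p - 1) * (Lpow p (\<lambda>x. u m x - f x) + Lpow p (\<lambda>x. u n x - f x))"
proof -
  have i: "inLp p (\<lambda>x. u k x - f x)" for k using assms by (auto simp: Lp_tendsto_def intro: inLp_diff)
  show ?thesis using Lpow_diff_le[OF assms(1) i[of m] i[of n]] by simp
qed

text \<open>What the Cauchy arguments require of an operator: continuous values, and compatibility
  with differences in each degree.\<close>

definition harm_op :: "(nat \<Rightarrow> (R3 \<Rightarrow> real) \<Rightarrow> R3 \<Rightarrow> 'b::euclidean_space) \<Rightarrow> bool" where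
  "harm_op T \<longleftrightarrow> (\<forall>l Y. Y \<in> Harm l \<longrightarrow> continuous_on (sphere 0 1) (T l Y)) \<and>
     (\<forall>l Y Z. Y \<in> Harm l \<longrightarrow> Z \<in> Harm l \<longrightarrow> T l (\<lambda>x. Y x - Z x) = (\<lambda>x. T l Y x - T l Z x))"

lemma harm_op_0: "harm_op T \<Longrightarrow> T l (\<lambda>_. 0) = (\<lambda>_. 0)"
  unfolding harm_op_def using Harm_0[of l] by (elim conjE allE[of _ l] allE[of _ "\<lambda>_. 0"]) simp

lemma harm_op_inLp:
  "harm_op T \<Longrightarrow> p \<ge> 0 \<Longrightarrow> (\<And>l. Y l \<in> Harm l) \<Longrightarrow> inLp p (\<lambda>x. \<Sum>l<N. T l (Y l) x)"
  by (intro continuous_inLp continuous_on_sum) (auto simp: harm_op_def)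

lemma harm_op_diff:
  assumes T: "harm_op T" and Y: "\<And>l. Y l \<in> Harm l" and Z: "\<And>l. Z l \<in> Harm l"
  shows "(\<Sum>l<N. T l (Y l) x) - (\<Sum>l<M. T l (Z l) x)
    = (\<Sum>l<max N M. T l (\<lambda>x. trunc_Harm N Y l x - trunc_Harm M Z l x) x)"
proof -
  have "T l (\<lambda>x. trunc_Harm N Y l x - trunc_Harm M Z l x) = (\<lambda>x. T l (trunc_Harm N Y l) x - T l (trunc_Harm M Z l) x)" for l
    using T trunc_Harm[where Y=Y, OF Y] trunc_Harm[where Y=Z, OF Z] unfolding harm_op_def by blast
  then show ?thesis
    using sum_trunc_Harm[of N "max N M" T Y x, OF _ harm_op_0[OF T]] sum_trunc_Harm[of M "max N M" T Z x, OF _ harm_op_0[OF T]]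
    by (simp add: sum_subtractf)
qed

text \<open>Differences of harmonic sums are again harmonic sums, so domination of \<open>T\<close>
  by \<open>U\<close> transfers the Cauchy property. The flag \<open>z\<close> switches on the
  condition that the components of degree 0 vanish, which the reverse estimates require.\<close>

lemma harm_dominated_limit:
  assumes p: "p \<ge> 1" and T: "harm_op T" and U: "harm_op U"
    and dom: "\<And>N Y. (\<And>l. Y l \<in> Harm l) \<Longrightarrow> (\<And>x. z \<Longrightarrow> Y 0 x = 0) \<Longrightarrow> Lpow p (\<lambda>x. \<Sum>l<N. T l (Y l) x) \<le> C * Lpow p (\<lambda>x. \<Sum>l<N. U l (Y l) x)"
    and C: "C \<ge> 0" and Y: "\<And>n l. Y n l \<in> Harm l" "\<And>n x. z \<Longrightarrow> Y n 0 x = 0"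
    and lim: "Lp_tendsto p (\<lambda>n x. \<Sum>l<N n. U l (Y n l) x) F"
  shows "\<exists>G. Lp_tendsto p (\<lambda>n x. \<Sum>l<N n. T l (Y n l) x) G"
proof (rule Lp_tendsto_Cauchy[OF p])
  show "inLp p (\<lambda>x. \<Sum>l<N n. T l (Y n l) x)" for n using harm_op_inLp[OF T _ Y(1)] p by simp
  show "(\<lambda>n. Lpow p (\<lambda>x. (\<Sum>l<N n. U l (Y n l) x) - F x)) \<longlonglongrightarrow> 0" using lim by (simp add: Lp_tendsto_def)
  show "C * 2 powr (p - 1) \<ge> 0" using C by simp
  fix m n
  have "Lpow p (\<lambda>x. (\<Sum>l<N m. T l (Y m l) x) - (\<Sum>l<N n. T l (Y n l) x))
    \<le> C * Lpow p (\<lambda>x. (\<Sum>l<N m. U l (Y m l) x) - (\<Sum>l<N n. U l (Y n l) x))"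
    unfolding harm_op_diff[OF T Y(1) Y(1)] harm_op_diff[OF U Y(1) Y(1)]
  proof (rule dom)
    show "(\<lambda>x. trunc_Harm (N m) (Y m) l x - trunc_Harm (N n) (Y n) l x) \<in> Harm l" for l
      by (intro Harm_diff trunc_Harm Y(1))
    show "trunc_Harm (N m) (Y m) 0 x - trunc_Harm (N n) (Y n) 0 x = 0" if z for x
      by (simp add: trunc_Harm_def Y(2)[OF that])
  qed
  also have "... \<le> C * (2 powr (p - 1) * (Lpow p (\<lambda>x. (\<Sum>l<N m. U l (Y m l) x) - F x) + Lpow p (\<lambda>x. (\<Sum>l<N n. U l (Y n l) x) - F x)))"
    using C by (intro mult_left_mono Lp_tendsto_Cauchy_bound[OF p lim])
  finally show "Lpow p (\<lambda>x. (\<Sum>l<N m. T l (Y m l) x) - (\<Sum>l<N n. T l (Y n l) x))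
    \<le> C * 2 powr (p - 1) * (Lpow p (\<lambda>x. (\<Sum>l<N m. U l (Y m l) x) - F x) + Lpow p (\<lambda>x. (\<Sum>l<N n. U l (Y n l) x) - F x))"
    by (simp add: mult.assoc)
qed

lemma harm_op_mult: "harm_op (\<lambda>l Y x. m l * Y x)"
  unfolding harm_op_def using Harm_continuous by (auto intro!: continuous_on_mult simp: right_diff_distrib)

lemma harm_op_id: "harm_op (\<lambda>l Y. Y)"
  unfolding harm_op_def by (auto intro!: Harm_continuous)

lemma harm_bounded_limit:
  assumes p: "p \<ge> 1" and T: "harm_op T" "harm_bounded p T" and Y: "\<And>n l. Y n l \<in> Harm l"
    and lim: "Lp_tendsto p (\<lambda>n. hsum (N n) (Y n)) F"
  shows "\<exists>G. Lp_tendsto p (\<lambda>n x. \<Sum>l<N n. T l (Y n l) x) G"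
proof -
  obtain C where C: "C \<ge> 0" "\<And>N Y. (\<And>l. Y l \<in> Harm l) \<Longrightarrow> Lpow p (\<lambda>x. \<Sum>l<N. T l (Y l) x) \<le> C * Lpow p (hsum N Y)"
    using T(2) by (rule harm_boundedE) blast
  show ?thesis
    by (rule harm_dominated_limit[where z=False and U="\<lambda>l Y. Y", OF p T(1) harm_op_id C(2) C(1) Y _ lim]) auto
qed

lemma inLp_iff_Lp_s: "Lp_s p f = inLp p f"
  by (simp add: Lp_s_def inLp_def)

lemma inLp_iff_Lp_v: "Lp_v p f = inLp p f"
  by (simp add: Lp_v_def inLp_def)

lemma Lp_dist_eq: "Lp_dist p f g = Lpow p (\<lambda>x. f x - g x)"
  by (simp add: Lp_dist_def Lpow_def)

lemma Harm_dense:
  fixes F :: "R3 \<Rightarrow> real"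
  assumes p: "p > 1" and F: "inLp p F"
  obtains N Y where "\<And>n l. Y n l \<in> Harm l" "Lp_tendsto p (\<lambda>n. hsum (N n) (Y n)) F"
proof -
  have "\<exists>N Y. (\<forall>l. Y l \<in> Harm l) \<and> Lpow p (\<lambda>x. (\<Sum>l<N. Y l x) - F x) < inverse (real (Suc n))" for n
  proof -
    obtain q where q: "poly3 q" "(\<ointegral>x. \<bar>F x - q x\<bar> powr p) < inverse (real (Suc n))"
      by (rule poly3_dense_Lp[OF p, of F "inverse (real (Suc n))"]) (use F in \<open>auto simp: inLp_def\<close>)
    obtain N Y where Y: "\<And>l. Y l \<in> Harm l" "\<And>x. norm x = 1 \<Longrightarrow> q x = (\<Sum>l<N. Y l x)"
      by (rule poly3_harmonic_decomposition[OF q(1)]) (rule that)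
    have "Lpow p (\<lambda>x. (\<Sum>l<N. Y l x) - F x) = Lpow p (\<lambda>x. F x - (\<Sum>l<N. Y l x))" by (rule Lpow_diff_commute)
    also have "... = Lpow p (\<lambda>x. F x - q x)" by (rule Lpow_cong) (simp add: Y(2))
    finally have "Lpow p (\<lambda>x. (\<Sum>l<N. Y l x) - F x) < inverse (real (Suc n))" using q(2) by (simp add: Lpow_def)
    then show ?thesis using Y(1) by blast
  qed
  then obtain N Y where Y: "\<And>n l. Y n l \<in> Harm l" "\<And>n. Lpow p (\<lambda>x. (\<Sum>l<N n. Y n l x) - F x) < inverse (real (Suc n))"
    by metis
  have "(\<lambda>n. Lpow p (\<lambda>x. (\<Sum>l<N n. Y n l x) - F x)) \<longlonglongrightarrow> 0"
    by (rule tendsto_sandwich[OF _ _ tendsto_const LIMSEQ_inverse_real_of_nat]) (use Y(2) in \<open>auto intro!: always_eventually less_imp_le\<close>)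
  then have "Lp_tendsto p (\<lambda>n. hsum (N n) (Y n)) F"
    unfolding Lp_tendsto_def using F p Y(1) harm_op_inLp[OF harm_op_id, of p] by simp
  then show thesis using that Y(1) by blast
qed

lemma Harm_coefficient:
  assumes Y: "\<And>l. Y l \<in> Harm l" and Z: "Z \<in> Harm k"
  shows "(\<ointegral>x. (\<Sum>l<N. m l * Y l x) * Z x) = m k * (\<ointegral>x. (\<Sum>l<N. Y l x) * Z x)"
proof -
  have e: "(\<ointegral>x. (\<Sum>l<N. c l * Y l x) * Z x) = (\<Sum>l<N. c l * (\<ointegral>x. Y l x * Z x))" for c
    unfolding sum_distrib_right mult.assoc
    by (subst lint_sum)
       (auto intro!: integrable_poly3 poly3_mult poly3_cmult HarmD(2)[OF Y] HarmD(2)[OF Z])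
  have "m l * (\<ointegral>x. Y l x * Z x) = m k * (1 * (\<ointegral>x. Y l x * Z x))" for l
    using Harm_orthogonal[OF Y Z, of l] by (cases "l = k") auto
  then have "(\<Sum>l<N. m l * (\<ointegral>x. Y l x * Z x)) = m k * (\<Sum>l<N. 1 * (\<ointegral>x. Y l x * Z x))"
    unfolding sum_distrib_left by presburger
  then show ?thesis unfolding e[symmetric] by simp
qed

lemma Lp_tendsto_integral_mult:
  fixes u :: "nat \<Rightarrow> R3 \<Rightarrow> real"
  assumes "p \<ge> 1" "Lp_tendsto p u f" "continuous_on (sphere 0 1) k"
  shows "(\<lambda>n. \<ointegral>x. u n x * k x) \<longlonglongrightarrow> (\<ointegral>x. f x * k x)"
proof -
  obtain B where B: "\<And>x. norm x = 1 \<Longrightarrow> norm (k x) \<le> B" using continuous_sphere_bound[OF assms(3)] by blast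
  have [measurable]: "k \<in> borel_measurable sigmaS" by (rule sphere_measurable[OF assms(3)])
  show ?thesis
  proof (rule Lp_tendsto_integral[OF assms(1,2), where C=B])
    show "norm (a * k y) \<le> B * norm a" if "norm y = 1" for y a
      using mult_right_mono[OF B[OF that], of "norm a"] by (simp add: abs_mult mult.commute)
  qed (auto simp: left_diff_distrib)
qed

lemma mult_rel_limit:
  assumes p: "p \<ge> 1" and Y: "\<And>n l. Y n l \<in> Harm l"
    and g: "Lp_tendsto p (\<lambda>n. hsum (N n) (Y n)) g" and h: "Lp_tendsto p (\<lambda>n x. \<Sum>l<N n. m l * Y n l x) h"
  shows "mult_rel m g h"
  unfolding mult_rel_def
proof (intro conjI allI ballI)
  show "integrable sigmaS h" using h p inLp_integrable by (auto simp: Lp_tendsto_def)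
  fix k Z assume Z: "Z \<in> Harm k"
  show "(\<ointegral>x. h x * Z x) = m k * (\<ointegral>x. g x * Z x)"
    by (rule LIMSEQ_unique[OF Lp_tendsto_integral_mult[OF p h Harm_continuous[OF Z]], unfolded Harm_coefficient[OF Y Z],
          OF tendsto_mult[OF tendsto_const Lp_tendsto_integral_mult[OF p g Harm_continuous[OF Z]]]])
qed

text \<open>The difference integrates to 0 against every harmonic sum, so the converse of Hoelder's
  inequality applies with \<open>A = 0\<close> and forces the norm to vanish.\<close>

lemma Harm_coefficients_unique:
  assumes f: "integrable sigmaS f" and g: "integrable sigmaS g"
    and eq: "\<And>l Y. Y \<in> Harm l \<Longrightarrow> (\<ointegral>x. f x * Y x) = (\<ointegral>x. g x * Y x)"
  shows "AE x in sigmaS. f x = g x"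
proof -
  obtain K :: real where K: "K > 0" "\<And>G A. integrable sigmaS G \<Longrightarrow> A \<ge> 0 \<Longrightarrow>
     (\<And>N Y. (\<And>l. Y l \<in> Harm l) \<Longrightarrow> \<bar>\<ointegral>x. G x * (\<Sum>l<N. Y l x)\<bar> \<le> 1 * (A + Lpow 2 (hsum N Y))) \<Longrightarrow>
     inLp 2 G \<and> Lpow 2 G \<le> K * A"
    by (rule converse_Holder_harmonic[of 2 2 1]) (auto intro: that)
  have i: "integrable sigmaS (\<lambda>x. (f x - g x) * Y x)" "(\<ointegral>x. (f x - g x) * Y x) = 0" if Y: "Y \<in> Harm l" for Y l
  proof -
    have j: "integrable sigmaS (\<lambda>x. f x * Y x)" "integrable sigmaS (\<lambda>x. g x * Y x)"
      using sphere_kernel_integrable[OF f Harm_continuous[OF Y]] sphere_kernel_integrable[OF g Harm_continuous[OF Y]]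
      by (simp_all add: mult.commute)
    then show "integrable sigmaS (\<lambda>x. (f x - g x) * Y x)" "(\<ointegral>x. (f x - g x) * Y x) = 0"
      by (simp_all add: left_diff_distrib eq[OF Y])
  qed
  have "inLp 2 (\<lambda>x. f x - g x) \<and> Lpow 2 (\<lambda>x. f x - g x) \<le> K * 0"
  proof (rule K(2))
    fix N and Y :: "nat \<Rightarrow> R3 \<Rightarrow> real" assume Y: "\<And>l. Y l \<in> Harm l"
    have "(\<ointegral>x. (f x - g x) * (\<Sum>l<N. Y l x)) = (\<Sum>l<N. \<ointegral>x. (f x - g x) * Y l x)"
      unfolding sum_distrib_left by (rule lint_sum) (rule i[OF Y])
    then have "(\<ointegral>x. (f x - g x) * (\<Sum>l<N. Y l x)) = 0" by (simp add: i(2)[OF Y])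
    then show "\<bar>\<ointegral>x. (f x - g x) * (\<Sum>l<N. Y l x)\<bar> \<le> 1 * (0 + Lpow 2 (hsum N Y))" by simp
  qed (use f g in auto)
  then have "inLp 2 (\<lambda>x. f x - g x)" "Lpow 2 (\<lambda>x. f x - g x) = 0"
    using Lpow_nonneg[of 2 "\<lambda>x. f x - g x"] by auto
  then have "AE x in sigmaS. norm (f x - g x) powr 2 = 0"
    unfolding Lpow_def inLp_def by (subst (asm) integral_nonneg_eq_0_iff_AE) auto
  then show ?thesis by eventually_elim simp
qed

section \<open>Potentials of harmonic sums\<close>

lemma harm_bounded_cong:
  assumes "harm_bounded p T" "\<And>l Y x. Y \<in> Harm l \<Longrightarrow> norm x = 1 \<Longrightarrow> T l Y x = U l Y x"
  shows "harm_bounded p U"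
proof -
  obtain C where C: "C \<ge> 0" "\<And>N Y. (\<And>l. Y l \<in> Harm l) \<Longrightarrow> Lpow p (\<lambda>x. \<Sum>l<N. T l (Y l) x) \<le> C * Lpow p (hsum N Y)"
    using assms(1) by (rule harm_boundedE) blast
  show ?thesis
  proof (rule harm_boundedI[where C=C])
    fix N and Y :: "nat \<Rightarrow> R3 \<Rightarrow> real" assume Y: "\<And>l. Y l \<in> Harm l"
    have "Lpow p (\<lambda>x. \<Sum>l<N. U l (Y l) x) = Lpow p (\<lambda>x. \<Sum>l<N. T l (Y l) x)"
      by (rule Lpow_cong) (simp add: assms(2) Y)
    then show "Lpow p (\<lambda>x. \<Sum>l<N. U l (Y l) x) \<le> C * Lpow p (hsum N Y)" using C(2)[OF Y] by simp
  qed
qed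

lemma grad_diff: "poly3 Y \<Longrightarrow> poly3 Z \<Longrightarrow> grad (\<lambda>x. Y x - Z x) x = grad Y x - grad Z x"
  by (simp add: vec_eq_iff grad_nth poly3_pd_diff)

lemma harm_op_grad:
  assumes "\<And>x v w. A x (v - w) = A x v - A x w"
    and "\<And>f. continuous_on (sphere 0 1) f \<Longrightarrow> continuous_on (sphere 0 1) (\<lambda>x. A x (f x))"
  shows "harm_op (\<lambda>l Y x. c l *\<^sub>R A x (grad Y x))"
  unfolding harm_op_def
proof (intro conjI allI impI ext)
  show "continuous_on (sphere 0 1) (\<lambda>x. c l *\<^sub>R A x (grad Y x))" if "Y \<in> Harm l" for l Y
    by (intro continuous_on_scaleR continuous_on_const assms(2) poly3_grad_continuous HarmD(2)[OF that])
qed (simp add: grad_diff HarmD(2) assms(1) scaleR_diff_right)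

lemma harm_op_continuous: "harm_op T \<Longrightarrow> Y \<in> Harm l \<Longrightarrow> continuous_on (sphere 0 1) (T l Y)"
  by (simp add: harm_op_def)

text \<open>Agrees with \<open>sgrad\<close> on the sphere, but for polynomial \<open>q\<close> it
  is a polynomial field on the whole space, so continuity and linearity are immediate.\<close>

definition sgp :: "(R3 \<Rightarrow> real) \<Rightarrow> R3 \<Rightarrow> R3" where
  "sgp q x = - cross3 x (cross3 x (grad q x))"

lemma sgrad_eq_sgp: "poly3 q \<Longrightarrow> norm x = 1 \<Longrightarrow> sgrad q x = sgp q x"
  by (simp add: sgp_def cross_cross_grad)

lemma sgp_continuous: "poly3 q \<Longrightarrow> continuous_on A (sgp q)"
  unfolding sgp_def by (intro continuous_intros poly3_grad_continuous)

lemma harm_op_rot: "harm_op (\<lambda>l Y x. c l *\<^sub>R cross3 x (grad Y x))"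
  by (rule harm_op_grad[where A=cross3]) (auto intro: continuous_on_cross3 continuous_on_id simp: Cross3.right_diff_distrib)

lemma harm_op_sgp: "harm_op (\<lambda>l Y x. c l *\<^sub>R sgp Y x)"
  unfolding sgp_def by (rule harm_op_grad[where A="\<lambda>x v. - cross3 x (cross3 x v)"])
    (auto intro!: continuous_on_cross3 continuous_on_minus continuous_on_id simp: Cross3.right_diff_distrib)

lemma harm_bounded_rot:
  assumes p: "p > 1"
  shows "harm_bounded p (\<lambda>l Y x. slm l *\<^sub>R cross3 x (grad Y x))"
proof (rule harm_bounded_vec)
  show "harm_bounded p (\<lambda>l Y x. (slm l *\<^sub>R cross3 x (grad Y x)) $ i)" for i
    using harm_bounded_ang[OF p, of i] by (simp add: ang_def)
qed (use p harm_op_continuous[OF harm_op_rot] in auto)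

lemma norm_cross3_le:
  assumes "norm (x :: R3) = 1"
  shows "norm (cross3 x v) \<le> norm v"
proof (rule power2_le_imp_le)
  show "(norm (cross3 x v))\<^sup>2 \<le> (norm v)\<^sup>2" using norm_cross[of x v] assms by simp
qed simp

text \<open>Up to sign the tangential gradient is \<open>x\<close> crossed with
  \<open>x \<times> \<nabla>Y\<close>, and crossing with a unit vector does not increase the
  norm.\<close>

lemma harm_bounded_sgp:
  assumes p: "p > 1"
  shows "harm_bounded p (\<lambda>l Y x. slm l *\<^sub>R sgp Y x)"
proof -
  obtain C where C: "C \<ge> 0" "\<And>N Y. (\<And>l. Y l \<in> Harm l) \<Longrightarrow>
      Lpow p (\<lambda>x. \<Sum>l<N. slm l *\<^sub>R cross3 x (grad (Y l) x)) \<le> C * Lpow p (hsum N Y)"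
    using harm_bounded_rot[OF p] by (rule harm_boundedE) blast
  show ?thesis
  proof (rule harm_boundedI[where C=C])
    fix N and Y :: "nat \<Rightarrow> R3 \<Rightarrow> real" assume Y: "\<And>l. Y l \<in> Harm l"
    have "(\<Sum>l<N. slm l *\<^sub>R sgp (Y l) x) = - cross3 x (\<Sum>l<N. slm l *\<^sub>R cross3 x (grad (Y l) x))" for x
      by (induction N) (simp_all add: sgp_def cross_add_right cross_mult_right)
    then have "Lpow p (\<lambda>x. \<Sum>l<N. slm l *\<^sub>R sgp (Y l) x) \<le> Lpow p (\<lambda>x. \<Sum>l<N. slm l *\<^sub>R cross3 x (grad (Y l) x))"
      by (intro Lpow_mono harm_op_inLp[OF harm_op_rot] harm_op_inLp[OF harm_op_sgp] Y) (use p norm_cross3_le in auto)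
    also have "... \<le> C * Lpow p (hsum N Y)" by (rule C(2)[OF Y])
    finally show "Lpow p (\<lambda>x. \<Sum>l<N. slm l *\<^sub>R sgp (Y l) x) \<le> C * Lpow p (hsum N Y)" .
  qed
qed

text \<open>\<open>2l\<close> is \<open>(2l+1) - 1\<close>; likewise, in the next lemma,
  \<open>2 sqrt(l(l+1))\<close> is \<open>(2l+1) - sqrt_defect l\<close>.\<close>

lemma mult_bounded_degree: "p > 1 \<Longrightarrow> mult_bounded p (\<lambda>l. real l * slm l)"
  by (rule mult_bounded_cong[OF mult_bounded_add[OF _ mult_bounded_const[of p "1/2"]
      mult_bounded_mult[OF mult_bounded_const[of p "-1/2"] mult_bounded_single_layer]]]) (auto simp: field_simps)

lemma mult_bounded_sqrt: "p > 1 \<Longrightarrow> mult_bounded p (\<lambda>l. sqrt (real l * (real l + 1)) * slm l)"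
  by (rule mult_bounded_cong[OF mult_bounded_add[OF _ mult_bounded_const[of p "1/2"]
      mult_bounded_mult[OF mult_bounded_const[of p "-1/2"] mult_bounded_mult[OF mult_bounded_sqrt_defect mult_bounded_single_layer]]]])
    (auto simp: sqrt_defect_def field_simps)

lemma Harm_grad_radial: "Y \<in> Harm l \<Longrightarrow> grad Y x \<bullet> x = real l * Y x"
  using hom_poly3_euler[OF HarmD(1), of Y l x] by (simp add: inner_vec_def sum_3 grad_nth mult.commute)

lemma Harm_grad_decomposition: "Y \<in> Harm l \<Longrightarrow> norm x = 1 \<Longrightarrow> grad Y x = (real l * Y x) *\<^sub>R x + sgp Y x"
  using sgrad_eq[OF HarmD(2), of Y l x] by (simp add: sgrad_eq_sgp HarmD(2) Harm_grad_radial)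

lemma harm_bounded_grad:
  assumes p: "p > 1"
  shows "harm_bounded p (\<lambda>l Y x. slm l *\<^sub>R grad Y x)"
proof -
  have "harm_bounded p (\<lambda>l Y x. (real l * slm l * Y x) *\<^sub>R x)"
  proof -
    have "Lpow p (\<lambda>x. \<Sum>l<N. (real l * slm l * Y l x) *\<^sub>R x) = Lpow p (\<lambda>x. \<Sum>l<N. real l * slm l * Y l x)" for N Y
      unfolding Lpow_def by (rule lint_cong) (simp_all add: scaleR_sum_left[symmetric])
    then show ?thesis using mult_bounded_degree[OF p] unfolding harm_bounded_def by simp
  qed
  moreover have "continuous_on (sphere 0 1) (\<lambda>x. (real l * slm l * Y x) *\<^sub>R x)" if "Y \<in> Harm l" for l Y
    by (intro continuous_intros Harm_continuous[OF that])
  moreover have "continuous_on (sphere 0 1) (\<lambda>x. slm l *\<^sub>R sgp Y x)" if "Y \<in> Harm l" for l Y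
    by (intro continuous_intros sgp_continuous HarmD(2)[OF that])
  ultimately have "harm_bounded p (\<lambda>l Y x. (real l * slm l * Y x) *\<^sub>R x + slm l *\<^sub>R sgp Y x)"
    using p by (intro harm_bounded_add harm_bounded_sgp) auto
  then show ?thesis
    by (rule harm_bounded_cong) (simp add: Harm_grad_decomposition scaleR_add_right mult_ac)
qed

lemma sgrad_ibp:
  assumes "poly3 q" "poly3 r"
  shows "(\<ointegral>x. r x *\<^sub>R sgp q x) = (\<ointegral>x. q x *\<^sub>R (2 * r x) *\<^sub>R x - q x *\<^sub>R sgrad r x)"
proof -
  note c = poly3_continuous[OF assms(1)] poly3_continuous[OF assms(2)] sgp_continuous[OF assms(1)] sgp_continuous[OF assms(2)]
  have i: "integrable sigmaS (\<lambda>x. r x *\<^sub>R sgp q x)" "integrable sigmaS (\<lambda>x. q x *\<^sub>R (2 * r x) *\<^sub>R x - q x *\<^sub>R sgp r x)"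
    by (intro sphere_integrable continuous_intros c)+
  have "(\<ointegral>x. r x *\<^sub>R sgp q x) = (\<ointegral>x. q x *\<^sub>R (2 * r x) *\<^sub>R x - q x *\<^sub>R sgp r x)"
    unfolding vec_eq_iff
  proof
    fix j
    have "(\<ointegral>x. r x *\<^sub>R sgp q x) $ j = (\<ointegral>x. r x * sgrad q x $ j)"
      unfolding integral_vec_nth(1)[OF i(1)] by (rule lint_cong) (auto simp: sgrad_eq_sgp assms)
    also have "... = (\<ointegral>x. q x * (2 * r x) * x $ j - q x * sgrad r x $ j)" by (rule sgrad_ibp_component[OF assms])
    also have "... = (\<ointegral>x. q x *\<^sub>R (2 * r x) *\<^sub>R x - q x *\<^sub>R sgp r x) $ j"
      unfolding integral_vec_nth(1)[OF i(2)] by (rule lint_cong) (auto simp: sgrad_eq_sgp assms)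
    finally show "(\<ointegral>x. r x *\<^sub>R sgp q x) $ j = (\<ointegral>x. q x *\<^sub>R (2 * r x) *\<^sub>R x - q x *\<^sub>R sgp r x) $ j" .
  qed
  also have "... = (\<ointegral>x. q x *\<^sub>R (2 * r x) *\<^sub>R x - q x *\<^sub>R sgrad r x)"
    by (rule lint_cong) (auto simp: sgrad_eq_sgp assms)
  finally show ?thesis .
qed

lemma grad_Harm_sum:
  assumes "\<And>l. Y l \<in> Harm l"
  shows "grad (\<lambda>x. \<Sum>l<N. c l * Y l x) x = (\<Sum>l<N. c l *\<^sub>R grad (Y l) x)"
proof -
  have P: "poly3 (Y l)" for l by (rule HarmD(2)[OF assms])
  show ?thesis
    unfolding vec_eq_iff grad_nth by (simp add: poly3_pd_sum poly3_cmult poly3_pd_cmult P grad_nth)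
qed

lemma sgp_Harm_sum:
  assumes "\<And>l. Y l \<in> Harm l"
  shows "sgp (\<lambda>x. \<Sum>l<N. c l * Y l x) x = (\<Sum>l<N. c l *\<^sub>R sgp (Y l) x)"
proof -
  have "- cross3 x (cross3 x (\<Sum>l<N. c l *\<^sub>R grad (Y l) x)) = (\<Sum>l<N. c l *\<^sub>R (- cross3 x (cross3 x (grad (Y l) x))))"
    by (induction N) (simp_all add: cross_add_right cross_mult_right)
  then show ?thesis unfolding sgp_def grad_Harm_sum[OF assms] .
qed

text \<open>Inside the ball the gradient is an integral against a kernel continuous on the sphere,
  so \<open>L^p\<close> convergence on the sphere gives pointwise convergence there.\<close>

lemma grad_Poisson_tendsto:
  assumes p: "p > 1" and Y: "\<And>n l. Y n l \<in> Harm l"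
    and g: "Lp_tendsto p (\<lambda>n x. \<Sum>l<N n. c l * Y n l x) g" and x: "norm x < 1"
  shows "(\<lambda>n. \<Sum>l<N n. c l *\<^sub>R grad (Y n l) x) \<longlonglongrightarrow> grad (Poisson g) x"
proof (rule vec_tendstoI)
  fix i
  define y where "y n x = (\<Sum>l<N n. c l * Y n l x)" for n x
  have H: "(\<lambda>x. c l * Y n l x) \<in> Harm l" for n l by (intro Harm_cmult Y)
  have ig: "integrable sigmaS g" using g p by (auto simp: Lp_tendsto_def intro: inLp_integrable[of p])
  have iy: "integrable sigmaS (y n)" for n
    unfolding y_def by (intro integrable_poly3 poly3_sum poly3_cmult HarmD(2)[OF Y])
  have cG: "continuous_on (sphere 0 1) (\<lambda>y. PkG x y $ i)"
    by (intro continuous_on_component continuous_on_kernels continuous_intros) (use x in auto)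
  have "grad (y n) x $ i = (\<ointegral>w. y n w * PkG x w $ i)" for n
  proof -
    have "grad (y n) x $ i = pd i (Poisson (y n)) x"
      unfolding grad_nth by (rule pd_cong_ball[OF _ x]) (simp add: y_def[abs_def] Poisson_sum_Harm[OF H])
    then show ?thesis unfolding pd_Poisson(1)[OF iy x] by (simp add: mult.commute)
  qed
  moreover have "(\<Sum>l<N n. c l *\<^sub>R grad (Y n l) x) = grad (y n) x" for n
    unfolding y_def[abs_def] by (rule grad_Harm_sum[OF Y, symmetric])
  moreover have "(\<lambda>n. \<ointegral>w. y n w * PkG x w $ i) \<longlonglongrightarrow> (\<ointegral>w. g w * PkG x w $ i)"
    by (rule Lp_tendsto_integral_mult[OF _ g[folded y_def] cG]) (use p in simp)
  moreover have "grad (Poisson g) x $ i = (\<ointegral>w. g w * PkG x w $ i)"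
    unfolding grad_nth pd_Poisson(1)[OF ig x] by (simp add: mult.commute)
  ultimately show "(\<lambda>n. (\<Sum>l<N n. c l *\<^sub>R grad (Y n l) x) $ i) \<longlonglongrightarrow> grad (Poisson g) x $ i" by simp
qed

lemma weak_sgrad_limit:
  assumes p: "p > 1" and Y: "\<And>n l. Y n l \<in> Harm l"
    and g: "Lp_tendsto p (\<lambda>n x. \<Sum>l<N n. c l * Y n l x) g"
    and G: "Lp_tendsto p (\<lambda>n x. \<Sum>l<N n. c l *\<^sub>R sgp (Y n l) x) G"
  shows "weak_sgrad g G"
  unfolding weak_sgrad_def
proof (intro conjI allI impI)
  have p1: "p \<ge> 1" using p by simp
  show "integrable sigmaS G" using G p1 by (auto simp: Lp_tendsto_def intro: inLp_integrable[of p])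
  fix \<phi> :: "R3 \<Rightarrow> real" assume \<phi>: "poly3 \<phi>"
  define y where "y n x = (\<Sum>l<N n. c l * Y n l x)" for n x
  have yp: "poly3 (y n)" for n unfolding y_def by (intro poly3_sum poly3_cmult HarmD(2)[OF Y])
  define k where "k x = (2 * \<phi> x) *\<^sub>R x - sgrad \<phi> x" for x
  have cs: "continuous_on (sphere 0 1) (sgrad \<phi>)"
    using sgp_continuous[OF \<phi>] by (rule continuous_on_eq) (simp add: sgrad_eq_sgp[OF \<phi>])
  have ck: "continuous_on (sphere 0 1) k" unfolding k_def by (intro continuous_intros poly3_continuous \<phi> cs)
  obtain B where B: "\<And>x. norm x = 1 \<Longrightarrow> norm (\<phi> x) \<le> B" using continuous_sphere_bound[OF poly3_continuous[OF \<phi>]] by blast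
  obtain D where D: "\<And>x. norm x = 1 \<Longrightarrow> norm (k x) \<le> D" using continuous_sphere_bound[OF ck] by blast
  have [measurable]: "\<phi> \<in> borel_measurable sigmaS" "k \<in> borel_measurable sigmaS"
    by (intro sphere_measurable ck poly3_continuous \<phi>)+
  have "(\<lambda>n. \<ointegral>x. \<phi> x *\<^sub>R (\<Sum>l<N n. c l *\<^sub>R sgp (Y n l) x)) \<longlonglongrightarrow> (\<ointegral>x. \<phi> x *\<^sub>R G x)"
    by (rule Lp_tendsto_integral[OF p1 G, where C=B]) (use B in \<open>auto simp: scaleR_diff_right intro!: mult_right_mono\<close>)
  moreover have "(\<lambda>n. \<ointegral>x. y n x *\<^sub>R k x) \<longlonglongrightarrow> (\<ointegral>x. g x *\<^sub>R k x)"
    by (rule Lp_tendsto_integral[OF p1 g[folded y_def], where C=D])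
       (use D in \<open>auto simp: scaleR_diff_left mult.commute[of D] intro!: mult_left_mono\<close>)
  moreover have "(\<ointegral>x. \<phi> x *\<^sub>R (\<Sum>l<N n. c l *\<^sub>R sgp (Y n l) x)) = (\<ointegral>x. y n x *\<^sub>R k x)" for n
    using sgrad_ibp[OF yp \<phi>, of n] by (simp add: y_def[abs_def] sgp_Harm_sum[OF Y] k_def scaleR_diff_right)
  ultimately have "(\<ointegral>x. \<phi> x *\<^sub>R G x) = (\<ointegral>x. g x *\<^sub>R k x)" by (auto intro: LIMSEQ_unique)
  then show "(\<ointegral>\<eta>. \<phi> \<eta> *\<^sub>R G \<eta>) = (\<ointegral>\<eta>. g \<eta> *\<^sub>R (2 * \<phi> \<eta>) *\<^sub>R \<eta> - g \<eta> *\<^sub>R sgrad \<phi> \<eta>)"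
    by (simp add: k_def scaleR_diff_right)
qed

text \<open>\<open>F\<close> plays the role of \<open>(2l+1) g\<close>. Then \<open>g\<close>, its
  multiple by the degree, its image under \<open>sqrt(l(l+1))\<close> and its weak gradient are
  images of \<open>F\<close> under bounded operators, and all are limits along the same harmonic
  components.\<close>

theorem Harm_potential:
  assumes p: "p > 1" and Y: "\<And>n l. Y n l \<in> Harm l" and F: "Lp_tendsto p (\<lambda>n. hsum (N n) (Y n)) F"
  obtains g h G where "Lp_tendsto p (\<lambda>n x. \<Sum>l<N n. slm l * Y n l x) g"
    "Lp_tendsto p (\<lambda>n x. \<Sum>l<N n. real l * slm l * Y n l x) h"
    "Lp_tendsto p (\<lambda>n x. \<Sum>l<N n. slm l *\<^sub>R sgp (Y n l) x) G"
    "W1p p g" "mult_rel real g h" "weak_sgrad g G"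
    "\<And>x. norm x < 1 \<Longrightarrow> (\<lambda>n. \<Sum>l<N n. slm l *\<^sub>R grad (Y n l) x) \<longlonglongrightarrow> grad (Poisson g) x"
proof -
  have p1: "p \<ge> 1" using p by simp
  note lim = harm_bounded_limit[OF p1 _ _ Y F]
  obtain g where g: "Lp_tendsto p (\<lambda>n x. \<Sum>l<N n. slm l * Y n l x) g"
    using lim[OF harm_op_mult mult_bounded_single_layer[OF p]] by blast
  obtain h where h: "Lp_tendsto p (\<lambda>n x. \<Sum>l<N n. real l * slm l * Y n l x) h"
    using lim[OF harm_op_mult mult_bounded_degree[OF p]] by blast
  obtain s where s: "Lp_tendsto p (\<lambda>n x. \<Sum>l<N n. sqrt (real l * (real l + 1)) * slm l * Y n l x) s"
    using lim[OF harm_op_mult mult_bounded_sqrt[OF p]] by blast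
  obtain G where G: "Lp_tendsto p (\<lambda>n x. \<Sum>l<N n. slm l *\<^sub>R sgp (Y n l) x) G"
    using lim[OF harm_op_sgp harm_bounded_sgp[OF p]] by blast
  have H: "(\<lambda>x. slm l * Y n l x) \<in> Harm l" for n l by (intro Harm_cmult Y)
  have "mult_rel (\<lambda>l. sqrt (real l * (real l + 1))) g s"
    by (rule mult_rel_limit[OF p1 H g]) (use s in \<open>simp only: mult.assoc\<close>)
  then have W: "W1p p g"
    unfolding W1p_def inLp_iff_Lp_s using g s by (auto simp: Lp_tendsto_def)
  have M: "mult_rel real g h"
    by (rule mult_rel_limit[OF p1 H g]) (use h in \<open>simp only: mult.assoc\<close>)
  show thesis
    by (rule that[OF g h G W M weak_sgrad_limit[OF p Y g G] grad_Poisson_tendsto[OF p Y g]])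
qed

section \<open>Pairings, uniqueness of limits and change of exponent\<close>

lemma inner_Young:
  fixes a b :: "R3 \<Rightarrow> R3"
  assumes pq: "p > 1" "q > 1" "1/p + 1/q = 1" and a: "inLp p a" and b: "inLp q b"
  shows "\<bar>\<ointegral>x. a x \<bullet> b x\<bar> \<le> Lpow p a + Lpow q b"
proof -
  have le: "\<bar>a x \<bullet> b x\<bar> \<le> norm (a x) powr p + norm (b x) powr q" for x
    using Youngs_inequality_unweighted[OF pq, of "norm (a x)" "norm (b x)"] Cauchy_Schwarz_ineq2[of "a x" "b x"] by simp
  have i: "integrable sigmaS (\<lambda>x. norm (a x) powr p + norm (b x) powr q)" using a b by (simp add: inLp_def)
  have ab: "integrable sigmaS (\<lambda>x. a x \<bullet> b x)"
    by (rule lint_bound[OF i]) (use a b le in \<open>auto simp: inLp_def intro!: AE_I2 order_trans[OF le abs_ge_self]\<close>)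
  have "\<bar>\<ointegral>x. a x \<bullet> b x\<bar> \<le> (\<ointegral>x. \<bar>a x \<bullet> b x\<bar>)" by (rule integral_abs_bound)
  also have "... \<le> (\<ointegral>x. norm (a x) powr p + norm (b x) powr q)"
    by (rule integral_mono) (use ab i le in auto)
  also have "... = Lpow p a + Lpow q b" using a b by (simp add: inLp_def Lpow_def)
  finally show ?thesis .
qed

lemma inLp_AE_cong:
  assumes "inLp p f" "AE x in sigmaS. f x = g x" "g \<in> borel_measurable sigmaS"
  shows "inLp p g"
proof -
  have "integrable sigmaS (\<lambda>x. norm (g x) powr p)"
    using assms by (subst integrable_cong_AE[of _ _ "\<lambda>x. norm (f x) powr p"]) (auto simp: inLp_def elim: eventually_mono)
  then show ?thesis using assms(3) by (simp add: inLp_def)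
qed

lemma Lp_tendsto_AE_cong:
  assumes u: "Lp_tendsto p u f" and fg: "AE x in sigmaS. f x = g x" and g: "g \<in> borel_measurable sigmaS"
  shows "Lp_tendsto p u g"
proof -
  have m: "u n \<in> borel_measurable sigmaS" "f \<in> borel_measurable sigmaS" for n using u by (auto simp: Lp_tendsto_def inLp_def)
  have "Lpow p (\<lambda>x. u n x - g x) = Lpow p (\<lambda>x. u n x - f x)" for n
    unfolding Lpow_def by (rule integral_cong_AE) (use m g fg in \<open>auto elim: eventually_mono\<close>)
  then show ?thesis using u inLp_AE_cong[OF _ fg g] by (auto simp: Lp_tendsto_def)
qed

lemma Lp_tendsto_cong:
  assumes u: "Lp_tendsto p u f" and eq: "\<And>n x. norm x = 1 \<Longrightarrow> u n x = v n x"
  shows "Lp_tendsto p v f"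
proof -
  have "Lpow p (\<lambda>x. v n x - f x) = Lpow p (\<lambda>x. u n x - f x)" "inLp p (v n) = inLp p (u n)" for n
    by (rule Lpow_cong inLp_cong; simp add: eq)+
  then show ?thesis using u by (simp add: Lp_tendsto_def)
qed

lemma Lpow_eq_0_AE:
  assumes "inLp p f" "Lpow p f = 0"
  shows "AE x in sigmaS. f x = 0"
proof -
  have "AE x in sigmaS. norm (f x) powr p = 0"
    using assms unfolding Lpow_def inLp_def by (subst (asm) integral_nonneg_eq_0_iff_AE) auto
  then show ?thesis by eventually_elim simp
qed

lemma Lp_tendsto_unique:
  assumes p: "p \<ge> 1" and u: "Lp_tendsto p u f" and v: "Lp_tendsto p v g"
    and d: "(\<lambda>n. Lpow p (\<lambda>x. u n x - v n x)) \<longlonglongrightarrow> 0"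
  shows "AE x in sigmaS. f x = g x"
proof -
  define c where "c = 2 powr (p - 1)"
  have iu: "inLp p (u n)" "inLp p f" "inLp p (v n)" "inLp p g" for n using u v by (auto simp: Lp_tendsto_def)
  have le: "Lpow p (\<lambda>x. f x - g x) \<le> c * (Lpow p (\<lambda>x. u n x - f x) + c * (Lpow p (\<lambda>x. u n x - v n x) + Lpow p (\<lambda>x. v n x - g x)))" for n
  proof -
    have "Lpow p (\<lambda>x. f x - g x) = Lpow p (\<lambda>x. (f x - u n x) + ((u n x - v n x) + (v n x - g x)))" by simp
    also have "... \<le> c * (Lpow p (\<lambda>x. f x - u n x) + Lpow p (\<lambda>x. (u n x - v n x) + (v n x - g x)))"
      unfolding c_def by (intro Lpow_add_le p inLp_diff inLp_add iu)
    also have "... \<le> c * (Lpow p (\<lambda>x. f x - u n x) + c * (Lpow p (\<lambda>x. u n x - v n x) + Lpow p (\<lambda>x. v n x - g x)))"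
      unfolding c_def by (intro mult_left_mono add_left_mono Lpow_add_le p inLp_diff iu) auto
    finally show ?thesis by (simp add: Lpow_diff_commute[of p f])
  qed
  have "(\<lambda>n. c * (Lpow p (\<lambda>x. u n x - f x) + c * (Lpow p (\<lambda>x. u n x - v n x) + Lpow p (\<lambda>x. v n x - g x)))) \<longlonglongrightarrow> c * (0 + c * (0 + 0))"
    using u v by (intro tendsto_intros d) (auto simp: Lp_tendsto_def)
  then have "Lpow p (\<lambda>x. f x - g x) \<le> c * (0 + c * (0 + 0))"
    by (rule LIMSEQ_le_const) (use le in auto)
  then have "Lpow p (\<lambda>x. f x - g x) = 0" using Lpow_nonneg[of p "\<lambda>x. f x - g x"] by simp
  then have "AE x in sigmaS. f x - g x = 0" by (rule Lpow_eq_0_AE[OF inLp_diff[OF p iu(2,4)]])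
  then show ?thesis by eventually_elim simp
qed

lemma Lp_tendsto_mono:
  fixes f :: "R3 \<Rightarrow> 'b::euclidean_space"
  assumes p: "1 \<le> p" "p \<le> r" and u: "Lp_tendsto r u f"
  shows "Lp_tendsto p u f"
proof -
  have le: "norm v powr p \<le> e + e powr (1 - r / p) * norm v powr r" if "e > 0" for e and v :: 'b
    using le_eps_plus_powr[of "norm v powr p" e "r / p"] that p by (simp add: powr_powr)
  have i: "inLp p g" if "inLp r g" for g :: "R3 \<Rightarrow> 'b"
  proof -
    have "integrable sigmaS (\<lambda>x. norm (g x) powr p)"
      by (rule lint_bound[of _ "\<lambda>x. 1 + norm (g x) powr r"])
         (use that le[of 1] in \<open>auto simp: inLp_def intro!: AE_I2\<close>)
    then show ?thesis using that by (simp add: inLp_def)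
  qed
  have d: "inLp r (\<lambda>x. u n x - f x)" for n using u p by (auto simp: Lp_tendsto_def intro: inLp_diff)
  define a where "a n = Lpow r (\<lambda>x. u n x - f x)" for n
  have a0: "a \<longlonglongrightarrow> 0" using u by (simp add: a_def[abs_def] Lp_tendsto_def)
  have b: "Lpow p (\<lambda>x. u n x - f x) \<le> 4 * pi * e + e powr (1 - r / p) * a n" if e: "e > 0" for e n
  proof -
    have "Lpow p (\<lambda>x. u n x - f x) \<le> (\<ointegral>x. e + e powr (1 - r / p) * norm (u n x - f x) powr r)"
      unfolding Lpow_def by (rule integral_mono) (use d[of n] i[OF d[of n]] le[OF e] in \<open>auto simp: inLp_def\<close>)
    also have "... = 4 * pi * e + e powr (1 - r / p) * a n"
      using d by (simp add: inLp_def a_def Lpow_def)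
    finally show ?thesis .
  qed
  have "(\<lambda>n. Lpow p (\<lambda>x. u n x - f x)) \<longlonglongrightarrow> 0"
  proof (rule LIMSEQ_I)
    fix s :: real assume s: "s > 0"
    define e where "e = s / (8 * pi)"
    have e: "e > 0" "4 * pi * e = s / 2" using s by (auto simp: e_def)
    have "(\<lambda>n. e powr (1 - r / p) * a n) \<longlonglongrightarrow> e powr (1 - r / p) * 0" by (intro tendsto_intros a0)
    then obtain N where "\<And>n. n \<ge> N \<Longrightarrow> \<bar>e powr (1 - r / p) * a n\<bar> < s / 2"
      using LIMSEQ_D[of "\<lambda>n. e powr (1 - r / p) * a n" 0 "s / 2"] s by auto
    then have "norm (Lpow p (\<lambda>x. u n x - f x) - 0) < s" if "n \<ge> N" for n
      using b[OF e(1), of n] that Lpow_nonneg[of p "\<lambda>x. u n x - f x"] unfolding e(2) by fastforce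
    then show "\<exists>N. \<forall>n\<ge>N. norm (Lpow p (\<lambda>x. u n x - f x) - 0) < s" by blast
  qed
  then show ?thesis using u i by (auto simp: Lp_tendsto_def)
qed

lemma (in lame_constants) Pe_tendsto:
  assumes p: "p \<ge> 1" and u: "Lp_tendsto p u f" and x: "norm x < 1"
  shows "(\<lambda>n. Pe lam mu (u n) x) \<longlonglongrightarrow> Pe lam mu f x"
proof -
  obtain C where C: "C \<ge> 0" "\<And>y v. norm y = 1 \<Longrightarrow> norm (Lker lam mu x y *v v) \<le> C * norm v"
    by (rule Lker_bounded[OF x]) (rule that)
  obtain B where B: "\<And>y. norm y = 1 \<Longrightarrow> norm (Pker x y) \<le> B" using continuous_sphere_bound[OF continuous_Pker[OF x]] by blast
  have P [measurable]: "Pker x \<in> borel_measurable sigmaS" by (rule sphere_measurable[OF continuous_Pker[OF x]])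
  show ?thesis unfolding Pe_def
  proof (rule Lp_tendsto_integral[OF p u, where C="B + C"])
    show "norm (Pker x y *\<^sub>R a + Lker lam mu x y *v a) \<le> (B + C) * norm a" if y: "norm y = 1" for y a
      using norm_triangle_ineq[of "Pker x y *\<^sub>R a" "Lker lam mu x y *v a"] C(2)[OF y, of a] mult_right_mono[OF B[OF y], of "norm a"]
      by (simp add: distrib_right)
    show "(\<lambda>y. Pker x y *\<^sub>R g y + Lker lam mu x y *v g y) \<in> borel_measurable sigmaS" if g: "g \<in> borel_measurable sigmaS" for g
      using measurable_Lker[OF x g] g by measurable
  qed (simp add: matrix_vector_mult_diff_distrib scaleR_diff_right)
qed

section \<open>The closed subspaces generated by a harmonic operator\<close>

text \<open>The two cases of the theorem: \<open>A x v = v\<close>, \<open>en l = l(2l+1)\<close>, \<open>s = 1\<close> and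
  \<open>A x v = x \<times> v\<close>, \<open>en l = l(l+1)\<close>, \<open>s = 0\<close>.\<close>
locale harmonic_operator = lame_constants +
  fixes A :: "R3 \<Rightarrow> R3 \<Rightarrow> R3" and en :: "nat \<Rightarrow> real" and s :: real and V :: "(R3 \<Rightarrow> R3) set"
  assumes A_diff: "\<And>x v w. A x (v - w) = A x v - A x w"
    and A_scale: "\<And>x v c. A x (c *\<^sub>R v) = c *\<^sub>R A x v"
    and A_continuous: "\<And>f. continuous_on (sphere 0 1) f \<Longrightarrow> continuous_on (sphere 0 1) (\<lambda>x. A x (f x))"
    and A_measurable: "\<And>f. f \<in> borel_measurable sigmaS \<Longrightarrow> (\<lambda>x. A x (f x)) \<in> borel_measurable sigmaS"
    and A_bound: "\<And>x v. norm x = 1 \<Longrightarrow> norm (A x v) \<le> norm v"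
    and A_sgp: "\<And>l Y x. Y \<in> Harm l \<Longrightarrow> norm x = 1 \<Longrightarrow> A x (grad Y x) = (s * (real l * Y x)) *\<^sub>R x + A x (sgp Y x)"
    and energy: "\<And>l k Y Z. Y \<in> Harm l \<Longrightarrow> Z \<in> Harm k \<Longrightarrow>
       (\<ointegral>x. A x (grad Y x) \<bullet> A x (grad Z x)) = en l * (\<ointegral>x. Y x * Z x)"
    and en_pos: "\<And>l. l > 0 \<Longrightarrow> en l > 0"
    and A_harm_bounded: "\<And>p. p > 1 \<Longrightarrow> harm_bounded p (\<lambda>l Y x. slm l *\<^sub>R A x (grad Y x))"
    and en_bounded: "\<And>p. p > 1 \<Longrightarrow> mult_bounded p (\<lambda>l. if l = 0 then 0 else (2 * real l + 1)\<^sup>2 / en l)"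
    and A_Harm: "\<And>l Y j. Y \<in> Harm l \<Longrightarrow> \<exists>k. (\<lambda>x. A x (grad Y x) $ j) \<in> Harm k"
    and A_div: "\<And>l Y x. Y \<in> Harm l \<Longrightarrow> (\<Sum>j\<in>UNIV. pd j (\<lambda>x. A x (grad Y x) $ j) x) = 0"
    and V_sum: "\<And>v. v \<in> V \<Longrightarrow> \<exists>N Y. (\<forall>l. Y l \<in> Harm l) \<and> (\<forall>x. norm x = 1 \<longrightarrow> v x = (\<Sum>l\<in>{1..<N}. A x (grad (Y l) x)))"
    and sum_V: "\<And>N Y. (\<forall>l. Y l \<in> Harm l) \<Longrightarrow> \<exists>v\<in>V. \<forall>x. norm x = 1 \<longrightarrow> v x = (\<Sum>l\<in>{1..<N}. A x (grad (Y l) x))"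
begin

text \<open>Division by \<open>2l+1\<close> turns the first order operator into one of order zero,
  bounded on \<open>L^p\<close>.\<close>

definition T :: "nat \<Rightarrow> (R3 \<Rightarrow> real) \<Rightarrow> R3 \<Rightarrow> R3" where
  "T l Y x = slm l *\<^sub>R A x (grad Y x)"

lemma A_linear: "linear (A x)"
proof (rule linearI)
  show "A x (v + w) = A x v + A x w" for v w
    using A_diff[of x v "(-1) *\<^sub>R w"] by (simp only: A_scale) simp
qed (rule A_scale)

lemma A_0: "A x 0 = 0"
  by (rule linear_0[OF A_linear])

lemma T_op: "harm_op T"
  unfolding T_def[abs_def] by (rule harm_op_grad[where A=A, OF A_diff A_continuous])

lemma T_bounded: "p > 1 \<Longrightarrow> harm_bounded p T"
  unfolding T_def[abs_def] by (rule A_harm_bounded)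

lemma A_grad_cmult: "Y \<in> Harm l \<Longrightarrow> A x (grad (\<lambda>x. c * Y x) x) = c *\<^sub>R A x (grad Y x)"
proof -
  assume "Y \<in> Harm l"
  then have "grad (\<lambda>x. c * Y x) x = c *\<^sub>R grad Y x"
    by (simp add: vec_eq_iff grad_nth poly3_pd_cmult HarmD(2))
  then show ?thesis by (simp add: A_scale)
qed

lemma T_cmult: "Y \<in> Harm l \<Longrightarrow> T l (\<lambda>x. c * Y x) x = c *\<^sub>R T l Y x"
  by (simp add: T_def A_grad_cmult)

lemma T_0: "Y \<in> Harm 0 \<Longrightarrow> T 0 Y x = 0"
  using hom_poly3_0_pd[OF HarmD(1)[of Y 0]] by (simp add: T_def grad_def vec_eq_iff A_0 zero_vec_def[symmetric])

lemma sum_T_V: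
  assumes Y: "\<And>l. Y l \<in> Harm l"
  shows "\<exists>v\<in>V. \<forall>x. norm x = 1 \<longrightarrow> v x = (\<Sum>l<N. T l (Y l) x)"
proof -
  have "\<forall>l. (\<lambda>x. slm l * Y l x) \<in> Harm l" using Harm_cmult[OF Y] by blast
  from sum_V[OF this] obtain v where v: "v \<in> V"
    "\<And>x. norm x = 1 \<Longrightarrow> v x = (\<Sum>l\<in>{1..<N}. A x (grad (\<lambda>x. slm l * Y l x) x))" by blast
  have "A x (grad (\<lambda>x. slm l * Y l x) x) = T l (Y l) x" for l x
    unfolding T_def by (rule A_grad_cmult[OF Y])
  then have "v x = (\<Sum>l\<in>{1..<N}. T l (Y l) x)" if "norm x = 1" for x using v(2)[OF that] by simp
  moreover have "(\<Sum>l\<in>{1..<N}. T l (Y l) x) = (\<Sum>l<N. T l (Y l) x)" for x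
    by (rule sum.mono_neutral_left) (auto simp: not_less_eq_eq[symmetric] T_0[OF Y[of 0]])
  ultimately show ?thesis using v(1) by metis
qed

lemma V_sum_T:
  assumes v: "v \<in> V"
  shows "\<exists>N Y. (\<forall>l. Y l \<in> Harm l) \<and> (\<forall>x. Y 0 x = 0) \<and> (\<forall>x. norm x = 1 \<longrightarrow> v x = (\<Sum>l<N. T l (Y l) x))"
proof -
  obtain N Y where Y: "\<And>l. Y l \<in> Harm l" "\<And>x. norm x = 1 \<Longrightarrow> v x = (\<Sum>l\<in>{1..<N}. A x (grad (Y l) x))"
    using V_sum[OF v] by blast
  \<comment> \<open>The factor \<open>2l+1\<close> undoes the normalisation of \<open>T\<close>. The
    component of degree 0 is set to zero, which does not change the field and meets the condition of
    the lower bound.\<close>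
  define Z where "Z l x = (if l = 0 then 0 else 2 * real l + 1) * Y l x" for l x
  have Z: "Z l \<in> Harm l" for l unfolding Z_def[abs_def] by (rule Harm_cmult[OF Y(1)])
  have "T l (Z l) x = A x (grad (Y l) x)" if "l > 0" for l x
    using T_cmult[OF Y(1), of l "2 * real l + 1" x] that by (simp add: Z_def[abs_def]) (simp add: T_def)
  then have "(\<Sum>l\<in>{1..<N}. A x (grad (Y l) x)) = (\<Sum>l\<in>{1..<N}. T l (Z l) x)" for x by simp
  moreover have "(\<Sum>l\<in>{1..<N}. T l (Z l) x) = (\<Sum>l<N. T l (Z l) x)" for x
    by (rule sum.mono_neutral_left) (auto simp: not_less_eq_eq[symmetric] T_0[OF Z[of 0]])
  ultimately show ?thesis using Z Y(2) by (intro exI[of _ N] exI[of _ Z]) (auto simp: Z_def)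
qed

abbreviation en_mult :: "(nat \<Rightarrow> R3 \<Rightarrow> real) \<Rightarrow> nat \<Rightarrow> R3 \<Rightarrow> real" where
  "en_mult Z l x \<equiv> (if l = 0 then 0 else (2 * real l + 1)\<^sup>2 / en l) * Z l x"

text \<open>By \<open>energy\<close> the pairing in degree \<open>l\<close> carries the factor
  \<open>en l / (2l+1)^2\<close>, which \<open>en_mult\<close> cancels, and distinct degrees are
  orthogonal. Degree 0 is lost in this pairing, whence the condition on \<open>Y 0\<close>.\<close>

lemma duality:
  assumes Y: "\<And>l. Y l \<in> Harm l" "\<And>x. Y 0 x = 0" and Z: "\<And>l. Z l \<in> Harm l"
  shows "(\<ointegral>x. (\<Sum>l<N. Y l x) * (\<Sum>l<M. Z l x)) = (\<ointegral>x. (\<Sum>l<N. T l (Y l) x) \<bullet> (\<Sum>l<M. T l (en_mult Z l) x))"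
proof -
  define c where "c l = (if l = 0 then 0 else (2 * real l + 1)\<^sup>2 / en l)" for l
  have tt: "(\<ointegral>x. T l (Y l) x \<bullet> T k (\<lambda>x. c k * Z k x) x) = (\<ointegral>x. Y l x * Z k x)" for l k
  proof -
    have "(\<ointegral>x. T l (Y l) x \<bullet> T k (\<lambda>x. c k * Z k x) x)
      = (\<ointegral>x. (1 / (2 * real l + 1) * c k * (1 / (2 * real k + 1))) * (A x (grad (Y l) x) \<bullet> A x (grad (Z k) x)))"
      by (rule lint_cong) (auto simp: T_cmult[OF Z] T_def)
    also have "... = (1 / (2 * real l + 1) * c k * (1 / (2 * real k + 1))) * (en l * (\<ointegral>x. Y l x * Z k x))"
      by (simp only: integral_mult_right_zero energy[OF Y(1) Z])
    also have "... = (\<ointegral>x. Y l x * Z k x)"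
    proof (cases "l = k")
      case True
      show ?thesis
      proof (cases "l = 0")
        case False
        then show ?thesis using en_pos[of l] True by (simp add: c_def power2_eq_square)
      qed (simp add: Y(2))
    next
      case False
      then show ?thesis using Harm_orthogonal[OF Y(1) Z False] by simp
    qed
    finally show ?thesis .
  qed
  have cT: "continuous_on (sphere 0 1) (T l (Y l))" "continuous_on (sphere 0 1) (T l (\<lambda>x. c l * Z l x))" for l
    by (intro harm_op_continuous[OF T_op] Harm_cmult Y Z)+
  have i: "integrable sigmaS (\<lambda>x. T l (Y l) x \<bullet> T k (\<lambda>x. c k * Z k x) x)" for l k
    by (intro sphere_integrable continuous_on_inner cT)
  have j: "integrable sigmaS (\<lambda>x. Y l x * Z k x)" for l k
    by (intro integrable_poly3 poly3_mult HarmD(2)[OF Y(1)] HarmD(2)[OF Z])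
  have "(\<ointegral>x. (\<Sum>l<N. Y l x) * (\<Sum>l<M. Z l x)) = (\<Sum>l<N. \<Sum>k<M. \<ointegral>x. Y l x * Z k x)"
    unfolding sum_product by (simp add: lint_sum integrable_sum j)
  also have "... = (\<ointegral>x. (\<Sum>l<N. T l (Y l) x) \<bullet> (\<Sum>l<M. T l (\<lambda>x. c l * Z l x) x))"
    unfolding inner_sum_left inner_sum_right by (subst sum.swap) (simp add: lint_sum integrable_sum i tt sum.swap[of _ "{..<N}"])
  finally show ?thesis by (simp add: c_def)
qed

lemma en_mult_Harm: "Z l \<in> Harm l \<Longrightarrow> en_mult Z l \<in> Harm l"
  by (rule Harm_cmult)

lemma T_en_bounded:
  assumes "p > 1"
  obtains C where "C \<ge> 0" "\<And>M Z. (\<And>l. Z l \<in> Harm l) \<Longrightarrow>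
    Lpow p (\<lambda>x. \<Sum>l<M. T l (en_mult Z l) x) \<le> C * Lpow p (hsum M Z)"
  using harm_bounded_mult[OF T_bounded[OF assms] en_bounded[OF assms]] by (rule harm_boundedE) blast

text \<open>The sum is tested against a harmonic sum. By \<open>duality\<close> and Young's
  inequality the pairing is at most the p-th power integral of the field plus a multiple of the q-th
  power integral of the test sum, and the converse of Hoelder's inequality concludes.\<close>

lemma T_lower_bound:
  assumes p: "p > 1"
  obtains C where "C \<ge> 0" "\<And>N Y. (\<And>l. Y l \<in> Harm l) \<Longrightarrow> (\<And>x. Y 0 x = 0) \<Longrightarrow>
    Lpow p (hsum N Y) \<le> C * Lpow p (\<lambda>x. \<Sum>l<N. T l (Y l) x)"
proof -
  obtain q where q: "q > 1" "1/p + 1/q = 1" using conjugate_exponent[OF p] by blast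
  obtain C where C: "C \<ge> 0" "\<And>M Z. (\<And>l. Z l \<in> Harm l) \<Longrightarrow>
    Lpow q (\<lambda>x. \<Sum>l<M. T l (en_mult Z l) x) \<le> C * Lpow q (hsum M Z)"
    by (rule T_en_bounded[OF q(1)]) blast
  \<comment> \<open>\<open>C + 1\<close> is positive even if \<open>C\<close> is 0, and the
    additional 1 covers the term that \<open>C\<close> does not multiply.\<close>
  obtain K :: real where K: "K > 0" "\<And>G B. integrable sigmaS G \<Longrightarrow> B \<ge> 0 \<Longrightarrow>
     (\<And>N Y. (\<And>l. Y l \<in> Harm l) \<Longrightarrow> \<bar>\<ointegral>x. G x * (\<Sum>l<N. Y l x)\<bar> \<le> (C + 1) * (B + Lpow q (hsum N Y))) \<Longrightarrow>
     inLp p G \<and> Lpow p G \<le> K * B"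
    by (rule converse_Holder_harmonic[OF p q, of "C + 1"]) (use C(1) in \<open>auto intro: that\<close>)
  show thesis
  proof (rule that)
    show "K \<ge> 0" using K by simp
    fix N and Y :: "nat \<Rightarrow> R3 \<Rightarrow> real" assume Y: "\<And>l. Y l \<in> Harm l" "\<And>x. Y 0 x = 0"
    have i: "inLp p (\<lambda>x. \<Sum>l<N. T l (Y l) x)" using harm_op_inLp[OF T_op _ Y(1)] p by simp
    have "inLp p (hsum N Y) \<and> Lpow p (hsum N Y) \<le> K * Lpow p (\<lambda>x. \<Sum>l<N. T l (Y l) x)"
    proof (rule K(2))
      fix M and Z :: "nat \<Rightarrow> R3 \<Rightarrow> real" assume Z: "\<And>l. Z l \<in> Harm l"
      have j: "inLp q (\<lambda>x. \<Sum>l<M. T l (en_mult Z l) x)" 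
        by (rule harm_op_inLp[OF T_op]) (use q in simp, rule en_mult_Harm[OF Z])
      have "\<bar>\<ointegral>x. (\<Sum>l<N. Y l x) * (\<Sum>l<M. Z l x)\<bar>
        \<le> Lpow p (\<lambda>x. \<Sum>l<N. T l (Y l) x) + Lpow q (\<lambda>x. \<Sum>l<M. T l (en_mult Z l) x)"
        unfolding duality[OF Y Z] by (rule inner_Young[OF p q i j])
      also have "... \<le> Lpow p (\<lambda>x. \<Sum>l<N. T l (Y l) x) + C * Lpow q (hsum M Z)"
        by (intro add_left_mono C(2) Z)
      also have "... \<le> (C + 1) * (Lpow p (\<lambda>x. \<Sum>l<N. T l (Y l) x) + Lpow q (hsum M Z))"
        using C(1) Lpow_nonneg[of q "\<lambda>x. \<Sum>l<M. Z l x"] mult_nonneg_nonneg[OF C(1) Lpow_nonneg[of p "\<lambda>x. \<Sum>l<N. T l (Y l) x"]]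
        by (simp add: distrib_left distrib_right)
      finally show "\<bar>\<ointegral>x. (\<Sum>l<N. Y l x) * (\<Sum>l<M. Z l x)\<bar>
        \<le> (C + 1) * (Lpow p (\<lambda>x. \<Sum>l<N. T l (Y l) x) + Lpow q (hsum M Z))" .
    qed (intro Lpow_nonneg integrable_poly3 poly3_sum HarmD(2)[OF Y(1)])+
    then show "Lpow p (hsum N Y) \<le> K * Lpow p (\<lambda>x. \<Sum>l<N. T l (Y l) x)" ..
  qed
qed

text \<open>The \<open>L^p\<close> closure of the span; \<open>Lp_sub_iff\<close> shows it to be the
  image of the extended projection.\<close>

definition closure_V :: "real \<Rightarrow> (R3 \<Rightarrow> R3) \<Rightarrow> bool" where
  "closure_V p f \<longleftrightarrow> (\<exists>v. (\<forall>n. v n \<in> V) \<and> Lp_tendsto p v f)"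

lemma closure_VI:
  assumes Y: "\<And>n l. Y n l \<in> Harm l" and f: "Lp_tendsto p (\<lambda>n x. \<Sum>l<N n. T l (Y n l) x) f"
  shows "closure_V p f"
proof -
  have "\<forall>n. \<exists>v. v \<in> V \<and> (\<forall>x. norm x = 1 \<longrightarrow> v x = (\<Sum>l<N n. T l (Y n l) x))"
    using sum_T_V[where Y="Y n" and N="N n" for n, OF Y] by blast
  from choice[OF this] obtain v where "\<forall>n. v n \<in> V \<and> (\<forall>x. norm x = 1 \<longrightarrow> v n x = (\<Sum>l<N n. T l (Y n l) x))" ..
  then show ?thesis unfolding closure_V_def by (intro exI[of _ v] conjI Lp_tendsto_cong[OF f]) auto
qed

text \<open>By the lower bound the harmonic sums behind an approximating sequence of fields form a
  Cauchy sequence themselves; their limit is \<open>F\<close>.\<close>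

lemma closure_VE:
  assumes p: "p > 1" and f: "closure_V p f"
  obtains N Y F where "\<And>n l. Y n l \<in> Harm l" "\<And>n x. Y n 0 x = 0" "Lp_tendsto p (\<lambda>n. hsum (N n) (Y n)) F"
    "Lp_tendsto p (\<lambda>n x. \<Sum>l<N n. T l (Y n l) x) f"
proof -
  obtain v where v: "\<And>n. v n \<in> V" "Lp_tendsto p v f" using f unfolding closure_V_def by blast
  have "\<forall>n. \<exists>Z. (\<forall>l. snd Z l \<in> Harm l) \<and> (\<forall>x. snd Z 0 x = 0) \<and> (\<forall>x. norm x = 1 \<longrightarrow> v n x = (\<Sum>l<fst Z. T l (snd Z l) x))"
    using V_sum_T[OF v(1)] by simp
  from choice[OF this] obtain Z where Z: "\<forall>n. (\<forall>l. snd (Z n) l \<in> Harm l) \<and> (\<forall>x. snd (Z n) 0 x = 0) \<and>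
     (\<forall>x. norm x = 1 \<longrightarrow> v n x = (\<Sum>l<fst (Z n). T l (snd (Z n) l) x))" ..
  define N Y where "N n = fst (Z n)" and "Y n = snd (Z n)" for n
  have Y: "Y n l \<in> Harm l" "Y n 0 x = 0" "norm x = 1 \<Longrightarrow> v n x = (\<Sum>l<N n. T l (Y n l) x)" for n l x
    using Z unfolding N_def Y_def by blast+
  have lim: "Lp_tendsto p (\<lambda>n x. \<Sum>l<N n. T l (Y n l) x) f" by (rule Lp_tendsto_cong[OF v(2) Y(3)])
  obtain C where C: "C \<ge> 0" "\<And>N Y. (\<And>l. Y l \<in> Harm l) \<Longrightarrow> (\<And>x. Y 0 x = 0) \<Longrightarrow>
    Lpow p (hsum N Y) \<le> C * Lpow p (\<lambda>x. \<Sum>l<N. T l (Y l) x)"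
    by (rule T_lower_bound[OF p]) blast
  have "\<exists>F. Lp_tendsto p (\<lambda>n. hsum (N n) (Y n)) F"
    by (rule harm_dominated_limit[where z=True and T="\<lambda>l Y. Y", OF _ harm_op_id T_op C(2) C(1) Y(1,2) lim]) (use p in auto)
  then show thesis using that[OF Y(1,2) _ lim] by blast
qed

text \<open>The components of each field are harmonic polynomials and its divergence is zero, so
  \<open>Pe_harmonic\<close> applies and the field reproduces itself inside the ball.\<close>

lemma sum_T_ball:
  assumes Y: "\<And>l. Y l \<in> Harm l" and x: "norm x < 1"
  shows "Pe lam mu (\<lambda>x. \<Sum>l<N. T l (Y l) x) x = (\<Sum>l<N. T l (Y l) x)"
    "PoissonV (\<lambda>x. \<Sum>l<N. T l (Y l) x) x = (\<Sum>l<N. T l (Y l) x)"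
proof -
  define W where "W j x = (\<Sum>l<N. slm l * A x (grad (Y l) x) $ j)" for j x
  have H: "\<exists>k. (\<lambda>x. slm l * A x (grad (Y l) x) $ j) \<in> Harm k" for l j
    using A_Harm[OF Y, of l j] Harm_cmult by blast
  have pc: "poly3 (\<lambda>x. A x (grad (Y l) x) $ j)" for l j using A_Harm[OF Y, of l j] HarmD(2) by blast
  have e: "(\<Sum>l<N. T l (Y l) x) $ j = W j x" for j x by (simp add: W_def T_def)
  have p: "poly3 (W j)" for j unfolding W_def by (intro poly3_sum poly3_cmult pc)
  have P: "Poisson (W j) y = W j y" if y: "norm y < 1" for j y
  proof -
    have "Poisson (W j) y = (\<Sum>l<N. Poisson (\<lambda>x. slm l * A x (grad (Y l) x) $ j) y)"
      unfolding Poisson_def W_def sum_distrib_left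
      by (rule lint_sum)
         (intro sphere_integrable continuous_on_mult continuous_Pker y poly3_continuous poly3_cmult continuous_on_const pc)
    also have "... = W j y" unfolding W_def using H Poisson_Harm[OF _ y] by (intro sum.cong refl) blast
    finally show ?thesis .
  qed
  have d: "(\<Sum>j\<in>UNIV. pd j (W j) y) = 0" for y
  proof -
    have "pd j (W j) y = (\<Sum>l<N. slm l * pd j (\<lambda>x. A x (grad (Y l) x) $ j) y)" for j
      unfolding W_def[abs_def] by (subst poly3_pd_sum, rule poly3_cmult[OF pc], simp only: poly3_pd_cmult[OF pc])
    then have "(\<Sum>j\<in>UNIV. pd j (W j) y) = (\<Sum>l<N. slm l * (\<Sum>j\<in>UNIV. pd j (\<lambda>x. A x (grad (Y l) x) $ j) y))"
      by (simp only: sum_distrib_left) (rule sum.swap)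
    then show ?thesis by (simp add: A_div[OF Y])
  qed
  have "(\<chi> j. W j x) = (\<Sum>l<N. T l (Y l) x)" by (simp only: vec_eq_iff e vec_lambda_beta) simp
  then show "Pe lam mu (\<lambda>x. \<Sum>l<N. T l (Y l) x) x = (\<Sum>l<N. T l (Y l) x)"
    "PoissonV (\<lambda>x. \<Sum>l<N. T l (Y l) x) x = (\<Sum>l<N. T l (Y l) x)"
    using Pe_harmonic[OF x p P d e] by simp_all
qed

end

section \<open>Identification of the projected subspace with the closure of the span\<close>

context harmonic_operator
begin

lemma V_continuous: "v \<in> V \<Longrightarrow> continuous_on (sphere 0 1) v"
proof -
  assume "v \<in> V"
  then obtain N Y where Y: "\<And>l. Y l \<in> Harm l" "\<And>x. norm x = 1 \<Longrightarrow> v x = (\<Sum>l<N. T l (Y l) x)"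
    using V_sum_T by blast
  have "continuous_on (sphere 0 1) (\<lambda>x. \<Sum>l<N. T l (Y l) x)"
    by (intro continuous_on_sum harm_op_continuous[OF T_op] Y)
  then show ?thesis by (rule continuous_on_eq) (simp add: Y(2))
qed

lemma V_inner_integrable:
  assumes "v \<in> V" "integrable sigmaS f"
  shows "integrable sigmaS (\<lambda>x. f x \<bullet> v x)"
proof -
  obtain B where B: "\<And>x. norm x = 1 \<Longrightarrow> norm (v x) \<le> B" using continuous_sphere_bound[OF V_continuous[OF assms(1)]] by blast
  have [measurable]: "v \<in> borel_measurable sigmaS" "f \<in> borel_measurable sigmaS"
    using sphere_measurable[OF V_continuous[OF assms(1)]] assms(2) by auto
  show ?thesis
  proof (rule lint_bound)
    show "integrable sigmaS (\<lambda>x. norm (f x) * B)" using assms(2) by simp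
    show "AE x in sigmaS. norm (f x \<bullet> v x) \<le> norm (norm (f x) * B)"
    proof (rule AE_I2)
      fix x assume "x \<in> space sigmaS"
      then have "norm (f x \<bullet> v x) \<le> norm (f x) * B"
        using order_trans[OF Cauchy_Schwarz_ineq2[of "f x" "v x"] mult_left_mono[OF B]] by simp
      then show "norm (f x \<bullet> v x) \<le> norm (norm (f x) * B)" by simp
    qed
  qed measurable
qed

text \<open>For \<open>p > 2\<close> the projection of an \<open>L\<^sup>p\<close> function lies in \<open>L\<^sup>p\<close> by duality:
  its potential tested against harmonic sums only sees the function itself.\<close>
lemma proj_rel_closure:
  assumes p: "p > 1" and pr: "proj_rel V a b" and a: "inLp p a"
  shows "closure_V p b"
proof -
  have a2: "inLp 2 a" "inLp 2 b" and orth: "\<And>v. v \<in> V \<Longrightarrow> (\<ointegral>x. (a x - b x) \<bullet> v x) = 0"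
    using pr by (auto simp: proj_rel_def inLp_iff_Lp_v)
  obtain vs where vs: "\<And>n. vs n \<in> V" "(\<lambda>n. Lpow 2 (\<lambda>x. vs n x - b x)) \<longlonglongrightarrow> 0"
    using pr unfolding proj_rel_def Lp_dist_eq by blast
  have vsb: "Lp_tendsto 2 vs b"
    unfolding Lp_tendsto_def using vs(2) a2(2) continuous_inLp[OF V_continuous[OF vs(1)], of 2] by simp
  show ?thesis
  proof (cases "p \<le> 2")
    \<comment> \<open>On a space of finite measure, \<open>L^2\<close> convergence already implies
      \<open>L^p\<close> convergence.\<close>
    case True
    then show ?thesis using vs(1) Lp_tendsto_mono[of p 2, OF _ _ vsb] p unfolding closure_V_def by (intro exI[of _ vs]) simp
  next
    case False
    obtain N Y F where Y: "\<And>n l. Y n l \<in> Harm l" "\<And>n x. Y n 0 x = 0" and F: "Lp_tendsto 2 (\<lambda>n. hsum (N n) (Y n)) F"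
      and b: "Lp_tendsto 2 (\<lambda>n x. \<Sum>l<N n. T l (Y n l) x) b"
    proof (rule closure_VE)
      show "closure_V 2 b" unfolding closure_V_def using vs(1) vsb by blast
    qed (simp, blast)
    obtain q where q: "q > 1" "1/p + 1/q = 1" using conjugate_exponent[OF p] by blast
    obtain C where C: "C \<ge> 0" "\<And>M Z. (\<And>l. Z l \<in> Harm l) \<Longrightarrow>
      Lpow q (\<lambda>x. \<Sum>l<M. T l (en_mult Z l) x) \<le> C * Lpow q (hsum M Z)"
      by (rule T_en_bounded[OF q(1)]) blast
    obtain K :: real where K: "K > 0" "\<And>G B. integrable sigmaS G \<Longrightarrow> B \<ge> 0 \<Longrightarrow>
       (\<And>N Y. (\<And>l. Y l \<in> Harm l) \<Longrightarrow> \<bar>\<ointegral>x. G x * (\<Sum>l<N. Y l x)\<bar> \<le> (C + 1) * (B + Lpow q (hsum N Y))) \<Longrightarrow>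
       inLp p G \<and> Lpow p G \<le> K * B"
      by (rule converse_Holder_harmonic[OF p q, of "C + 1"]) (use C(1) in \<open>auto intro: that\<close>)
    \<comment> \<open>By \<open>duality\<close>, pairing \<open>F\<close> with a harmonic sum
      amounts to pairing \<open>b\<close> with an element of \<open>V\<close>. There
      \<open>b\<close> may be replaced by \<open>a\<close>, which lies in \<open>L^p\<close>; so
      \<open>F\<close> lies in \<open>L^p\<close> although it arose as a limit in
      \<open>L^2\<close>.\<close>
    have "inLp p F \<and> Lpow p F \<le> K * Lpow p a"
    proof (rule K(2))
      show "integrable sigmaS F" using F by (auto simp: Lp_tendsto_def intro: inLp_integrable[of 2])
      fix M and Z :: "nat \<Rightarrow> R3 \<Rightarrow> real" assume Z: "\<And>l. Z l \<in> Harm l"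
      define w where "w x = (\<Sum>l<M. T l (en_mult Z l) x)" for x
      have cw: "continuous_on (sphere 0 1) w"
        unfolding w_def by (intro continuous_on_sum harm_op_continuous[OF T_op] en_mult_Harm Z)
      have "\<exists>v\<in>V. \<forall>x. norm x = 1 \<longrightarrow> v x = w x"
        unfolding w_def by (rule sum_T_V) (rule en_mult_Harm[OF Z])
      then obtain v where v: "v \<in> V" "\<And>x. norm x = 1 \<Longrightarrow> v x = w x" by blast
      obtain B where B: "\<And>x. norm x = 1 \<Longrightarrow> norm (w x) \<le> B" using continuous_sphere_bound[OF cw] by blast
      have wm [measurable]: "w \<in> borel_measurable sigmaS" by (rule sphere_measurable[OF cw])
      have "(\<lambda>n. \<ointegral>x. (\<Sum>l<N n. Y n l x) * (\<Sum>l<M. Z l x)) \<longlonglongrightarrow> (\<ointegral>x. F x * (\<Sum>l<M. Z l x))"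
        by (rule Lp_tendsto_integral_mult[OF _ F]) (auto intro!: continuous_on_sum Harm_continuous[OF Z])
      then have "(\<lambda>n. \<ointegral>x. (\<Sum>l<N n. T l (Y n l) x) \<bullet> w x) \<longlonglongrightarrow> (\<ointegral>x. F x * (\<Sum>l<M. Z l x))"
        unfolding duality[OF Y Z] w_def .
      moreover have "(\<lambda>n. \<ointegral>x. (\<Sum>l<N n. T l (Y n l) x) \<bullet> w x) \<longlonglongrightarrow> (\<ointegral>x. b x \<bullet> w x)"
      proof (rule Lp_tendsto_integral[OF _ b, where C=B])
        show "norm (c \<bullet> w y) \<le> B * norm c" if "norm y = 1" for y c
          using order_trans[OF Cauchy_Schwarz_ineq2[of c "w y"] mult_left_mono[OF B[OF that]]] by (simp add: mult.commute)
      qed (auto simp: inner_diff_left)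
      ultimately have "(\<ointegral>x. F x * (\<Sum>l<M. Z l x)) = (\<ointegral>x. b x \<bullet> w x)" by (rule LIMSEQ_unique)
      also have "... = (\<ointegral>x. b x \<bullet> v x)" by (rule lint_cong) (auto simp: v(2))
      also have "... = (\<ointegral>x. a x \<bullet> v x)"
        using orth[OF v(1)] V_inner_integrable[OF v(1)] inLp_integrable[OF _ a2(1)] inLp_integrable[OF _ a2(2)]
        by (simp add: inner_diff_left)
      also have "... = (\<ointegral>x. a x \<bullet> w x)" by (rule lint_cong) (auto simp: v(2))
      finally have "\<bar>\<ointegral>x. F x * (\<Sum>l<M. Z l x)\<bar> \<le> Lpow p a + Lpow q w"
        using inner_Young[OF p q a continuous_inLp[OF cw]] q by simp
      also have "... \<le> Lpow p a + C * Lpow q (hsum M Z)"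
        unfolding w_def[abs_def] by (intro add_left_mono C(2) Z)
      also have "... \<le> (C + 1) * (Lpow p a + Lpow q (hsum M Z))"
        using mult_nonneg_nonneg[OF C(1) Lpow_nonneg[of p a]] by (simp add: distrib_left distrib_right)
      finally show "\<bar>\<ointegral>x. F x * (\<Sum>l<M. Z l x)\<bar> \<le> (C + 1) * (Lpow p a + Lpow q (hsum M Z))" .
    qed simp
    then have "inLp p F" ..
    then obtain M Z where Z: "\<And>n l. Z n l \<in> Harm l" and ZF: "Lp_tendsto p (\<lambda>n. hsum (M n) (Z n)) F"
      by (rule Harm_dense[OF p]) blast
    obtain b' where b': "Lp_tendsto p (\<lambda>n x. \<Sum>l<M n. T l (Z n l) x) b'"
      using harm_bounded_limit[OF _ T_op T_bounded[OF p] Z ZF] p by auto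
    have p2: "(1::real) \<le> 2" "2 \<le> p" using False by auto
    obtain D where D: "D \<ge> 0" "\<And>N Y. (\<And>l. Y l \<in> Harm l) \<Longrightarrow> Lpow 2 (\<lambda>x. \<Sum>l<N. T l (Y l) x) \<le> D * Lpow 2 (hsum N Y)"
      using T_bounded[of 2, simplified] by (rule harm_boundedE) blast
    \<comment> \<open>Both sequences of harmonic sums tend to \<open>F\<close> in
      \<open>L^2\<close>, and \<open>T\<close> is bounded there, so the limit \<open>b'\<close>
      obtained in \<open>L^p\<close> is \<open>b\<close>.\<close>
    have "AE x in sigmaS. b' x = b x"
    proof (rule Lp_tendsto_unique[OF p2(1) Lp_tendsto_mono[OF p2 b'] b])
      have le: "Lpow 2 (\<lambda>x. (\<Sum>l<M n. T l (Z n l) x) - (\<Sum>l<N n. T l (Y n l) x))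
          \<le> D * (2 powr (2 - 1) * (Lpow 2 (\<lambda>x. (\<Sum>l<M n. Z n l x) - F x) + Lpow 2 (\<lambda>x. (\<Sum>l<N n. Y n l x) - F x)))" for n
      proof -
        have "Lpow 2 (\<lambda>x. (\<Sum>l<M n. T l (Z n l) x) - (\<Sum>l<N n. T l (Y n l) x)) \<le> D * Lpow 2 (\<lambda>x. (\<Sum>l<M n. Z n l x) - (\<Sum>l<N n. Y n l x))"
          unfolding harm_op_diff[OF T_op Z Y(1)] harm_op_diff[OF harm_op_id Z Y(1)]
          by (rule D(2)) (intro Harm_diff trunc_Harm Z Y(1))
        also have "Lpow 2 (\<lambda>x. (\<Sum>l<M n. Z n l x) - (\<Sum>l<N n. Y n l x))
          \<le> 2 powr (2 - 1) * (Lpow 2 (\<lambda>x. (\<Sum>l<M n. Z n l x) - F x) + Lpow 2 (\<lambda>x. (\<Sum>l<N n. Y n l x) - F x))"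
          using Lpow_diff_le[of 2 "\<lambda>x. (\<Sum>l<M n. Z n l x) - F x" "\<lambda>x. (\<Sum>l<N n. Y n l x) - F x"]
            inLp_diff[of 2 _ F] F Lp_tendsto_mono[OF p2 ZF] by (simp add: Lp_tendsto_def)
        finally show ?thesis using D(1) by (simp add: mult_left_mono)
      qed
      have "(\<lambda>n. D * (2 powr (2 - 1) * (Lpow 2 (\<lambda>x. (\<Sum>l<M n. Z n l x) - F x) + Lpow 2 (\<lambda>x. (\<Sum>l<N n. Y n l x) - F x))))
          \<longlonglongrightarrow> D * (2 powr (2 - 1) * (0 + 0))"
        using F Lp_tendsto_mono[OF p2 ZF] by (intro tendsto_intros) (auto simp: Lp_tendsto_def)
      from tendsto_sandwich[OF always_eventually[OF allI[OF Lpow_nonneg]] always_eventually[OF allI[OF le]] tendsto_const this[unfolded add_0 mult_zero_right]]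
      show "(\<lambda>n. Lpow 2 (\<lambda>x. (\<Sum>l<M n. T l (Z n l) x) - (\<Sum>l<N n. T l (Y n l) x))) \<longlonglongrightarrow> 0" .
    qed
    then have "Lp_tendsto p (\<lambda>n x. \<Sum>l<M n. T l (Z n l) x) b"
      by (rule Lp_tendsto_AE_cong[OF b']) (use a2 in \<open>simp add: inLp_def\<close>)
    then show ?thesis by (rule closure_VI[OF Z])
  qed
qed

text \<open>An element of \<open>V\<close> is its own projection, which gives one inclusion.
  Conversely every projection lies in the closure by \<open>proj_rel_closure\<close>, and elements
  of \<open>V\<close> within \<open>1/(n+1)\<close> of the n-th projection converge to
  \<open>f\<close>.\<close>

lemma Lp_sub_iff:
  assumes p: "p > 1"
  shows "f \<in> Lp_sub V p \<longleftrightarrow> closure_V p f"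
proof
  assume "closure_V p f"
  then obtain v where v: "\<And>n. v n \<in> V" "Lp_tendsto p v f" unfolding closure_V_def by blast
  have "proj_rel V (v n) (v n)" for n
    unfolding proj_rel_def inLp_iff_Lp_v Lp_dist_eq
    using v(1) continuous_inLp[OF V_continuous[OF v(1)], of 2] by (intro conjI exI[of _ "\<lambda>_. v n"]) (simp_all add: Lpow_def)
  then show "f \<in> Lp_sub V p"
    using v(2) unfolding Lp_sub_def inLp_iff_Lp_v Lp_dist_eq Lp_tendsto_def mem_Collect_eq
    by (intro conjI exI[of _ f] exI[of _ v]) simp_all
next
  assume "f \<in> Lp_sub V p"
  then obtain a fs hs where f: "inLp p f" and fs: "\<And>n. inLp p (fs n)" "\<And>n. proj_rel V (fs n) (hs n)"
    and lim: "(\<lambda>n. Lpow p (\<lambda>x. hs n x - f x)) \<longlonglongrightarrow> 0"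
    unfolding Lp_sub_def inLp_iff_Lp_v Lp_dist_eq by blast
  have "\<exists>v. v \<in> V \<and> inLp p v \<and> inLp p (hs n) \<and> Lpow p (\<lambda>x. v x - hs n x) < inverse (real (Suc n))" for n
  proof -
    obtain v where v: "\<And>k. v k \<in> V" "Lp_tendsto p v (hs n)"
      using proj_rel_closure[OF p fs(2,1)] unfolding closure_V_def by blast
    then have "(\<lambda>k. Lpow p (\<lambda>x. v k x - hs n x)) \<longlonglongrightarrow> 0" by (simp add: Lp_tendsto_def)
    then have "\<forall>\<^sub>F k in sequentially. Lpow p (\<lambda>x. v k x - hs n x) < inverse (real (Suc n))"
      by (rule order_tendstoD) simp
    then obtain k where "Lpow p (\<lambda>x. v k x - hs n x) < inverse (real (Suc n))"
      using eventually_happens'[OF sequentially_bot] by blast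
    then show ?thesis using v by (auto simp: Lp_tendsto_def)
  qed
  then have "\<forall>n. \<exists>v. v \<in> V \<and> inLp p v \<and> inLp p (hs n) \<and> Lpow p (\<lambda>x. v x - hs n x) < inverse (real (Suc n))" ..
  from choice[OF this] obtain v where v: "\<forall>n. v n \<in> V \<and> inLp p (v n) \<and> inLp p (hs n) \<and> Lpow p (\<lambda>x. v n x - hs n x) < inverse (real (Suc n))" ..
  define c where "c = 2 powr (p - 1)"
  have le: "Lpow p (\<lambda>x. v n x - f x) \<le> c * (inverse (real (Suc n)) + Lpow p (\<lambda>x. hs n x - f x))" for n
  proof -
    have "Lpow p (\<lambda>x. (v n x - hs n x) + (hs n x - f x)) \<le> c * (Lpow p (\<lambda>x. v n x - hs n x) + Lpow p (\<lambda>x. hs n x - f x))"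
      unfolding c_def by (rule Lpow_add_le) (use v f p in \<open>auto intro!: inLp_diff\<close>)
    also have "... \<le> c * (inverse (real (Suc n)) + Lpow p (\<lambda>x. hs n x - f x))"
      using v by (intro mult_left_mono add_right_mono less_imp_le) (auto simp: c_def)
    finally show ?thesis by simp
  qed
  have "(\<lambda>n. c * (inverse (real (Suc n)) + Lpow p (\<lambda>x. hs n x - f x))) \<longlonglongrightarrow> c * (0 + 0)"
    by (intro tendsto_intros lim LIMSEQ_inverse_real_of_nat)
  from tendsto_sandwich[OF always_eventually[OF allI[OF Lpow_nonneg]] always_eventually[OF allI[OF le]] tendsto_const this[unfolded add_0 mult_zero_right]]
  show "closure_V p f" unfolding closure_V_def Lp_tendsto_def using v f by (intro exI[of _ v] conjI) simp_all
qed

section \<open>From boundary fields to potentials and back\<close>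

lemma A_tendsto: "u \<longlonglongrightarrow> v \<Longrightarrow> (\<lambda>n. A x (u n)) \<longlonglongrightarrow> A x v"
  by (rule bounded_linear.tendsto[OF linear_conv_bounded_linear[THEN iffD1, OF A_linear]])

lemma sum_T_A: "(\<Sum>l<N. T l (Y l) x) = A x (\<Sum>l<N. slm l *\<^sub>R grad (Y l) x)"
  by (simp add: linear_sum[OF A_linear] T_def A_scale)

text \<open>On finite sums \<open>Pe\<close>, the operator \<open>A\<close> applied to the gradient
  of the Poisson integral, and the Poisson integral of the boundary field coincide. Each passes to
  the limit separately, and uniqueness of limits at each point of the ball equates them.\<close>

lemma closure_V_potential:
  assumes p: "p > 1" and f: "closure_V p f"
  obtains g h G where "W1p p g" "mult_rel real g h" "weak_sgrad g G"
    "\<And>x. norm x < 1 \<Longrightarrow> Pe lam mu f x = A x (grad (Poisson g) x)"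
    "\<And>x. norm x < 1 \<Longrightarrow> Pe lam mu f x = PoissonV (\<lambda>y. (s * h y) *\<^sub>R y + A y (G y)) x"
proof -
  have p1: "p \<ge> 1" using p by simp
  obtain N Y F where Y: "\<And>n l. Y n l \<in> Harm l" and F: "Lp_tendsto p (\<lambda>n. hsum (N n) (Y n)) F"
    and lim: "Lp_tendsto p (\<lambda>n x. \<Sum>l<N n. T l (Y n l) x) f"
    by (rule closure_VE[OF p f]) blast
  obtain g h G where g: "Lp_tendsto p (\<lambda>n x. \<Sum>l<N n. slm l * Y n l x) g"
    and h: "Lp_tendsto p (\<lambda>n x. \<Sum>l<N n. real l * slm l * Y n l x) h"
    and G: "Lp_tendsto p (\<lambda>n x. \<Sum>l<N n. slm l *\<^sub>R sgp (Y n l) x) G"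
    and W: "W1p p g" "mult_rel real g h" "weak_sgrad g G"
    and gr: "\<And>x. norm x < 1 \<Longrightarrow> (\<lambda>n. \<Sum>l<N n. slm l *\<^sub>R grad (Y n l) x) \<longlonglongrightarrow> grad (Poisson g) x"
    by (rule Harm_potential[OF p Y F]) blast
  have Pe: "(\<lambda>n. \<Sum>l<N n. T l (Y n l) x) \<longlonglongrightarrow> Pe lam mu f x" if x: "norm x < 1" for x
    using Pe_tendsto[OF p1 lim x] unfolding sum_T_ball(1)[OF Y x] .
  have e1: "Pe lam mu f x = A x (grad (Poisson g) x)" if x: "norm x < 1" for x
    using LIMSEQ_unique[OF Pe[OF x] A_tendsto[OF gr[OF x], of x, folded sum_T_A]] .
  have e2: "Pe lam mu f x = PoissonV (\<lambda>y. (s * h y) *\<^sub>R y + A y (G y)) x" if x: "norm x < 1" for x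
  proof -
    define hn where "hn n x = (\<Sum>l<N n. real l * slm l * Y n l x)" for n x
    define Gn where "Gn n x = (\<Sum>l<N n. slm l *\<^sub>R sgp (Y n l) x)" for n x
    have cn: "continuous_on (sphere 0 1) (hn n)" "continuous_on (sphere 0 1) (Gn n)" for n
      unfolding hn_def Gn_def by (intro continuous_on_sum continuous_on_mult continuous_on_scaleR continuous_on_const
        Harm_continuous[OF Y] sgp_continuous HarmD(2)[OF Y])+
    have Tn: "(\<Sum>l<N n. T l (Y n l) y) = (s * hn n y) *\<^sub>R y + A y (Gn n y)" if y: "norm y = 1" for n y
    proof -
      have "T l (Y n l) y = (s * (real l * slm l * Y n l y)) *\<^sub>R y + A y (slm l *\<^sub>R sgp (Y n l) y)" for l
        unfolding T_def A_sgp[OF Y y] by (simp add: A_scale scaleR_add_right mult_ac)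
      then show ?thesis
        by (simp only: hn_def Gn_def sum.distrib linear_sum[OF A_linear] sum_distrib_left scaleR_sum_left)
    qed
    obtain B where B: "\<And>y. norm y = 1 \<Longrightarrow> norm (Pker x y) \<le> B" using continuous_sphere_bound[OF continuous_Pker[OF x]] by blast
    have P [measurable]: "Pker x \<in> borel_measurable sigmaS" by (rule sphere_measurable[OF continuous_Pker[OF x]])
    have B0: "B \<ge> 0" using B[of "axis 1 1"] by (simp add: order_trans[OF abs_ge_zero])
    have l1: "(\<lambda>n. \<ointegral>y. Pker x y *\<^sub>R ((s * hn n y) *\<^sub>R y)) \<longlonglongrightarrow> (\<ointegral>y. Pker x y *\<^sub>R ((s * h y) *\<^sub>R y))"
    proof (rule Lp_tendsto_integral[OF p1 h[folded hn_def], where C="B * \<bar>s\<bar>"])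
      show "norm (Pker x y *\<^sub>R ((s * c) *\<^sub>R y)) \<le> B * \<bar>s\<bar> * norm c" if y: "norm y = 1" for y c
        using mult_right_mono[OF B[OF y], of "\<bar>s * c\<bar>"] y by (simp add: abs_mult mult.assoc)
    qed (auto simp: algebra_simps)
    have l2: "(\<lambda>n. \<ointegral>y. Pker x y *\<^sub>R A y (Gn n y)) \<longlonglongrightarrow> (\<ointegral>y. Pker x y *\<^sub>R A y (G y))"
    proof (rule Lp_tendsto_integral[OF p1 G[folded Gn_def], where C=B])
      show "norm (Pker x y *\<^sub>R A y v) \<le> B * norm v" if "norm y = 1" for y v
        unfolding norm_scaleR using B[OF that] A_bound[OF that] B0 by (intro mult_mono) auto
    qed (auto simp: A_diff scaleR_diff_right intro!: borel_measurable_scaleR A_measurable P)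
    have ih: "inLp p h" "inLp p G" using h G by (auto simp: Lp_tendsto_def)
    have i1: "integrable sigmaS (\<lambda>y. Pker x y *\<^sub>R ((s * k y) *\<^sub>R y))" if k: "integrable sigmaS k" for k
    proof (rule lint_bound)
      show "integrable sigmaS (\<lambda>y. B * \<bar>s\<bar> * k y)" using k by simp
      show "(\<lambda>y. Pker x y *\<^sub>R ((s * k y) *\<^sub>R y)) \<in> borel_measurable sigmaS" using k by measurable
      show "AE y in sigmaS. norm (Pker x y *\<^sub>R ((s * k y) *\<^sub>R y)) \<le> norm (B * \<bar>s\<bar> * k y)"
        by (rule AE_I2) (use B B0 in \<open>auto simp: abs_mult mult.assoc intro!: mult_right_mono\<close>)
    qed
    have i2: "integrable sigmaS (\<lambda>y. Pker x y *\<^sub>R A y (k y))" if k: "integrable sigmaS k" for k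
    proof (rule lint_bound)
      show "integrable sigmaS (\<lambda>y. B * norm (k y))" using k by simp
      show "(\<lambda>y. Pker x y *\<^sub>R A y (k y)) \<in> borel_measurable sigmaS" by (intro borel_measurable_scaleR P A_measurable) (use k in auto)
      show "AE y in sigmaS. norm (Pker x y *\<^sub>R A y (k y)) \<le> norm (B * norm (k y))"
        by (rule AE_I2) (use B B0 A_bound in \<open>auto simp: abs_mult intro!: mult_mono\<close>)
    qed
    have add: "PoissonV (\<lambda>y. (s * k y) *\<^sub>R y + A y (w y)) x = (\<ointegral>y. Pker x y *\<^sub>R ((s * k y) *\<^sub>R y)) + (\<ointegral>y. Pker x y *\<^sub>R A y (w y))"
      if "integrable sigmaS k" "integrable sigmaS w" for k w
      unfolding PoissonV_def scaleR_add_right by (rule lint_add[OF i1[OF that(1)] i2[OF that(2)]])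
    have "(\<lambda>n. PoissonV (\<lambda>y. (s * hn n y) *\<^sub>R y + A y (Gn n y)) x) \<longlonglongrightarrow> PoissonV (\<lambda>y. (s * h y) *\<^sub>R y + A y (G y)) x"
      unfolding add[OF sphere_integrable[OF cn(1)] sphere_integrable[OF cn(2)]]
        add[OF inLp_integrable[OF p1 ih(1)] inLp_integrable[OF p1 ih(2)]]
      by (intro tendsto_add l1 l2)
    moreover have "PoissonV (\<lambda>y. (s * hn n y) *\<^sub>R y + A y (Gn n y)) x = (\<Sum>l<N n. T l (Y n l) x)" for n
    proof -
      have "PoissonV (\<lambda>y. (s * hn n y) *\<^sub>R y + A y (Gn n y)) x = PoissonV (\<lambda>y. \<Sum>l<N n. T l (Y n l) y) x"
        unfolding PoissonV_def by (rule lint_cong) (auto simp: Tn)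
      then show ?thesis unfolding sum_T_ball(2)[OF Y x] .
    qed
    ultimately show ?thesis using LIMSEQ_unique[OF Pe[OF x]] by simp
  qed
  show thesis by (rule that[OF W e1 e2])
qed

text \<open>With \<open>d = sqrt_defect\<close> one has \<open>2\<ell>+1 = 2\<surd>(\<ell>(\<ell>+1)) + d\<close>, so that \<open>(2\<ell>+1)g\<close> lies in \<open>L\<^sup>p\<close> for \<open>g \<in> W\<^sup>1\<^sup>,\<^sup>p\<close>.\<close>
lemma potential_closure_V:
  assumes p: "p > 1" and g: "W1p p g"
  obtains f where "closure_V p f" "\<And>x. norm x < 1 \<Longrightarrow> A x (grad (Poisson g) x) = Pe lam mu f x"
proof -
  have p1: "p \<ge> 1" using p by simp
  obtain h where gp: "inLp p g" and hp: "inLp p h" and h: "mult_rel (\<lambda>l. sqrt (real l * (real l + 1))) g h"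
    using g unfolding W1p_def inLp_iff_Lp_s by blast
  obtain N Y where Y: "\<And>n l. Y n l \<in> Harm l" and Yg: "Lp_tendsto p (\<lambda>n. hsum (N n) (Y n)) g"
    by (rule Harm_dense[OF p gp]) blast
  obtain k where k: "Lp_tendsto p (\<lambda>n x. \<Sum>l<N n. sqrt_defect l * Y n l x) k"
    using harm_bounded_limit[OF p1 harm_op_mult mult_bounded_sqrt_defect[OF p] Y Yg] by blast
  have kr: "mult_rel sqrt_defect g k" by (rule mult_rel_limit[OF p1 Y Yg k])
  have kp: "inLp p k" using k by (simp add: Lp_tendsto_def)
  define F where "F x = 2 *\<^sub>R h x + k x" for x
  have Fp: "inLp p F" unfolding F_def by (intro inLp_add p1 inLp_scaleR hp kp)
  have Fc: "(\<ointegral>x. F x * Z x) = (2 * real l + 1) * (\<ointegral>x. g x * Z x)" if Z: "Z \<in> Harm l" for l Z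
  proof -
    have i: "integrable sigmaS (\<lambda>x. h x * Z x)" "integrable sigmaS (\<lambda>x. k x * Z x)"
      unfolding mult.commute[of _ "Z _"]
      by (intro sphere_kernel_integrable[OF _ Harm_continuous[OF Z]] inLp_integrable[OF p1 hp] inLp_integrable[OF p1 kp])+
    have "(\<ointegral>x. F x * Z x) = (\<ointegral>x. 2 * (h x * Z x) + k x * Z x)"
      by (simp add: F_def distrib_right mult.assoc)
    also have "... = 2 * (\<ointegral>x. h x * Z x) + (\<ointegral>x. k x * Z x)" using i by simp
    also have "... = (2 * sqrt (real l * (real l + 1)) + sqrt_defect l) * (\<ointegral>x. g x * Z x)"
      using h kr Z unfolding mult_rel_def by (simp add: distrib_right)
    finally show ?thesis by (simp add: sqrt_defect_def)
  qed
  obtain M Z where Z: "\<And>n l. Z n l \<in> Harm l" and ZF: "Lp_tendsto p (\<lambda>n. hsum (M n) (Z n)) F"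
    by (rule Harm_dense[OF p Fp]) blast
  obtain g' where g': "Lp_tendsto p (\<lambda>n x. \<Sum>l<M n. slm l * Z n l x) g'"
    and gr: "\<And>x. norm x < 1 \<Longrightarrow> (\<lambda>n. \<Sum>l<M n. slm l *\<^sub>R grad (Z n l) x) \<longlonglongrightarrow> grad (Poisson g') x"
    by (rule Harm_potential[OF p Z ZF]) blast
  have g'r: "mult_rel (\<lambda>l. 1 / (2 * real l + 1)) F g'" by (rule mult_rel_limit[OF p1 Z ZF g'])
  have g'p: "inLp p g'" using g' by (simp add: Lp_tendsto_def)
  \<comment> \<open>The coefficients of \<open>F\<close> are \<open>2l+1\<close> times those of
    \<open>g\<close>, and those of \<open>g'\<close> are the coefficients of \<open>F\<close> over
    \<open>2l+1\<close>.\<close>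
  have "AE x in sigmaS. g x = g' x"
  proof (rule Harm_coefficients_unique[OF inLp_integrable[OF p1 gp] inLp_integrable[OF p1 g'p]])
    show "(\<ointegral>x. g x * W x) = (\<ointegral>x. g' x * W x)" if W: "W \<in> Harm l" for l W
      using g'r W unfolding mult_rel_def by (simp add: Fc[OF W] add_pos_nonneg)
  qed
  then have "Poisson g x = Poisson g' x" if "norm x < 1" for x
    unfolding Poisson_def using sphere_measurable[OF continuous_Pker[OF that]] gp g'p
    by (intro integral_cong_AE) (auto simp: inLp_def elim: eventually_mono)
  then have gg: "grad (Poisson g) x = grad (Poisson g') x" if "norm x < 1" for x
    unfolding vec_eq_iff grad_nth using pd_cong_ball[OF _ that] by blast
  obtain f where f: "Lp_tendsto p (\<lambda>n x. \<Sum>l<M n. T l (Z n l) x) f"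
    using harm_bounded_limit[OF p1 T_op T_bounded[OF p] Z ZF] by blast
  show thesis
  proof (rule that[OF closure_VI[OF Z f]])
    fix x :: R3 assume x: "norm x < 1"
    have "(\<lambda>n. \<Sum>l<M n. T l (Z n l) x) \<longlonglongrightarrow> Pe lam mu f x"
      using Pe_tendsto[OF p1 f x] unfolding sum_T_ball(1)[OF Z x] .
    then show "A x (grad (Poisson g) x) = Pe lam mu f x"
      unfolding gg[OF x] using LIMSEQ_unique[OF A_tendsto[OF gr[OF x], of x, folded sum_T_A]] by blast
  qed
qed

lemma hardy_potential:
  assumes p: "p > 1" and u: "\<exists>f\<in>Lp_sub V p. \<forall>x\<in>ball 0 1. u x = Pe lam mu f x"
  shows "\<exists>g. W1p p g \<and> (\<forall>x\<in>ball 0 1. u x = A x (grad (Poisson g) x)) \<and>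
    (\<exists>h G. mult_rel real g h \<and> weak_sgrad g G \<and>
      (\<forall>x\<in>ball 0 1. u x = PoissonV (\<lambda>y. (s * h y) *\<^sub>R y + A y (G y)) x))"
proof -
  obtain f where f: "closure_V p f" "\<And>x. norm x < 1 \<Longrightarrow> u x = Pe lam mu f x"
    using Lp_sub_iff[OF p] u by auto
  obtain g h G where "W1p p g" "mult_rel real g h" "weak_sgrad g G"
    "\<And>x. norm x < 1 \<Longrightarrow> Pe lam mu f x = A x (grad (Poisson g) x)"
    "\<And>x. norm x < 1 \<Longrightarrow> Pe lam mu f x = PoissonV (\<lambda>y. (s * h y) *\<^sub>R y + A y (G y)) x"
    by (rule closure_V_potential[OF p f(1)]) blast
  then show ?thesis using f(2) by (intro exI[of _ g] conjI exI[of _ h] exI[of _ G]) auto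
qed

lemma potential_hardy:
  assumes p: "p > 1" and g: "W1p p g" "\<forall>x\<in>ball 0 1. u x = A x (grad (Poisson g) x)"
  shows "\<exists>f\<in>Lp_sub V p. \<forall>x\<in>ball 0 1. u x = Pe lam mu f x"
proof -
  obtain f where "closure_V p f" "\<And>x. norm x < 1 \<Longrightarrow> A x (grad (Poisson g) x) = Pe lam mu f x"
    by (rule potential_closure_V[OF p g(1)]) blast
  then show ?thesis using Lp_sub_iff[OF p] g(2) by (intro bexI[of _ f]) auto
qed

end

section \<open>The two cases\<close>

lemma inner_rot_grad: "cross3 x (grad Y x) \<bullet> cross3 x (grad Z x) = (\<Sum>i\<in>UNIV. ang i Y x * ang i Z x)"
  by (simp add: ang_def inner_vec_def)

lemma rot_energy:
  assumes "Y \<in> Harm l" "Z \<in> Harm k"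
  shows "(\<ointegral>x. cross3 x (grad Y x) \<bullet> cross3 x (grad Z x)) = real (l * (l + 1)) * (\<ointegral>x. Y x * Z x)"
  unfolding inner_rot_grad by (rule integral_ang_ang[OF assms(1) HarmD(2)[OF assms(2)]])

lemma inner_cross3_cross3: "norm (x :: R3) = 1 \<Longrightarrow> cross3 x a \<bullet> cross3 x b = a \<bullet> b - (x \<bullet> a) * (x \<bullet> b)"
  using dot_cross[of x a x b] by (simp add: norm_eq_1 inner_commute)

text \<open>The tangential part contributes \<open>l(l+1)\<close> and the radial part
  \<open>l * k\<close>, which by orthogonality counts only for \<open>k = l\<close>; the sum is
  \<open>l(2l+1)\<close>.\<close>

lemma grad_energy:
  assumes Y: "Y \<in> Harm l" and Z: "Z \<in> Harm k"
  shows "(\<ointegral>x. grad Y x \<bullet> grad Z x) = real (l * (2 * l + 1)) * (\<ointegral>x. Y x * Z x)"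
proof -
  have i: "integrable sigmaS (\<lambda>x. cross3 x (grad Y x) \<bullet> cross3 x (grad Z x))" "integrable sigmaS (\<lambda>x. Y x * Z x)"
    by (intro sphere_integrable continuous_intros poly3_grad_continuous poly3_continuous HarmD(2)[OF Y] HarmD(2)[OF Z])+
  have "(\<ointegral>x. grad Y x \<bullet> grad Z x) = (\<ointegral>x. cross3 x (grad Y x) \<bullet> cross3 x (grad Z x) + real (l * k) * (Y x * Z x))"
    by (rule lint_cong)
       (simp_all add: inner_cross3_cross3 Harm_grad_radial[OF Y, unfolded inner_commute[of "grad Y _"]]
         Harm_grad_radial[OF Z, unfolded inner_commute[of "grad Z _"]])
  also have "... = real (l * (l + 1)) * (\<ointegral>x. Y x * Z x) + real (l * k) * (\<ointegral>x. Y x * Z x)"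
    using i by (simp only: lint_add integrable_mult_right integral_mult_right_zero rot_energy[OF Y Z])
  also have "... = real (l * (2 * l + 1)) * (\<ointegral>x. Y x * Z x)"
    using Harm_orthogonal[OF Y Z] by (cases "l = k") (auto simp: algebra_simps)
  finally show ?thesis .
qed

lemma div_rot_grad:
  assumes "poly3 Y"
  shows "(\<Sum>j\<in>UNIV. pd j (ang j Y) x) = 0"
  by (simp add: sum_3 ang_fun poly3_pd_diff poly3_mult poly3_coord poly3_pd assms poly3_pd_coord_mult
      poly3_pd_commute[OF assms, of 2 1] poly3_pd_commute[OF assms, of 3 1] poly3_pd_commute[OF assms, of 3 2])

lemma cross3_sgp:
  assumes "poly3 Y" "norm x = 1"
  shows "cross3 x (sgp Y x) = cross3 x (grad Y x)"
  using sgrad_eq[OF assms] sgrad_eq_sgp[OF assms] by (simp add: Cross3.right_diff_distrib cross_mult_right)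

lemma harmonic_operator_grad:
  assumes "mu > 0" "2 * mu + lam > 0"
  shows "harmonic_operator lam mu (\<lambda>x v. v) (\<lambda>l. real (l * (2 * l + 1))) 1 Eminus_span"
proof (unfold_locales; (fact assms)?)
  \<comment> \<open>Reduces the multiplier of the duality to \<open>2 + 1/l\<close>, whose two parts
    are bounded multipliers on positive degrees.\<close>
  have en1: "(2 * real l + 1)\<^sup>2 / real (l * (2 * l + 1)) = 2 + 1 / real l" if "l > 0" for l
  proof -
    have "(2 * real l + 1)\<^sup>2 / (real l * (2 * real l + 1)) = (2 * real l + 1) / real l"
      unfolding power2_eq_square by (rule mult_divide_mult_cancel_right) (simp add: add_nonneg_eq_0_iff)
    then show ?thesis using that by (simp add: add_divide_distrib distrib_left add.commute)
  qed
  show "grad Y x = (1 * (real l * Y x)) *\<^sub>R x + sgp Y x" if "Y \<in> Harm l" "norm x = 1" for l Y x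
    using Harm_grad_decomposition[OF that] by simp
  show "(\<ointegral>x. grad Y x \<bullet> grad Z x) = real (l * (2 * l + 1)) * (\<ointegral>x. Y x * Z x)"
    if "Y \<in> Harm l" "Z \<in> Harm k" for l k Y Z by (rule grad_energy[OF that])
  show "harm_bounded p (\<lambda>l Y x. slm l *\<^sub>R grad Y x)" if "p > 1" for p by (rule harm_bounded_grad[OF that])
  show "mult_bounded p (\<lambda>l. if l = 0 then 0 else (2 * real l + 1)\<^sup>2 / real (l * (2 * l + 1)))" if "p > 1" for p
  proof (rule mult_bounded_cong)
    show "mult_bounded p (\<lambda>l. 2 * (if l = 0 then 0 else 1) + (if l = 0 then 0 else 1 / real l))"
      using that by (intro mult_bounded_add mult_bounded_mult mult_bounded_const mult_bounded_nonconst mult_bounded_inverse) auto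
    show "2 * (if l = 0 then 0 else 1) + (if l = 0 then 0 else 1 / real l) = (if l = 0 then 0 else (2 * real l + 1)\<^sup>2 / real (l * (2 * l + 1)))" for l
      using en1[of l] by (cases "l = 0") (simp_all del: of_nat_mult of_nat_add)
  qed
  show "\<exists>k. (\<lambda>x. grad Y x $ j) \<in> Harm k" if "Y \<in> Harm l" for l Y j
    using Harm_pd[OF that] unfolding grad_nth by blast
  show "(\<Sum>j\<in>UNIV. pd j (\<lambda>x. grad Y x $ j) x) = 0" if "Y \<in> Harm l" for l Y x
    using HarmD(3)[OF that] unfolding grad_nth lap_def[symmetric] by simp
  have e: "(\<Sum>l\<in>{1..<N}. (real l * Y l x) *\<^sub>R x + sgrad (Y l) x) = (\<Sum>l\<in>{1..<N}. grad (Y l) x)"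
    if "\<forall>l. Y l \<in> Harm l" "norm x = 1" for N Y and x :: R3
    using Harm_grad_decomposition[OF spec[OF that(1)] that(2)] sgrad_eq_sgp[OF HarmD(2)[OF spec[OF that(1)]] that(2)] by simp
  show "\<exists>N Y. (\<forall>l. Y l \<in> Harm l) \<and> (\<forall>x. norm x = 1 \<longrightarrow> v x = (\<Sum>l\<in>{1..<N}. grad (Y l) x))" if "v \<in> Eminus_span" for v
    using that e unfolding Eminus_span_def by blast
  show "\<exists>v\<in>Eminus_span. \<forall>x. norm x = 1 \<longrightarrow> v x = (\<Sum>l\<in>{1..<N}. grad (Y l) x)" if "\<forall>l. Y l \<in> Harm l" for N Y
  proof (rule bexI)
    show "(\<lambda>\<eta>. \<Sum>l\<in>{1..<N}. (real l * Y l \<eta>) *\<^sub>R \<eta> + sgrad (Y l) \<eta>) \<in> Eminus_span"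
      unfolding Eminus_span_def mem_Collect_eq by (intro exI[of _ N] exI[of _ Y] conjI refl that)
  qed (use e[OF that] in simp)
qed (auto intro: add_pos_nonneg)

lemma harmonic_operator_rot:
  assumes "mu > 0" "2 * mu + lam > 0"
  shows "harmonic_operator lam mu cross3 (\<lambda>l. real (l * (l + 1))) 0 Ezero_span"
proof (unfold_locales; (fact assms)?)
  \<comment> \<open>The identity \<open>(2l+1)^2 = 4 l(l+1) + 1\<close> splits the multiplier into a
    constant and the product of the bounded multipliers \<open>1/l\<close> and
    \<open>1/(l+1)\<close>.\<close>
  have en1: "(2 * real l + 1)\<^sup>2 / real (l * (l + 1)) = 4 + 1 / (real l * (real l + 1))" if "l > 0" for l
  proof -
    have "(2 * real l + 1)\<^sup>2 / (real l * (real l + 1)) = 4 + 1 / (real l * (real l + 1))"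
    proof -
      have "(2 * real l + 1)\<^sup>2 = 4 * (real l * (real l + 1)) + 1" by (simp add: power2_eq_square algebra_simps)
      then show ?thesis using that by (simp add: add_divide_distrib add_nonneg_eq_0_iff)
    qed
    then show ?thesis by (simp add: distrib_left add.commute)
  qed
  show "continuous_on (sphere 0 1) (\<lambda>x. cross3 x (f x))" if "continuous_on (sphere 0 1) f" for f
    by (intro continuous_on_cross3 continuous_on_id that)
  show "(\<lambda>x. cross3 x (f x)) \<in> borel_measurable sigmaS" if "f \<in> borel_measurable sigmaS" for f
  proof (rule borel_measurable_vecI)
    show "(\<lambda>x. cross3 x (f x) $ i) \<in> borel_measurable sigmaS" for i
      using that measurable_sigmaS_borel exhaust_3[of i]
      by (elim disjE) (auto simp: cross_components intro!: borel_measurable_diff borel_measurable_times borel_measurable_vec_nth)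
  qed
  show "norm (cross3 x v) \<le> norm v" if "norm x = 1" for x v by (rule norm_cross3_le[OF that])
  show "cross3 x (grad Y x) = (0 * (real l * Y x)) *\<^sub>R x + cross3 x (sgp Y x)" if "Y \<in> Harm l" "norm x = 1" for l Y x
    using cross3_sgp[OF HarmD(2)[OF that(1)] that(2)] by simp
  show "(\<ointegral>x. cross3 x (grad Y x) \<bullet> cross3 x (grad Z x)) = real (l * (l + 1)) * (\<ointegral>x. Y x * Z x)"
    if "Y \<in> Harm l" "Z \<in> Harm k" for l k Y Z by (rule rot_energy[OF that])
  show "harm_bounded p (\<lambda>l Y x. slm l *\<^sub>R cross3 x (grad Y x))" if "p > 1" for p by (rule harm_bounded_rot[OF that])
  show "mult_bounded p (\<lambda>l. if l = 0 then 0 else (2 * real l + 1)\<^sup>2 / real (l * (l + 1)))" if "p > 1" for p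
  proof (rule mult_bounded_cong)
    show "mult_bounded p (\<lambda>l. 4 * (if l = 0 then 0 else 1) + (if l = 0 then 0 else 1 / real l) * (if l = 0 then 0 else 1 / (real l + 1)))"
      using that by (intro mult_bounded_add mult_bounded_mult mult_bounded_const mult_bounded_nonconst mult_bounded_inverse mult_bounded_inverse_Suc) auto
    show "4 * (if l = 0 then 0 else 1) + (if l = 0 then 0 else 1 / real l) * (if l = 0 then 0 else 1 / (real l + 1))
       = (if l = 0 then 0 else (2 * real l + 1)\<^sup>2 / real (l * (l + 1)))" for l
      using en1[of l] by (cases "l = 0") (simp_all del: of_nat_mult of_nat_add)
  qed
  show "\<exists>k. (\<lambda>x. cross3 x (grad Y x) $ j) \<in> Harm k" if "Y \<in> Harm l" for l Y j
    using Harm_ang[OF that, of j] unfolding ang_def[abs_def] by blast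
  show "(\<Sum>j\<in>UNIV. pd j (\<lambda>x. cross3 x (grad Y x) $ j) x) = 0" if "Y \<in> Harm l" for l Y x
    using div_rot_grad[OF HarmD(2)[OF that], of x] unfolding ang_def[abs_def] .
  have e: "(\<Sum>l\<in>{1..<N}. cross3 x (sgrad (Y l) x)) = (\<Sum>l\<in>{1..<N}. cross3 x (grad (Y l) x))"
    if "\<forall>l. Y l \<in> Harm l" "norm x = 1" for N Y and x :: R3
    using cross3_sgp[OF HarmD(2)[OF spec[OF that(1)]] that(2)] sgrad_eq_sgp[OF HarmD(2)[OF spec[OF that(1)]] that(2)] by simp
  show "\<exists>N Y. (\<forall>l. Y l \<in> Harm l) \<and> (\<forall>x. norm x = 1 \<longrightarrow> v x = (\<Sum>l\<in>{1..<N}. cross3 x (grad (Y l) x)))" if "v \<in> Ezero_span" for v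
    using that e unfolding Ezero_span_def by blast
  show "\<exists>v\<in>Ezero_span. \<forall>x. norm x = 1 \<longrightarrow> v x = (\<Sum>l\<in>{1..<N}. cross3 x (grad (Y l) x))" if "\<forall>l. Y l \<in> Harm l" for N Y
  proof (rule bexI)
    show "(\<lambda>\<eta>. \<Sum>l\<in>{1..<N}. cross3 \<eta> (sgrad (Y l) \<eta>)) \<in> Ezero_span"
      unfolding Ezero_span_def mem_Collect_eq by (intro exI[of _ N] exI[of _ Y] conjI refl that)
  qed (use e[OF that] in simp)
qed (auto simp: Cross3.right_diff_distrib cross_mult_right intro: add_pos_nonneg)

theorem mainTheorem13:
  fixes lam mu p :: real and u :: "R3 \<Rightarrow> R3"
  assumes "mu > 0" and "2 * mu + lam > 0" and "1 < p"
  shows "(u \<in> hp_minus lam mu p \<longleftrightarrow>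
            (\<exists>g. W1p p g \<and>
               (\<forall>x\<in>ball 0 1. u x = grad (Poisson g) x) \<and>
               (\<exists>h G. mult_rel real g h \<and> weak_sgrad g G \<and>
                  (\<forall>x\<in>ball 0 1. u x = PoissonV (\<lambda>\<eta>. h \<eta> *\<^sub>R \<eta> + G \<eta>) x))))
       \<and> (u \<in> hp_zero lam mu p \<longleftrightarrow>
            (\<exists>g. W1p p g \<and>
               (\<forall>x\<in>ball 0 1. u x = cross3 x (grad (Poisson g) x)) \<and>
               (\<exists>G. weak_sgrad g G \<and>
                  (\<forall>x\<in>ball 0 1. u x = PoissonV (\<lambda>\<eta>. cross3 \<eta> (G \<eta>)) x))))"
proof -
  \<comment> \<open>With \<open>s = 1\<close> the boundary field is the radial field of
    \<open>h\<close> plus the weak gradient; with \<open>s = 0\<close> the radial term disappears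
    and the rotated weak gradient is left.\<close>
  interpret grd: harmonic_operator lam mu "\<lambda>x v. v" "\<lambda>l. real (l * (2 * l + 1))" 1 Eminus_span
    by (rule harmonic_operator_grad[OF assms(1,2)])
  interpret rot: harmonic_operator lam mu cross3 "\<lambda>l. real (l * (l + 1))" 0 Ezero_span
    by (rule harmonic_operator_rot[OF assms(1,2)])
  note g1 = grd.hardy_potential[OF assms(3), of u] and g2 = grd.potential_hardy[OF assms(3), of _ u]
    and r1 = rot.hardy_potential[OF assms(3), of u] and r2 = rot.potential_hardy[OF assms(3), of _ u]
  show ?thesis
  proof (intro conjI iffI)
    assume "u \<in> hp_minus lam mu p"
    then show "\<exists>g. W1p p g \<and> (\<forall>x\<in>ball 0 1. u x = grad (Poisson g) x) \<and>
       (\<exists>h G. mult_rel real g h \<and> weak_sgrad g G \<and> (\<forall>x\<in>ball 0 1. u x = PoissonV (\<lambda>\<eta>. h \<eta> *\<^sub>R \<eta> + G \<eta>) x))"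
      using g1 unfolding hp_minus_def mem_Collect_eq by (simp only: mult_1_left)
  next
    assume "u \<in> hp_zero lam mu p"
    then show "\<exists>g. W1p p g \<and> (\<forall>x\<in>ball 0 1. u x = cross3 x (grad (Poisson g) x)) \<and>
       (\<exists>G. weak_sgrad g G \<and> (\<forall>x\<in>ball 0 1. u x = PoissonV (\<lambda>\<eta>. cross3 \<eta> (G \<eta>)) x))"
      using r1 unfolding hp_zero_def mem_Collect_eq mult_zero_left scaleR_zero_left add_0_left by blast
  next
    assume "\<exists>g. W1p p g \<and> (\<forall>x\<in>ball 0 1. u x = grad (Poisson g) x) \<and>
       (\<exists>h G. mult_rel real g h \<and> weak_sgrad g G \<and> (\<forall>x\<in>ball 0 1. u x = PoissonV (\<lambda>\<eta>. h \<eta> *\<^sub>R \<eta> + G \<eta>) x))"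
    then show "u \<in> hp_minus lam mu p"
      unfolding hp_minus_def mem_Collect_eq by (elim exE conjE) (rule g2)
  next
    assume "\<exists>g. W1p p g \<and> (\<forall>x\<in>ball 0 1. u x = cross3 x (grad (Poisson g) x)) \<and>
       (\<exists>G. weak_sgrad g G \<and> (\<forall>x\<in>ball 0 1. u x = PoissonV (\<lambda>\<eta>. cross3 \<eta> (G \<eta>)) x))"
    then show "u \<in> hp_zero lam mu p"
      unfolding hp_zero_def mem_Collect_eq by (elim exE conjE) (rule r2)
  qed
qed

end
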